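(* Let $\mu$ be the self-affine measure associated with an affinely irreducible homogeneous affine IFS $\Phi=\{\phi_\ell(x)=Ax+a_\ell\}_{\ell=1}^m$ on $\mathbb{R}^d$ and a strictly positive probability vector $\boldsymbol{p}=(p_\ell)_{\ell=1}^m$. Then $\mu$ is non-Rajchman if and only if at least one of the following two conditions holds: (i) $\Phi$ is a generalized Pisot IFS of type I. (ii) $\Phi$ has an integral factor $\Psi$ such that the self-affine measure associated with $\Psi$ and $\boldsymbol{p}$ is singular (with respect to Lebesgue measure).
   Context: A homogeneous affine IFS on $\mathbb{R}^d$ ($d\ge 1$) is a finite family $\Phi=\{\phi_\ell(x)=Ax+a_\ell\}_{\ell=1}^m$ with $A\in GL_d(\mathbb{R})$ of spectral radius less than $1$ and $a_\ell\in\mathbb{R}^d$. It is affinely irreducible if there is no proper affine subspace $V$ of $\mathbb{R}^d$ with $\phi_\ell(V)=V$ for all $1\le \ell\le m$. For a probability vector $\boldsymbol{p}=(p_\ell)_{\ell=1}^m$, the associated self-affine measure is the unique Borel probability measure $\mu$ with $\mu=\sum_{\ell=1}^m p_\ell\,\mu\circ\phi_\ell^{-1}$. The Fourier transform of a Borel probability measure $\nu$ on $\mathbb{R}^d$ is $\widehat\nu(\xi)=\int e^{2\pi i\langle \xi,x\rangle}\,d\nu(x)$; $\nu$ is Rajchman if $|\widehat\nu(\xi)|\to0$ as $|\xi|\to\infty$, and non-Rajchman otherwise. On $\mathbb{C}^d$, $\langle z,w\rangle=\sum_j z_j\overline{w_j}$. Pisot tuple: a finite collection $\{\beta_1,\dots,\beta_k\}$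 of distinct algebraic integers (real or complex) such that (i) $|\beta_j|>1$ for all $j$; (ii) there is a monic $P\in\mathbb{Z}[x]$ with $P(\beta_j)=0$ for all $1\le j\le k$ such that every other root $z$ of $P$, if any, satisfies $|z|<1$. It is of type I if, taking $P$ of smallest possible degree, $P$ has at least one root in $\{|z|<1\}$; otherwise it is of type II. Generalized Pisot IFS: a homogeneous affine IFS $\{Ax+a_\ell\}_{\ell=1}^m$ on $\mathbb{R}^d$ for which there exist $k\ge1$, $\beta_1,\dots,\beta_k\in\mathbb{C}$ and $\zeta_1,\dots,\zeta_k\in\mathbb{C}^d\setminus\{0\}$ such that: (i) $\{\beta_1,\dots,\beta_k\}$ is a Pisot tuple; (ii) $A^{\top}\zeta_j=\beta_j^{-1}\zeta_j$ for $1\le j\le k$; (iii) for every $1\le\ell\le m$ there is $P_\ell\in\mathbb{Z}[x]$ with $\langle\zeta_j,a_\ell-a_1\rangle=P_\ell(\beta_j)$ for all $1\le j\le k$. It is a generalized Pisot IFS of type I if such data can be chosen with $\{\beta_1,\dots,\beta_k\}$ a Pisot tuple of type I. Integral affine IFS: a homogeneous affine IFS $\{Ax+a_\ell\}_{\ell=1}^m$ on $\mathbb{R}^d$ such that $A^{-1}$ is an integer matrix and $a_\ell\in\mathbb{Z}^d$ for all $\ell$. Factor: an IFS $\Psi=\{\psi_\ell\}_{\ell=1}^m$ on $\mathbb{R}^q$ ($1\le q\le d$) is a factor of $\Phi=\{Ax+a_\ell\}_{\ell=1}^m$ on $\mathbb{R}^d$ if there are a nonzero $A^{\top}$-invariant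 linear subspace $V\subset\mathbb{R}^d$ with $\dim V=q$ and an invertible affine map $T:V\to\mathbb{R}^q$ such that $\psi_\ell=T\circ\phi_{V,\ell}\circ T^{-1}$ for all $\ell$, where $\phi_{V,\ell}:V\to V$, $\phi_{V,\ell}(x)=P_VAx+P_Va_\ell$, and $P_V$ is the orthogonal projection of $\mathbb{R}^d$ onto $V$. It is an integral factor if in addition $\Psi$ is an integral affine IFS. *)

theory Defs
  imports "HOL-Analysis.Analysis" "HOL-Computational_Algebra.Polynomial"
begin

text \<open>
  The ambient space of the given IFS is \<open>real ^ 'd\<close>. The dimension \<open>q\<close> of a factor is bound inside the
  statement, so there \<open>\<real>\<^sup>q\<close> is the set of functions \<open>nat \<Rightarrow> real\<close> that are extensional on \<open>{..<q}\<close>, i.e.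
  the space of the product measures over \<open>{..<q}\<close>. Families of maps, vectors and weights
  are indexed by \<open>{1..m}\<close>.
\<close>

abbreviation Rq :: "nat \<Rightarrow> (nat \<Rightarrow> real) set" where
  "Rq q \<equiv> {..<q} \<rightarrow>\<^sub>E UNIV"

abbreviation borel_Rq :: "nat \<Rightarrow> (nat \<Rightarrow> real) measure" where
  "borel_Rq q \<equiv> \<Pi>\<^sub>M i\<in>{..<q}. borel"

abbreviation lborel_Rq :: "nat \<Rightarrow> (nat \<Rightarrow> real) measure" where
  "lborel_Rq q \<equiv> \<Pi>\<^sub>M i\<in>{..<q}. lborel"


section \<open>Homogeneous affine iterated function systems\<close>

text \<open>
  Eigenvalues and spectral radius of a real square matrix whose rows and columns are indexed by a
  finite set \<open>I\<close>: this covers both \<open>real ^ 'd ^ 'd\<close> (with \<open>I = UNIV\<close>) and \<open>q \<times> q\<close> matrices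
  (with \<open>I = {..<q}\<close>).
\<close>

definition complex_eigenvalues :: "'i set \<Rightarrow> ('i \<Rightarrow> 'i \<Rightarrow> real) \<Rightarrow> complex set" where
  "complex_eigenvalues I M =
     {c. \<exists>z :: 'i \<Rightarrow> complex. (\<exists>i\<in>I. z i \<noteq> 0) \<and>
           (\<forall>i\<in>I. (\<Sum>j\<in>I. complex_of_real (M i j) * z j) = c * z i)}"

definition spectral_radius :: "'i set \<Rightarrow> ('i \<Rightarrow> 'i \<Rightarrow> real) \<Rightarrow> real" where
  "spectral_radius I M = Max (cmod ` complex_eigenvalues I M)"

definition homogeneous_affine_IFS ::
  "nat \<Rightarrow> (nat \<Rightarrow> real ^ 'd \<Rightarrow> real ^ 'd) \<Rightarrow> real ^ 'd ^ 'd \<Rightarrow> (nat \<Rightarrow> real ^ 'd) \<Rightarrow> bool" where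
  "homogeneous_affine_IFS m \<phi> A a \<longleftrightarrow>
     1 \<le> m \<and> invertible A \<and> spectral_radius UNIV (\<lambda>i j. A $ i $ j) < 1 \<and>
     (\<forall>l\<in>{1..m}. \<forall>x. \<phi> l x = A *v x + a l)"

text \<open>\<open>affine {}\<close> holds in the library, hence the explicit non-emptiness.\<close>

definition affinely_irreducible :: "nat \<Rightarrow> (nat \<Rightarrow> real ^ 'd \<Rightarrow> real ^ 'd) \<Rightarrow> bool" where
  "affinely_irreducible m \<phi> \<longleftrightarrow>
     \<not> (\<exists>V. affine V \<and> V \<noteq> {} \<and> V \<noteq> UNIV \<and> (\<forall>l\<in>{1..m}. \<phi> l ` V = V))"

definition strictly_positive_prob_vector :: "nat \<Rightarrow> (nat \<Rightarrow> real) \<Rightarrow> bool" where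
  "strictly_positive_prob_vector m p \<longleftrightarrow> (\<forall>l\<in>{1..m}. 0 < p l) \<and> (\<Sum>l\<in>{1..m}. p l) = 1"

text \<open>
  The measurable space is a parameter, so that the same definition serves \<open>borel\<close> on
  \<open>real ^ 'd\<close> and \<open>borel_Rq q\<close>.
\<close>

definition self_affine_measure ::
  "'x measure \<Rightarrow> nat \<Rightarrow> (nat \<Rightarrow> 'x \<Rightarrow> 'x) \<Rightarrow> (nat \<Rightarrow> real) \<Rightarrow> 'x measure \<Rightarrow> bool" where
  "self_affine_measure M m \<phi> p \<mu> \<longleftrightarrow>
     sets \<mu> = sets M \<and> emeasure \<mu> (space \<mu>) = 1 \<and>
     (\<forall>E\<in>sets M. measure \<mu> E = (\<Sum>l\<in>{1..m}. p l * measure \<mu> (\<phi> l -` E \<inter> space M)))"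


section \<open>Rajchman measures and singular measures\<close>

definition fourier_transform :: "(real ^ 'd) measure \<Rightarrow> real ^ 'd \<Rightarrow> complex" where
  "fourier_transform \<nu> \<xi> = (LINT x|\<nu>. exp (2 * of_real pi * \<i> * of_real (\<xi> \<bullet> x)))"

definition rajchman :: "(real ^ 'd) measure \<Rightarrow> bool" where
  "rajchman \<nu> \<longleftrightarrow> ((\<lambda>\<xi>. cmod (fourier_transform \<nu> \<xi>)) \<longlongrightarrow> 0) at_infinity"

definition singular_wrt :: "'x measure \<Rightarrow> 'x measure \<Rightarrow> bool" where
  "singular_wrt M \<nu> \<longleftrightarrow>
     (\<exists>N\<in>sets M. emeasure M N = 0 \<and> emeasure \<nu> (space M - N) = 0)"


section \<open>Pisot tuples and generalized Pisot systems\<close>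

definition pisot_witness :: "complex set \<Rightarrow> int poly \<Rightarrow> bool" where
  "pisot_witness B P \<longleftrightarrow>
     lead_coeff P = 1 \<and>
     (\<forall>\<beta>\<in>B. poly (map_poly of_int P) \<beta> = 0) \<and>
     (\<forall>z. poly (map_poly of_int P) z = 0 \<and> z \<notin> B \<longrightarrow> cmod z < 1)"

definition pisot_tuple :: "complex set \<Rightarrow> bool" where
  "pisot_tuple B \<longleftrightarrow>
     finite B \<and> B \<noteq> {} \<and> (\<forall>\<beta>\<in>B. algebraic_int \<beta>) \<and> (\<forall>\<beta>\<in>B. 1 < cmod \<beta>) \<and>
     (\<exists>P. pisot_witness B P)"

definition pisot_tuple_type_I :: "complex set \<Rightarrow> bool" where
  "pisot_tuple_type_I B \<longleftrightarrow>
     pisot_tuple B \<and>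
     (\<exists>P. is_arg_min degree (pisot_witness B) P \<and>
          (\<exists>z. poly (map_poly of_int P) z = 0 \<and> cmod z < 1))"

text \<open>The library's \<open>\<bullet>\<close> on \<open>complex ^ 'd\<close> is the real inner product.\<close>

definition hermitian_inner :: "complex ^ 'd \<Rightarrow> complex ^ 'd \<Rightarrow> complex" where
  "hermitian_inner z w = (\<Sum>j\<in>UNIV. z $ j * cnj (w $ j))"

definition complexify :: "real ^ 'd \<Rightarrow> complex ^ 'd" where
  "complexify x = (\<chi> j. complex_of_real (x $ j))"

definition generalized_pisot_data ::
  "nat \<Rightarrow> real ^ 'd ^ 'd \<Rightarrow> (nat \<Rightarrow> real ^ 'd) \<Rightarrow>
   nat \<Rightarrow> (nat \<Rightarrow> complex) \<Rightarrow> (nat \<Rightarrow> complex ^ 'd) \<Rightarrow> bool" where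
  "generalized_pisot_data m A a k \<beta> \<zeta> \<longleftrightarrow>
     1 \<le> k \<and> inj_on \<beta> {1..k} \<and> pisot_tuple (\<beta> ` {1..k}) \<and>
     (\<forall>j\<in>{1..k}. \<zeta> j \<noteq> 0 \<and>
        map_matrix complex_of_real (transpose A) *v \<zeta> j = inverse (\<beta> j) *s \<zeta> j) \<and>
     (\<forall>l\<in>{1..m}. \<exists>P :: int poly. \<forall>j\<in>{1..k}.
        hermitian_inner (\<zeta> j) (complexify (a l - a 1)) = poly (map_poly of_int P) (\<beta> j))"

definition generalized_pisot_IFS_type_I ::
  "nat \<Rightarrow> (nat \<Rightarrow> real ^ 'd \<Rightarrow> real ^ 'd) \<Rightarrow> real ^ 'd ^ 'd \<Rightarrow> (nat \<Rightarrow> real ^ 'd) \<Rightarrow> bool" where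
  "generalized_pisot_IFS_type_I m \<phi> A a \<longleftrightarrow>
     homogeneous_affine_IFS m \<phi> A a \<and>
     (\<exists>k \<beta> \<zeta>. generalized_pisot_data m A a k \<beta> \<zeta> \<and> pisot_tuple_type_I (\<beta> ` {1..k}))"


section \<open>Integral factors\<close>

definition inverse_matrices_Rq :: "nat \<Rightarrow> (nat \<Rightarrow> nat \<Rightarrow> real) \<Rightarrow> (nat \<Rightarrow> nat \<Rightarrow> real) \<Rightarrow> bool" where
  "inverse_matrices_Rq q B C \<longleftrightarrow>
     (\<forall>i<q. \<forall>j<q. (\<Sum>k<q. B i k * C k j) = (if i = j then 1 else 0) \<and>
                    (\<Sum>k<q. C i k * B k j) = (if i = j then 1 else 0))"

definition homogeneous_affine_IFS_Rq ::
  "nat \<Rightarrow> nat \<Rightarrow> (nat \<Rightarrow> (nat \<Rightarrow> real) \<Rightarrow> nat \<Rightarrow> real) \<Rightarrow>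
   (nat \<Rightarrow> nat \<Rightarrow> real) \<Rightarrow> (nat \<Rightarrow> nat \<Rightarrow> real) \<Rightarrow> bool" where
  "homogeneous_affine_IFS_Rq q m \<psi> B b \<longleftrightarrow>
     1 \<le> m \<and> (\<exists>C. inverse_matrices_Rq q B C) \<and> spectral_radius {..<q} B < 1 \<and>
     (\<forall>l\<in>{1..m}. \<forall>x\<in>Rq q. \<psi> l x = (\<lambda>i\<in>{..<q}. (\<Sum>j<q. B i j * x j) + b l i))"

definition integral_affine_IFS_Rq ::
  "nat \<Rightarrow> nat \<Rightarrow> (nat \<Rightarrow> (nat \<Rightarrow> real) \<Rightarrow> nat \<Rightarrow> real) \<Rightarrow> bool" where
  "integral_affine_IFS_Rq q m \<psi> \<longleftrightarrow>
     (\<exists>B b. homogeneous_affine_IFS_Rq q m \<psi> B b \<and>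
        (\<exists>C. inverse_matrices_Rq q B C \<and> (\<forall>i<q. \<forall>j<q. C i j \<in> \<int>)) \<and>
        (\<forall>l\<in>{1..m}. \<forall>i<q. b l i \<in> \<int>))"

definition orth_proj :: "(real ^ 'd) set \<Rightarrow> real ^ 'd \<Rightarrow> real ^ 'd" where
  "orth_proj V x = (THE y. y \<in> V \<and> (\<forall>v\<in>V. orthogonal (x - y) v))"

definition invertible_affine_map_onto_Rq ::
  "nat \<Rightarrow> (real ^ 'd) set \<Rightarrow> (real ^ 'd \<Rightarrow> nat \<Rightarrow> real) \<Rightarrow> bool" where
  "invertible_affine_map_onto_Rq q V T \<longleftrightarrow>
     bij_betw T V (Rq q) \<and>
     (\<exists>(L :: nat \<Rightarrow> real ^ 'd \<Rightarrow> real) (c :: nat \<Rightarrow> real).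
        (\<forall>i<q. linear (L i)) \<and> (\<forall>x\<in>V. T x = (\<lambda>i\<in>{..<q}. L i x + c i)))"

definition factor_IFS ::
  "nat \<Rightarrow> nat \<Rightarrow> (nat \<Rightarrow> (nat \<Rightarrow> real) \<Rightarrow> nat \<Rightarrow> real) \<Rightarrow>
   real ^ 'd ^ 'd \<Rightarrow> (nat \<Rightarrow> real ^ 'd) \<Rightarrow> bool" where
  "factor_IFS q m \<psi> A a \<longleftrightarrow>
     1 \<le> q \<and> q \<le> CARD('d) \<and>
     (\<exists>V T. subspace V \<and> V \<noteq> {0} \<and> (\<forall>x\<in>V. transpose A *v x \<in> V) \<and> dim V = q \<and>
        invertible_affine_map_onto_Rq q V T \<and>
        (\<forall>l\<in>{1..m}. \<forall>y\<in>Rq q.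
           \<psi> l y = T (let x = inv_into V T y in orth_proj V (A *v x) + orth_proj V (a l))))"

definition integral_factor_IFS ::
  "nat \<Rightarrow> nat \<Rightarrow> (nat \<Rightarrow> (nat \<Rightarrow> real) \<Rightarrow> nat \<Rightarrow> real) \<Rightarrow>
   real ^ 'd ^ 'd \<Rightarrow> (nat \<Rightarrow> real ^ 'd) \<Rightarrow> bool" where
  "integral_factor_IFS q m \<psi> A a \<longleftrightarrow> factor_IFS q m \<psi> A a \<and> integral_affine_IFS_Rq q m \<psi>"

end

theory Submission
  imports Defs "Jordan_Normal_Form.Determinant" "HOL-Probability.Probability"
    "HOL-Computational_Algebra.Fundamental_Theorem_Algebra"
begin

text \<open>
  Write \<open>E\<close> for the inverse of \<open>A\<^sup>T\<close> and \<open>P\<close> for the mask, so that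
  \<open>\<mu>^(\<xi>) = P(\<xi>) \<mu>^(A\<^sup>T \<xi>)\<close>. If \<open>\<mu>\<close> is not Rajchman, compactness gives an orbit
  \<open>E\<^sup>n \<eta>\<close> along which \<open>\<mu>^\<close> stays away from zero; then the squared distances of the numbers
  \<open>\<langle>E\<^sup>n \<eta>, a\<^sub>l - a\<^sub>1\<rangle>\<close> to the integers are summable, and the determinant argument of
  Pisot and Fatou yields a monic integer polynomial annihilating \<open>\<eta>\<close> under \<open>E\<close>. If the one of
  smallest degree has a root in the closed unit disc, its eigenvectors form type I Pisot data. Otherwise
  the orbit is eventually integral, its span carries an integral factor (with the inverse of a companion
  matrix as linear part), and a nonvanishing Fourier coefficient makes the factor measure singular.

  Conversely, a singular integral factor measure has a nonzero Fourier coefficient at a nonzero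
  integer vector (otherwise its image on the torus is Haar measure), and this coefficient is repeated
  along an orbit of \<open>E\<close>. For type I Pisot data, the trace forms \<open>g \<mapsto> \<Sum> \<beta>\<^sup>n g(\<beta>) / M'(\<beta>)\<close> give orbits
  whose phases are exponentially close to integers in both time directions. What remains is to choose
  \<open>g\<close> so that no factor of the infinite product for \<open>\<mu>^\<close> vanishes: for
  \<open>g = (a + b x\<^sup>L) h\<close> each time \<open>n\<close> in a window of length about \<open>log a + log b\<close> excludes few pairs
  \<open>(a, b)\<close>, because an exponential sum with \<open>m\<close> slow frequencies has at most \<open>2 m\<close> zeros.
\<close>

hide_const (open) Module.smult

text \<open>The mask may have zeros, and one vanishing factor kills \<open>muhat\<close> on all
  later points of an orbit of \<open>E\<close>, so phases close to integers are not enough for a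
  lower bound. This obstacle separates the two alternatives. A conjugate inside the unit circle
  (type I) makes the phases at nonnegative times deviate from integers by small amounts that vary
  with the parameters, and this freedom dodges the zeros for every \<open>p\<close>. Without such a
  conjugate the phases at nonnegative times are exact integers, nothing can be perturbed, and the
  outcome depends on \<open>p\<close> through the integral factor.

  In the other direction, determinants only give a recurrence for the nearest integers. It passes to
  the vector \<eta> because irreducibility amounts to observability: a vector whose
  \<open>E\<close>-orbit pairs to 0 with all \<open>a l - a 1\<close> is 0. Singularity of the
  factor measure comes from averaging characters along one orbit in the integer lattice: the
  averages tend to the common nonzero coefficient almost everywhere for the measure, and to 0 almost
  everywhere for Lebesgue measure.\<close>

abbreviation cpoly :: "int poly \<Rightarrow> complex poly" where
  "cpoly \<equiv> map_poly of_int"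

lemma cpoly_add: "cpoly (f + g) = cpoly f + cpoly g"
  by (intro poly_eqI) (simp add: coeff_map_poly)

lemma cpoly_diff: "cpoly (f - g) = cpoly f - cpoly g"
  by (intro poly_eqI) (simp add: coeff_map_poly)

lemma cpoly_smult: "cpoly (smult c g) = smult (of_int c) (cpoly g)"
  by (intro poly_eqI) (simp add: coeff_map_poly)

lemma cpoly_mult: "cpoly (f * g) = cpoly f * cpoly g"
  by (intro poly_eqI) (simp add: coeff_map_poly coeff_mult)

lemma cpoly_pCons: "cpoly (pCons a f) = pCons (of_int a) (cpoly f)"
  by (simp add: map_poly_pCons)

lemma cpoly_pderiv: "cpoly (pderiv f) = pderiv (cpoly f)"
  by (intro poly_eqI) (simp add: coeff_map_poly coeff_pderiv)

lemma degree_cpoly [simp]: "degree (cpoly f) = degree f"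
  by (rule degree_map_poly) simp

lemma cpoly_eq_0_iff [simp]: "cpoly f = 0 \<longleftrightarrow> f = 0"
  by (simp add: poly_eq_iff coeff_map_poly)

lemma poly_cpoly_cnj: "poly (cpoly f) (cnj z) = cnj (poly (cpoly f) z)"
  by (induction f) (simp_all add: cpoly_pCons)

subsection \<open>Polynomials in the shift operator\<close>

text \<open>For the shift \<open>S\<close> this is \<open>(f(S) x)(n)\<close>. Recurrences are read
  as annihilation by \<open>f(S)\<close>: products go to compositions (\<open>psh_mult\<close>), so
  splitting off a root of \<open>f\<close> lowers the order by one, and any two such operators
  commute.\<close>

definition psh :: "'a::comm_ring_1 poly \<Rightarrow> (nat \<Rightarrow> 'a) \<Rightarrow> nat \<Rightarrow> 'a" where
  "psh f x n = (\<Sum>i\<le>degree f. coeff f i * x (n + i))"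

lemma psh_le: "degree f \<le> d \<Longrightarrow> psh f x n = (\<Sum>i\<le>d. coeff f i * x (n + i))"
  unfolding psh_def by (intro sum.mono_neutral_left) (auto simp: coeff_eq_0)

lemma psh_0 [simp]: "psh 0 x n = 0"
  by (simp add: psh_def)

lemma psh_pCons: "psh (pCons a f) x n = a * x n + psh f x (Suc n)"
proof -
  have "psh (pCons a f) x n = (\<Sum>i\<le>Suc (degree f). coeff (pCons a f) i * x (n + i))"
    by (rule psh_le) (simp add: degree_pCons_le)
  then show ?thesis
    by (simp add: sum.atMost_Suc_shift psh_def del: sum.atMost_Suc)
qed

lemma psh_1 [simp]: "psh 1 x n = x n"
  by (simp add: psh_def)

lemma psh_add: "psh (f + g) x n = psh f x n + psh g x n"
proof -
  define d where "d = max (degree f) (degree g)"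
  have "degree (f + g) \<le> d" "degree f \<le> d" "degree g \<le> d"
    by (auto simp: d_def degree_add_le)
  then show ?thesis by (simp add: psh_le[of _ d] sum.distrib ring_distribs)
qed

lemma psh_smult: "psh (smult c f) x n = c * psh f x n"
proof -
  have "degree (smult c f) \<le> degree f" by (rule degree_smult_le)
  then show ?thesis by (simp add: psh_le[of _ "degree f"] sum_distrib_left mult.assoc)
qed

lemma psh_mult: "psh (f * g) x n = psh f (psh g x) n"
  by (induction f arbitrary: n) (simp_all add: psh_pCons psh_add psh_smult)

lemma psh_mult_commute: "psh f (psh g x) n = psh g (psh f x) n"
  by (metis psh_mult mult.commute)

lemma psh_shift: "psh f (\<lambda>i. x (i + k)) n = psh f x (n + k)"
  by (simp add: psh_def add_ac)

lemma psh_diff_right: "psh f (\<lambda>i. x i - y i) n = psh f x n - psh f y n"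
  by (simp add: psh_def sum_subtractf right_diff_distrib)

lemma psh_sum_right: "psh f (\<lambda>i. \<Sum>j\<in>J. x j i * c j) n = (\<Sum>j\<in>J. psh f (x j) n * c j)"
  unfolding psh_def by (simp add: sum_distrib_left sum_distrib_right mult.assoc) (rule sum.swap)

lemma psh_zero_right: "(\<And>i. x i = 0) \<Longrightarrow> psh f x n = 0"
  by (simp add: psh_def)

lemma psh_cpoly: "psh (cpoly f) (\<lambda>i. of_int (x i)) n = of_int (psh f x n)"
  by (simp add: psh_def coeff_map_poly)

lemma psh_geometric: "psh f (\<lambda>n. z ^ n * c) n = poly f z * (z ^ n * c)"
  by (induction f arbitrary: n) (simp_all add: psh_pCons algebra_simps)

lemma psh_tendsto_0:
  fixes x :: "nat \<Rightarrow> 'a::real_normed_field"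
  assumes "x \<longlonglongrightarrow> 0"
  shows "psh f x \<longlonglongrightarrow> 0"
proof -
  have "(\<lambda>n. \<Sum>i\<le>degree f. coeff f i * x (n + i)) \<longlonglongrightarrow> (\<Sum>i\<le>degree f. coeff f i * 0)"
    by (intro tendsto_sum tendsto_mult tendsto_const LIMSEQ_ignore_initial_segment assms)
  then show ?thesis by (simp add: psh_def[abs_def])
qed

section \<open>Recurrences with all roots on one side of the unit circle\<close>

lemma linear_factor_recurrence:
  fixes z :: "'a::comm_ring_1"
  assumes "\<And>n. psh [:- z, 1:] w n = 0"
  shows "w n = z ^ n * w 0"
  by (induction n) (use assms in \<open>auto simp: psh_pCons\<close>)

lemma synthetic_div_root:
  fixes z :: "'a::comm_ring_1"
  assumes "poly f z = 0"
  shows "f = [:- z, 1:] * synthetic_div f z"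
  using synthetic_div_correct'[of z f] assms by simp

lemma psh_linear_tendsto_0:
  fixes x :: "nat \<Rightarrow> complex"
  assumes z: "cmod z < 1" and w: "psh [:- z, 1:] x \<longlonglongrightarrow> 0"
  shows "x \<longlonglongrightarrow> 0"
proof -
  define r where "r = cmod z"
  have r: "0 \<le> r" "r < 1" using z by (auto simp: r_def)
  have rec: "x (Suc n) = z * x n + psh [:- z, 1:] x n" for n
    by (simp add: psh_pCons)
  show ?thesis
  proof (rule LIMSEQ_I)
    fix e :: real assume e: "e > 0"
    then have "(1 - r) * e / 2 > 0" using r by simp
    with w obtain N where N: "\<And>n. n \<ge> N \<Longrightarrow> cmod (psh [:- z, 1:] x n) < (1 - r) * e / 2"
      by (metis LIMSEQ_iff diff_zero)
    \<comment> \<open>\<open>e / 2\<close> is the fixed point of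
      \<open>t \<mapsto> r * t + (1 - r) * e / 2\<close>; this dictated the bound
      \<open>(1 - r) * e / 2\<close> on the forcing term.\<close>
    have bd: "cmod (x (N + n)) \<le> r ^ n * cmod (x N) + e / 2" for n
    proof (induction n)
      case 0 then show ?case using e by simp
    next
      case (Suc n)
      have "cmod (x (Suc (N + n))) \<le> r * cmod (x (N + n)) + (1 - r) * e / 2"
        using N[of "N + n"] rec[of "N + n"] norm_triangle_ineq[of "z * x (N + n)" "psh [:- z, 1:] x (N + n)"]
        by (simp add: norm_mult r_def)
      also have "\<dots> \<le> r * (r ^ n * cmod (x N) + e / 2) + (1 - r) * e / 2"
        using Suc r by (intro add_right_mono mult_left_mono) auto
      also have "\<dots> = r ^ Suc n * cmod (x N) + e / 2" by (simp add: field_simps)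
      finally show ?case by simp
    qed
    have "(\<lambda>n. r ^ n * cmod (x N)) \<longlonglongrightarrow> 0 * cmod (x N)"
      using r by (intro tendsto_mult LIMSEQ_realpow_zero tendsto_const) auto
    then obtain K where K: "\<And>n. n \<ge> K \<Longrightarrow> r ^ n * cmod (x N) < e / 2"
      using e LIMSEQ_D[of "\<lambda>n. r ^ n * cmod (x N)" 0 "e/2"] by fastforce
    show "\<exists>no. \<forall>n\<ge>no. norm (x n - 0) < e"
    proof (intro exI allI impI)
      fix n assume "n \<ge> N + K"
      then have n: "n - N \<ge> K" "N + (n - N) = n" by auto
      show "norm (x n - 0) < e" using bd[of "n - N"] K[OF n(1)] n(2) by simp
    qed
  qed
qed

text \<open>Peel off one root \<open>z\<close>: the sequence \<open>psh g x\<close> obeys a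
  first-order recurrence with ratio \<open>z\<close> and a forcing term tending to 0, hence tends to
  0 itself, and the induction applies to the quotient \<open>g\<close>.\<close>

lemma contracting_recurrence:
  fixes x :: "nat \<Rightarrow> complex"
  assumes "f \<noteq> 0" "\<And>z. poly f z = 0 \<Longrightarrow> cmod z < 1" "psh f x \<longlonglongrightarrow> 0"
  shows "x \<longlonglongrightarrow> 0"
  using assms
proof (induction "degree f" arbitrary: f x)
  case 0
  then obtain c where c: "f = [:c:]" "c \<noteq> 0" by (metis degree_eq_zeroE pCons_0_0)
  have "(\<lambda>n. psh f x n / c) \<longlonglongrightarrow> 0 / c" using 0 c by (intro tendsto_divide tendsto_const) auto
  then show ?case using c by (simp add: psh_pCons)
next
  case (Suc d)
  then have "\<not> constant (poly f)" by (simp add: constant_degree)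
  then obtain z where z: "poly f z = 0" using fundamental_theorem_of_algebra by blast
  define g where "g = synthetic_div f z"
  have f: "f = [:- z, 1:] * g" using synthetic_div_root[OF z] by (simp add: g_def)
  have "degree g = d" using Suc(2) degree_synthetic_div[of f z] by (simp add: g_def)
  moreover have "g \<noteq> 0" using f Suc.prems(1) by auto
  moreover have "\<And>y. poly g y = 0 \<Longrightarrow> cmod y < 1" using Suc.prems(2) f by simp
  moreover have "psh g x \<longlonglongrightarrow> 0"
  proof (rule psh_linear_tendsto_0)
    show "cmod z < 1" using Suc.prems z by simp
    have "psh [:- z, 1:] (psh g x) = psh f x" by (rule ext) (simp only: f psh_mult)
    then show "psh [:- z, 1:] (psh g x) \<longlonglongrightarrow> 0" using Suc.prems by metis
  qed
  ultimately show ?case using Suc(1) by blast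
qed

text \<open>After splitting off a root \<open>z\<close>, \<open>psh g x\<close> is geometric with
  ratio of modulus at least 1 and yet tends to 0, so it is 0 and the degree drops. This later
  upgrades asymptotically integral phases to integral ones.\<close>

lemma expanding_recurrence:
  fixes x :: "nat \<Rightarrow> complex"
  assumes "f \<noteq> 0" "\<And>z. poly f z = 0 \<Longrightarrow> 1 \<le> cmod z" "\<And>n. psh f x n = 0" "x \<longlonglongrightarrow> 0"
  shows "x n = 0"
  using assms
proof (induction "degree f" arbitrary: f x n)
  case 0
  then obtain c where c: "f = [:c:]" "c \<noteq> 0" by (metis degree_eq_zeroE pCons_0_0)
  then show ?case using 0(4)[of n] by (simp add: psh_pCons)
next
  case (Suc d)
  then have "\<not> constant (poly f)" by (simp add: constant_degree)
  then obtain z where z: "poly f z = 0" using fundamental_theorem_of_algebra by blast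
  define g where "g = synthetic_div f z"
  have f: "f = [:- z, 1:] * g" using synthetic_div_root[OF z] by (simp add: g_def)
  have dg: "degree g = d" using Suc(2) degree_synthetic_div[of f z] by (simp add: g_def)
  have gz: "g \<noteq> 0" using f Suc.prems(1) by auto
  have gr: "\<And>y. poly g y = 0 \<Longrightarrow> 1 \<le> cmod y" using Suc.prems(2) f by simp
  have w: "psh g x n = z ^ n * psh g x 0" for n
    by (rule linear_factor_recurrence) (use Suc.prems(3) in \<open>simp only: f psh_mult\<close>)
  have "cmod (psh g x 0) \<le> cmod (psh g x n)" for n
    using Suc.prems(2)[OF z] by (subst w) (simp add: norm_mult norm_power mult_right_le_one_le mult_le_cancel_right1)
  moreover have "(\<lambda>n. cmod (psh g x n)) \<longlonglongrightarrow> 0"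
    using psh_tendsto_0[OF Suc.prems(4)] tendsto_norm_zero by blast
  ultimately have "cmod (psh g x 0) \<le> 0"
    by (intro LIMSEQ_le_const[of "\<lambda>n. cmod (psh g x n)"]) auto
  then have "\<And>n. psh g x n = 0" by (metis mult_zero_right norm_le_zero_iff w)
  then show ?case using Suc(1)[OF dg[symmetric] gz gr] Suc.prems(4) by blast
qed

section \<open>Integer sequences: from some recurrence to a monic one\<close>

text \<open>The subgroup of a lattice generated by a sequence of vectors is finitely generated, so
  some vector is an integer combination of its predecessors. The induction on the dimension
  eliminates the last coordinate.\<close>

lemma integer_vectors_noetherian:
  fixes v :: "nat \<Rightarrow> nat \<Rightarrow> int"
  shows "\<exists>k c. \<forall>t<d. v k t = (\<Sum>i<k. c i * v i t)"
proof (induction d arbitrary: v)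
  case 0 then show ?case by simp
next
  case (Suc d)
  define I where "I = {s. \<exists>k c. s = (\<Sum>i<k. c i * v i d)}"
  have single: "v i d \<in> I" for i
    unfolding I_def
    by (rule CollectI, rule exI[of _ "Suc i"], rule exI[of _ "\<lambda>j. if j = i then 1 else 0"])
       (simp add: sum.If_cases)
  show ?case
  proof (cases "\<forall>i. v i d = 0")
    case True
    from Suc[of v] obtain k c where "\<forall>t<d. v k t = (\<Sum>i<k. c i * v i t)" by blast
    then show ?thesis using True by (intro exI[of _ k] exI[of _ c]) (auto simp: less_Suc_eq)
  next
    case False
    then obtain i0 where "v i0 d \<noteq> 0" by blast
    then have ex: "\<exists>s\<in>I. s \<noteq> 0" using single by blast
    obtain g where g: "g \<in> I" "g \<noteq> 0" and min: "\<And>s. s \<in> I \<Longrightarrow> s \<noteq> 0 \<Longrightarrow> nat \<bar>g\<bar> \<le> nat \<bar>s\<bar>"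
      using ex_has_least_nat[of "\<lambda>s. s \<in> I \<and> s \<noteq> 0" _ "\<lambda>s. nat \<bar>s\<bar>"] ex by metis
    from g obtain k0 c0 where g_eq: "g = (\<Sum>i<k0. c0 i * v i d)" by (auto simp: I_def)
    \<comment> \<open>\<open>I\<close> is an ideal of the integers and \<open>g\<close> a nonzero
      element of least absolute value: a nonzero remainder would be a smaller one.\<close>
    have "v i d mod g = 0" for i
    proof (rule ccontr)
      assume nz: "v i d mod g \<noteq> 0"
      define K where "K = max k0 (Suc i)"
      define c1 c2 where "c1 j = (if j < k0 then c0 j else 0)" and "c2 j = (if j = i then 1 else 0 :: int)" for j
      have S1: "(\<Sum>j<K. c1 j * v j d) = g"
        unfolding g_eq by (rule sum.mono_neutral_cong_right) (auto simp: K_def c1_def)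
      have S2: "(\<Sum>j<K. c2 j * v j d) = v i d"
        by (simp add: c2_def K_def if_distrib[of "\<lambda>x. x * _"] cong: if_cong)
      have "v i d - (v i d div g) * g = (\<Sum>j<K. (c2 j - (v i d div g) * c1 j) * v j d)"
        by (simp add: left_diff_distrib sum_subtractf sum_distrib_left[symmetric] mult.assoc S1 S2)
      then have "v i d mod g \<in> I"
        unfolding I_def minus_div_mult_eq_mod by (intro CollectI exI)
      from min[OF this nz] have "\<bar>g\<bar> \<le> \<bar>v i d mod g\<bar>" by linarith
      moreover have "\<bar>v i d mod g\<bar> < \<bar>g\<bar>" using g(2) by (rule abs_mod_less)
      ultimately show False by linarith
    qed
    then have q: "v i d = (v i d div g) * g" for i
      using mult_div_mod_eq[of g "v i d"] by (simp add: mult.commute)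
    \<comment> \<open>\<open>T\<close> is a combination of the first \<open>k0\<close> vectors with
      last coordinate \<open>g\<close>. Subtracting multiples of it from the later vectors clears
      their last coordinate and leaves vectors in dimension \<open>d\<close>.\<close>
    define T where "T t = (\<Sum>j<k0. c0 j * v j t)" for t
    define u where "u i = v (k0 + i) d div g" for i
    define w where "w i t = v (k0 + i) t - u i * T t" for i t
    from Suc[of w] obtain k e where ke: "\<forall>t<d. w k t = (\<Sum>i<k. e i * w i t)" by blast
    have wd: "w i d = 0" for i
      using q[of "k0 + i"] by (simp add: w_def T_def u_def g_eq[symmetric])
    have w_all: "w k t = (\<Sum>i<k. e i * w i t)" if "t < Suc d" for t
      using that ke wd by (auto simp: less_Suc_eq)
    define S where "S = (\<Sum>i<k. e i * u i)"
    define c where "c j = (if j < k0 then (u k - S) * c0 j else e (j - k0))" for j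
    have step: "v (k0 + k) t = (\<Sum>i<k0 + k. c i * v i t)" if t: "t < Suc d" for t
    proof -
      have split: "(\<Sum>i<k0 + l. c i * v i t) = (\<Sum>i<k0. c i * v i t) + (\<Sum>i<l. c (k0 + i) * v (k0 + i) t)" for l
        by (induction l) (simp_all add: add.assoc)
      have 1: "(\<Sum>i<k0. c i * v i t) = (u k - S) * T t"
        by (simp add: c_def T_def sum_distrib_left mult.assoc)
      have 2: "(\<Sum>i<k. c (k0 + i) * v (k0 + i) t) = (\<Sum>i<k. e i * w i t + e i * u i * T t)"
        by (rule sum.cong) (simp_all add: c_def w_def right_diff_distrib mult.assoc)
      also have "\<dots> = w k t + S * T t"
        by (simp only: sum.distrib S_def sum_distrib_right[symmetric] w_all[OF t])
      finally show ?thesis using 1 by (simp only: split) (simp add: w_def left_diff_distrib)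
    qed
    show ?thesis by (rule exI[of _ "k0 + k"], rule exI[of _ c]) (use step in blast)
  qed
qed

lemma monic_of_coeffs:
  fixes c :: "nat \<Rightarrow> 'a::comm_ring_1"
  obtains f where "lead_coeff f = 1" "degree f = k" "\<And>i. i < k \<Longrightarrow> coeff f i = c i"
    "\<And>x n. psh f x n = x (n + k) + (\<Sum>i<k. c i * x (n + i))"
proof -
  define f where "f = monom 1 k + (\<Sum>i<k. monom (c i) i)"
  have cf: "coeff f i = (if i = k then 1 else if i < k then c i else 0)" for i
    by (auto simp: f_def coeff_sum)
  have deg: "degree f = k"
    by (rule antisym[OF degree_le le_degree]) (auto simp: cf)
  have "psh f x n = x (n + k) + (\<Sum>i<k. c i * x (n + i))" for x n
    unfolding psh_def deg lessThan_Suc_atMost[symmetric] sum.lessThan_Suc by (simp add: cf add.commute)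
  then show thesis using that[of f] deg cf by simp
qed

text \<open>Fatou's lemma for sequences. The windows of length \<open>degree R\<close> are integer
  vectors, so one of them depends on earlier ones; this is a monic \<open>Q\<close> with
  \<open>psh Q N\<close> zero on the first \<open>degree R\<close> places. As \<open>psh Q N\<close>
  also satisfies the recurrence of \<open>R\<close>, it vanishes everywhere.\<close>

lemma integer_recurrence_monic:
  fixes N :: "nat \<Rightarrow> int"
  assumes "R \<noteq> 0" "\<And>n. psh R N n = 0"
  shows "\<exists>Q. lead_coeff Q = 1 \<and> (\<forall>n. psh Q N n = 0)"
proof -
  define d where "d = degree R"
  from integer_vectors_noetherian[of d "\<lambda>i t. N (i + t)"] obtain k c
    where kc: "\<forall>t<d. N (k + t) = (\<Sum>i<k. c i * N (i + t))" by blast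
  obtain Q where Q: "lead_coeff Q = 1" "\<And>x n. psh Q x n = x (n + k) + (\<Sum>i<k. - c i * x (n + i))"
    using monic_of_coeffs[of k "\<lambda>i. - c i"] by metis
  have init: "psh Q N n = 0" if "n < d" for n
    using kc[rule_format, OF that] by (simp add: Q(2) add.commute sum_negf)
  have R: "psh R (psh Q N) n = 0" for n
    using psh_mult_commute[of R Q N n] psh_zero_right[of "psh R N" Q n] assms(2) by simp
  have "psh Q N n = 0" for n
  proof (induction n rule: less_induct)
    case (less n)
    show ?case
    proof (cases "n < d")
      case False
      have z: "psh Q N (n - d + i) = 0" if "i < d" for i using less[of "n - d + i"] that False by simp
      have "0 = (\<Sum>i\<le>d. coeff R i * psh Q N (n - d + i))"
        using R[of "n - d"] by (simp add: psh_def[of R] d_def)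
      also have "\<dots> = coeff R d * psh Q N n"
        using z False by (simp add: lessThan_Suc_atMost[symmetric])
      finally show ?thesis using assms(1) by (simp add: d_def)
    qed (use init in auto)
  qed
  then show ?thesis using Q by blast
qed

text \<open>By Gauss's lemma the primitive part of an element of least degree of the ideal divides both polynomials.\<close>

lemma int_poly_bezout:
  fixes Q R :: "int poly"
  assumes "Q \<noteq> 0"
  obtains W a b c where "W dvd Q" "W dvd R" "c \<noteq> 0" "smult c W = a * Q + b * R"
proof -
  define I where "I = {a * Q + b * R | a b. True}"
  have "1 * Q + 0 * R \<in> I" unfolding I_def by blast
  then have "\<exists>W. W \<in> I \<and> W \<noteq> 0" using assms by auto
  then obtain W0 where W0: "W0 \<in> I" "W0 \<noteq> 0"
    and min: "\<And>W. W \<in> I \<Longrightarrow> W \<noteq> 0 \<Longrightarrow> degree W0 \<le> degree W"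
    using ex_has_least_nat[of "\<lambda>W. W \<in> I \<and> W \<noteq> 0" _ degree] by metis
  from W0 obtain a b where ab: "W0 = a * Q + b * R" by (auto simp: I_def)
  define W where "W = primitive_part W0"
  define c where "c = content W0"
  have W0_eq: "W0 = smult c W" by (simp add: W_def c_def)
  have c: "c \<noteq> 0" using W0 by (auto simp: c_def)
  have dv: "W dvd S" if S: "S = a' * Q + b' * R" for S a' b'
  proof -
    obtain q r where qr: "pseudo_divmod S W0 = (q, r)" by force
    define k where "k = coeff W0 (degree W0) ^ (Suc (degree S) - degree W0)"
    have eq: "smult k S = W0 * q + r" and r: "r = 0 \<or> degree r < degree W0"
      using pseudo_divmod[OF W0(2) qr] by (auto simp: k_def)
    have "r = smult k S - W0 * q" using eq by simp
    also have "\<dots> = ([:k:] * a' - q * a) * Q + ([:k:] * b' - q * b) * R"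
      by (simp add: S ab algebra_simps smult_add_right)
    finally have "r \<in> I" by (auto simp: I_def)
    then have "r = 0" using r min[of r] not_less by blast
    then have "smult k S = W * smult c q" using eq W0_eq by simp
    then have "W dvd smult k S" by (simp add: dvd_smult)
    \<comment> \<open>The constant \<open>k\<close> cancels over the fraction field, and primitivity
      of \<open>W\<close> brings the divisibility back to integer coefficients.\<close>
    from fract_poly_dvd[OF this]
    have "map_poly to_fract W dvd smult (to_fract k) (map_poly to_fract S)"
      by (simp only: fract_poly_smult)
    moreover have "to_fract k \<noteq> 0" using W0(2) by (simp add: k_def)
    ultimately have "map_poly to_fract W dvd map_poly to_fract S"
      using dvd_smult_cancel by blast
    then show ?thesis using W0(2) by (intro fract_poly_dvdD) (auto simp: W_def)
  qed
  have "W dvd Q" by (rule dv[of _ 1 0]) simp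
  moreover have "W dvd R" by (rule dv[of _ 0 1]) simp
  ultimately show thesis using that c ab W0_eq by metis
qed

lemma poly_cpoly_smult: "poly (cpoly (smult c f)) z = of_int c * poly (cpoly f) z"
  by (simp add: cpoly_smult)

section \<open>Minimal polynomials over the integers\<close>

text \<open>Minimality is required among monic polynomials only; that \<open>M\<close> divides every
  integer polynomial sharing a root with it is the content of
  \<open>min_int_poly_dvd\<close>.\<close>

definition min_int_poly :: "int poly \<Rightarrow> complex \<Rightarrow> bool" where
  "min_int_poly M z \<longleftrightarrow> lead_coeff M = 1 \<and> poly (cpoly M) z = 0 \<and>
     (\<forall>P. lead_coeff P = 1 \<and> poly (cpoly P) z = 0 \<longrightarrow> degree M \<le> degree P)"

lemma min_int_poly_exists:
  assumes "lead_coeff P = 1" "poly (cpoly P) z = 0"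
  obtains M where "min_int_poly M z"
  using ex_has_least_nat[of "\<lambda>P. lead_coeff P = 1 \<and> poly (cpoly P) z = 0" P degree] assms
  unfolding min_int_poly_def by metis

text \<open>A Bezout combination produces a common divisor \<open>W\<close> of \<open>M\<close> and
  \<open>R\<close> vanishing at \<open>z\<close>. In \<open>M = W * S\<close> both leading
  coefficients are units, so the factor that vanishes at \<open>z0\<close> has full degree, and the
  other one is constant. Since \<open>z\<close> is any root of \<open>M\<close>, all conjugates are
  on an equal footing.\<close>

lemma min_int_poly_dvd:
  assumes M: "min_int_poly M z0" and z: "poly (cpoly M) z = 0" "poly (cpoly R) z = 0"
  shows "M dvd R"
proof -
  have lM: "lead_coeff M = 1" and M0: "M \<noteq> 0" and z0: "poly (cpoly M) z0 = 0"
    and min: "\<And>P. lead_coeff P = 1 \<Longrightarrow> poly (cpoly P) z0 = 0 \<Longrightarrow> degree M \<le> degree P"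
    using M by (auto simp: min_int_poly_def)
  obtain W a b c where W: "W dvd M" "W dvd R" "c \<noteq> 0" "smult c W = a * M + b * R"
    using int_poly_bezout[OF M0] by metis
  have "of_int c * poly (cpoly W) z = 0"
    unfolding poly_cpoly_smult[symmetric] W(4) using z by (simp add: cpoly_add cpoly_mult)
  then have Wz: "poly (cpoly W) z = 0" using W(3) by simp
  obtain S where S: "M = W * S" using W(1) by blast
  have nz: "W \<noteq> 0" "S \<noteq> 0" using S M0 by auto
  have lc: "lead_coeff W * lead_coeff S = 1" using lM by (simp add: S lead_coeff_mult)
  then have lc1: "lead_coeff W * lead_coeff W = 1" "lead_coeff S * lead_coeff S = 1"
    by (auto simp: zmult_eq_1_iff)
  have deg: "degree M = degree W + degree S" using nz by (simp add: S degree_mult_eq)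
  have monic: "degree M \<le> degree V" if "poly (cpoly V) z0 = 0" "lead_coeff V * lead_coeff V = 1" for V
  proof -
    have "degree M \<le> degree (smult (lead_coeff V) V)"
      by (rule min) (use that in \<open>auto simp: cpoly_smult\<close>)
    then show ?thesis using degree_smult_le order_trans by blast
  qed
  have "poly (cpoly W) z0 * poly (cpoly S) z0 = 0" using z0 by (simp add: S cpoly_mult)
  then consider "poly (cpoly W) z0 = 0" | "poly (cpoly S) z0 = 0" by auto
  then show ?thesis
  proof cases
    case 1
    then have "degree S = 0" using monic[of W] lc1 deg by auto
    then obtain s where s: "S = [:s:]" by (rule degree_eq_zeroE)
    then have "s * s = 1" using lc1 by simp
    then have "W = M * [:s:]" by (simp add: S s mult.assoc)
    then have "M dvd W" by (metis dvd_triv_left)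
    then show ?thesis using W(2) dvd_trans by blast
  next
    case 2
    then have "degree W = 0" using monic[of S] lc1 deg by auto
    then obtain w where "W = [:w:]" by (rule degree_eq_zeroE)
    then show ?thesis using Wz nz by (simp add: cpoly_pCons)
  qed
qed

lemma min_int_poly_degree: 
  assumes "min_int_poly M z0" shows "degree M > 0"
proof (rule ccontr)
  assume "\<not> ?thesis"
  then obtain c where "M = [:c:]" by (auto elim: degree_eq_zeroE)
  then show False using assms by (auto simp: min_int_poly_def cpoly_pCons)
qed

lemma min_int_poly_simple_roots:
  assumes M: "min_int_poly M z0" and z: "poly (cpoly M) z = 0"
  shows "poly (pderiv (cpoly M)) z \<noteq> 0"
proof
  assume "poly (pderiv (cpoly M)) z = 0"
  then have "poly (cpoly (pderiv M)) z = 0" by (simp add: cpoly_pderiv)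
  then have "M dvd pderiv M" by (rule min_int_poly_dvd[OF M z])
  then show False using min_int_poly_degree[OF M] by simp
qed

section \<open>Interpolation at simple roots\<close>

lemma root_quotient_deriv:
  fixes f :: "'a::{idom} poly"
  assumes "poly f z = 0"
  shows "poly (synthetic_div f z) z = poly (pderiv f) z"
proof -
  have "pderiv f = pderiv ([:- z, 1:] * synthetic_div f z)" using synthetic_div_root[OF assms] by simp
  then show ?thesis by (simp only: pderiv_mult) (simp add: pderiv_pCons)
qed

lemma card_simple_roots:
  fixes f :: "complex poly"
  assumes "f \<noteq> 0" "\<And>z. poly f z = 0 \<Longrightarrow> poly (pderiv f) z \<noteq> 0"
  shows "card {z. poly f z = 0} = degree f"
  using assms
proof (induction "degree f" arbitrary: f)
  case 0
  then obtain c where "f = [:c:]" "c \<noteq> 0" by (metis degree_eq_zeroE pCons_0_0)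
  then show ?case by simp
next
  case (Suc d)
  then have "\<not> constant (poly f)" by (simp add: constant_degree)
  then obtain z where z: "poly f z = 0" using fundamental_theorem_of_algebra by blast
  define g where "g = synthetic_div f z"
  have f: "f = [:- z, 1:] * g" using synthetic_div_root[OF z] by (simp add: g_def)
  have dg: "degree g = d" using Suc(2) degree_synthetic_div[of f z] by (simp add: g_def)
  have gz: "g \<noteq> 0" using f Suc.prems(1) by auto
  have zg: "poly g z \<noteq> 0" using root_quotient_deriv[OF z] Suc.prems(2)[OF z] by (simp add: g_def)
  have "poly (pderiv g) y \<noteq> 0" if y: "poly g y = 0" for y
  proof -
    have "poly f y = 0" using y f by simp
    moreover have "poly (pderiv f) y = (y - z) * poly (pderiv g) y"
      unfolding f pderiv_mult using y by (simp add: pderiv_pCons left_diff_distrib)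
    ultimately show ?thesis using Suc.prems(2)[of y] by auto
  qed
  then have "card {z. poly g z = 0} = d" using Suc(1)[OF dg[symmetric] gz] dg by simp
  moreover have "{z. poly f z = 0} = insert z {z. poly g z = 0}" using f by auto
  ultimately show ?case using zg poly_roots_finite[OF gz] Suc(2) by simp
qed

text \<open>The quotient of \<open>f\<close> by \<open>x - z\<close> vanishes at the other roots and
  takes the value \<open>f'(z)\<close> at \<open>z\<close>, so both sides agree at
  \<open>degree f\<close> points while having smaller degree.\<close>

lemma lagrange_identity:
  fixes f h :: "complex poly"
  assumes simple: "\<And>z. poly f z = 0 \<Longrightarrow> poly (pderiv f) z \<noteq> 0" and "degree h < degree f"
  shows "h = (\<Sum>z | poly f z = 0. smult (poly h z / poly (pderiv f) z) (synthetic_div f z))" (is "_ = ?s")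
proof -
  have f0: "f \<noteq> 0" using assms(2) by auto
  define Z where "Z = {z. poly f z = 0}"
  have fin: "finite Z" using poly_roots_finite[OF f0] by (simp add: Z_def)
  have card: "card Z = degree f" unfolding Z_def using card_simple_roots f0 simple by blast
  have off: "poly (synthetic_div f z) y = 0" if "z \<in> Z" "y \<in> Z" "y \<noteq> z" for y z
  proof -
    have "poly f y = (y - z) * poly (synthetic_div f z) y"
      using arg_cong[OF synthetic_div_root[of f z], of "\<lambda>p. poly p y"] that(1)
      by (simp add: Z_def left_diff_distrib)
    then show ?thesis using that by (simp add: Z_def)
  qed
  show ?thesis unfolding Z_def[symmetric]
  proof (rule poly_eqI_degree[of Z])
    fix y assume y: "y \<in> Z"
    have "poly (\<Sum>z\<in>Z. smult (poly h z / poly (pderiv f) z) (synthetic_div f z)) y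
       = (\<Sum>z\<in>Z. if z = y then poly h y else 0)"
      unfolding poly_sum
    proof (rule sum.cong)
      fix z assume z: "z \<in> Z"
      show "poly (smult (poly h z / poly (pderiv f) z) (synthetic_div f z)) y = (if z = y then poly h y else 0)"
        using off[OF z y] simple[of z] root_quotient_deriv[of f z] z by (auto simp: Z_def)
    qed simp
    then show "poly h y = poly (\<Sum>z\<in>Z. smult (poly h z / poly (pderiv f) z) (synthetic_div f z)) y"
      using y fin by simp
  next
    show "card Z > degree h" using assms(2) card by simp
    have "degree (smult (poly h z / poly (pderiv f) z) (synthetic_div f z)) \<le> degree f - 1" for z
      using degree_smult_le[of _ "synthetic_div f z"] by (simp add: degree_synthetic_div)
    then have "degree (\<Sum>z\<in>Z. smult (poly h z / poly (pderiv f) z) (synthetic_div f z)) \<le> degree f - 1"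
      by (intro degree_sum_le fin) auto
    then show "card Z > degree (\<Sum>z\<in>Z. smult (poly h z / poly (pderiv f) z) (synthetic_div f z))"
      using assms(2) card by linarith
  qed
qed

text \<open>Euler's identity: the sum of \<open>h(z) / M'(z)\<close> is the coefficient of \<open>h mod M\<close> in degree \<open>deg M - 1\<close>.\<close>

lemma sum_roots_over_deriv_int:
  assumes M: "lead_coeff M = 1" and deg: "degree M > 0"
    and simple: "\<And>z. poly (cpoly M) z = 0 \<Longrightarrow> poly (pderiv (cpoly M)) z \<noteq> 0"
  shows "(\<Sum>z | poly (cpoly M) z = 0. poly (cpoly h) z / poly (pderiv (cpoly M)) z) \<in> \<int>"
proof -
  have M0: "M \<noteq> 0" using M by auto
  define Z where "Z = {z. poly (cpoly M) z = 0}"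
  obtain q r where qr: "pseudo_divmod h M = (q, r)" by force
  have eq: "h = M * q + r" and r: "r = 0 \<or> degree r < degree M"
    using pseudo_divmod[OF M0 qr] M by auto
  have dr: "degree (cpoly r) < degree (cpoly M)" using r deg by auto
  \<comment> \<open>The quotients of \<open>M\<close> by \<open>x - z\<close> are monic, so
    comparing coefficients of degree \<open>degree M - 1\<close> in the interpolation formula leaves
    the bare sum.\<close>
  have one: "coeff (synthetic_div (cpoly M) z) (degree M - 1) = 1" if "z \<in> Z" for z
  proof -
    have "lead_coeff (cpoly M) = lead_coeff ([:- z, 1:] * synthetic_div (cpoly M) z)"
      using synthetic_div_root[of "cpoly M" z] that by (simp add: Z_def)
    then have "lead_coeff (cpoly M) = lead_coeff (synthetic_div (cpoly M) z)"
      by (simp only: lead_coeff_mult) simp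
    then show ?thesis using M by (simp add: degree_synthetic_div coeff_map_poly)
  qed
  have "coeff (cpoly r) (degree M - 1)
      = (\<Sum>z\<in>Z. poly (cpoly r) z / poly (pderiv (cpoly M)) z * coeff (synthetic_div (cpoly M) z) (degree M - 1))"
    by (subst lagrange_identity[OF simple dr]) (simp_all add: coeff_sum Z_def)
  also have "\<dots> = (\<Sum>z\<in>Z. poly (cpoly h) z / poly (pderiv (cpoly M)) z)"
  proof (rule sum.cong)
    fix z assume z: "z \<in> Z"
    then have "poly (cpoly h) z = poly (cpoly r) z" by (simp add: eq cpoly_add cpoly_mult Z_def)
    then show "poly (cpoly r) z / poly (pderiv (cpoly M)) z * coeff (synthetic_div (cpoly M) z) (degree M - 1)
      = poly (cpoly h) z / poly (pderiv (cpoly M)) z" using one[OF z] by simp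
  qed simp
  finally have "(\<Sum>z\<in>Z. poly (cpoly h) z / poly (pderiv (cpoly M)) z) = of_int (coeff r (degree M - 1))"
    by (simp add: coeff_map_poly)
  then show ?thesis unfolding Z_def by (metis Ints_of_int)
qed

text \<open>The coefficients of the quotient of \<open>M\<close> by \<open>x - z\<close> are integer
  polynomials in \<open>z\<close>. A single \<open>h\<close> serves all roots; it becomes the
  polynomial demanded by the Pisot data.\<close>

lemma psh_root_quotient:
  "\<exists>h. \<forall>z. psh (synthetic_div (cpoly M) z) (\<lambda>i. of_int (N i)) n = poly (cpoly h) z"
proof (induction M arbitrary: n)
  case 0
  show ?case by (rule exI[of _ 0]) simp
next
  case (pCons a M)
  obtain h where h: "\<forall>z. psh (synthetic_div (cpoly M) z) (\<lambda>i. of_int (N i)) (Suc n) = poly (cpoly h) z"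
    using pCons(2)[of "Suc n"] by metis
  show ?case
  proof (intro exI[of _ "smult (N n) M + h"] allI)
    fix z
    show "psh (synthetic_div (cpoly (pCons a M)) z) (\<lambda>i. of_int (N i)) n = poly (cpoly (smult (N n) M + h)) z"
      using h by (simp only: cpoly_pCons synthetic_div_pCons psh_pCons cpoly_add cpoly_smult poly_add poly_smult)
        (simp only: mult.commute)
  qed
qed

subsection \<open>Gram determinants\<close>

text \<open>Gram-Schmidt without normalisation on the first \<open>n\<close> coordinates. If an
  earlier vector vanishes there, its coefficient is a quotient by 0, hence 0, so dependent rows are
  allowed.\<close>

fun gso :: "nat \<Rightarrow> (nat \<Rightarrow> nat \<Rightarrow> real) \<Rightarrow> nat \<Rightarrow> nat \<Rightarrow> real" where
  "gso n Y i = (\<lambda>t. Y i t -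
     (\<Sum>j<i. (\<Sum>s<n. Y i s * gso n Y j s) / (\<Sum>s<n. (gso n Y j s)\<^sup>2) * gso n Y j t))"

declare gso.simps [simp del]

lemma gso_orthogonal:
  assumes "j < i"
  shows "(\<Sum>t<n. gso n Y i t * gso n Y j t) = 0"
  using assms
proof (induction i arbitrary: j rule: less_induct)
  case (less i)
  define w where "w = gso n Y"
  have wij: "(\<Sum>t<n. w l t * w j t) = 0" if "l < i" "l \<noteq> j" for l
  proof (cases "l < j")
    case True
    then have "(\<Sum>t<n. w j t * w l t) = 0" using less.IH[OF less.prems, of l] by (simp add: w_def)
    then show ?thesis by (simp add: mult.commute)
  next
    case False
    then show ?thesis using less.IH[OF that(1), of j] that by (simp add: w_def)
  qed
  define m where "m l = (\<Sum>s<n. Y i s * w l s) / (\<Sum>s<n. (w l s)\<^sup>2)" for l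
  have wi: "w i t = Y i t - (\<Sum>l<i. m l * w l t)" for t
    by (simp add: w_def m_def gso.simps[of n Y i])
  have "(\<Sum>t<n. w i t * w j t) = (\<Sum>t<n. Y i t * w j t) - (\<Sum>t<n. \<Sum>l<i. m l * (w l t * w j t))"
    by (simp add: wi left_diff_distrib sum_subtractf sum_distrib_right mult.assoc)
  also have "(\<Sum>t<n. \<Sum>l<i. m l * (w l t * w j t)) = (\<Sum>l<i. m l * (\<Sum>t<n. w l t * w j t))"
    by (subst sum.swap) (simp add: sum_distrib_left)
  also have "\<dots> = (\<Sum>l<i. if l = j then m j * (\<Sum>t<n. (w j t)\<^sup>2) else 0)"
    by (rule sum.cong) (auto simp: wij power2_eq_square)
  also have "\<dots> = m j * (\<Sum>t<n. (w j t)\<^sup>2)" using less.prems by simp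
  \<comment> \<open>With a zero denominator \<open>m j\<close> is 0, but then \<open>w j\<close>
    vanishes on the window and the right-hand side is 0 as well.\<close>
  also have "\<dots> = (\<Sum>t<n. Y i t * w j t)"
  proof (cases "(\<Sum>t<n. (w j t)\<^sup>2) = 0")
    case True
    then have "w j t = 0" if "t < n" for t
      using that by (subst (asm) sum_nonneg_eq_0_iff) auto
    then show ?thesis by simp
  qed (simp add: m_def)
  finally show ?case by (simp add: w_def)
qed

lemma gso_orthogonal_row:
  assumes "j < i"
  shows "(\<Sum>t<n. gso n Y i t * Y j t) = 0"
proof -
  define m where "m l = (\<Sum>s<n. Y j s * gso n Y l s) / (\<Sum>s<n. (gso n Y l s)\<^sup>2)" for l
  have Yj: "Y j t = gso n Y j t + (\<Sum>l<j. m l * gso n Y l t)" for t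
    by (simp add: m_def gso.simps[of n Y j])
  have "(\<Sum>t<n. gso n Y i t * Y j t) = (\<Sum>t<n. gso n Y i t * gso n Y j t)
       + (\<Sum>t<n. \<Sum>l<j. m l * (gso n Y i t * gso n Y l t))"
    by (simp add: Yj distrib_left sum.distrib sum_distrib_left mult_ac)
  also have "(\<Sum>t<n. \<Sum>l<j. m l * (gso n Y i t * gso n Y l t))
     = (\<Sum>l<j. m l * (\<Sum>t<n. gso n Y i t * gso n Y l t))"
    by (subst sum.swap) (simp add: sum_distrib_left)
  also have "\<dots> = 0" using assms by (intro sum.neutral) (simp add: gso_orthogonal)
  finally show ?thesis using gso_orthogonal[OF assms] by simp
qed

text \<open>\<open>gso n Y i\<close> is orthogonal to the earlier rows, so its inner product with
  the modified row equals its own squared norm, and Cauchy-Schwarz applies.\<close>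

lemma gso_norm_le:
  fixes c :: "nat \<Rightarrow> real"
  shows "(\<Sum>t<n. (gso n Y i t)\<^sup>2) \<le> (\<Sum>t<n. (Y i t + (\<Sum>j<i. c j * Y j t))\<^sup>2)"
proof -
  define w where "w = gso n Y i"
  define y where "y t = Y i t + (\<Sum>j<i. c j * Y j t)" for t
  define m where "m l = (\<Sum>s<n. Y i s * gso n Y l s) / (\<Sum>s<n. (gso n Y l s)\<^sup>2)" for l
  have Yi: "Y i t = w t + (\<Sum>l<i. m l * gso n Y l t)" for t
    by (simp add: m_def w_def gso.simps[of n Y i])
  have z1: "(\<Sum>t<n. \<Sum>l<i. m l * (w t * gso n Y l t)) = 0"
    by (subst sum.swap) (simp add: sum_distrib_left[symmetric] w_def gso_orthogonal)
  have z2: "(\<Sum>t<n. \<Sum>l<i. c l * (w t * Y l t)) = 0"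
    by (subst sum.swap) (simp add: sum_distrib_left[symmetric] w_def gso_orthogonal_row)
  have "(\<Sum>t<n. w t * y t) = (\<Sum>t<n. w t * w t + (\<Sum>l<i. m l * (w t * gso n Y l t)) + (\<Sum>l<i. c l * (w t * Y l t)))"
    by (rule sum.cong) (simp_all add: y_def Yi[of t for t] distrib_left sum_distrib_left mult_ac)
  also have "\<dots> = (\<Sum>t<n. (w t)\<^sup>2)"
    using z1 z2 by (simp add: sum.distrib power2_eq_square)
  finally have wy: "(\<Sum>t<n. w t * y t) = (\<Sum>t<n. (w t)\<^sup>2)" .
  have "(\<Sum>t<n. (w t)\<^sup>2)\<^sup>2 \<le> (\<Sum>t<n. (w t)\<^sup>2) * (\<Sum>t<n. (y t)\<^sup>2)"
    using Cauchy_Schwarz_ineq_sum[of w y "{..<n}"] by (simp add: wy)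
  moreover have "0 \<le> (\<Sum>t<n. (w t)\<^sup>2)" "0 \<le> (\<Sum>t<n. (y t)\<^sup>2)" by (simp_all add: sum_nonneg)
  ultimately have "(\<Sum>t<n. (w t)\<^sup>2) \<le> (\<Sum>t<n. (y t)\<^sup>2)"
    by (cases "(\<Sum>t<n. (w t)\<^sup>2) = 0") (auto simp: power2_eq_square)
  then show ?thesis by (simp add: w_def y_def)
qed

text \<open>The rows are \<open>K * W\<close> with \<open>K\<close> unit lower triangular and
  \<open>W\<close> having orthogonal rows, so the Gram matrix is a diagonal matrix conjugated by
  determinant-one factors.\<close>

lemma gram_det_eq:
  "det (mat k k (\<lambda>(i, j). \<Sum>t<n. Y i t * Y j t)) = (\<Prod>i<k. \<Sum>t<n. (gso n Y i t)\<^sup>2)"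
proof -
  define m where "m i l = (\<Sum>s<n. Y i s * gso n Y l s) / (\<Sum>s<n. (gso n Y l s)\<^sup>2)" for i l
  define K where "K = mat k k (\<lambda>(i, j). if j < i then m i j else if i = j then 1 else 0)"
  define W where "W = mat k n (\<lambda>(i, t). gso n Y i t)"
  define YY where "YY = mat k n (\<lambda>(i, t). Y i t)"
  have KW: "YY = K * W"
  proof (rule eq_matI)
    fix i t assume it: "i < dim_row (K * W)" "t < dim_col (K * W)"
    then have i: "i < k" and t: "t < n" by (auto simp: K_def W_def)
    have "(K * W) $$ (i, t) = (\<Sum>j = 0..<k. (if j < i then m i j else if i = j then 1 else 0) * gso n Y j t)"
      using i t by (simp add: K_def W_def scalar_prod_def)
    also have "\<dots> = (\<Sum>j\<in>insert i {..<i}. (if j < i then m i j else if i = j then 1 else 0) * gso n Y j t)"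
      using i by (intro sum.mono_neutral_right) auto
    also have "\<dots> = gso n Y i t + (\<Sum>j<i. m i j * gso n Y j t)" by simp
    also have "\<dots> = Y i t" by (simp add: m_def gso.simps[of n Y i])
    finally show "YY $$ (i, t) = (K * W) $$ (i, t)" using i t by (simp add: YY_def)
  qed (auto simp: K_def W_def YY_def)
  have car: "K \<in> carrier_mat k k" "W \<in> carrier_mat k n" by (auto simp: K_def W_def)
  have G: "mat k k (\<lambda>(i, j). \<Sum>t<n. Y i t * Y j t) = YY * transpose_mat YY"
    by (rule eq_matI) (auto simp: YY_def scalar_prod_def lessThan_atLeast0)
  have "YY * transpose_mat YY = K * W * (transpose_mat W * transpose_mat K)"
    using car by (simp add: KW transpose_mult[of K k k W n])
  also have "\<dots> = K * (W * transpose_mat W) * transpose_mat K"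
    using car by (simp add: assoc_mult_mat[of _ k k _ k _ k] assoc_mult_mat[of K k k W n _ k]
        assoc_mult_mat[of W k n _ k _ k])
  finally have eq: "YY * transpose_mat YY = K * (W * transpose_mat W) * transpose_mat K" .
  have dK: "det K = 1"
  proof -
    have "diag_mat K = replicate k 1"
      by (rule nth_equalityI) (auto simp: diag_mat_def K_def)
    then show ?thesis
      by (subst det_lower_triangular[of k]) (auto simp: K_def)
  qed
  have WW: "W * transpose_mat W = mat k k (\<lambda>(i, j). if i = j then (\<Sum>t<n. (gso n Y i t)\<^sup>2) else 0)"
  proof (rule eq_matI)
    fix i j assume "i < dim_row (mat k k (\<lambda>(i, j). if i = j then (\<Sum>t<n. (gso n Y i t)\<^sup>2) else 0))"
      "j < dim_col (mat k k (\<lambda>(i, j). if i = j then (\<Sum>t<n. (gso n Y i t)\<^sup>2) else 0))"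
    then have ij: "i < k" "j < k" by auto
    have e: "(W * transpose_mat W) $$ (i, j) = (\<Sum>t<n. gso n Y i t * gso n Y j t)"
      using ij by (simp add: W_def scalar_prod_def lessThan_atLeast0)
    have "(\<Sum>t<n. gso n Y i t * gso n Y j t) = 0" if "i \<noteq> j"
      using gso_orthogonal[of j i n Y] gso_orthogonal[of i j n Y] that
      by (cases "j < i") (auto simp: mult.commute)
    then show "(W * transpose_mat W) $$ (i, j)
       = mat k k (\<lambda>(i, j). if i = j then (\<Sum>t<n. (gso n Y i t)\<^sup>2) else 0) $$ (i, j)"
      using ij e by (simp add: power2_eq_square)
  qed (auto simp: W_def)
  have dW: "det (W * transpose_mat W) = (\<Prod>i<k. \<Sum>t<n. (gso n Y i t)\<^sup>2)"
  proof -
    have "diag_mat (mat k k (\<lambda>(i, j). if i = j then (\<Sum>t<n. (gso n Y i t)\<^sup>2) else 0))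
        = map (\<lambda>i. \<Sum>t<n. (gso n Y i t)\<^sup>2) [0..<k]"
      by (rule nth_equalityI) (auto simp: diag_mat_def)
    moreover have "prod_list (map (\<lambda>i. \<Sum>t<n. (gso n Y i t)\<^sup>2) [0..<k]) = (\<Prod>i<k. \<Sum>t<n. (gso n Y i t)\<^sup>2)"
      using prod.distinct_set_conv_list[of "[0..<k]" "\<lambda>i. \<Sum>t<n. (gso n Y i t)\<^sup>2"]
      by (simp add: lessThan_atLeast0)
    ultimately show ?thesis unfolding WW by (subst det_lower_triangular[of k]) auto
  qed
  have "W * transpose_mat W \<in> carrier_mat k k" using car by auto
  then show ?thesis
    unfolding G eq using car dK dW by (simp add: det_mult[of _ k] det_transpose[of K k])
qed

text \<open>The Gram determinant of integer rows is a nonnegative integer, and a unit triangular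
  change of rows bounds it by the given product; below 1 it must be 0. A kernel vector
  \<open>r\<close>, taken over the integers, satisfies \<open>r G r = 0\<close>, which is the
  squared norm of the combined row.\<close>

lemma integer_rows_dependent:
  fixes Y :: "nat \<Rightarrow> nat \<Rightarrow> int" and c :: "nat \<Rightarrow> nat \<Rightarrow> real"
  assumes "(\<Prod>i<k. \<Sum>t<n. (of_int (Y i t) + (\<Sum>j<i. c i j * of_int (Y j t)))\<^sup>2) < 1"
  obtains r where "\<exists>i<k. r i \<noteq> (0::int)" "\<And>t. t < n \<Longrightarrow> (\<Sum>i<k. r i * Y i t) = 0"
proof -
  define G where "G = mat k k (\<lambda>(i, j). \<Sum>t<n. Y i t * Y j t)"
  have Gc: "G \<in> carrier_mat k k" by (simp add: G_def)
  define YR where "YR i t = real_of_int (Y i t)" for i t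
  have "of_int (det G) = det (map_mat real_of_int G)" by (rule of_int_hom.hom_det[symmetric])
  also have "map_mat real_of_int G = mat k k (\<lambda>(i, j). \<Sum>t<n. YR i t * YR j t)"
    by (rule eq_matI) (auto simp: G_def YR_def)
  also have "det \<dots> = (\<Prod>i<k. \<Sum>t<n. (gso n YR i t)\<^sup>2)" by (rule gram_det_eq)
  finally have d: "real_of_int (det G) = (\<Prod>i<k. \<Sum>t<n. (gso n YR i t)\<^sup>2)" .
  have "(\<Prod>i<k. \<Sum>t<n. (gso n YR i t)\<^sup>2) \<le> (\<Prod>i<k. \<Sum>t<n. (YR i t + (\<Sum>j<i. c i j * YR j t))\<^sup>2)"
    by (intro prod_mono conjI gso_norm_le) (simp add: sum_nonneg)
  then have "real_of_int (det G) < 1" using assms d by (simp add: YR_def)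
  moreover have "0 \<le> real_of_int (det G)" unfolding d by (intro prod_nonneg) (simp add: sum_nonneg)
  ultimately have "det G = 0" by linarith
  then obtain v where v: "v \<in> carrier_vec k" "v \<noteq> 0\<^sub>v k" "G *\<^sub>v v = 0\<^sub>v k"
    using det_0_iff_vec_prod_zero[OF Gc] by blast
  define r where "r i = vec_index v i" for i
  have "\<exists>i<k. r i \<noteq> 0"
  proof (rule ccontr)
    assume "\<not> ?thesis"
    then have "v = 0\<^sub>v k" using v(1) by (intro eq_vecI) (auto simp: r_def)
    then show False using v(2) by simp
  qed
  moreover have "(\<Sum>i<k. r i * Y i t) = 0" if t: "t < n" for t
  proof -
    have Gv: "(\<Sum>j<k. (\<Sum>t<n. Y i t * Y j t) * r j) = 0" if "i < k" for i
    proof -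
      have "vec_index (G *\<^sub>v v) i = 0" using v(3) that by simp
      then show ?thesis using that v(1) by (simp add: G_def scalar_prod_def r_def lessThan_atLeast0)
    qed
    have "(\<Sum>t<n. (\<Sum>i<k. r i * Y i t)\<^sup>2) = (\<Sum>t<n. \<Sum>i<k. \<Sum>j<k. r i * (Y i t * Y j t * r j))"
      by (simp add: power2_eq_square sum_product mult_ac)
    also have "\<dots> = (\<Sum>i<k. \<Sum>t<n. \<Sum>j<k. r i * (Y i t * Y j t * r j))" by (rule sum.swap)
    also have "\<dots> = (\<Sum>i<k. \<Sum>j<k. \<Sum>t<n. r i * (Y i t * Y j t * r j))" 
      by (rule sum.cong) (auto intro: sum.swap)
    also have "\<dots> = (\<Sum>i<k. r i * (\<Sum>j<k. (\<Sum>t<n. Y i t * Y j t) * r j))"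
      by (simp add: sum_distrib_left sum_distrib_right mult_ac)
    also have "\<dots> = 0" using Gv by simp
    finally have "(\<Sum>t<n. (\<Sum>i<k. r i * Y i t)\<^sup>2) = 0" .
    then show ?thesis using t by (subst (asm) sum_nonneg_eq_0_iff) auto
  qed
  ultimately show thesis using that by blast
qed

subsection \<open>Almost integral linear recurrences\<close>

text \<open>The relation \<open>R\<close> for \<open>H0\<close> is extended beyond its window: at a
  time \<open>t\<close>, the relation \<open>S\<close> valid up to \<open>3 * t\<close> commutes
  with \<open>R\<close>, so \<open>psh S (psh R N) (t - d) = 0\<close>. This expresses a nonzero
  multiple of \<open>psh R N t\<close> by earlier values, which are 0 by induction.\<close>

lemma integer_recurrence_glue:
  fixes N :: "nat \<Rightarrow> int"
  assumes "\<And>H. H \<ge> H0 \<Longrightarrow> \<exists>R. R \<noteq> 0 \<and> degree R \<le> H \<and> (\<forall>j\<le>3 * H. psh R N j = 0)"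
  shows "\<exists>R. R \<noteq> 0 \<and> (\<forall>n. psh R N n = 0)"
proof -
  obtain R where R: "R \<noteq> 0" "degree R \<le> H0" "\<And>j. j \<le> 3 * H0 \<Longrightarrow> psh R N j = 0"
    using assms[of H0] by auto
  have "psh R N t = 0" for t
  proof (induction t rule: less_induct)
    case (less t)
    show ?case
    proof (cases "t \<le> 3 * H0")
      case False
      then have tH: "t \<ge> H0" by simp
      obtain S where S: "S \<noteq> 0" "degree S \<le> t" "\<And>j. j \<le> 3 * t \<Longrightarrow> psh S N j = 0"
        using assms[OF tH] by auto
      define d where "d = degree S"
      have "psh S (psh R N) (t - d) = psh R (psh S N) (t - d)" by (rule psh_mult_commute)
      also have "\<dots> = 0"
        unfolding psh_def[of R] using R(2) tH by (intro sum.neutral ballI) (simp add: S(3))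
      finally have "0 = (\<Sum>i\<le>d. coeff S i * psh R N (t - d + i))" by (simp add: psh_def[of S] d_def)
      also have "\<dots> = coeff S d * psh R N t + (\<Sum>i<d. coeff S i * psh R N (t - d + i))"
        using S(2) by (simp add: lessThan_Suc_atMost[symmetric] d_def)
      also have "(\<Sum>i<d. coeff S i * psh R N (t - d + i)) = 0"
        using S(2) less by (intro sum.neutral) (simp add: d_def)
      finally show ?thesis using S(1) by (simp add: d_def)
    qed (use R in auto)
  qed
  then show ?thesis using R by blast
qed

text \<open>Since \<open>x\<close> obeys an exact recurrence of order \<open>D\<close>, applying it
  to \<open>N\<close> leaves a square-summable error \<open>f\<close>. In the Gram matrix of the
  shifts of \<open>N\<close>, every row from the \<open>D\<close>-th on can thus be replaced by a
  row of \<open>f\<close>, whose squared norm is a tail of a convergent series. Only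
  \<open>D\<close> rows grow, exponentially in the window length, so for many shifts the determinant
  drops below 1.\<close>

lemma almost_integer_recurrence:
  fixes x :: "nat \<Rightarrow> real" and N :: "nat \<Rightarrow> int" and ch :: "nat \<Rightarrow> real"
  assumes rec: "\<And>n. x (n + D) = (\<Sum>i<D. ch i * x (n + i))"
    and growth: "\<And>n. \<bar>real_of_int (N n)\<bar> \<le> C * Th ^ n" and "C \<ge> 1" "Th \<ge> 1"
    and sq: "summable (\<lambda>n. (x n - of_int (N n))\<^sup>2)"
  shows "\<exists>R. R \<noteq> 0 \<and> (\<forall>n. psh R N n = 0)"
proof -
  define e where "e n = x n - of_int (N n)" for n
  define f where "f n = real_of_int (N (n + D)) - (\<Sum>i<D. ch i * of_int (N (n + i)))" for n
  have f_eq: "f n = (\<Sum>i<D. ch i * e (n + i)) - e (n + D)" for n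
    by (simp add: f_def e_def rec right_diff_distrib sum_subtractf)
  have sum_e: "summable (\<lambda>n. (e (n + i))\<^sup>2)" for i
    using sq by (simp add: e_def summable_iff_shift[of "\<lambda>n. (e n)\<^sup>2", unfolded e_def])
  have f_le: "(f n)\<^sup>2 \<le> 2 * ((\<Sum>i<D. (ch i)\<^sup>2) * (\<Sum>i<D. (e (n + i))\<^sup>2)) + 2 * (e (n + D))\<^sup>2" for n
  proof -
    have "(f n)\<^sup>2 \<le> 2 * (\<Sum>i<D. ch i * e (n + i))\<^sup>2 + 2 * (e (n + D))\<^sup>2"
      unfolding f_eq using sum_squares_bound[of "(\<Sum>i<D. ch i * e (n + i))" "- e (n + D)"]
      by (simp add: power2_diff)
    then show ?thesis
      using Cauchy_Schwarz_ineq_sum[of ch "\<lambda>i. e (n + i)" "{..<D}"] by linarith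
  qed
  have sf: "summable (\<lambda>n. (f n)\<^sup>2)"
  proof (rule summable_comparison_test'[where N = 0])
    show "summable (\<lambda>n. 2 * ((\<Sum>i<D. (ch i)\<^sup>2) * (\<Sum>i<D. (e (n + i))\<^sup>2)) + 2 * (e (n + D))\<^sup>2)"
      by (intro summable_add summable_mult summable_sum sum_e)
  qed (use f_le in auto)
  define s where "s j = (\<Sum>n. (f (n + j))\<^sup>2)" for j
  have s_nonneg: "0 \<le> s j" for j
    unfolding s_def by (intro suminf_nonneg) (use sf in \<open>auto simp: summable_iff_shift[of "\<lambda>n. (f n)\<^sup>2"]\<close>)
  have s_ge: "(\<Sum>t<n. (f (j + t))\<^sup>2) \<le> s j" for n j
    unfolding s_def using sf
    by (subst add.commute, intro sum_le_suminf) (auto simp: summable_iff_shift[of "\<lambda>n. (f n)\<^sup>2"])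
  have s_lim: "s \<longlonglongrightarrow> 0"
    unfolding s_def by (rule suminf_exist_split2) (use sf in simp)
  define S where "S = s 0 + 1"
  have sS: "s j \<le> S" for j
  proof -
    have "s 0 = s j + (\<Sum>n<j. (f n)\<^sup>2)" unfolding s_def using suminf_split_initial_segment[OF sf, of j] by simp
    then show ?thesis by (simp add: S_def sum_nonneg add_increasing2)
  qed
  have S1: "S \<ge> 1" using s_nonneg[of 0] by (simp add: S_def)
  \<comment> \<open>The factor 2 absorbs the number \<open>n\<close> of summands, by
    \<open>n < 2 ^ n\<close>.\<close>
  define T where "T = 2 * Th\<^sup>2"
  define A where "A = C\<^sup>2 * Th ^ (2 * D)"
  have T1: "T \<ge> 1" and A1: "A \<ge> 1"
    using assms(3,4) by (auto simp: T_def A_def one_le_power mult_ge1_I intro: order_trans[of 1 "Th\<^sup>2"])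
  \<comment> \<open>The \<open>D\<close> long rows over a window of length \<open>3 * H + 1\<close>
    cost a factor \<open>T ^ (3 * D)\<close> per unit of \<open>H\<close>. One short row per unit of
    \<open>H\<close>, of size at most \<open>\<delta>\<close>, beats this and leaves the ratio
    1/2.\<close>
  define \<delta> where "\<delta> = 1 / (2 * T ^ (3 * D))"
  have "1 \<le> T ^ (3 * D)" by (rule one_le_power[OF T1])
  then have "1 \<le> 2 * T ^ (3 * D)" by linarith
  then have \<delta>: "0 < \<delta>" "\<delta> \<le> 1" using T1 by (auto simp: \<delta>_def)
  obtain J where J: "\<And>j. j \<ge> J \<Longrightarrow> s j < \<delta>"
    using LIMSEQ_D[OF s_lim \<delta>(1)] by (auto simp: abs_less_iff)
  \<comment> \<open>\<open>B\<close> gathers what does not depend on \<open>H\<close>, including the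
    \<open>J\<close> rows whose tails are not yet below \<open>\<delta>\<close> and are only bounded
    by \<open>S\<close>.\<close>
  define B where "B = A ^ D * T ^ D * S ^ J * (1 / \<delta>) ^ (D + J)"
  have "(\<lambda>H. B * (1 / 2) ^ H) \<longlonglongrightarrow> B * 0" by (intro tendsto_mult tendsto_const LIMSEQ_realpow_zero) auto
  then obtain H1 where H1: "\<And>H. H \<ge> H1 \<Longrightarrow> B * (1 / 2) ^ H < 1"
    using LIMSEQ_D[of _ "B * 0" 1] by (fastforce simp: abs_less_iff)
  have step: "\<exists>R. R \<noteq> 0 \<and> degree R \<le> H \<and> (\<forall>j\<le>3 * H. psh R N j = 0)" if H: "H \<ge> max H1 (D + J)" for H
  proof -
    define k where "k = Suc H"
    define n where "n = Suc (3 * H)"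
    \<comment> \<open>The triangular change of rows: from row \<open>i >= D\<close> the recurrence
      of \<open>x\<close> on the \<open>D\<close> preceding rows is subtracted; the first
      \<open>D\<close> rows stay as they are.\<close>
    define c where "c i j = (if D \<le> i \<and> i - D \<le> j then - ch (j - (i - D)) else 0)" for i j
    define row where "row i = (\<Sum>t<n. (of_int (N (i + t)) + (\<Sum>j<i. c i j * of_int (N (j + t))))\<^sup>2)" for i
    have row_nonneg: "0 \<le> row i" for i by (simp add: row_def sum_nonneg)
    have row_big: "row i \<le> A * T ^ n" if i: "i < D" for i
    proof -
      have c0: "c i j = 0" for j using i by (simp add: c_def)
      have "row i = (\<Sum>t<n. (of_int (N (i + t)))\<^sup>2)" by (simp add: row_def c0)
      also have "\<dots> \<le> (\<Sum>t<n. C\<^sup>2 * Th ^ (2 * D) * Th ^ (2 * n))"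
      proof (rule sum_mono)
        fix t assume t: "t \<in> {..<n}"
        have "(real_of_int (N (i + t)))\<^sup>2 \<le> (C * Th ^ (i + t))\<^sup>2"
          using growth[of "i + t"] by (metis abs_ge_zero power2_abs power_mono)
        also have "\<dots> \<le> (C * Th ^ (D + n))\<^sup>2"
          using i t assms(3,4) by (intro power_mono mult_left_mono power_increasing) auto
        also have "\<dots> = C\<^sup>2 * Th ^ (2 * D) * Th ^ (2 * n)"
          by (simp add: power_mult_distrib power_add power_mult[symmetric] mult.commute[of _ 2])
        finally show "(real_of_int (N (i + t)))\<^sup>2 \<le> \<dots>" .
      qed
      also have "\<dots> = A * (real n * (Th\<^sup>2) ^ n)" by (simp add: A_def power_mult)
      also have "\<dots> \<le> A * (2 ^ n * (Th\<^sup>2) ^ n)"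
        using A1 by (intro mult_left_mono mult_right_mono) (auto intro: less_imp_le of_nat_less_two_power)
      finally show ?thesis by (simp add: T_def power_mult_distrib)
    qed
    have row_small: "row i \<le> s (i - D)" if i: "D \<le> i" for i
    proof -
      define u where "u = i - D"
      have u: "i = u + D" using i by (simp add: u_def)
      have cu: "c i (u + l) = - ch l" for l by (simp add: c_def u)
      have "(\<Sum>j<i. c i j * of_int (N (j + t))) = - (\<Sum>l<D. ch l * of_int (N (u + t + l)))" for t
      proof -
        have "(\<Sum>j<i. c i j * of_int (N (j + t))) = (\<Sum>j\<in>{u..<i}. c i j * of_int (N (j + t)))"
          by (rule sum.mono_neutral_right) (auto simp: c_def u)
        also have "\<dots> = (\<Sum>l<D. c i (u + l) * of_int (N (u + l + t)))"
          by (rule sum.reindex_bij_witness[of _ "\<lambda>l. u + l" "\<lambda>j. j - u"]) (auto simp: u)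
        also have "\<dots> = - (\<Sum>l<D. ch l * of_int (N (u + t + l)))"
          unfolding cu by (simp add: sum_negf add_ac)
        finally show ?thesis .
      qed
      moreover have "i + t = u + t + D" for t by (simp add: u)
      ultimately have "row i = (\<Sum>t<n. (f (i - D + t))\<^sup>2)" by (simp add: row_def f_def u add_ac)
      then show ?thesis using s_ge by simp
    qed
    have "(\<Prod>i<k. row i) = (\<Prod>i<D. row i) * (\<Prod>i\<in>{D..<D + J}. row i) * (\<Prod>i\<in>{D + J..<k}. row i)"
      using H by (simp add: prod.atLeastLessThan_concat lessThan_atLeast0 k_def mult.assoc)
    also have "\<dots> \<le> (A * T ^ n) ^ D * S ^ J * \<delta> ^ (k - (D + J))"
    proof (intro mult_mono)
      show "(\<Prod>i<D. row i) \<le> (A * T ^ n) ^ D"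
        using prod_mono[of "{..<D}" row "\<lambda>_. A * T ^ n"] row_nonneg row_big by simp
      show "(\<Prod>i\<in>{D..<D + J}. row i) \<le> S ^ J"
        using prod_mono[of "{D..<D + J}" row "\<lambda>_. S"] row_nonneg row_small sS order_trans by fastforce
      have "row i \<le> \<delta>" if "D + J \<le> i" for i
        proof -
        have "D \<le> i" "J \<le> i - D" using that by linarith+
        then show ?thesis using row_small[of i] J[of "i - D"] by linarith
      qed
      then show "(\<Prod>i\<in>{D + J..<k}. row i) \<le> \<delta> ^ (k - (D + J))"
        using prod_mono[of "{D + J..<k}" row "\<lambda>_. \<delta>"] row_nonneg by simp
    qed (use row_nonneg A1 T1 S1 in \<open>auto intro!: prod_nonneg mult_nonneg_nonneg\<close>)
    also have "\<dots> = B * (T ^ (3 * D) * \<delta>) ^ H * \<delta>"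
    proof -
      have "\<delta> ^ (k - (D + J)) = \<delta> ^ k * (1 / \<delta>) ^ (D + J)"
        using \<delta> H by (simp add: power_diff k_def power_one_over divide_inverse power_inverse)
      moreover have "(A * T ^ n) ^ D = A ^ D * (T ^ D * (T ^ (3 * D)) ^ H)"
      proof -
        have "(T ^ n) ^ D = T ^ (D + 3 * D * H)"
          unfolding power_mult[symmetric] by (simp add: n_def algebra_simps)
        then show ?thesis by (simp only: power_mult_distrib power_add power_mult)
      qed
      ultimately have "(A * T ^ n) ^ D * S ^ J * \<delta> ^ (k - (D + J))
          = A ^ D * (T ^ D * (T ^ (3 * D)) ^ H) * S ^ J * (\<delta> ^ k * (1 / \<delta>) ^ (D + J))"
        by (simp only:)
      also have "\<dots> = B * (T ^ (3 * D) * \<delta>) ^ H * \<delta>"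
        unfolding B_def k_def power_Suc power_mult_distrib by (simp only: mult_ac)
      finally show ?thesis .
    qed
    also have "T ^ (3 * D) * \<delta> = 1 / 2" using T1 by (simp add: \<delta>_def)
    also have "B * (1 / 2) ^ H * \<delta> \<le> B * (1 / 2) ^ H * 1"
      using \<delta> A1 T1 S1 by (intro mult_left_mono) (auto simp: B_def)
    also have "\<dots> < 1" using H1[of H] H by simp
    finally have small: "(\<Prod>i<k. row i) < 1" .
    obtain r where r: "\<exists>i<k. r i \<noteq> (0::int)" "\<And>t. t < n \<Longrightarrow> (\<Sum>i<k. r i * N (i + t)) = 0"
      using integer_rows_dependent[where n = n and k = k and Y = "\<lambda>i t. N (i + t)" and c = c, OF small[unfolded row_def]]
      by blast
    define R where "R = (\<Sum>i<k. monom (r i) i)"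
    have cR: "coeff R i = (if i < k then r i else 0)" for i
      by (simp add: R_def coeff_sum)
    have "R \<noteq> 0" using r(1) cR by (metis coeff_0)
    moreover have dR: "degree R \<le> H" by (rule degree_le) (simp add: cR k_def)
    moreover have "psh R N j = 0" if "j \<le> 3 * H" for j
      using r(2)[of j] that dR
      by (simp add: psh_le[of _ H] cR k_def n_def lessThan_Suc_atMost add.commute)
    ultimately show ?thesis by blast
  qed
  show ?thesis by (rule integer_recurrence_glue[of "max H1 (D + J)"]) (rule step)
qed

no_notation vec_index (infixl "$" 100)
no_notation scalar_prod (infix "\<bullet>" 70)
hide_const (open) Matrix.orthogonal
hide_fact (open) Matrix.orthogonal_def

subsection \<open>Zeros of exponential sums\<close>

lemma zeros_of_derivative:
  fixes f f' :: "real \<Rightarrow> real"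
  assumes der: "\<And>x. a \<le> x \<Longrightarrow> x \<le> b \<Longrightarrow> (f has_real_derivative f' x) (at x)"
    and "finite S" "\<And>s. s \<in> S \<Longrightarrow> a \<le> s \<and> s \<le> b \<and> f s = 0"
  obtains S' where "finite S'" "card S \<le> Suc (card S')"
    "\<And>s. s \<in> S' \<Longrightarrow> a \<le> s \<and> s \<le> b \<and> f' s = 0"
proof -
  \<comment> \<open>The induction adds the largest zero last. Keeping the zeros of \<open>f'\<close>
    below some zero of \<open>f\<close> ensures that the new Rolle point is not yet counted.\<close>
  have "\<exists>S'. finite S' \<and> card S \<le> Suc (card S') \<and>
     (\<forall>s\<in>S'. a \<le> s \<and> f' s = 0 \<and> (\<exists>u\<in>S. s < u))"
    using assms(2,3)
  proof (induction S rule: finite_linorder_max_induct)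
    case empty
    show ?case by (intro exI[of _ "{}"]) simp
  next
    case (insert v S)
    then obtain S' where S': "finite S'" "card S \<le> Suc (card S')"
      "\<forall>s\<in>S'. a \<le> s \<and> f' s = 0 \<and> (\<exists>u\<in>S. s < u)" by auto
    show ?case
    proof (cases "S = {}")
      case True
      then show ?thesis by (intro exI[of _ "{}"]) simp
    next
      case False
      define u where "u = Max S"
      have u: "u \<in> S" "\<And>s. s \<in> S \<Longrightarrow> s \<le> u" using False insert(1) by (auto simp: u_def)
      have uv: "u < v" "a \<le> u" "v \<le> b" "f u = 0" "f v = 0" using u insert by auto
      have "\<exists>z. u < z \<and> z < v \<and> DERIV f z :> 0"
      proof (rule Rolle)
        show "continuous_on {u..v} f"
          using der uv by (intro DERIV_atLeastAtMost_imp_continuous_on) (metis order_trans)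
        show "f differentiable (at x)" if "u < x" "x < v" for x
          using der[of x] uv that real_differentiable_def by fastforce
      qed (use uv in auto)
      then obtain z where z: "u < z" "z < v" "DERIV f z :> 0" by blast
      then have "f' z = 0" using der[of z] uv DERIV_unique by fastforce
      moreover have "z \<notin> S'" using S'(3) u(2) z(1) by fastforce
      moreover have "v \<notin> S" using insert(2) by blast
      ultimately show ?thesis
        using S' z uv insert(1) by (intro exI[of _ "insert z S'"]) auto
    qed
  qed
  then obtain S' where S': "finite S'" "card S \<le> Suc (card S')"
     "\<forall>s\<in>S'. a \<le> s \<and> f' s = 0 \<and> (\<exists>u\<in>S. s < u)" by blast
  show thesis
    by (rule that[OF S'(1,2)]) (use S'(3) assms(3) in fastforce)
qed

text \<open>Induction on the number of frequencies in the style of Polya. To remove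
  \<open>v\<close>, divide by a positive solution \<open>c\<close> of \<open>c'' = - v^2 c\<close>,
  differentiate, clear the denominator and differentiate again: the result is
  \<open>(g'' + v^2 g) c\<close>. The frequency \<open>v\<close> is gone, the others survive with
  nonzero factors, and Rolle loses at most one zero each time.\<close>

lemma trig_sum_zeros:
  fixes al be :: "real \<Rightarrow> real"
  assumes "finite W" "\<And>w. w \<in> W \<Longrightarrow> 0 < w \<and> w * K < pi"
    "\<exists>w\<in>W. al w \<noteq> 0 \<or> be w \<noteq> 0"
    "finite S" "\<And>s. s \<in> S \<Longrightarrow> 0 \<le> s \<and> s \<le> K"
    "\<And>s. s \<in> S \<Longrightarrow> (\<Sum>w\<in>W. al w * cos (w * s) + be w * sin (w * s)) = 0"
  shows "card S \<le> 2 * card W"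
  using assms
proof (induction W arbitrary: al be S rule: finite_induct)
  case empty
  then show ?case by simp
next
  case (insert v W)
  have v: "0 < v" "v * K < pi" using insert.prems(1) by auto
  show ?case
  proof (cases "\<exists>w\<in>W. al w \<noteq> 0 \<or> be w \<noteq> 0")
    case False
    then have one: "al v * cos (v * s) + be v * sin (v * s) = 0" if "s \<in> S" for s
      using insert.prems(5)[OF that] insert.hyps by simp
    have nz: "al v \<noteq> 0 \<or> be v \<noteq> 0" using False insert.prems(2) by auto
    \<comment> \<open>For a single frequency two zeros give a 2 by 2 linear system for the
      coefficients with determinant \<open>sin (v * (t - s))\<close>, which is positive because
      \<open>v * K < pi\<close>.\<close>
    have *: "\<not> s < t" if st: "s \<in> S" "t \<in> S" for s t
    proof
      assume lt: "s < t"
      have "v * (t - s) \<le> v * K" using insert.prems(4)[OF st(1)] insert.prems(4)[OF st(2)] v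
        by (intro mult_left_mono) auto
      then have "v * (t - s) < pi" using v(2) by linarith
      then have "sin (v * (t - s)) > 0" using lt v(1) by (intro sin_gt_zero) auto
      then have sn: "sin (v * t) * cos (v * s) - cos (v * t) * sin (v * s) > 0"
        by (simp add: right_diff_distrib sin_diff)
      have "al v * (sin (v * t) * cos (v * s) - cos (v * t) * sin (v * s))
          = sin (v * t) * (al v * cos (v * s) + be v * sin (v * s))
          - sin (v * s) * (al v * cos (v * t) + be v * sin (v * t))" by (simp add: algebra_simps)
      then have a0: "al v = 0" using one st sn by simp
      have "be v * (sin (v * t) * cos (v * s) - cos (v * t) * sin (v * s))
          = cos (v * s) * (al v * cos (v * t) + be v * sin (v * t))
          - cos (v * t) * (al v * cos (v * s) + be v * sin (v * s))" by (simp add: algebra_simps)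
      then have "be v = 0" using one st sn by simp
      then show False using nz a0 by simp
    qed
    have "card S \<le> Suc 0"
      using insert.prems(3) * by (subst card_le_Suc0_iff_eq) (auto, metis linorder_neqE_linordered_idom)
    then show ?thesis using insert.hyps by simp
  next
    case True
    define V where "V = insert v W"
    define g where "g s = (\<Sum>w\<in>V. al w * cos (w * s) + be w * sin (w * s))" for s
    define g1 where "g1 s = (\<Sum>w\<in>V. - al w * w * sin (w * s) + be w * w * cos (w * s))" for s
    define g2 where "g2 s = (\<Sum>w\<in>V. - al w * w\<^sup>2 * cos (w * s) - be w * w\<^sup>2 * sin (w * s))" for s
    \<comment> \<open>Centring at \<open>K / 2\<close> keeps the argument within
      \<open>pi / 2\<close> on all of \<open>[0, K]\<close>, so \<open>c\<close> is positive
      there.\<close>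
    define c where "c s = cos (v * (s - K / 2))" for s
    define c1 where "c1 s = - v * sin (v * (s - K / 2))" for s
    have dg: "(g has_real_derivative g1 s) (at s)" for s
      unfolding g_def g1_def by (intro DERIV_sum) (auto intro!: derivative_eq_intros)
    have dg1: "(g1 has_real_derivative g2 s) (at s)" for s
      unfolding g1_def g2_def by (intro DERIV_sum) (auto intro!: derivative_eq_intros simp: power2_eq_square)
    have dc: "(c has_real_derivative c1 s) (at s)" for s
      unfolding c_def c1_def by (auto intro!: derivative_eq_intros)
    have dc1: "(c1 has_real_derivative - v\<^sup>2 * c s) (at s)" for s
      unfolding c_def c1_def by (auto intro!: derivative_eq_intros simp: power2_eq_square)
    have cpos: "c s > 0" if "0 \<le> s" "s \<le> K" for s
      unfolding c_def
    proof (rule cos_gt_zero_pi)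
      have le: "v * (s - K / 2) \<le> v * (K / 2)" "v * (- (K / 2)) \<le> v * (s - K / 2)"
        by (rule mult_left_mono; use that v in simp)+
      have "v * (K / 2) = v * K / 2" "v * (- (K / 2)) = - (v * K / 2)" by simp_all
      then show "v * (s - K / 2) < pi / 2" "- (pi / 2) < v * (s - K / 2)" using le v by linarith+
    qed
    obtain S1 where S1: "finite S1" "card S \<le> Suc (card S1)"
      "\<And>s. s \<in> S1 \<Longrightarrow> 0 \<le> s \<and> s \<le> K \<and> (g1 s * c s - g s * c1 s) / (c s * c s) = 0"
    proof (rule zeros_of_derivative[of 0 K "\<lambda>s. g s / c s" "\<lambda>s. (g1 s * c s - g s * c1 s) / (c s * c s)" S])
      show "((\<lambda>s. g s / c s) has_real_derivative (g1 s * c s - g s * c1 s) / (c s * c s)) (at s)"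
        if "0 \<le> s" "s \<le> K" for s
        using cpos[OF that] by (intro DERIV_divide dg dc) auto
    qed (use insert.prems in \<open>auto simp: g_def V_def\<close>)
    obtain S2 where S2: "finite S2" "card S1 \<le> Suc (card S2)"
      "\<And>s. s \<in> S2 \<Longrightarrow> 0 \<le> s \<and> s \<le> K \<and> (g2 s + v\<^sup>2 * g s) * c s = 0"
    proof (rule zeros_of_derivative[of 0 K "\<lambda>s. g1 s * c s - g s * c1 s" "\<lambda>s. (g2 s + v\<^sup>2 * g s) * c s" S1])
      show "((\<lambda>s. g1 s * c s - g s * c1 s) has_real_derivative (g2 s + v\<^sup>2 * g s) * c s) (at s)" for s
        by (rule derivative_eq_intros dg dg1 dc dc1 refl)+ (simp add: algebra_simps)
    next
      fix s assume "s \<in> S1"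
      then show "0 \<le> s \<and> s \<le> K \<and> g1 s * c s - g s * c1 s = 0"
        using S1(3)[of s] cpos[of s] by auto
    qed (use S1 in auto)
    define al' where "al' w = (v\<^sup>2 - w\<^sup>2) * al w" for w
    define be' where "be' w = (v\<^sup>2 - w\<^sup>2) * be w" for w
    have h: "g2 s + v\<^sup>2 * g s = (\<Sum>w\<in>W. al' w * cos (w * s) + be' w * sin (w * s))" for s
    proof -
      have "g2 s + v\<^sup>2 * g s = (\<Sum>w\<in>V. al' w * cos (w * s) + be' w * sin (w * s))"
        unfolding g2_def g_def sum_distrib_left sum.distrib[symmetric]
        by (rule sum.cong) (auto simp: al'_def be'_def algebra_simps)
      also have "\<dots> = (\<Sum>w\<in>W. al' w * cos (w * s) + be' w * sin (w * s))"
        using insert.hyps by (simp add: V_def al'_def be'_def)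
      finally show ?thesis .
    qed
    have "card S2 \<le> 2 * card W"
    proof (rule insert.IH[of al' be' S2])
      obtain w where w: "w \<in> W" "al w \<noteq> 0 \<or> be w \<noteq> 0" using True by blast
      have "v\<^sup>2 \<noteq> w\<^sup>2" using w(1) insert.hyps(2) v(1) insert.prems(1)[of w] by (auto simp: power2_eq_iff)
      then show "\<exists>w\<in>W. al' w \<noteq> 0 \<or> be' w \<noteq> 0" using w by (auto simp: al'_def be'_def intro!: bexI[of _ w])
      show "(\<Sum>w\<in>W. al' w * cos (w * s) + be' w * sin (w * s)) = 0" if "s \<in> S2" for s
        using S2(3)[OF that] cpos[of s] by (auto simp: h[symmetric])
    qed (use S2 insert.prems in auto)
    then show ?thesis using S1 S2 insert.hyps by simp
  qed
qed

section \<open>The character of period one on the line\<close>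

definition ee :: "real \<Rightarrow> complex" where
  "ee t = cis (2 * pi * t)"

lemma norm_ee [simp]: "cmod (ee t) = 1"
  by (simp add: ee_def)

lemma ee_add: "ee (s + t) = ee s * ee t"
  by (simp add: ee_def cis_mult distrib_left)

lemma ee_0 [simp]: "ee 0 = 1"
  by (simp add: ee_def)

lemma ee_int: "t \<in> \<int> \<Longrightarrow> ee t = 1"
  unfolding ee_def by (metis cis_multiple_2pi)

lemma ee_minus: "ee (- t) = cnj (ee t)"
  by (simp add: ee_def cis_cnj)

text \<open>Multiplying by a unimodular factor makes all frequencies positive without moving the
  zeros, and the real part is a sum covered by \<open>trig_sum_zeros\<close>. It is not identically
  0: indices sharing a frequency share their phase by \<open>cons\<close>, so their positive weights
  add up without cancellation.\<close>

lemma exp_sum_zeros: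
  fixes p c \<tau> :: "nat \<Rightarrow> real"
  assumes p: "\<And>l. l \<in> {1..m} \<Longrightarrow> 0 < p l" and m: "1 \<le> m" and K: "0 < K"
    and small: "\<And>l. l \<in> {1..m} \<Longrightarrow> \<bar>\<tau> l\<bar> * K < 1 / 8"
    and cons: "\<And>l l'. l \<in> {1..m} \<Longrightarrow> l' \<in> {1..m} \<Longrightarrow> \<tau> l = \<tau> l' \<Longrightarrow> c l = c l'"
    and S: "finite S" "\<And>s. s \<in> S \<Longrightarrow> 0 \<le> s \<and> s \<le> K"
      "\<And>s. s \<in> S \<Longrightarrow> (\<Sum>l\<in>{1..m}. p l * ee (c l + s * \<tau> l)) = 0"
  shows "card S \<le> 2 * m"
proof -
  \<comment> \<open>The shift by \<open>1 / (8 * K)\<close> moves the frequencies, of size below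
    \<open>1 / (8 * K)\<close>, into \<open>(0, 1 / (4 * K))\<close>, so that
    \<open>\<omega> l * K < pi / 2\<close>.\<close>
  define \<omega> where "\<omega> l = 2 * pi * (\<tau> l + 1 / (8 * K))" for l
  define W where "W = \<omega> ` {1..m}"
  define al where "al w = (\<Sum>l | l \<in> {1..m} \<and> \<omega> l = w. p l * cos (2 * pi * c l))" for w
  define be where "be w = (\<Sum>l | l \<in> {1..m} \<and> \<omega> l = w. - p l * sin (2 * pi * c l))" for w
  have "card S \<le> 2 * card W"
  proof (rule trig_sum_zeros[of W K al be S])
    show "finite W" by (simp add: W_def)
  next
    fix w assume "w \<in> W"
    then obtain l where l: "l \<in> {1..m}" "w = \<omega> l" by (auto simp: W_def)
    have "\<bar>\<tau> l\<bar> < 1 / (8 * K)" using small[OF l(1)] K by (simp add: field_simps)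
    then have "0 < \<tau> l + 1 / (8 * K)" "\<tau> l + 1 / (8 * K) < 1 / (4 * K)" by (auto simp: field_simps)
    then have "0 < \<omega> l" "\<omega> l < 2 * pi * (1 / (4 * K))"
      unfolding \<omega>_def by (simp, intro mult_strict_left_mono) auto
    moreover have "\<omega> l * K < 2 * pi * (1 / (4 * K)) * K"
      using \<open>\<omega> l < 2 * pi * (1 / (4 * K))\<close> K by (rule mult_strict_right_mono)
    moreover have "2 * pi * (1 / (4 * K)) * K = pi / 2" using K by simp
    ultimately have "\<omega> l * K < pi / 2" by (simp only:)
    then have "\<omega> l * K < pi" using pi_gt_zero by linarith
    then show "0 < w \<and> w * K < pi" using \<open>0 < \<omega> l\<close> by (simp add: l)
  next
    have one: "1 \<in> {1..m}" using m by simp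
    have eq: "c l = c 1" if "l \<in> {1..m}" "\<omega> l = \<omega> 1" for l
      using cons[OF that(1) one] that(2) by (simp add: \<omega>_def)
    define P where "P = (\<Sum>l | l \<in> {1..m} \<and> \<omega> l = \<omega> 1. p l)"
    have "P > 0" unfolding P_def by (rule sum_pos) (use one p in auto)
    moreover have "al (\<omega> 1) = P * cos (2 * pi * c 1)"
      unfolding al_def P_def sum_distrib_right
    proof (rule sum.cong)
      fix l assume "l \<in> {l. l \<in> {1..m} \<and> \<omega> l = \<omega> 1}"
      then have "c l = c 1" using eq by blast
      then show "p l * cos (2 * pi * c l) = p l * cos (2 * pi * c 1)" by (simp only:)
    qed simp
    moreover have "be (\<omega> 1) = - P * sin (2 * pi * c 1)"
      unfolding be_def P_def sum_distrib_right sum_negf[symmetric]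
    proof (rule sum.cong)
      fix l assume "l \<in> {l. l \<in> {1..m} \<and> \<omega> l = \<omega> 1}"
      then have "c l = c 1" using eq by blast
      then show "- p l * sin (2 * pi * c l) = - p l * sin (2 * pi * c 1)" by (simp only:)
    qed simp
    ultimately have "al (\<omega> 1) \<noteq> 0 \<or> be (\<omega> 1) \<noteq> 0"
      using sin_cos_squared_add[of "2 * pi * c 1"] by (auto simp: power2_eq_square)
    then show "\<exists>w\<in>W. al w \<noteq> 0 \<or> be w \<noteq> 0" using one by (auto simp: W_def)
  next
    fix s assume s: "s \<in> S"
    have "0 = ee (s / (8 * K)) * (\<Sum>l\<in>{1..m}. p l * ee (c l + s * \<tau> l))" using S(3)[OF s] by simp
    also have "\<dots> = (\<Sum>l\<in>{1..m}. p l * cis (2 * pi * c l + \<omega> l * s))"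
      unfolding sum_distrib_left
      by (rule sum.cong) (auto simp: ee_def cis_mult[symmetric] \<omega>_def algebra_simps)
    finally have "0 = Re (\<Sum>l\<in>{1..m}. p l * cis (2 * pi * c l + \<omega> l * s))" by simp
    also have "\<dots> = (\<Sum>l\<in>{1..m}. p l * cos (2 * pi * c l + \<omega> l * s))" by simp
    also have "\<dots> = (\<Sum>w\<in>W. \<Sum>l | l \<in> {1..m} \<and> \<omega> l = w. p l * cos (2 * pi * c l + \<omega> l * s))"
      unfolding W_def by (rule sum.image_gen) simp
    also have "\<dots> = (\<Sum>w\<in>W. al w * cos (w * s) + be w * sin (w * s))"
    proof (rule sum.cong)
      fix w assume "w \<in> W"
      have "(\<Sum>l | l \<in> {1..m} \<and> \<omega> l = w. p l * cos (2 * pi * c l + \<omega> l * s))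
        = (\<Sum>l | l \<in> {1..m} \<and> \<omega> l = w. p l * cos (2 * pi * c l) * cos (w * s) + (- p l * sin (2 * pi * c l)) * sin (w * s))"
        by (rule sum.cong) (auto simp: cos_add algebra_simps)
      then show "(\<Sum>l | l \<in> {1..m} \<and> \<omega> l = w. p l * cos (2 * pi * c l + \<omega> l * s))
         = al w * cos (w * s) + be w * sin (w * s)"
        by (simp only: al_def be_def sum.distrib sum_distrib_right)
    qed simp
    finally show "(\<Sum>w\<in>W. al w * cos (w * s) + be w * sin (w * s)) = 0" by simp
  qed (use S in auto)
  moreover have "card W \<le> m" using card_image_le[of "{1..m}" \<omega>] by (simp add: W_def)
  ultimately show ?thesis by simp
qed

subsection \<open>Self-affine measures and characters\<close>

lemma self_affine_prob_space:
  assumes "self_affine_measure M m \<psi> p \<nu>" shows "prob_space \<nu>"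
  using assms by (intro prob_spaceI) (simp add: self_affine_measure_def)

text \<open>The definition is an identity between measures of sets. Writing \<nu> as a mixture of
  its images under the maps, over a probability mass function with weights \<open>p\<close>, turns
  it into one between integrals.\<close>

lemma self_affine_integral_real:
  fixes f :: "'x \<Rightarrow> real"
  assumes sa: "self_affine_measure M m \<psi> p \<nu>" and p: "strictly_positive_prob_vector m p"
    and \<psi>: "\<And>l. l \<in> {1..m} \<Longrightarrow> \<psi> l \<in> measurable M M"
    and f: "f \<in> borel_measurable M" and B: "\<And>x. x \<in> space M \<Longrightarrow> \<bar>f x\<bar> \<le> B"
  shows "(LINT x|\<nu>. f x) = (\<Sum>l\<in>{1..m}. p l * (LINT x|\<nu>. f (\<psi> l x)))"
proof -
  have sets: "sets \<nu> = sets M" using sa by (simp add: self_affine_measure_def)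
  then have space: "space \<nu> = space M" by (rule sets_eq_imp_space_eq)
  have cong: "measurable \<nu> = measurable M" "\<And>N. measurable N \<nu> = measurable N M"
    by (rule ext, rule measurable_cong_sets[OF sets refl], rule measurable_cong_sets[OF refl sets])
  interpret prob_space \<nu> using self_affine_prob_space[OF sa] .
  have p0: "\<And>l. l \<in> {1..m} \<Longrightarrow> 0 < p l" and p1: "(\<Sum>l\<in>{1..m}. p l) = 1"
    using p by (auto simp: strictly_positive_prob_vector_def)
  define P where "P l = (if l \<in> {1..m} then p l else 0)" for l
  have P0: "\<And>l. 0 \<le> P l" using p0 by (auto simp: P_def less_imp_le)
  have Pint: "(\<integral>\<^sup>+ l. ennreal (P l) \<partial>count_space UNIV) = 1"
  proof -
    have "(\<integral>\<^sup>+ l. ennreal (P l) \<partial>count_space UNIV) = (\<Sum>l\<in>{1..m}. ennreal (P l))"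
      by (rule nn_integral_count_space'[of "{1..m}"]) (auto simp: P_def)
    also have "\<dots> = ennreal (\<Sum>l\<in>{1..m}. P l)" using P0 by (intro sum_ennreal) auto
    also have "(\<Sum>l\<in>{1..m}. P l) = 1" using p1 by (simp add: P_def)
    finally show ?thesis by simp
  qed
  define Q where "Q = embed_pmf P"
  have pmfQ: "pmf Q l = P l" for l unfolding Q_def using P0 Pint by (rule pmf_embed_pmf)
  have setQ: "set_pmf Q = {1..m}" using p0 by (auto simp: set_pmf_eq pmfQ P_def less_le)
  \<comment> \<open>Indices outside \<open>{1..m}\<close> carry no mass; the value \<nu> there
    merely makes \<open>N\<close> a probability kernel on all of \<open>nat\<close>.\<close>
  define N where "N l = (if l \<in> {1..m} then distr \<nu> M (\<psi> l) else \<nu>)" for l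
  have sub: "N l \<in> space (subprob_algebra M)" for l
  proof -
    have "prob_space (N l)" "sets (N l) = sets M"
      using \<psi>[of l] sets prob_space_axioms by (auto simp: N_def cong intro!: prob_space_distr)
    then show ?thesis by (simp add: space_subprob_algebra prob_space_imp_subprob_space)
  qed
  have Nm: "N \<in> measurable (measure_pmf Q) (subprob_algebra M)" using sub by simp
  have eq: "\<nu> = measure_pmf Q \<bind> N"
  proof (rule measure_eqI)
    show "sets \<nu> = sets (measure_pmf Q \<bind> N)"
      using sets sub by (subst sets_bind[of _ _ M]) (auto simp: space_subprob_algebra)
    fix E assume "E \<in> sets \<nu>"
    then have E: "E \<in> sets M" using sets by simp
    have "emeasure (measure_pmf Q \<bind> N) E = (\<integral>\<^sup>+ l. emeasure (N l) E \<partial>measure_pmf Q)"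
      by (rule emeasure_bind[OF _ Nm E]) simp
    also have "\<dots> = (\<Sum>l\<in>{1..m}. emeasure (N l) E * ennreal (pmf Q l))"
      by (subst nn_integral_measure_pmf_finite) (auto simp: setQ)
    also have "\<dots> = (\<Sum>l\<in>{1..m}. ennreal (p l * measure \<nu> (\<psi> l -` E \<inter> space M)))"
    proof (rule sum.cong)
      fix l assume l: "l \<in> {1..m}"
      have "emeasure (N l) E = ennreal (measure \<nu> (\<psi> l -` E \<inter> space M))"
        using l \<psi>[OF l] E by (simp add: N_def emeasure_distr cong space emeasure_eq_measure)
      then show "emeasure (N l) E * ennreal (pmf Q l) = ennreal (p l * measure \<nu> (\<psi> l -` E \<inter> space M))"
        using l p0[OF l] by (simp add: pmfQ P_def ennreal_mult mult.commute)
    qed simp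
    also have "\<dots> = ennreal (\<Sum>l\<in>{1..m}. p l * measure \<nu> (\<psi> l -` E \<inter> space M))"
      by (intro sum_ennreal) (meson mult_nonneg_nonneg p0 less_imp_le measure_nonneg)
    also have "\<dots> = emeasure \<nu> E"
      using sa E by (simp add: self_affine_measure_def emeasure_eq_measure)
    finally show "emeasure \<nu> E = emeasure (measure_pmf Q \<bind> N) E" by simp
  qed
  have "(LINT x|\<nu>. f x) = (LINT x|(measure_pmf Q \<bind> N). f x)" using eq by simp
  also have "\<dots> = (LINT l|measure_pmf Q. (LINT x|N l. f x))"
  proof (rule integral_bind[where K = M and B' = 1 and B = B])
    show "AE l in measure_pmf Q. emeasure (N l) (space (N l)) \<le> ennreal 1"
      using sub subprob_space.emeasure_space_le_1 by (auto simp: space_subprob_algebra intro!: AE_I2)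
  qed (use f B Nm measure_pmf.finite_measure_axioms in auto)
  also have "\<dots> = (\<Sum>l\<in>{1..m}. pmf Q l *\<^sub>R (LINT x|N l. f x))"
    by (rule integral_measure_pmf) (auto simp: setQ)
  also have "\<dots> = (\<Sum>l\<in>{1..m}. p l * (LINT x|\<nu>. f (\<psi> l x)))"
  proof (rule sum.cong)
    fix l assume l: "l \<in> {1..m}"
    have "(LINT x|N l. f x) = (LINT x|\<nu>. f (\<psi> l x))"
      using l \<psi>[OF l] f by (simp add: N_def integral_distr cong)
    then show "pmf Q l *\<^sub>R (LINT x|N l. f x) = p l * (LINT x|\<nu>. f (\<psi> l x))"
      using l by (simp add: pmfQ P_def)
  qed simp
  finally show ?thesis .
qed

lemma self_affine_integral:
  fixes f :: "'x \<Rightarrow> complex"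
  assumes sa: "self_affine_measure M m \<psi> p \<nu>" and p: "strictly_positive_prob_vector m p"
    and \<psi>: "\<And>l. l \<in> {1..m} \<Longrightarrow> \<psi> l \<in> measurable M M"
    and f: "f \<in> borel_measurable M" and B: "\<And>x. x \<in> space M \<Longrightarrow> cmod (f x) \<le> B"
  shows "(LINT x|\<nu>. f x) = (\<Sum>l\<in>{1..m}. p l * (LINT x|\<nu>. f (\<psi> l x)))"
proof -
  have sets: "sets \<nu> = sets M" using sa by (simp add: self_affine_measure_def)
  then have space: "space \<nu> = space M" by (rule sets_eq_imp_space_eq)
  have cong: "measurable \<nu> N = measurable M N" for N by (rule measurable_cong_sets[OF sets refl])
  interpret prob_space \<nu> using self_affine_prob_space[OF sa] .
  have int: "integrable \<nu> g" if "g \<in> borel_measurable M" "\<And>x. x \<in> space M \<Longrightarrow> cmod (g x) \<le> B" for g :: "'x \<Rightarrow> complex"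
    by (rule integrable_const_bound[where B = B]) (use that space in \<open>auto simp: cong intro!: AE_I2\<close>)
  have fi: "integrable \<nu> f" by (rule int[OF f B])
  have fli: "integrable \<nu> (\<lambda>x. f (\<psi> l x))" if "l \<in> {1..m}" for l
    by (rule int) (use \<psi>[OF that] f B measurable_space[OF \<psi>[OF that]] in \<open>auto intro: measurable_compose\<close>)
  have R: "(LINT x|\<nu>. Re (f x)) = (\<Sum>l\<in>{1..m}. p l * (LINT x|\<nu>. Re (f (\<psi> l x))))"
    by (rule self_affine_integral_real[OF sa p \<psi>, where B = B]) (use f B order_trans[OF abs_Re_le_cmod] in auto)
  have I: "(LINT x|\<nu>. Im (f x)) = (\<Sum>l\<in>{1..m}. p l * (LINT x|\<nu>. Im (f (\<psi> l x))))"
    by (rule self_affine_integral_real[OF sa p \<psi>, where B = B]) (use f B order_trans[OF abs_Im_le_cmod] in auto)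
  show ?thesis
    by (rule complex_eqI) (simp_all add: R I fi fli flip: integral_Re integral_Im)
qed

section \<open>Integrals of characters and Cesaro means\<close>

lemma borel_measurable_ee [measurable]: "ee \<in> borel_measurable borel"
  unfolding ee_def[abs_def] by (intro borel_measurable_continuous_onI continuous_intros)

lemma continuous_ee: "continuous_on A ee"
  unfolding ee_def[abs_def] by (intro continuous_intros)

lemma integral_ee_int:
  fixes a b :: real and k :: int
  assumes "b - a \<in> \<nat>" "k \<noteq> 0"
  shows "(LINT t|lborel. indicator {a..b} t *\<^sub>R ee (k * t)) = 0"
proof -
  define F where "F t = ee (k * t) / (2 * pi * \<i> * k)" for t :: real
  have ab: "a \<le> b" using assms(1) Nats_altdef2 by force
  have "(LINT t|lborel. indicator {a..b} t *\<^sub>R ee (k * t)) = F b - F a"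
  proof (rule integral_FTC_Icc[OF ab])
    fix x :: real
    define c where "c = 2 * pi * \<i> * k"
    have "((\<lambda>z. exp (c * z)) has_field_derivative c * exp (c * complex_of_real x)) (at (complex_of_real x))"
      by (auto intro!: derivative_eq_intros)
    then have "((\<lambda>t. exp (c * complex_of_real t)) has_vector_derivative c * exp (c * complex_of_real x)) (at x within {a..b})"
      by (rule has_vector_derivative_real_field)
    then have "((\<lambda>t. ee (k * t)) has_vector_derivative (2 * pi * \<i> * k) * ee (k * x)) (at x within {a..b})"
      by (simp add: ee_def cis_conv_exp c_def mult_ac)
    then have "((\<lambda>t. ee (k * t) / (2 * pi * \<i> * k)) has_vector_derivative
       (2 * pi * \<i> * k) * ee (k * x) / (2 * pi * \<i> * k)) (at x within {a..b})"
      by (rule has_vector_derivative_divide)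
    then show "(F has_vector_derivative ee (k * x)) (at x within {a..b})"
      using assms(2) by (simp add: F_def[abs_def])
  next
    show "continuous_on {a..b} (\<lambda>t. ee (k * t))"
      by (intro continuous_on_compose2[OF continuous_ee[of UNIV]] continuous_intros) auto
  qed
  also have "ee (k * b) = ee (k * a)"
  proof -
    have "k * b = k * a + k * (b - a)" by (simp add: algebra_simps)
    moreover have "ee (k * (b - a)) = 1" using assms(1) by (intro ee_int) (auto elim!: Nats_cases)
    ultimately show ?thesis by (simp add: ee_add)
  qed
  then have "F b - F a = 0" by (simp add: F_def)
  finally show ?thesis .
qed

definition chr :: "nat \<Rightarrow> (nat \<Rightarrow> real) \<Rightarrow> (nat \<Rightarrow> real) \<Rightarrow> complex" where
  "chr q k y = ee (\<Sum>i<q. k i * y i)"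

lemma norm_chr [simp]: "cmod (chr q k y) = 1"
  by (simp add: chr_def)

lemma chr_measurable [measurable]: "chr q k \<in> borel_measurable (borel_Rq q)"
  unfolding chr_def by measurable

lemma chr_prod: "chr q k y = (\<Prod>i<q. ee (k i * y i))"
  unfolding chr_def by (induction q) (simp_all add: ee_add)

lemma chr_add: "chr q (\<lambda>i. k i + k' i) y = chr q k y * chr q k' y"
  by (simp add: chr_def distrib_right sum.distrib ee_add)

lemma chr_minus: "chr q (\<lambda>i. - k i) y = cnj (chr q k y)"
  by (simp add: chr_def sum_negf ee_minus)

lemma chr_cong: "(\<And>i. i < q \<Longrightarrow> k i = k' i) \<Longrightarrow> chr q k y = chr q k' y"
  by (simp add: chr_def)

lemma cesaro_0:
  fixes A :: "nat \<Rightarrow> real"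
  assumes "A \<longlonglongrightarrow> 0" "\<And>n. 0 \<le> A n"
  shows "(\<lambda>N. (\<Sum>n<N. A n) / N) \<longlonglongrightarrow> 0"
proof (rule LIMSEQ_I)
  fix e :: real assume e: "e > 0"
  obtain M where M: "\<And>n. n \<ge> M \<Longrightarrow> A n < e / 2" using LIMSEQ_D[OF assms(1), of "e/2"] e by fastforce
  define S where "S = (\<Sum>n<M. A n)"
  obtain K :: nat where K: "2 * S / e < K" using reals_Archimedean2 by blast
  show "\<exists>no. \<forall>N\<ge>no. norm ((\<Sum>n<N. A n) / N - 0) < e"
  proof (intro exI[of _ "max (Suc K) M"] allI impI)
    fix N assume N: "N \<ge> max (Suc K) M"
    have "(\<Sum>n<N. A n) = S + (\<Sum>n\<in>{M..<N}. A n)"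
      unfolding S_def using N by (simp add: sum.atLeastLessThan_concat lessThan_atLeast0)
    also have "(\<Sum>n\<in>{M..<N}. A n) \<le> (\<Sum>n\<in>{M..<N}. e / 2)"
      by (rule sum_mono) (metis M atLeastLessThan_iff less_imp_le)
    also have "\<dots> \<le> N * (e / 2)" using e by (simp add: mult_right_mono)
    finally have "(\<Sum>n<N. A n) \<le> S + N * (e / 2)" by simp
    moreover have "S < N * (e / 2)"
    proof -
      have "2 * S / e < N" using K N by linarith
      then show ?thesis using e by (simp add: field_simps)
    qed
    ultimately have "(\<Sum>n<N. A n) < N * e" by simp
    then have "(\<Sum>n<N. A n) / N < e" using N by (simp add: field_simps)
    moreover have "0 \<le> (\<Sum>n<N. A n) / N" by (intro divide_nonneg_nonneg sum_nonneg assms(2)) auto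
    ultimately show "norm ((\<Sum>n<N. A n) / N - 0) < e" by simp
  qed
qed

subsection \<open>Integral systems with a nonvanishing Fourier coefficient\<close>

locale integral_system =
  fixes q m :: nat and \<psi> :: "nat \<Rightarrow> (nat \<Rightarrow> real) \<Rightarrow> nat \<Rightarrow> real" and p :: "nat \<Rightarrow> real"
    and \<nu> :: "(nat \<Rightarrow> real) measure" and B C :: "nat \<Rightarrow> nat \<Rightarrow> real" and b :: "nat \<Rightarrow> nat \<Rightarrow> real"
  assumes sa: "self_affine_measure (borel_Rq q) m \<psi> p \<nu>"
    and pp: "strictly_positive_prob_vector m p"
    and psi: "\<And>l x. l \<in> {1..m} \<Longrightarrow> x \<in> Rq q \<Longrightarrow> \<psi> l x = (\<lambda>i\<in>{..<q}. (\<Sum>j<q. B i j * x j) + b l i)"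
    and inv: "inverse_matrices_Rq q B C"
    and Cint: "\<And>i j. i < q \<Longrightarrow> j < q \<Longrightarrow> C i j \<in> \<int>"
    and bint: "\<And>l i. l \<in> {1..m} \<Longrightarrow> i < q \<Longrightarrow> b l i \<in> \<int>"
begin

text \<open>The transposes act on frequencies. Restriction to \<open>{..<q}\<close> makes
  frequencies points of \<open>Rq q\<close>, so that \<open>Bt (Ct k) = k\<close> is an equality of
  functions.\<close>

definition Bt :: "(nat \<Rightarrow> real) \<Rightarrow> nat \<Rightarrow> real" where
  "Bt k = (\<lambda>j\<in>{..<q}. \<Sum>i<q. k i * B i j)"

definition Ct :: "(nat \<Rightarrow> real) \<Rightarrow> nat \<Rightarrow> real" where
  "Ct k = (\<lambda>j\<in>{..<q}. \<Sum>i<q. k i * C i j)"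

definition nuhat :: "(nat \<Rightarrow> real) \<Rightarrow> complex" where
  "nuhat k = (LINT y|\<nu>. chr q k y)"

definition Pb :: "(nat \<Rightarrow> real) \<Rightarrow> complex" where
  "Pb k = (\<Sum>l\<in>{1..m}. p l * ee (\<Sum>i<q. k i * b l i))"

definition lattice :: "(nat \<Rightarrow> real) set" where
  "lattice = {..<q} \<rightarrow>\<^sub>E \<int>"

lemma sets_nu: "sets \<nu> = sets (borel_Rq q)"
  using sa by (simp add: self_affine_measure_def)

lemma space_nu: "space \<nu> = Rq q"
  using sets_eq_imp_space_eq[OF sets_nu] by (simp add: space_PiM)

sublocale prob_space \<nu>
  using self_affine_prob_space[OF sa] .

lemma chr_meas [measurable]: "chr q k \<in> borel_measurable \<nu>"
  using chr_measurable measurable_cong_sets[OF sets_nu refl] by blast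

lemma chr_integrable [simp]: "integrable \<nu> (chr q k)"
  by (rule integrable_const_bound[where B = 1]) auto

lemma Bt_Ct: "k \<in> Rq q \<Longrightarrow> Bt (Ct k) = k"
proof (rule ext)
  fix j assume k: "k \<in> Rq q"
  show "Bt (Ct k) j = k j"
  proof (cases "j < q")
    case True
    have "(\<Sum>i<q. Ct k i * B i j) = (\<Sum>i<q. \<Sum>i'<q. k i' * (C i' i * B i j))"
      by (simp add: Ct_def sum_distrib_right mult.assoc)
    also have "\<dots> = (\<Sum>i'<q. k i' * (\<Sum>i<q. C i' i * B i j))"
      by (subst sum.swap) (simp add: sum_distrib_left)
    also have "\<dots> = (\<Sum>i'<q. k i' * (if i' = j then 1 else 0))"
      using inv True by (intro sum.cong) (auto simp: inverse_matrices_Rq_def)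
    also have "\<dots> = (\<Sum>i'<q. if i' = j then k i' else 0)" by (rule sum.cong) auto
    also have "\<dots> = k j" using True by simp
    finally show ?thesis using True by (simp add: Bt_def)
  next
    case False
    then show ?thesis using k by (simp add: Bt_def PiE_arb[of k])
  qed
qed

lemma Bt_diff: "Bt (\<lambda>i. k i - k' i) = (\<lambda>j\<in>{..<q}. Bt k j - Bt k' j)"
  by (rule ext) (simp add: Bt_def left_diff_distrib sum_subtractf)

lemma nuhat_cong: "(\<And>i. i < q \<Longrightarrow> k i = k' i) \<Longrightarrow> nuhat k = nuhat k'"
proof -
  assume "\<And>i. i < q \<Longrightarrow> k i = k' i"
  then have "chr q k = chr q k'" by (intro ext chr_cong)
  then show ?thesis by (simp add: nuhat_def)
qed

lemma Ct_lattice: "k \<in> lattice \<Longrightarrow> Ct k \<in> lattice"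
  using Cint by (auto simp: lattice_def Ct_def PiE_iff intro!: Ints_sum Ints_mult)

lemma lattice_Rq: "k \<in> lattice \<Longrightarrow> k \<in> Rq q"
  by (auto simp: lattice_def)

lemma Ct_pow_lattice: "k \<in> lattice \<Longrightarrow> (Ct ^^ n) k \<in> lattice"
  by (induction n) (auto simp: Ct_lattice)

lemma nuhat_step: "nuhat k = Pb k * nuhat (Bt k)"
proof -
  have meas: "\<psi> l \<in> measurable (borel_Rq q) (borel_Rq q)" if l: "l \<in> {1..m}" for l
  proof -
    have "(\<lambda>x. \<lambda>i\<in>{..<q}. (\<Sum>j<q. B i j * x j) + b l i) \<in> measurable (borel_Rq q) (borel_Rq q)"
      by measurable
    then show ?thesis
      by (subst measurable_cong[where g = "\<lambda>x. \<lambda>i\<in>{..<q}. (\<Sum>j<q. B i j * x j) + b l i"])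
         (auto simp: space_PiM psi[OF l])
  qed
  have eq: "chr q k (\<psi> l y) = ee (\<Sum>i<q. k i * b l i) * chr q (Bt k) y"
    if l: "l \<in> {1..m}" and y: "y \<in> Rq q" for l y
  proof -
    have "(\<Sum>i<q. k i * (\<psi> l y) i) = (\<Sum>i<q. \<Sum>j<q. k i * B i j * y j) + (\<Sum>i<q. k i * b l i)"
      by (simp add: psi[OF l y] distrib_left sum.distrib sum_distrib_left mult.assoc)
    also have "(\<Sum>i<q. \<Sum>j<q. k i * B i j * y j) = (\<Sum>j<q. Bt k j * y j)"
      by (subst sum.swap) (simp add: Bt_def sum_distrib_right)
    finally show ?thesis by (simp add: chr_def ee_add mult.commute)
  qed
  have "nuhat k = (\<Sum>l\<in>{1..m}. p l * (LINT y|\<nu>. chr q k (\<psi> l y)))"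
    unfolding nuhat_def by (rule self_affine_integral[OF sa pp meas, where B = 1]) auto
  also have "\<dots> = (\<Sum>l\<in>{1..m}. p l * (ee (\<Sum>i<q. k i * b l i) * nuhat (Bt k)))"
  proof (rule sum.cong)
    fix l assume l: "l \<in> {1..m}"
    have "(LINT y|\<nu>. chr q k (\<psi> l y)) = (LINT y|\<nu>. ee (\<Sum>i<q. k i * b l i) * chr q (Bt k) y)"
      by (rule Bochner_Integration.integral_cong) (auto simp: eq[OF l] space_nu)
    then show "p l * (LINT y|\<nu>. chr q k (\<psi> l y)) = p l * (ee (\<Sum>i<q. k i * b l i) * nuhat (Bt k))"
      by (simp add: nuhat_def)
  qed simp
  finally show ?thesis by (simp add: Pb_def sum_distrib_right mult.assoc)
qed

text \<open>The translations \<open>b l\<close> are integral, so the mask is periodic under the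
  lattice.\<close>

lemma Pb_add_lattice:
  assumes "k' \<in> lattice" shows "Pb (\<lambda>i. k' i - k i) = Pb (\<lambda>i. - k i)"
proof -
  have "ee (\<Sum>i<q. (k' i - k i) * b l i) = ee (\<Sum>i<q. - k i * b l i)" if l: "l \<in> {1..m}" for l
  proof -
    have "(\<Sum>i<q. k' i * b l i) \<in> \<int>"
      using assms bint[OF l] by (intro Ints_sum Ints_mult) (auto simp: lattice_def PiE_iff)
    then have "ee (\<Sum>i<q. k' i * b l i) = 1" by (rule ee_int)
    moreover have "(\<Sum>i<q. (k' i - k i) * b l i) = (\<Sum>i<q. k' i * b l i) + (\<Sum>i<q. - k i * b l i)"
      by (simp add: left_diff_distrib sum_subtractf sum_negf)
    ultimately show ?thesis by (simp only: ee_add mult_1_left)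
  qed
  then show ?thesis by (simp add: Pb_def)
qed

lemma Pb_int:
  assumes "\<And>i. i < q \<Longrightarrow> k i \<in> \<int>" shows "Pb k = 1"
proof -
  have "ee (\<Sum>i<q. k i * b l i) = 1" if "l \<in> {1..m}" for l
    using assms bint[OF that] by (intro ee_int Ints_sum Ints_mult) auto
  then have "Pb k = (\<Sum>l\<in>{1..m}. of_real (p l))" by (simp add: Pb_def)
  also have "\<dots> = of_real (\<Sum>l\<in>{1..m}. p l)" by simp
  finally show ?thesis using pp by (simp add: strictly_positive_prob_vector_def del: of_real_sum)
qed

lemma lattice_int: "k \<in> lattice \<Longrightarrow> i < q \<Longrightarrow> k i \<in> \<int>"
  by (auto simp: lattice_def PiE_iff)

lemma Pb_lattice: "k \<in> lattice \<Longrightarrow> Pb k = 1"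
  by (rule Pb_int) (rule lattice_int)

text \<open>On the lattice the mask equals 1, and \<open>Ct\<close> maps the lattice into itself:
  Fourier coefficients are constant along its orbits.\<close>

lemma nuhat_Ct: "k \<in> lattice \<Longrightarrow> nuhat (Ct k) = nuhat k"
  by (subst nuhat_step) (simp add: Pb_lattice Ct_lattice Bt_Ct lattice_Rq)

lemma nuhat_Ct_pow: "k \<in> lattice \<Longrightarrow> nuhat ((Ct ^^ n) k) = nuhat k"
  by (induction n) (auto simp: nuhat_Ct Ct_pow_lattice)

lemma nuhat_tendsto:
  assumes "\<And>i. i < q \<Longrightarrow> (\<lambda>n. ks n i) \<longlonglongrightarrow> k i"
  shows "(\<lambda>n. nuhat (ks n)) \<longlonglongrightarrow> nuhat k"
  unfolding nuhat_def
proof (rule integral_dominated_convergence[where w = "\<lambda>_. 1"])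
  have "(\<lambda>n. chr q (ks n) y) \<longlonglongrightarrow> chr q k y" for y
  proof -
    have "(\<lambda>n. \<Sum>i<q. ks n i * y i) \<longlonglongrightarrow> (\<Sum>i<q. k i * y i)"
      by (intro tendsto_sum tendsto_mult tendsto_const assms) auto
    from continuous_on_tendsto_compose[OF continuous_ee[of UNIV] this]
    show ?thesis by (simp add: chr_def)
  qed
  then show "AE y in \<nu>. (\<lambda>n. chr q (ks n) y) \<longlonglongrightarrow> chr q k y" by (intro AE_I2)
  show "AE y in \<nu>. norm (chr q (ks n) y) \<le> 1" for n by (intro AE_I2) (simp only: norm_chr)
qed (rule chr_meas, rule chr_meas, simp)

lemma nuhat_0 [simp]: "nuhat (\<lambda>_. 0) = 1"
proof -
  have "chr q (\<lambda>_. 0) = (\<lambda>y. 1)" by (simp add: fun_eq_iff chr_def)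
  then show ?thesis by (simp add: nuhat_def prob_space)
qed

lemma nuhat_minus: "nuhat (\<lambda>i. - k i) = cnj (nuhat k)"
  unfolding nuhat_def chr_minus using Bochner_Integration.integral_cnj[of \<nu> "chr q k"] by simp

end

text \<open>Each distance to \<open>n\<close> is attained at most twice. This bounds the row sums of
  a correlation matrix that depends only on the time difference.\<close>

lemma sum_distance_le:
  fixes A :: "nat \<Rightarrow> real"
  assumes "\<And>n. 0 \<le> A n" "n < N"
  shows "(\<Sum>n'<N. A (if n' \<le> n then n - n' else n' - n)) \<le> 2 * (\<Sum>r<N. A r)"
proof -
  have "(\<Sum>n'<N. A (if n' \<le> n then n - n' else n' - n))
    = (\<Sum>n'\<in>{..n}. A (if n' \<le> n then n - n' else n' - n)) + (\<Sum>n'\<in>{n<..<N}. A (if n' \<le> n then n - n' else n' - n))"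
    using assms(2) by (subst sum.union_disjoint[symmetric]) (auto intro!: sum.cong)
  also have "(\<Sum>n'\<in>{..n}. A (if n' \<le> n then n - n' else n' - n)) = (\<Sum>r\<in>{..n}. A r)"
    by (rule sum.reindex_bij_witness[of _ "\<lambda>r. n - r" "\<lambda>r. n - r"]) auto
  also have "(\<Sum>n'\<in>{n<..<N}. A (if n' \<le> n then n - n' else n' - n)) = (\<Sum>r\<in>{0<..<N - n}. A r)"
    by (rule sum.reindex_bij_witness[of _ "\<lambda>r. r + n" "\<lambda>r. r - n"]) auto
  also have "(\<Sum>r\<in>{..n}. A r) \<le> (\<Sum>r<N. A r)" using assms by (intro sum_mono2) auto
  also have "(\<Sum>r\<in>{0<..<N - n}. A r) \<le> (\<Sum>r<N. A r)" using assms by (intro sum_mono2) auto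
  finally show ?thesis by simp
qed

text \<open>The sides of the box have integer length \<open>2 * R\<close>, so every nontrivial
  integral character has mean 0 over it.\<close>

lemma box_character_integral:
  fixes k :: "nat \<Rightarrow> real" and q R :: nat
  defines "I \<equiv> \<lambda>y. (\<Prod>i<q. indicat_real {- real R..real R} (y i))"
  assumes int: "\<And>i. i < q \<Longrightarrow> k i \<in> \<int>"
  shows "integrable (lborel_Rq q) (\<lambda>y. I y *\<^sub>R chr q k y)"
    "\<exists>i<q. k i \<noteq> 0 \<Longrightarrow> (LINT y|lborel_Rq q. I y *\<^sub>R chr q k y) = 0"
    "\<forall>i<q. k i = 0 \<Longrightarrow> (LINT y|lborel_Rq q. I y *\<^sub>R chr q k y) = of_real ((2 * R) ^ q)"
proof -
  interpret product_sigma_finite "\<lambda>_::nat. lborel :: real measure" ..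
  define f where "f i t = indicat_real {- real R..real R} t *\<^sub>R ee (k i * t)" for i t
  have fint: "integrable lborel (f i)" for i
    unfolding f_def by (intro borel_integrable_compact compact_Icc continuous_on_compose2[OF continuous_ee[of UNIV]]
      continuous_intros) auto
  have eq: "I y *\<^sub>R chr q k y = (\<Prod>i<q. f i (y i))" for y
    by (simp add: I_def f_def chr_prod scaleR_conv_of_real prod.distrib)
  show "integrable (lborel_Rq q) (\<lambda>y. I y *\<^sub>R chr q k y)"
    unfolding eq by (rule product_integrable_prod) (auto intro: fint)
  have L: "(LINT y|lborel_Rq q. I y *\<^sub>R chr q k y) = (\<Prod>i<q. integral\<^sup>L lborel (f i))"
    unfolding eq by (rule product_integral_prod) (auto intro: fint)
  show "(LINT y|lborel_Rq q. I y *\<^sub>R chr q k y) = 0" if ne: "\<exists>i<q. k i \<noteq> 0"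
  proof -
    obtain i where i: "i < q" "k i \<noteq> 0" using ne by blast
    then obtain n where n: "k i = of_int n" using int by (auto elim: Ints_cases)
    have "integral\<^sup>L lborel (f i) = 0"
      unfolding f_def n by (rule integral_ee_int) (use i n in auto)
    then show ?thesis using i unfolding L by (intro prod_zero) auto
  qed
  show "(LINT y|lborel_Rq q. I y *\<^sub>R chr q k y) = of_real ((2 * R) ^ q)" if z: "\<forall>i<q. k i = 0"
  proof -
    have "integral\<^sup>L lborel (f i) = of_real (2 * R)" if "i < q" for i
    proof -
      have "f i = (\<lambda>t. complex_of_real (indicat_real {- real R..real R} t))"
        using z that by (simp add: fun_eq_iff f_def scaleR_conv_of_real)
      then have "integral\<^sup>L lborel (f i) = complex_of_real (LINT t|lborel. indicat_real {- real R..real R} t)"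
        by (simp only: integral_complex_of_real)
      moreover have "(LINT t|lborel. indicat_real {- real R..real R} t) = real (2 * R)" by simp
      ultimately show ?thesis by (simp only: of_real_of_nat_eq)
    qed
    then show ?thesis unfolding L by simp
  qed
qed

context integral_system
begin

lemma Bt_minus: "Bt (\<lambda>i. - k i) = (\<lambda>j\<in>{..<q}. - Bt k j)"
  by (rule ext) (simp add: Bt_def sum_negf)

text \<open>As long as \<open>Ct ^^ (r - j)\<close> keeps the first term in the lattice, the mask
  sees only \<open>- (Bt ^^ j) k\<close>. For \<open>s = r\<close> the product is the one in
  \<open>nuhat_minus_product\<close>, which makes the limit of the correlations computable.\<close>

lemma correlation_product:
  assumes k: "k \<in> lattice" and "s \<le> r"
  shows "nuhat (\<lambda>i. (Ct ^^ r) k i - k i) =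
     (\<Prod>j<s. Pb (\<lambda>i. - (Bt ^^ j) k i)) * nuhat (\<lambda>i. (Ct ^^ (r - s)) k i - (Bt ^^ s) k i)"
  using assms(2)
proof (induction s)
  case (Suc s)
  define k' where "k' = (Ct ^^ (r - s)) k"
  have k': "k' = Ct ((Ct ^^ (r - Suc s)) k)"
    using Suc.prems by (simp add: k'_def Suc_diff_Suc[symmetric])
  have "nuhat (\<lambda>i. k' i - (Bt ^^ s) k i) = Pb (\<lambda>i. k' i - (Bt ^^ s) k i) * nuhat (Bt (\<lambda>i. k' i - (Bt ^^ s) k i))"
    by (rule nuhat_step)
  also have "Pb (\<lambda>i. k' i - (Bt ^^ s) k i) = Pb (\<lambda>i. - (Bt ^^ s) k i)"
    by (rule Pb_add_lattice) (simp add: k'_def Ct_pow_lattice k)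
  also have "nuhat (Bt (\<lambda>i. k' i - (Bt ^^ s) k i)) = nuhat (\<lambda>i. (Ct ^^ (r - Suc s)) k i - (Bt ^^ Suc s) k i)"
    by (rule nuhat_cong) (simp add: Bt_diff k' Bt_Ct lattice_Rq Ct_pow_lattice k)
  finally show ?case using Suc by (simp add: k'_def mult.assoc)
qed simp

lemma nuhat_minus_product:
  "nuhat (\<lambda>i. - k i) = (\<Prod>j<s. Pb (\<lambda>i. - (Bt ^^ j) k i)) * nuhat (\<lambda>i. - (Bt ^^ s) k i)"
proof (induction s)
  case (Suc s)
  have "nuhat (\<lambda>i. - (Bt ^^ s) k i) = Pb (\<lambda>i. - (Bt ^^ s) k i) * nuhat (Bt (\<lambda>i. - (Bt ^^ s) k i))"
    by (rule nuhat_step)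
  also have "nuhat (Bt (\<lambda>i. - (Bt ^^ s) k i)) = nuhat (\<lambda>i. - (Bt ^^ Suc s) k i)"
    by (rule nuhat_cong) (simp add: Bt_minus)
  finally show ?case using Suc by (simp add: mult.assoc)
qed simp

text \<open>Stationarity: the mask is 1 at differences of lattice points, so a common power of
  \<open>Ct\<close> can be removed.\<close>

lemma correlation_shift:
  assumes k: "k \<in> lattice"
  shows "nuhat (\<lambda>i. (Ct ^^ (n + r)) k i - (Ct ^^ n) k i) = nuhat (\<lambda>i. (Ct ^^ r) k i - k i)"
proof (induction n)
  case (Suc n)
  define x y where "x = (Ct ^^ (n + r)) k" and "y = (Ct ^^ n) k"
  have xy: "x \<in> lattice" "y \<in> lattice" by (simp_all add: x_def y_def Ct_pow_lattice k)
  have "nuhat (\<lambda>i. Ct x i - Ct y i) = Pb (\<lambda>i. Ct x i - Ct y i) * nuhat (Bt (\<lambda>i. Ct x i - Ct y i))"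
    by (rule nuhat_step)
  also have "Pb (\<lambda>i. Ct x i - Ct y i) = 1"
    by (rule Pb_int) (simp add: Ints_diff lattice_int Ct_lattice xy)
  also have "nuhat (Bt (\<lambda>i. Ct x i - Ct y i)) = nuhat (\<lambda>i. x i - y i)"
    by (rule nuhat_cong) (simp add: Bt_diff Bt_Ct lattice_Rq xy)
  finally show ?case using Suc by (simp add: x_def y_def)
qed simp

text \<open>The averages \<open>S N\<close> of the characters at \<open>kn n = (Ct ^^ n) k\<close>
  have \<nu>-mean \<open>c = nuhat k\<close>, and the correlations tend to \<open>cnj c * c\<close>,
  so \<open>S N\<close> tends to \<open>c\<close> in L2 of \<nu>. For Lebesgue measure the
  characters are orthogonal on boxes and \<open>S N\<close> tends to 0. Along a subsequence both
  limits hold almost everywhere, and \<open>c\<close> is not 0.\<close>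

theorem singular_of_nonvanishing_coefficient:
  assumes k: "k \<in> lattice" and k0: "\<exists>i<q. k i \<noteq> 0" and nz: "nuhat k \<noteq> 0"
    and decay: "\<And>i. i < q \<Longrightarrow> (\<lambda>n. (Bt ^^ n) k i) \<longlonglongrightarrow> 0"
  shows "singular_wrt (lborel_Rq q) \<nu>"
proof -
  define kn where "kn n = (Ct ^^ n) k" for n
  define c where "c = nuhat k"
  have kn: "kn n \<in> lattice" for n by (simp add: kn_def Ct_pow_lattice k)
  have Bkn: "(Bt ^^ n) (kn (n + r)) = kn r" for n r
  proof (induction n)
    case (Suc n)
    have "(Bt ^^ Suc n) (kn (Suc n + r)) = (Bt ^^ n) (Bt (Ct (kn (n + r))))"
      by (simp add: funpow_swap1 kn_def)
    then show ?case using Suc by (simp add: Bt_Ct lattice_Rq kn)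
  qed (simp add: kn_def)
  \<comment> \<open>A repetition would make \<open>k\<close> periodic under \<open>Bt\<close>, whose
    iterates at \<open>k\<close> tend to 0.\<close>
  have dist: "\<exists>i<q. kn n i - kn n' i \<noteq> 0" if "n < n'" for n n'
  proof (rule ccontr)
    assume "\<not> ?thesis"
    then have "kn n = kn n'"
      using lattice_Rq[OF kn[of n]] lattice_Rq[OF kn[of n']] by (intro PiE_ext[of _ "{..<q}"]) auto
    then have "kn (n' - n) = k"
      using Bkn[of n "n' - n"] Bkn[of n 0] that by (simp add: kn_def)
    define r where "r = n' - n"
    have r: "kn r = k" "r > 0" using \<open>kn (n' - n) = k\<close> that by (simp_all add: r_def)
    have per: "(Bt ^^ r) k = k" using Bkn[of r 0] r by (simp add: kn_def)
    have pow: "(Bt ^^ (r * j)) k = k" for j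
      by (induction j) (simp_all add: funpow_add per)
    have lim: "(\<lambda>j. (Bt ^^ (r * j)) k i) \<longlonglongrightarrow> 0" if "i < q" for i
      by (rule LIMSEQ_subseq_LIMSEQ[OF decay[OF that], of "\<lambda>j. r * j", unfolded o_def]) (use r in \<open>auto simp: strict_mono_def\<close>)
    have "k i = 0" if "i < q" for i
      using lim[OF that] unfolding pow by (simp only: LIMSEQ_const_iff)
    then show False using k0 by blast
  qed
  \<comment> \<open>Multiplying the correlation \<open>a r\<close> by \<open>u r\<close> completes
    the partial product to \<open>nuhat (- k) = cnj c\<close>, at the price of \<open>w r\<close>;
    here \<open>u r\<close> tends to 1 and \<open>w r\<close> to \<open>c\<close>. Working with
    \<open>a r * u r\<close> avoids dividing by mask values.\<close>
  have a_lim: "(\<lambda>r. nuhat (\<lambda>i. kn r i - k i)) \<longlonglongrightarrow> cnj c * c"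
  proof -
    define a u w where "a r = nuhat (\<lambda>i. kn r i - k i)" and "u r = nuhat (\<lambda>i. - (Bt ^^ r) k i)"
      and "w r = nuhat (\<lambda>i. k i - (Bt ^^ r) k i)" for r
    have ul: "u \<longlonglongrightarrow> 1"
      unfolding u_def nuhat_0[symmetric] by (rule nuhat_tendsto) (use tendsto_minus[OF decay] in auto)
    have wl: "w \<longlonglongrightarrow> c"
      unfolding w_def c_def by (rule nuhat_tendsto) (use tendsto_diff[OF tendsto_const decay] in auto)
    have "a r * u r = cnj c * w r" for r
      using correlation_product[OF k, of r r] nuhat_minus_product[of k r]
      by (simp add: a_def u_def w_def kn_def c_def nuhat_minus)
    then have au: "(\<lambda>r. a r * u r) \<longlonglongrightarrow> cnj c * c" using tendsto_mult[OF tendsto_const wl] by simp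
    have "(\<lambda>r. a r * u r / u r) \<longlonglongrightarrow> cnj c * c / 1" by (intro tendsto_divide au ul) auto
    moreover have "\<forall>\<^sub>F r in sequentially. u r \<noteq> 0" using tendsto_imp_eventually_ne[OF ul] by simp
    then have "\<forall>\<^sub>F r in sequentially. a r * u r / u r = a r" by eventually_elim simp
    ultimately show ?thesis using tendsto_cong unfolding a_def by fastforce
  qed
  define A where "A r = cmod (nuhat (\<lambda>i. kn r i - k i) - cnj c * c)" for r
  have A_lim: "A \<longlonglongrightarrow> 0"
    unfolding A_def using tendsto_norm[OF tendsto_diff[OF a_lim tendsto_const[of "cnj c * c"]]] by simp
  define \<rho> where "\<rho> n n' = (LINT y|\<nu>. chr q (kn n) y * cnj (chr q (kn n') y))" for n n'
  have \<rho>_eq: "\<rho> n n' = nuhat (\<lambda>i. kn n i - kn n' i)" for n n'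
    by (simp add: \<rho>_def nuhat_def chr_minus[symmetric] chr_add[symmetric])
  have \<rho>_A: "cmod (\<rho> n n' - cnj c * c) = A (if n' \<le> n then n - n' else n' - n)" for n n'
  proof (cases "n' \<le> n")
    case True
    then show ?thesis using correlation_shift[OF k, of n' "n - n'"] by (simp add: \<rho>_eq A_def kn_def)
  next
    case False
    have "\<rho> n n' = cnj (nuhat (\<lambda>i. kn n' i - kn n i))"
      by (simp add: \<rho>_eq nuhat_minus[symmetric])
    also have "nuhat (\<lambda>i. kn n' i - kn n i) = nuhat (\<lambda>i. kn (n' - n) i - k i)"
      using False correlation_shift[OF k, of n "n' - n"] by (simp add: kn_def)
    finally have "\<rho> n n' - cnj c * c = cnj (nuhat (\<lambda>i. kn (n' - n) i - k i) - cnj c * c)" by simp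
    then show ?thesis using False by (simp only: complex_mod_cnj A_def if_False)
  qed
  define S where "S N y = (\<Sum>n<N. chr q (kn n) y) / of_nat N" for N y
  have S_meas [measurable]: "S N \<in> borel_measurable \<nu>" for N
    unfolding S_def[abs_def] by measurable
  have S_bd: "cmod (S N y) \<le> 1" for N y
  proof -
    have "cmod (\<Sum>n<N. chr q (kn n) y) \<le> (\<Sum>n<N. 1)" by (rule order_trans[OF norm_sum]) simp
    then show ?thesis by (cases "N = 0") (auto simp: S_def norm_divide field_simps)
  qed
  have S_int: "integrable \<nu> (S N)" for N
    by (rule integrable_const_bound[where B = 1]) (auto simp: S_bd)
  have mean: "(LINT y|\<nu>. S N y) = c" if "N > 0" for N
  proof -
    have "(LINT y|\<nu>. S N y) = (\<Sum>n<N. nuhat (kn n)) / of_nat N"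
      unfolding S_def by (simp add: nuhat_def)
    then show ?thesis using that by (simp add: kn_def nuhat_Ct_pow k c_def)
  qed
  have prod_int: "integrable \<nu> (\<lambda>y. chr q (kn n) y * cnj (chr q (kn n') y))" for n n'
    by (simp add: chr_minus[symmetric] chr_add[symmetric])
  \<comment> \<open>By stationarity the variance is a double sum of terms depending on the time
    difference only, hence at most twice the Cesaro mean of \<open>A\<close>.\<close>
  have var: "(LINT y|\<nu>. (cmod (S N y - c))\<^sup>2) \<le> 2 * ((\<Sum>r<N. A r) / N)" if N: "N > 0" for N
  proof -
    have SS: "S N y * cnj (S N y) = (\<Sum>n<N. \<Sum>n'<N. chr q (kn n) y * cnj (chr q (kn n') y)) / (of_nat N)\<^sup>2" for y
      by (simp add: S_def sum_product power2_eq_square)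
    have i1: "integrable \<nu> (\<lambda>y. S N y * cnj (S N y))"
      unfolding SS by (simp add: prod_int)
    have "complex_of_real (LINT y|\<nu>. (cmod (S N y - c))\<^sup>2) = (LINT y|\<nu>. (S N y - c) * cnj (S N y - c))"
      by (simp only: integral_complex_of_real[symmetric] complex_norm_square)
    also have "\<dots> = (LINT y|\<nu>. S N y * cnj (S N y) - (c * cnj (S N y) + cnj c * S N y - cnj c * c))"
      by (simp add: algebra_simps)
    also have "\<dots> = (LINT y|\<nu>. S N y * cnj (S N y)) - ((LINT y|\<nu>. c * cnj (S N y)) + (LINT y|\<nu>. cnj c * S N y) - cnj c * c)"
      using i1 S_int[of N] by (simp add: prob_space)
    also have "\<dots> = (LINT y|\<nu>. S N y * cnj (S N y)) - cnj c * c"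
      using mean[OF N] by (simp add: mult.commute)
    also have "(LINT y|\<nu>. S N y * cnj (S N y)) = (\<Sum>n<N. \<Sum>n'<N. \<rho> n n') / (of_nat N)\<^sup>2"
      unfolding SS by (simp add: prod_int \<rho>_def)
    also have "\<dots> - cnj c * c = (\<Sum>n<N. \<Sum>n'<N. \<rho> n n' - cnj c * c) / (of_nat N)\<^sup>2"
      using N by (simp add: sum_subtractf diff_divide_distrib power2_eq_square)
    finally have V: "complex_of_real (LINT y|\<nu>. (cmod (S N y - c))\<^sup>2)
       = (\<Sum>n<N. \<Sum>n'<N. \<rho> n n' - cnj c * c) / (of_nat N)\<^sup>2" .
    have "0 \<le> (LINT y|\<nu>. (cmod (S N y - c))\<^sup>2)" by (rule Bochner_Integration.integral_nonneg) simp
    then have "(LINT y|\<nu>. (cmod (S N y - c))\<^sup>2) = cmod (complex_of_real (LINT y|\<nu>. (cmod (S N y - c))\<^sup>2))"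
      by (simp only: norm_of_real abs_of_nonneg)
    also have "\<dots> = cmod ((\<Sum>n<N. \<Sum>n'<N. \<rho> n n' - cnj c * c) / (of_nat N)\<^sup>2)"
      by (simp only: V)
    also have "\<dots> \<le> (\<Sum>n<N. \<Sum>n'<N. cmod (\<rho> n n' - cnj c * c)) / (real N)\<^sup>2"
      by (simp add: norm_divide norm_power) (intro divide_right_mono sum_norm_le, auto)
    also have "\<dots> \<le> (\<Sum>n<N. 2 * (\<Sum>r<N. A r)) / (real N)\<^sup>2"
      unfolding \<rho>_A by (intro divide_right_mono sum_mono sum_distance_le) (auto simp: A_def)
    also have "\<dots> = 2 * ((\<Sum>r<N. A r) / N)" using N by (simp add: power2_eq_square)
    finally show ?thesis .
  qed
  \<comment> \<open>Powers of 2 are used so that the Lebesgue estimates, of order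
    \<open>1 / N\<close>, become summable; the subsequence \<open>r\<close> extracted here for \<nu>
    only improves them.\<close>
  have L1: "(\<lambda>j. (LINT y|\<nu>. norm ((cmod (S (2 ^ j) y - c))\<^sup>2))) \<longlonglongrightarrow> 0"
  proof (rule real_tendsto_sandwich[of "\<lambda>_. 0" _ _ "\<lambda>j. 2 * ((\<Sum>r<2 ^ j. A r) / real (2 ^ j))"])
    have "(\<lambda>N. 2 * ((\<Sum>r<N. A r) / real N)) \<longlonglongrightarrow> 2 * 0"
      by (intro tendsto_mult tendsto_const cesaro_0 A_lim) (auto simp: A_def)
    from LIMSEQ_subseq_LIMSEQ[OF this, of "\<lambda>j. 2 ^ j"]
    show "(\<lambda>j. 2 * ((\<Sum>r<2 ^ j. A r) / real (2 ^ j))) \<longlonglongrightarrow> 0" by (simp add: o_def strict_mono_def)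
    have "(LINT y|\<nu>. norm ((cmod (S (2 ^ j) y - c))\<^sup>2)) \<le> 2 * ((\<Sum>r<2 ^ j. A r) / real (2 ^ j))" for j
      using var[of "2 ^ j"] by simp
    then show "\<forall>\<^sub>F j in sequentially. (LINT y|\<nu>. norm ((cmod (S (2 ^ j) y - c))\<^sup>2)) \<le> 2 * ((\<Sum>r<2 ^ j. A r) / real (2 ^ j))"
      by (intro always_eventually allI)
  qed (auto intro: always_eventually)
  have "\<exists>r::nat \<Rightarrow> nat. strict_mono r \<and> (AE y in \<nu>. (\<lambda>j. (cmod (S (2 ^ r j) y - c))\<^sup>2) \<longlonglongrightarrow> 0)"
  proof (rule tendsto_L1_AE_subseq[OF _ L1])
    show "integrable \<nu> (\<lambda>y. (cmod (S (2 ^ n) y - c))\<^sup>2)" for n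
    proof (rule integrable_const_bound[where B = "(1 + cmod c)\<^sup>2"])
      have "cmod (S (2 ^ n) y - c) \<le> 1 + cmod c" for y
        using norm_triangle_ineq4[of "S (2 ^ n) y" c] S_bd[of "2 ^ n" y] by linarith
      then show "AE y in \<nu>. norm ((cmod (S (2 ^ n) y - c))\<^sup>2) \<le> (1 + cmod c)\<^sup>2"
        by (intro AE_I2) (simp add: power_mono)
    qed measurable
  qed
  then obtain r where r: "strict_mono r" and AE_nu: "AE y in \<nu>. (\<lambda>j. (cmod (S (2 ^ r j) y - c))\<^sup>2) \<longlonglongrightarrow> 0"
    by blast
  define I where "I R y = (\<Prod>i<q. indicat_real {- real R..real R} (y i))" for R :: nat and y :: "nat \<Rightarrow> real"
  have setsL: "sets (lborel_Rq q) = sets (borel_Rq q)" by (rule sets_PiM_cong) auto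
  have chrL [measurable]: "chr q x \<in> borel_measurable (lborel_Rq q)" for x
    using chr_measurable measurable_cong_sets[OF setsL refl] by blast
  have I_meas [measurable]: "I R \<in> borel_measurable (lborel_Rq q)" for R
    unfolding I_def by measurable
  have I01: "I R y = 0 \<or> I R y = 1" for R y
  proof (cases "\<exists>i<q. y i \<notin> {- real R..real R}")
    case True
    then obtain i where "i < q" "y i \<notin> {- real R..real R}" by blast
    then show ?thesis unfolding I_def by (intro disjI1 prod_zero bexI[of _ i]) (auto simp: indicator_def)
  next
    case False
    then show ?thesis unfolding I_def by (intro disjI2 prod.neutral) auto
  qed
  have box: "(\<integral>\<^sup>+ y. ennreal (I R y * (cmod (S N y))\<^sup>2) \<partial>lborel_Rq q) = ennreal ((2 * R) ^ q / N)" if N: "N > 0" for R N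
  proof -
    define d where "d n n' = (\<lambda>i. kn n i - kn n' i)" for n n'
    have dint: "d n n' i \<in> \<int>" if "i < q" for n n' i
      unfolding d_def by (intro Ints_diff lattice_int kn that)
    have ii: "integrable (lborel_Rq q) (\<lambda>y. I R y *\<^sub>R chr q (d n n') y)" for n n'
      unfolding I_def by (rule box_character_integral(1)) (rule dint)
    have e1: "complex_of_real (I R y * (cmod (S N y))\<^sup>2) = I R y *\<^sub>R (S N y * cnj (S N y))" for y
      by (simp only: scaleR_conv_of_real of_real_mult complex_norm_square)
    have e2: "S N y * cnj (S N y) = (\<Sum>n<N. \<Sum>n'<N. chr q (d n n') y) / (of_nat N)\<^sup>2" for y
      by (simp add: S_def sum_product power2_eq_square chr_minus[symmetric] chr_add[symmetric] d_def)
    have eq: "complex_of_real (I R y * (cmod (S N y))\<^sup>2)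
       = (\<Sum>n<N. \<Sum>n'<N. I R y *\<^sub>R chr q (d n n') y) / (of_nat N)\<^sup>2" for y
      unfolding e1 e2 by (simp add: scaleR_conv_of_real sum_distrib_left)
    have int_c: "integrable (lborel_Rq q) (\<lambda>y. complex_of_real (I R y * (cmod (S N y))\<^sup>2))"
      unfolding eq by (intro Bochner_Integration.integrable_divide Bochner_Integration.integrable_sum ii)
    then have int_r: "integrable (lborel_Rq q) (\<lambda>y. I R y * (cmod (S N y))\<^sup>2)"
      using integrable_Re by fastforce
    have val: "(LINT y|lborel_Rq q. I R y *\<^sub>R chr q (d n n') y) = (if n' = n then of_real ((2 * R) ^ q) else 0)" for n n'
    proof (cases "n' = n")
      case True
      then show ?thesis unfolding I_def by (simp add: box_character_integral(3) dint d_def)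
    next
      case False
      have "\<exists>i<q. d n n' i \<noteq> 0"
        using dist[of n n'] dist[of n' n] False by (cases "n < n'") (auto simp: d_def)
      then show ?thesis unfolding I_def using False by (simp add: box_character_integral(2) dint)
    qed
    have "complex_of_real (LINT y|lborel_Rq q. I R y * (cmod (S N y))\<^sup>2)
        = (LINT y|lborel_Rq q. (\<Sum>n<N. \<Sum>n'<N. I R y *\<^sub>R chr q (d n n') y) / (of_nat N)\<^sup>2)"
      unfolding integral_complex_of_real[symmetric] eq ..
    also have "\<dots> = (\<Sum>n<N. \<Sum>n'<N. (if n' = n then of_real ((2 * R) ^ q) else 0)) / (of_nat N)\<^sup>2"
      by (simp add: ii val)
    also have "\<dots> = of_real ((2 * R) ^ q / N)" using N by (simp add: power2_eq_square)
    finally have "(LINT y|lborel_Rq q. I R y * (cmod (S N y))\<^sup>2) = (2 * R) ^ q / N"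
      by (simp only: of_real_eq_iff)
    moreover have "0 \<le> I R y * (cmod (S N y))\<^sup>2" for y using I01[of R y] by auto
    ultimately show ?thesis using int_r by (simp add: nn_integral_eq_integral)
  qed
  \<comment> \<open>Borel-Cantelli in integral form: the squared norms on the box sum to a finite
    value, so the series of squares converges almost everywhere.\<close>
  have AE_box: "AE y in lborel_Rq q. (\<lambda>j. I R y * (cmod (S (2 ^ r j) y))\<^sup>2) \<longlonglongrightarrow> 0" for R
  proof -
    define h where "h j y = ennreal (I R y * (cmod (S (2 ^ r j) y))\<^sup>2)" for j y
    have SmL [measurable]: "S N \<in> borel_measurable (lborel_Rq q)" for N
      unfolding S_def[abs_def] by measurable
    have hm [measurable]: "h j \<in> borel_measurable (lborel_Rq q)" for j unfolding h_def by measurable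
    have "(\<integral>\<^sup>+ y. (\<Sum>j. h j y) \<partial>lborel_Rq q) = (\<Sum>j. \<integral>\<^sup>+ y. h j y \<partial>lborel_Rq q)"
      by (rule nn_integral_suminf) measurable
    also have "\<dots> \<le> (\<Sum>j. ennreal ((2 * R) ^ q * (1 / 2) ^ j))"
    proof (rule suminf_le)
      fix j
      have "(2::real) ^ j \<le> 2 ^ r j" using strict_mono_imp_increasing[OF r] by (intro power_increasing) auto
      then have "real ((2 * R) ^ q) / 2 ^ r j \<le> real ((2 * R) ^ q) * (1 / 2) ^ j"
        by (simp add: power_one_over divide_simps mult_left_mono)
      then show "(\<integral>\<^sup>+ y. h j y \<partial>lborel_Rq q) \<le> ennreal ((2 * R) ^ q * (1 / 2) ^ j)"
        unfolding h_def by (subst box) (auto intro: ennreal_leI)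
    qed auto
    also have "\<dots> < \<infinity>"
    proof -
      have "summable (\<lambda>j. real ((2 * R) ^ q) * (1 / 2) ^ j)" by (intro summable_mult summable_geometric) auto
      then show ?thesis by (subst suminf_ennreal2) (auto simp: less_top)
    qed
    finally have "AE y in lborel_Rq q. (\<Sum>j. h j y) \<noteq> \<infinity>" by (intro nn_integral_PInf_AE) auto
    then show ?thesis
    proof eventually_elim
      fix y assume "(\<Sum>j. h j y) \<noteq> \<infinity>"
      then have "summable (\<lambda>j. I R y * (cmod (S (2 ^ r j) y))\<^sup>2)"
        unfolding h_def using I01[of R y] by (intro summable_suminf_not_top) auto
      then show "(\<lambda>j. I R y * (cmod (S (2 ^ r j) y))\<^sup>2) \<longlonglongrightarrow> 0" by (rule summable_LIMSEQ_zero)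
    qed
  qed
  have "AE y in lborel_Rq q. \<forall>R. (\<lambda>j. I R y * (cmod (S (2 ^ r j) y))\<^sup>2) \<longlonglongrightarrow> 0"
    using AE_box by (simp add: AE_all_countable)
  then have AE_L: "AE y in lborel_Rq q. (\<lambda>j. cmod (S (2 ^ r j) y)) \<longlonglongrightarrow> 0"
  proof eventually_elim
    fix y assume lim: "\<forall>R. (\<lambda>j. I R y * (cmod (S (2 ^ r j) y))\<^sup>2) \<longlonglongrightarrow> 0"
    obtain R :: nat where R: "(\<Sum>i<q. \<bar>y i\<bar>) \<le> R" using real_arch_simple by blast
    have "\<bar>y i\<bar> \<le> R" if "i < q" for i
      using member_le_sum[of i "{..<q}" "\<lambda>i. \<bar>y i\<bar>"] that R by auto
    then have "I R y = 1" unfolding I_def by (intro prod.neutral) (auto simp: abs_le_iff minus_le_iff)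
    then have "(\<lambda>j. (cmod (S (2 ^ r j) y))\<^sup>2) \<longlonglongrightarrow> 0" using lim[rule_format, of R] by simp
    from tendsto_real_sqrt[OF this] show "(\<lambda>j. cmod (S (2 ^ r j) y)) \<longlonglongrightarrow> 0" by simp
  qed
  obtain E where E: "{y \<in> space (lborel_Rq q). \<not> (\<lambda>j. cmod (S (2 ^ r j) y)) \<longlonglongrightarrow> 0} \<subseteq> E"
    "emeasure (lborel_Rq q) E = 0" "E \<in> sets (lborel_Rq q)"
    using AE_L by (rule AE_E)
  have "AE y in \<nu>. y \<in> E"
    using AE_nu
  proof (rule AE_mp, intro AE_I2 impI)
    fix y assume y: "y \<in> space \<nu>" and lim: "(\<lambda>j. (cmod (S (2 ^ r j) y - c))\<^sup>2) \<longlonglongrightarrow> 0"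
    have "\<not> (\<lambda>j. cmod (S (2 ^ r j) y)) \<longlonglongrightarrow> 0"
    proof
      assume *: "(\<lambda>j. cmod (S (2 ^ r j) y)) \<longlonglongrightarrow> 0"
      from tendsto_real_sqrt[OF lim] have "(\<lambda>j. cmod (S (2 ^ r j) y - c)) \<longlonglongrightarrow> 0" by simp
      then have "(\<lambda>j. S (2 ^ r j) y) \<longlonglongrightarrow> c" by (simp add: tendsto_norm_zero_iff LIM_zero_iff)
      moreover have "(\<lambda>j. S (2 ^ r j) y) \<longlonglongrightarrow> 0" using * by (simp add: tendsto_norm_zero_iff)
      ultimately show False using nz LIMSEQ_unique unfolding c_def by blast
    qed
    then show "y \<in> E" using E(1) y by (auto simp: space_nu space_PiM)
  qed
  moreover have "E \<in> sets \<nu>" using E(3) setsL sets_nu by simp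
  ultimately have "emeasure \<nu> (space \<nu> - E) = 0"
    by (subst (asm) AE_iff_measurable[where N = "space \<nu> - E"]) auto
  then show ?thesis
    unfolding singular_wrt_def using E(2,3) by (intro bexI[of _ E]) (simp_all add: space_nu space_PiM)
qed

end

subsection \<open>Vanishing Fourier coefficients\<close>

inductive trigp :: "(real \<Rightarrow> complex) \<Rightarrow> bool" where
  base: "trigp (\<lambda>t. a * ee (of_int k * t))"
| add: "trigp f \<Longrightarrow> trigp g \<Longrightarrow> trigp (\<lambda>t. f t + g t)"

lemma trigp_mult_base: "trigp g \<Longrightarrow> trigp (\<lambda>t. (a * ee (of_int k * t)) * g t)"
proof (induction rule: trigp.induct)
  case (base b j)
  have "(\<lambda>t. (a * ee (of_int k * t)) * (b * ee (of_int j * t))) = (\<lambda>t. (a * b) * ee (of_int (k + j) * t))"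
    by (simp add: fun_eq_iff distrib_right ee_add)
  then show ?case using trigp.base[of "a * b" "k + j"] by (simp only:)
next
  case (add f g)
  then show ?case using trigp.add[OF add.IH] by (simp add: distrib_left)
qed

lemma trigp_mult: "trigp f \<Longrightarrow> trigp g \<Longrightarrow> trigp (\<lambda>t. f t * g t)"
proof (induction rule: trigp.induct)
  case (base a k)
  then show ?case by (rule trigp_mult_base)
next
  case (add f h)
  then show ?case using trigp.add[OF add.IH] by (simp add: distrib_right)
qed

text \<open>Links Stone-Weierstrass on the circle with trigonometric polynomials: a real linear
  functional is \<open>z \<mapsto> a * z + b * cnj z\<close> for suitable complex \<open>a\<close>
  and \<open>b\<close>, and products are handled by \<open>trigp_mult\<close>.\<close>

lemma trigp_polynomial:
  fixes h :: "complex \<Rightarrow> real"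
  assumes "real_polynomial_function h"
  shows "trigp (\<lambda>t. complex_of_real (h (ee t)))"
  using assms
proof (induction rule: real_polynomial_function.induct)
  case (linear f)
  define a b where "a = (complex_of_real (f 1) - \<i> * complex_of_real (f \<i>)) / 2"
    and "b = (complex_of_real (f 1) + \<i> * complex_of_real (f \<i>)) / 2"
  interpret bounded_linear f by fact
  have "complex_of_real (f (ee t)) = a * ee (of_int 1 * t) + b * ee (of_int (- 1) * t)" for t
  proof -
    have z: "ee t = Re (ee t) *\<^sub>R 1 + Im (ee t) *\<^sub>R \<i>" by (simp add: complex_eq_iff)
    have "f (ee t) = Re (ee t) * f 1 + Im (ee t) * f \<i>"
      by (subst z) (simp only: add scaleR real_scaleR_def)
    then show ?thesis
      by (simp add: complex_eq_iff a_def b_def ee_minus field_simps)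
  qed
  then show ?case using trigp.add[OF trigp.base[of a 1] trigp.base[of b "- 1"]] by (simp only:)
next
  case (const c)
  show ?case using trigp.base[of "complex_of_real c" 0] by simp
next
  case (add f g)
  then show ?case using trigp.add[OF add.IH] by simp
next
  case (mult f g)
  then show ?case using trigp_mult[OF mult.IH] by simp
qed

lemma trigp_bounded: "trigp f \<Longrightarrow> \<exists>K. \<forall>t. cmod (f t) \<le> K"
proof (induction rule: trigp.induct)
  case (base a k)
  show ?case by (rule exI[of _ "cmod a"]) (simp add: norm_mult)
next
  case (add f g)
  then obtain K L where "\<forall>t. cmod (f t) \<le> K" "\<forall>t. cmod (g t) \<le> L" by blast
  then have "\<forall>t. cmod (f t + g t) \<le> K + L" by (meson add_mono norm_triangle_ineq order_trans)
  then show ?case by blast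
qed

lemma trigp_measurable: "trigp f \<Longrightarrow> f \<in> borel_measurable borel"
  by (induction rule: trigp.induct) measurable

lemma ee_eq_iff: "ee s = ee t \<longleftrightarrow> s - t \<in> \<int>"
proof
  assume "ee s = ee t"
  then have "cis (2 * pi * (s - t)) = 1"
    by (simp add: ee_def right_diff_distrib cis_divide[symmetric])
  then obtain n :: int where "2 * pi * (s - t) = of_int n * 2 * pi"
    by (auto simp: complex_eq_iff cos_one_2pi_int)
  then have "s - t = of_int n" by simp
  then show "s - t \<in> \<int>" by simp
next
  assume "s - t \<in> \<int>"
  then have "ee (s - t) = 1" by (rule ee_int)
  then show "ee s = ee t" using ee_add[of "s - t" t] by simp
qed

lemma ee_arc_iff:
  assumes "0 \<le> s" "s < 1" shows "ee t \<in> ee ` {0..s} \<longleftrightarrow> frac t \<le> s"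
proof
  assume "ee t \<in> ee ` {0..s}"
  then obtain u where u: "0 \<le> u" "u \<le> s" "ee t = ee u" by auto
  then have "t - u \<in> \<int>" by (simp add: ee_eq_iff)
  then have "frac t = u" using u assms by (subst frac_unique_iff) auto
  then show "frac t \<le> s" using u by simp
next
  assume "frac t \<le> s"
  moreover have "ee t = ee (frac t)" by (simp add: ee_eq_iff frac_def)
  ultimately show "ee t \<in> ee ` {0..s}" by auto
qed

lemma frac_measurable [measurable]: "(frac :: real \<Rightarrow> real) \<in> borel_measurable borel"
  unfolding frac_def[abs_def] by measurable

lemma unit_integral_ee:
  "(LINT t|lborel. indicator {0..<1::real} t *\<^sub>R ee (of_int k * t)) = (if k = 0 then 1 else 0)"
proof -
  have "(LINT t|lborel. indicator {0..<1::real} t *\<^sub>R ee (of_int k * t)) = (LINT t|lborel. indicator {0..1::real} t *\<^sub>R ee (of_int k * t))"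
  proof (rule integral_cong_AE)
    show "AE t in lborel. indicator {0..<1} t *\<^sub>R ee (of_int k * t) = indicator {0..1} t *\<^sub>R ee (of_int k * t)"
      using AE_lborel_singleton[of 1] by eventually_elim (auto simp: indicator_def)
  qed measurable
  also have "\<dots> = (if k = 0 then 1 else 0)"
  proof (cases "k = 0")
    case True
    have "(LINT t|lborel. indicator {0..1::real} t *\<^sub>R ee (of_int k * t)) = (LINT t|lborel. complex_of_real (indicat_real {0..1::real} t))"
      using True by (simp add: scaleR_conv_of_real)
    also have "\<dots> = complex_of_real (LINT t|lborel. indicat_real {0..1::real} t)" by (rule integral_complex_of_real)
    finally show ?thesis using True by simp
  next
    case False
    then show ?thesis using integral_ee_int[of 1 0 k] by simp
  qed
  finally show ?thesis .
qed

section \<open>From Fourier coefficients to the distribution modulo one\<close>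

text \<open>Weyl's criterion with a complex weight \<open>G\<close>. The identity passes from
  characters to trigonometric polynomials, to continuous functions on the circle, to closed arcs,
  and to Borel sets. The weight is what allows several coordinates to be treated one at a
  time.\<close>

lemma equidistribution:
  fixes Y :: "'a \<Rightarrow> real" and G :: "'a \<Rightarrow> complex"
  assumes fin: "finite_measure N" and Y [measurable]: "Y \<in> borel_measurable N"
    and G [measurable]: "G \<in> borel_measurable N" and K: "\<And>x. cmod (G x) \<le> K"
    and eq: "\<And>k::int. (LINT x|N. ee (of_int k * Y x) * G x) = (if k = 0 then c else 0)"
    and A: "A \<in> sets borel"
  shows "(LINT x|N. of_real (indicator A (frac (Y x))) * G x) = c * of_real (measure lborel (A \<inter> {0..<1}))"
proof -
  interpret finite_measure N by fact
  have K0: "0 \<le> K" using K[of undefined] norm_ge_zero order_trans by blast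
  define L where "L g = (LINT x|N. g (Y x) * G x)" for g :: "real \<Rightarrow> complex"
  define J where "J g = (LINT t|lborel. indicator {0..<1} t *\<^sub>R g t)" for g :: "real \<Rightarrow> complex"
  have intL: "integrable N (\<lambda>x. g (Y x) * G x)"
    if [measurable]: "g \<in> borel_measurable borel" and "\<And>t. cmod (g t) \<le> b" for g b
  proof (rule integrable_const_bound[where B = "b * K"])
    have "0 \<le> b" using that(2)[of 0] norm_ge_zero order_trans by blast
    then show "AE x in N. norm (g (Y x) * G x) \<le> b * K"
      by (intro AE_I2) (simp add: norm_mult mult_mono that K)
  qed measurable
  have intJ: "integrable lborel (\<lambda>t. indicator {0..<1} t *\<^sub>R g t)"
    if [measurable]: "g \<in> borel_measurable borel" and b: "\<And>t. cmod (g t) \<le> b" for g :: "real \<Rightarrow> complex" and b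
  proof (rule Bochner_Integration.integrable_bound[where f = "\<lambda>t. b * indicat_real {0..<1} t"])
    show "AE t in lborel. norm (indicator {0..<1} t *\<^sub>R g t) \<le> norm (b * indicat_real {0..<1} t)"
      using b abs_ge_self order_trans by (intro AE_I2) (fastforce simp: indicator_def)
  qed auto
  have Lb: "cmod (L g) \<le> b * K * measure N (space N)"
    if "g \<in> borel_measurable borel" "\<And>t. cmod (g t) \<le> b" for g b
  proof -
    have b0: "0 \<le> b" using that(2)[of 0] norm_ge_zero order_trans by blast
    have "cmod (L g) \<le> (LINT x|N. norm (g (Y x) * G x))" unfolding L_def by (rule integral_norm_bound)
    also have "\<dots> \<le> (LINT x|N. b * K)"
      by (intro integral_mono integrable_norm intL[OF that]) (auto simp: norm_mult intro!: mult_mono that K b0)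
    finally show ?thesis by (simp add: mult_ac)
  qed
  have Jb: "cmod (J g) \<le> b" if "g \<in> borel_measurable borel" "\<And>t. cmod (g t) \<le> b" for g b
  proof -
    have ib: "integrable lborel (\<lambda>t. b * indicat_real {0..<1::real} t)"
      by (intro integrable_mult_right integrable_real_indicator) auto
    have "cmod (J g) \<le> (LINT t|lborel. norm (indicator {0..<1} t *\<^sub>R g t))" unfolding J_def by (rule integral_norm_bound)
    also have "\<dots> \<le> (LINT t|lborel. b * indicat_real {0..<1::real} t)"
      by (rule integral_mono[OF integrable_norm[OF intJ[OF that]] ib]) (auto simp: indicator_def that)
    finally show ?thesis by (simp add: measure_def)
  qed
  have trig: "L g = c * J g" if "trigp g" for g
    using that
  proof (induction rule: trigp.induct)
    case (base a k)
    have "L (\<lambda>t. a * ee (of_int k * t)) = a * (LINT x|N. ee (of_int k * Y x) * G x)"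
      unfolding L_def by (simp add: mult.assoc)
    moreover have "J (\<lambda>t. a * ee (of_int k * t)) = a * (LINT t|lborel. indicator {0..<1::real} t *\<^sub>R ee (of_int k * t))"
      unfolding J_def by (subst integral_mult_right_zero[symmetric]) (simp add: scaleR_conv_of_real mult_ac)
    ultimately show ?case by (simp add: eq unit_integral_ee)
  next
    case (add f g)
    obtain bf bg where b: "\<And>t. cmod (f t) \<le> bf" "\<And>t. cmod (g t) \<le> bg"
      using trigp_bounded[OF add.hyps(1)] trigp_bounded[OF add.hyps(2)] by blast
    note m = trigp_measurable[OF add.hyps(1)] trigp_measurable[OF add.hyps(2)]
    have "L (\<lambda>t. f t + g t) = L f + L g"
      unfolding L_def using intL[OF m(1) b(1)] intL[OF m(2) b(2)] by (simp add: distrib_right)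
    moreover have "J (\<lambda>t. f t + g t) = J f + J g"
      unfolding J_def using intJ[OF m(1) b(1)] intJ[OF m(2) b(2)] by (simp add: scaleR_add_right)
    ultimately show ?case using add.IH by (simp add: distrib_left)
  qed
  have cont: "L (\<lambda>t. complex_of_real (h (ee t))) = c * J (\<lambda>t. complex_of_real (h (ee t)))"
    if h: "continuous_on UNIV h" for h :: "complex \<Rightarrow> real"
  proof -
    define H where "H t = complex_of_real (h (ee t))" for t
    have Hc: "continuous_on UNIV H"
      unfolding H_def by (intro continuous_intros continuous_on_compose2[OF h] continuous_ee) auto
    have Hm [measurable]: "H \<in> borel_measurable borel" by (rule borel_measurable_continuous_onI[OF Hc])
    define M where "M = K * measure N (space N) + cmod c"
    have M0: "0 \<le> M" using K0 by (simp add: M_def)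
    have small: "cmod (L H - c * J H) \<le> e * M" if e: "e > 0" for e
    proof -
      obtain g where g: "real_polynomial_function g" "\<And>z. z \<in> sphere 0 1 \<Longrightarrow> \<bar>h z - g z\<bar> < e"
        using Stone_Weierstrass_real_polynomial_function[OF compact_sphere continuous_on_subset[OF h] e] by blast
      define T where "T t = complex_of_real (g (ee t))" for t
      have T: "trigp T" unfolding T_def by (rule trigp_polynomial[OF g(1)])
      obtain b where b: "\<And>t. cmod (T t) \<le> b" using trigp_bounded[OF T] by blast
      note Tm [measurable] = trigp_measurable[OF T]
      have d: "cmod (H t - T t) \<le> e" for t
        using g(2)[of "ee t"] by (simp add: H_def T_def flip: of_real_diff)
      have Hb: "cmod (H t) \<le> b + e" for t
        using norm_triangle_ineq[of "T t" "H t - T t"] b[of t] d[of t] by simp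
      have "L (\<lambda>t. H t - T t) = L H - L T"
        unfolding L_def using intL[OF Hm Hb] intL[OF Tm b] by (simp add: left_diff_distrib)
      moreover have "J (\<lambda>t. H t - T t) = J H - J T"
        unfolding J_def using intJ[OF Hm Hb] intJ[OF Tm b] by (simp add: scaleR_diff_right)
      ultimately have "L H - c * J H = L (\<lambda>t. H t - T t) - c * J (\<lambda>t. H t - T t)"
        by (simp add: trig[OF T] right_diff_distrib)
      also have "cmod \<dots> \<le> cmod (L (\<lambda>t. H t - T t)) + cmod c * cmod (J (\<lambda>t. H t - T t))"
        by (metis norm_mult norm_triangle_ineq4)
      also have "\<dots> \<le> e * K * measure N (space N) + cmod c * e"
        by (intro add_mono mult_left_mono Lb Jb d) auto
      finally show ?thesis by (simp add: M_def algebra_simps)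
    qed
    have "cmod (L H - c * J H) \<le> 0"
    proof (rule field_le_epsilon)
      fix d :: real assume d: "d > 0"
      have "cmod (L H - c * J H) \<le> d / (M + 1) * M" using d M0 by (intro small) auto
      also have "\<dots> \<le> d" using d M0 by (simp add: field_simps)
      finally show "cmod (L H - c * J H) \<le> 0 + d" by simp
    qed
    then have "L H = c * J H" by simp
    then show ?thesis by (simp only: H_def[abs_def])
  qed
  \<comment> \<open>The condition \<open>frac t <= s\<close> describes a closed arc
    \<open>C\<close>, because it contains both endpoints; the continuous functions
    \<open>max 0 (1 - n * infdist z C)\<close> converge to its indicator boundedly.\<close>
  have arc: "L (\<lambda>t. of_real (indicator {..s} (frac t))) = c * J (\<lambda>t. of_real (indicator {..s} (frac t)))"
    if s: "0 \<le> s" "s < 1" for s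
  proof -
    define C where "C = ee ` {0..s}"
    have C: "closed C" "C \<noteq> {}"
      using s by (auto simp: C_def intro!: compact_imp_closed compact_continuous_image continuous_ee)
    define h where "h n z = max 0 (1 - real n * infdist z C)" for n z
    define Hn where "Hn n t = complex_of_real (h n (ee t))" for n t
    define H where "H t = complex_of_real (indicator {..s} (frac t))" for t
    have hc: "continuous_on UNIV (h n)" for n unfolding h_def by (intro continuous_intros)
    have Hnm [measurable]: "Hn n \<in> borel_measurable borel" for n
      unfolding Hn_def
      by (intro borel_measurable_continuous_onI continuous_intros continuous_on_compose2[OF hc] continuous_ee) auto
    have Hm [measurable]: "H \<in> borel_measurable borel" unfolding H_def by measurable
    have b: "cmod (Hn n t) \<le> 1" for n t by (simp add: Hn_def h_def infdist_nonneg)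
    have lim: "(\<lambda>n. Hn n t) \<longlonglongrightarrow> H t" for t
    proof (cases "ee t \<in> C")
      case True
      then have "Hn n t = H t" for n
        using ee_arc_iff[OF s, of t] by (simp add: Hn_def h_def H_def C_def)
      then show ?thesis by simp
    next
      case False
      then have Ht: "H t = 0" using ee_arc_iff[OF s, of t] by (simp add: H_def C_def)
      have pos: "infdist (ee t) C > 0"
        using False C in_closed_iff_infdist_zero[of C "ee t"] infdist_nonneg[of "ee t" C] by linarith
      obtain n0 :: nat where n0: "1 / infdist (ee t) C < n0" using reals_Archimedean2 by blast
      have "Hn n t = 0" if "n \<ge> n0" for n
      proof -
        have "1 / infdist (ee t) C < n" using n0 that by linarith
        then have "1 < n * infdist (ee t) C" using pos by (simp add: field_simps)
        then show ?thesis by (simp add: Hn_def h_def)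
      qed
      then show ?thesis unfolding Ht by (intro tendsto_eventually) (auto simp: eventually_sequentially)
    qed
    have "(\<lambda>n. L (Hn n)) \<longlonglongrightarrow> L H"
      unfolding L_def
    proof (rule integral_dominated_convergence[where w = "\<lambda>_. K"])
      show "AE x in N. (\<lambda>n. Hn n (Y x) * G x) \<longlonglongrightarrow> H (Y x) * G x"
        by (intro AE_I2 tendsto_mult lim tendsto_const)
      have "norm (Hn n (Y x) * G x) \<le> 1 * K" for n x
        unfolding norm_mult by (intro mult_mono b K) auto
      then show "AE x in N. norm (Hn n (Y x) * G x) \<le> K" for n by (intro AE_I2) simp
    qed auto
    moreover have "(\<lambda>n. J (Hn n)) \<longlonglongrightarrow> J H"
      unfolding J_def
    proof (rule integral_dominated_convergence[where w = "\<lambda>t. indicat_real {0..<1} t"])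
      show "AE t in lborel. (\<lambda>n. indicator {0..<1} t *\<^sub>R Hn n t) \<longlonglongrightarrow> indicator {0..<1} t *\<^sub>R H t"
        by (intro AE_I2 tendsto_scaleR lim tendsto_const)
      show "AE t in lborel. norm (indicator {0..<1} t *\<^sub>R Hn n t) \<le> indicat_real {0..<1} t" for n
        by (intro AE_I2) (simp add: indicator_def b)
    qed auto
    then have "(\<lambda>n. c * J (Hn n)) \<longlonglongrightarrow> c * J H" by (intro tendsto_mult tendsto_const)
    moreover have "L (Hn n) = c * J (Hn n)" for n unfolding Hn_def by (rule cont[OF hc])
    ultimately have "L H = c * J H" using LIMSEQ_unique by simp
    then show ?thesis by (simp only: H_def[abs_def])
  qed
  \<comment> \<open>Both sides as countably additive complex set functions. They agree on
    half-lines, an intersection-stable generator, so Dynkin's argument extends the identity.\<close>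
  define F1 where "F1 A = (LINT x:{x \<in> space N. frac (Y x) \<in> A}|N. G x)" for A :: "real set"
  define F2 where "F2 A = (LINT t:A \<inter> {0..<1}|lborel. c)" for A :: "real set"
  have F1: "F1 A = L (\<lambda>t. of_real (indicator A (frac t)))" for A
    unfolding F1_def L_def set_lebesgue_integral_def
    by (rule Bochner_Integration.integral_cong) (auto simp: indicator_def scaleR_conv_of_real)
  have F2: "F2 A = c * J (\<lambda>t. of_real (indicator A (frac t)))" for A
  proof -
    have "c * J (\<lambda>t. of_real (indicator A (frac t)))
        = (LINT t|lborel. c * (indicator {0..<1} t *\<^sub>R of_real (indicator A (frac t))))"
      unfolding J_def by (rule integral_mult_right_zero[symmetric])
    also have "\<dots> = F2 A" unfolding F2_def set_lebesgue_integral_def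
      by (rule Bochner_Integration.integral_cong) (auto simp: indicator_def scaleR_conv_of_real frac_eq)
    finally show ?thesis by simp
  qed
  have S1 [measurable]: "{x \<in> space N. frac (Y x) \<in> A} \<in> sets N" if [measurable]: "A \<in> sets borel" for A
    by measurable
  have i1: "set_integrable N {x \<in> space N. frac (Y x) \<in> A} G" if "A \<in> sets borel" for A
    unfolding set_integrable_def
    by (rule integrable_const_bound[where B = K])
       (use S1[OF that] order_trans[OF norm_ge_zero K] K in \<open>auto simp: indicator_def intro!: AE_I2\<close>)
  have fin2: "emeasure lborel (A \<inter> {0..<1::real}) < \<infinity>" for A
  proof -
    have "emeasure lborel (A \<inter> {0..<1::real}) \<le> emeasure lborel {0..<1::real}" by (rule emeasure_mono) auto
    also have "\<dots> < \<infinity>" by simp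
    finally show ?thesis .
  qed
  have i2: "set_integrable lborel (A \<inter> {0..<1::real}) (\<lambda>_. c)" if A: "A \<in> sets borel" for A
    unfolding set_integrable_def using A fin2 by (intro integrable_scaleR_left) (auto intro: integrable_real_indicator)
  have main: "F1 A = F2 A" if A: "A \<in> sets borel" for A
  proof -
    have "Int_stable (range (\<lambda>a::real. {..a}))" by (auto simp: Int_stable_def)
    moreover have "range (\<lambda>a::real. {..a}) \<subseteq> Pow UNIV" by auto
    moreover have "A \<in> sigma_sets UNIV (range (\<lambda>a::real. {..a}))" using A by (simp add: borel_eq_atMost)
    ultimately show ?thesis
    proof (induction rule: sigma_sets_induct_disjoint)
      case (basic S)
      then obtain s where s: "S = {..s}" by auto
      consider "s < 0" | "0 \<le> s" "s < 1" | "1 \<le> s" by linarith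
      then show ?case
      proof cases
        case 1
        have "frac t \<notin> S" for t using 1 frac_ge_0[of t] unfolding s atMost_iff by linarith
        then have "{x \<in> space N. frac (Y x) \<in> S} = {}" by simp
        moreover have "S \<inter> {0..<1} = {}" using 1 by (auto simp: s)
        ultimately show ?thesis by (simp only: F1_def F2_def) (simp add: set_lebesgue_integral_def)
      next
        case 2
        then show ?thesis unfolding F1 F2 s by (rule arc)
      next
        case 3
        have "complex_of_real (indicator S (frac t)) = 1 * ee (of_int 0 * t)" for t
          using frac_lt_1[of t] 3 by (simp add: s)
        then show ?thesis unfolding F1 F2 using trig[OF trigp.base[of 1 0]] by (simp only:)
      qed
    next
      case empty
      then show ?case by (simp add: F1_def F2_def set_lebesgue_integral_def)
    next
      case (compl S)
      then have S [measurable]: "S \<in> sets borel" by (simp add: borel_eq_atMost)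
      have one: "complex_of_real (indicator UNIV (frac t)) = 1 * ee (of_int 0 * t)" for t by simp
      have "F1 UNIV = F2 UNIV" unfolding F1 F2 one by (rule trig[OF trigp.base])
      moreover have "F1 UNIV = F1 S + F1 (UNIV - S)"
      proof -
        have "{x \<in> space N. frac (Y x) \<in> UNIV} = {x \<in> space N. frac (Y x) \<in> S} \<union> {x \<in> space N. frac (Y x) \<in> UNIV - S}" by auto
        then show ?thesis unfolding F1_def by (simp only:) (intro set_integral_Un i1, auto)
      qed
      moreover have "F2 UNIV = F2 S + F2 (UNIV - S)"
      proof -
        have "(UNIV::real set) \<inter> {0..<1} = (S \<inter> {0..<1}) \<union> ((UNIV - S) \<inter> {0..<1})" by auto
        then show ?thesis unfolding F2_def by (simp only:) (intro set_integral_Un i2, auto)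
      qed
      ultimately show ?case using compl by simp
    next
      case (union S)
      have S [measurable]: "S i \<in> sets borel" for i using union(2) by (auto simp: borel_eq_atMost)
      have U: "(\<Union>i. S i) \<in> sets borel" by measurable
      have "F1 (\<Union>i. S i) = (\<Sum>i. F1 (S i))"
      proof -
        have e: "{x \<in> space N. frac (Y x) \<in> (\<Union>i. S i)} = (\<Union>i. {x \<in> space N. frac (Y x) \<in> S i})" by auto
        show ?thesis unfolding F1_def e
        proof (rule lebesgue_integral_countable_add)
          show "set_integrable N (\<Union>i. {x \<in> space N. frac (Y x) \<in> S i}) G"
            using i1[OF U] by (simp only: e)
          show "{x \<in> space N. frac (Y x) \<in> S i} \<inter> {x \<in> space N. frac (Y x) \<in> S j} = {}" if "i \<noteq> j" for i j
            using union(1) that unfolding disjoint_family_on_def by blast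
        qed (rule S1[OF S])
      qed
      moreover have "F2 (\<Union>i. S i) = (\<Sum>i. F2 (S i))"
      proof -
        have e: "(\<Union>i. S i) \<inter> {0..<1} = (\<Union>i. S i \<inter> {0..<1})" by auto
        show ?thesis unfolding F2_def e
        proof (rule lebesgue_integral_countable_add)
          show "set_integrable lborel (\<Union>i. S i \<inter> {0..<1}) (\<lambda>_. c)"
            using i2[OF U] by (simp only: e)
          show "(S i \<inter> {0..<1}) \<inter> (S j \<inter> {0..<1}) = {}" if "i \<noteq> j" for i j
            using union(1) that unfolding disjoint_family_on_def by blast
        qed simp
      qed
      ultimately show ?case using union(3) by simp
    qed
  qed
  have m: "A \<inter> {0..<1} \<in> sets lborel" using A by simp
  have "F2 A = (LINT t|lborel. indicat_real (A \<inter> {0..<1}) t) *\<^sub>R c"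
    unfolding F2_def set_lebesgue_integral_def
    by (rule integral_scaleR_left) (use m fin2 in \<open>auto intro: integrable_real_indicator\<close>)
  also have "(LINT t|lborel. indicat_real (A \<inter> {0..<1}) t) = measure lborel (A \<inter> {0..<1})" by simp
  finally have "F2 A = of_real (measure lborel (A \<inter> {0..<1})) * c" by (simp only: scaleR_conv_of_real)
  then show ?thesis using main[OF A] F1[of A] by (simp add: L_def mult.commute)
qed

text \<open>Induction on the number of coordinates in which characters have been replaced by
  indicators. In the step, the remaining factors form the weight of \<open>equidistribution\<close>
  for coordinate \<open>i\<close>, and the induction hypothesis supplies its Fourier
  coefficients.\<close>

lemma torus_law_integral:
  fixes A :: "nat \<Rightarrow> real set" and k :: "nat \<Rightarrow> int"
  assumes prob: "prob_space \<nu>" and sets: "sets \<nu> = sets (borel_Rq q)"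
    and zero: "\<And>k::nat \<Rightarrow> int. \<exists>i<q. k i \<noteq> 0 \<Longrightarrow> (LINT y|\<nu>. chr q (\<lambda>i. of_int (k i)) y) = 0"
    and A: "\<And>i. A i \<in> sets borel" and "i \<le> q"
  shows "(LINT y|\<nu>. (\<Prod>j<i. of_real (indicator (A j) (frac (y j)))) * (\<Prod>j\<in>{i..<q}. ee (of_int (k j) * y j)))
    = (\<Prod>j<i. of_real (measure lborel (A j \<inter> {0..<1}))) * (if \<forall>j\<in>{i..<q}. k j = 0 then 1 else 0)"
  using \<open>i \<le> q\<close>
proof (induction i arbitrary: k)
  case 0
  interpret prob_space \<nu> by fact
  have "(LINT y|\<nu>. (\<Prod>j\<in>{0..<q}. ee (of_int (k j) * y j))) = (LINT y|\<nu>. chr q (\<lambda>i. of_int (k i)) y)"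
    by (simp add: chr_prod lessThan_atLeast0)
  also have "\<dots> = (if \<forall>j\<in>{0..<q}. k j = 0 then 1 else 0)"
  proof (cases "\<forall>j\<in>{0..<q}. k j = 0")
    case True
    then have "chr q (\<lambda>i. of_int (k i)) y = 1" for y by (simp add: chr_def)
    then show ?thesis using True by (simp add: prob_space)
  next
    case False
    then have "\<exists>i<q. k i \<noteq> 0" by auto
    then show ?thesis using zero[of k] False by simp
  qed
  finally show ?case by simp
next
  case (Suc i)
  interpret prob_space \<nu> by fact
  have iq: "i < q" using Suc.prems by simp
  have comp [measurable]: "(\<lambda>y. y j) \<in> borel_measurable \<nu>" if "j < q" for j
    unfolding measurable_cong_sets[OF sets refl] by (rule measurable_component_singleton) (use that in simp)
  have Am [measurable]: "A j \<in> sets borel" for j by (rule A)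
  define G where "G y = (\<Prod>j<i. of_real (indicator (A j) (frac (y j)))) * (\<Prod>j\<in>{Suc i..<q}. ee (of_int (k j) * y j))"
    for y :: "nat \<Rightarrow> real"
  define c where "c = (\<Prod>j<i. complex_of_real (measure lborel (A j \<inter> {0..<1}))) * (if \<forall>j\<in>{Suc i..<q}. k j = 0 then 1 else 0)"
  have Gm: "G \<in> borel_measurable \<nu>"
    unfolding G_def
    by (intro borel_measurable_times borel_measurable_prod) (use iq in \<open>auto intro!: measurable_compose[OF comp]\<close>)
  have Gb: "cmod (G y) \<le> 1" for y
  proof -
    have "cmod (\<Prod>j<i. complex_of_real (indicator (A j) (frac (y j)))) \<le> 1"
      unfolding prod_norm[symmetric] by (intro prod_le_1) (auto simp: indicator_def)
    moreover have "cmod (\<Prod>j\<in>{Suc i..<q}. ee (of_int (k j) * y j)) = 1"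
      unfolding prod_norm[symmetric] by simp
    ultimately show ?thesis by (simp add: G_def norm_mult)
  qed
  have eq: "(LINT y|\<nu>. ee (of_int n * y i) * G y) = (if n = 0 then c else 0)" for n :: int
  proof -
    define k' where "k' = k(i := n)"
    have "ee (of_int n * y i) * G y
       = (\<Prod>j<i. of_real (indicator (A j) (frac (y j)))) * (\<Prod>j\<in>{i..<q}. ee (of_int (k' j) * y j))" for y
    proof -
      have "{i..<q} = insert i {Suc i..<q}" using iq by auto
      then have "(\<Prod>j\<in>{i..<q}. ee (of_int (k' j) * y j)) = ee (of_int n * y i) * (\<Prod>j\<in>{Suc i..<q}. ee (of_int (k' j) * y j))"
        by (simp add: k'_def)
      also have "(\<Prod>j\<in>{Suc i..<q}. ee (of_int (k' j) * y j)) = (\<Prod>j\<in>{Suc i..<q}. ee (of_int (k j) * y j))"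
        by (rule prod.cong) (auto simp: k'_def)
      finally show ?thesis by (simp add: G_def mult_ac)
    qed
    then have "(LINT y|\<nu>. ee (of_int n * y i) * G y) =
       (\<Prod>j<i. of_real (measure lborel (A j \<inter> {0..<1}))) * (if \<forall>j\<in>{i..<q}. k' j = 0 then 1 else 0)"
      using Suc.IH[of k'] iq by simp
    also have "(\<forall>j\<in>{i..<q}. k' j = 0) \<longleftrightarrow> n = 0 \<and> (\<forall>j\<in>{Suc i..<q}. k j = 0)"
    proof -
      have "{i..<q} = insert i {Suc i..<q}" using iq by auto
      then show ?thesis by (auto simp: k'_def)
    qed
    finally show ?thesis by (simp add: c_def)
  qed
  have "(LINT y|\<nu>. of_real (indicator (A i) (frac (y i))) * G y) = c * of_real (measure lborel (A i \<inter> {0..<1}))"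
    by (rule equidistribution[OF finite_measure_axioms comp[OF iq] Gm Gb eq A])
  then show ?case by (simp add: G_def c_def mult_ac)
qed

text \<open>The fractional parts of \<nu> are then distributed like Lebesgue measure on the unit
  cube. If a Lebesgue null set \<open>E\<close> carried \<nu>, the union \<open>E'\<close> of its
  integer translates would still be null, and \<open>E\<close> lies in the preimage of
  \<open>E'\<close> under taking fractional parts, forcing \<open>E\<close> to have \<nu>-measure
  0.\<close>

lemma not_singular_of_vanishing_coefficients:
  assumes prob: "prob_space \<nu>" and sets: "sets \<nu> = sets (borel_Rq q)"
    and zero: "\<And>k::nat \<Rightarrow> int. \<exists>i<q. k i \<noteq> 0 \<Longrightarrow> (LINT y|\<nu>. chr q (\<lambda>i. of_int (k i)) y) = 0"
  shows "\<not> singular_wrt (lborel_Rq q) \<nu>"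
proof
  assume "singular_wrt (lborel_Rq q) \<nu>"
  then obtain E where E: "E \<in> sets (lborel_Rq q)" "emeasure (lborel_Rq q) E = 0"
    "emeasure \<nu> (space (lborel_Rq q) - E) = 0" by (auto simp: singular_wrt_def)
  interpret prob_space \<nu> by fact
  interpret PS: product_sigma_finite "\<lambda>_::nat. lborel :: real measure" ..
  define L where "L = lborel_Rq q"
  have setsL: "sets L = sets (borel_Rq q)" unfolding L_def by (rule sets_PiM_cong) auto
  have spaceL: "space L = Rq q" by (simp add: L_def space_PiM)
  have space: "space \<nu> = Rq q" using sets_eq_imp_space_eq[OF sets] by (simp add: space_PiM)
  have mL: "measurable L M = measurable (borel_Rq q) M" "measurable M L = measurable M (borel_Rq q)"
    "measurable \<nu> M = measurable (borel_Rq q) M" for M :: "'b measure"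
    by (rule measurable_cong_sets[OF setsL refl], rule measurable_cong_sets[OF refl setsL],
        rule measurable_cong_sets[OF sets refl])
  define F where "F y = (\<lambda>i\<in>{..<q}. frac (y i))" for y :: "nat \<Rightarrow> real"
  have Fm: "F \<in> measurable \<nu> L"
  proof -
    have "F \<in> measurable (borel_Rq q) (borel_Rq q)" unfolding F_def by measurable
    then show ?thesis using measurable_cong_sets[OF sets setsL] by simp
  qed
  define cube where "cube = ({..<q} \<rightarrow>\<^sub>E {0..<1::real})"
  have cube: "cube \<in> sets L" unfolding L_def cube_def by (rule sets_PiM_I_finite) auto
  \<comment> \<open>The uniform law on the unit interval: \<nu> modulo 1 (\<open>law1\<close>) and
    Lebesgue measure on the cube (\<open>law2\<close>) are both identified with its
    \<open>q\<close>-fold product.\<close>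
  define U where "U = density lborel (indicator {0..<1::real})"
  have U_em: "emeasure U B = emeasure lborel (B \<inter> {0..<1})" if "B \<in> sets borel" for B
    using that emeasure_restricted[of "{0..<1::real}" lborel B] by (simp add: U_def Int_commute)
  have [simp]: "sets U = sets borel" by (simp add: U_def)
  interpret UP: prob_space U
    by standard (use U_em[of UNIV] in \<open>simp add: U_def\<close>)
  interpret PU: product_sigma_finite "\<lambda>_::nat. U" by standard
  have setsU: "sets (PiM {..<q} (\<lambda>_. U)) = sets (borel_Rq q)" by (rule sets_PiM_cong) auto
  have fin01: "emeasure lborel (B \<inter> {0..<1::real}) < \<infinity>" for B
  proof -
    have "emeasure lborel (B \<inter> {0..<1::real}) \<le> emeasure lborel {0..<1::real}" by (rule emeasure_mono) auto
    also have "\<dots> < \<infinity>" by simp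
    finally show ?thesis .
  qed
  have law1: "distr \<nu> L F = PiM {..<q} (\<lambda>_. U)"
  proof (rule PU.PiM_eqI)
    show "sets (distr \<nu> L F) = sets (PiM {..<q} (\<lambda>_. U))" by (simp add: setsL setsU)
    fix A :: "nat \<Rightarrow> real set" assume A: "\<And>i. i \<in> {..<q} \<Longrightarrow> A i \<in> sets U"
    define A' where "A' i = (if i < q then A i else {})" for i
    have A': "A' i \<in> sets borel" for i using A by (simp add: A'_def)
    have PA: "Pi\<^sub>E {..<q} A = Pi\<^sub>E {..<q} A'" by (rule PiE_cong) (simp add: A'_def)
    have PAs: "Pi\<^sub>E {..<q} A \<in> sets L" unfolding PA L_def using A' by (intro sets_PiM_I_finite) auto
    define W where "W = F -` Pi\<^sub>E {..<q} A \<inter> space \<nu>"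
    have Ws: "W \<in> sets \<nu>" unfolding W_def by (rule measurable_sets[OF Fm PAs])
    have W_iff: "y \<in> W \<longleftrightarrow> (\<forall>i<q. frac (y i) \<in> A' i)" if "y \<in> space \<nu>" for y
      using that by (auto simp: W_def F_def A'_def PiE_iff extensional_def)
    have prod_ind: "(\<Prod>j<q. complex_of_real (indicator (A' j) (frac (y j)))) = of_real (indicator W y)"
      if y: "y \<in> space \<nu>" for y
    proof (cases "y \<in> W")
      case True
      then show ?thesis using W_iff[OF y] by simp
    next
      case False
      then obtain j where "j < q" "frac (y j) \<notin> A' j" using W_iff[OF y] by blast
      then have "(\<Prod>j<q. complex_of_real (indicator (A' j) (frac (y j)))) = 0"
        by (intro prod_zero bexI[of _ j]) auto
      then show ?thesis using False by simp
    qed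
    have "complex_of_real (measure \<nu> W) = (LINT y|\<nu>. complex_of_real (indicator W y))"
      using Ws by (simp add: integral_complex_of_real)
    also have "\<dots> = (LINT y|\<nu>. (\<Prod>j<q. complex_of_real (indicator (A' j) (frac (y j)))))"
      by (rule Bochner_Integration.integral_cong) (simp_all add: prod_ind)
    also have "\<dots> = (\<Prod>j<q. complex_of_real (measure lborel (A' j \<inter> {0..<1})))"
      using torus_law_integral[where A = A' and i = q and k = "\<lambda>_. 0", OF prob sets zero A' order_refl] by simp
    finally have "complex_of_real (measure \<nu> W) = complex_of_real (\<Prod>j<q. measure lborel (A' j \<inter> {0..<1}))" by simp
    then have mW: "measure \<nu> W = (\<Prod>j<q. measure lborel (A' j \<inter> {0..<1}))" by (simp only: of_real_eq_iff)
    have "emeasure (distr \<nu> L F) (Pi\<^sub>E {..<q} A) = emeasure \<nu> W"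
      using Fm PAs by (simp add: emeasure_distr W_def)
    also have "\<dots> = (\<Prod>j<q. ennreal (measure lborel (A' j \<inter> {0..<1})))"
      by (simp add: emeasure_eq_measure mW prod_ennreal)
    also have "\<dots> = (\<Prod>j<q. emeasure U (A j))"
    proof (rule prod.cong)
      fix j assume "j \<in> {..<q}"
      then show "ennreal (measure lborel (A' j \<inter> {0..<1})) = emeasure U (A j)"
        using A[of j] fin01[of "A j"] emeasure_eq_ennreal_measure[of lborel "A j \<inter> {0..<1}"]
        by (simp add: A'_def U_em less_top del: UP.emeasure_eq_measure)
    qed simp
    finally show "emeasure (distr \<nu> L F) (Pi\<^sub>E {..<q} A) = (\<Prod>i\<in>{..<q}. emeasure U (A i))" .
  qed auto
  have law2: "density L (indicator cube) = PiM {..<q} (\<lambda>_. U)"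
  proof (rule PU.PiM_eqI)
    show "sets (density L (indicator cube)) = sets (PiM {..<q} (\<lambda>_. U))" by (simp add: setsL setsU)
    fix A :: "nat \<Rightarrow> real set" assume A: "\<And>i. i \<in> {..<q} \<Longrightarrow> A i \<in> sets U"
    have PAs: "Pi\<^sub>E {..<q} A \<in> sets L" unfolding L_def using A by (intro sets_PiM_I_finite) auto
    have "emeasure (density L (indicator cube)) (Pi\<^sub>E {..<q} A) = emeasure L (cube \<inter> Pi\<^sub>E {..<q} A)"
      using cube PAs by (rule emeasure_restricted)
    also have "cube \<inter> Pi\<^sub>E {..<q} A = Pi\<^sub>E {..<q} (\<lambda>i. A i \<inter> {0..<1})"
      by (auto simp: cube_def PiE_iff)
    also have "emeasure L \<dots> = (\<Prod>i\<in>{..<q}. emeasure lborel (A i \<inter> {0..<1}))"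
      unfolding L_def using A by (intro PS.emeasure_PiM) auto
    also have "\<dots> = (\<Prod>i\<in>{..<q}. emeasure U (A i))"
      using A by (intro prod.cong) (auto simp: U_em)
    finally show "emeasure (density L (indicator cube)) (Pi\<^sub>E {..<q} A) = (\<Prod>i\<in>{..<q}. emeasure U (A i))" .
  qed auto
  define tau where "tau k y = (\<lambda>i\<in>{..<q}. y i + of_int (k i))" for k :: "nat \<Rightarrow> int" and y :: "nat \<Rightarrow> real"
  have tau_m: "tau k \<in> measurable L L" for k
  proof -
    have "tau k \<in> measurable (borel_Rq q) (borel_Rq q)" unfolding tau_def by measurable
    then show ?thesis using measurable_cong_sets[OF setsL setsL] by simp
  qed
  have tau_law: "distr L L (tau k) = L" for k
    unfolding L_def
  proof (rule PS.PiM_eqI)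
    fix A :: "nat \<Rightarrow> real set" assume A: "\<And>i. i \<in> {..<q} \<Longrightarrow> A i \<in> sets lborel"
    have PAs: "Pi\<^sub>E {..<q} A \<in> sets L" unfolding L_def using A by (intro sets_PiM_I_finite) auto
    have pre: "(\<lambda>t. t + of_int (k i)) -` A i \<in> sets borel" if "i < q" for i
      using measurable_sets[of "\<lambda>t::real. t + of_int (k i)" borel borel "A i"] A[of i] that by simp
    have "emeasure (distr L L (tau k)) (Pi\<^sub>E {..<q} A) = emeasure L (tau k -` Pi\<^sub>E {..<q} A \<inter> space L)"
      using tau_m PAs by (simp add: emeasure_distr)
    also have "tau k -` Pi\<^sub>E {..<q} A \<inter> space L = Pi\<^sub>E {..<q} (\<lambda>i. (\<lambda>t. t + of_int (k i)) -` A i)"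
      by (auto simp: spaceL tau_def PiE_iff)
    also have "emeasure L \<dots> = (\<Prod>i\<in>{..<q}. emeasure lborel ((\<lambda>t. t + of_int (k i)) -` A i))"
      unfolding L_def using pre by (intro PS.emeasure_PiM) auto
    also have "\<dots> = (\<Prod>i\<in>{..<q}. emeasure lborel (A i))"
    proof (rule prod.cong)
      fix i assume i: "i \<in> {..<q}"
      have fe: "(\<lambda>t. t + of_int (k i)) = (+) (of_int (k i) :: real)" by (simp add: fun_eq_iff add.commute)
      have "emeasure lborel (A i) = emeasure (distr lborel borel (\<lambda>t. of_int (k i) + t)) (A i)"
        by (simp add: lborel_distr_plus)
      also have "\<dots> = emeasure lborel ((\<lambda>t. t + of_int (k i)) -` A i)"
        using A[OF i] by (subst emeasure_distr) (auto simp: fe)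
      finally show "emeasure lborel ((\<lambda>t. t + of_int (k i)) -` A i) = emeasure lborel (A i)" by simp
    qed simp
    finally show "emeasure (distr (lborel_Rq q) (lborel_Rq q) (tau k)) (Pi\<^sub>E {..<q} A) = (\<Prod>i\<in>{..<q}. emeasure lborel (A i))"
      by (simp add: L_def)
  qed auto
  define Z where "Z = ({..<q} \<rightarrow>\<^sub>E (UNIV::int set))"
  have Zc: "countable Z" unfolding Z_def by (rule countable_PiE) auto
  define E' where "E' = (\<Union>k\<in>Z. tau k -` E \<inter> space L)"
  have Ek: "tau k -` E \<inter> space L \<in> null_sets L" for k
  proof (rule null_setsI)
    show "tau k -` E \<inter> space L \<in> sets L" using measurable_sets[OF tau_m] E(1) by (simp add: L_def)
    have "emeasure L (tau k -` E \<inter> space L) = emeasure (distr L L (tau k)) E"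
      using tau_m E(1) by (subst emeasure_distr) (auto simp: L_def)
    then show "emeasure L (tau k -` E \<inter> space L) = 0" using E(2) by (simp add: tau_law) (simp add: L_def)
  qed
  have E': "E' \<in> null_sets L" unfolding E'_def by (rule null_sets_UN'[OF Zc]) (rule Ek)
  have "E \<subseteq> F -` E' \<inter> space \<nu>"
  proof
    fix y assume y: "y \<in> E"
    then have yR: "y \<in> Rq q" using sets.sets_into_space[OF E(1)] by (auto simp: space_PiM)
    define k where "k = (\<lambda>i\<in>{..<q}. \<lfloor>y i\<rfloor>)"
    have "tau k (F y) = y"
      using yR by (auto simp: tau_def F_def k_def frac_def fun_eq_iff PiE_iff extensional_def)
    moreover have "k \<in> Z" by (simp add: Z_def k_def)
    moreover have "F y \<in> space L" by (simp add: F_def spaceL)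
    ultimately have "F y \<in> E'" unfolding E'_def using y by (intro UN_I[of k]) simp_all
    then show "y \<in> F -` E' \<inter> space \<nu>" using yR space by simp
  qed
  then have "emeasure \<nu> E \<le> emeasure \<nu> (F -` E' \<inter> space \<nu>)"
    using E' Fm by (intro emeasure_mono) (auto intro: measurable_sets)
  also have "\<dots> = emeasure (distr \<nu> L F) E'" using Fm E' by (subst emeasure_distr) auto
  also have "\<dots> = emeasure (density L (indicator cube)) E'" by (simp add: law1 law2)
  also have "\<dots> = emeasure L (cube \<inter> E')"
    by (rule emeasure_restricted[OF cube null_setsD2[OF E']])
  also have "\<dots> \<le> emeasure L E'" using E' by (intro emeasure_mono) auto
  also have "\<dots> = 0" using E' by auto
  finally have "emeasure \<nu> E = 0" by simp
  moreover have "E \<in> sets \<nu>" using E(1) setsL sets by (simp add: L_def)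
  moreover have "emeasure \<nu> (space \<nu> - E) = 0" using E(3) by (simp add: space space_PiM)
  ultimately have "prob E = 0" "prob (space \<nu> - E) = 0" by (simp_all add: measure_def)
  then show False using prob_compl[OF \<open>E \<in> sets \<nu>\<close>] by simp
qed

subsection \<open>Powers of a matrix\<close>

text \<open>Linear dependence of a set does not see repeated members of a family, so a repetition is
  turned into a relation separately.\<close>

lemma euclidean_sequence_dependent:
  fixes w :: "nat \<Rightarrow> 'v::euclidean_space"
  obtains c :: "nat \<Rightarrow> real" where "\<exists>i\<le>DIM('v). c i \<noteq> 0" "(\<Sum>i\<le>DIM('v). c i *\<^sub>R w i) = 0"
proof (cases "inj_on w {..DIM('v)}")
  case True
  define S where "S = w ` {..DIM('v)}"
  have "card S = Suc (DIM('v))" unfolding S_def by (simp add: card_image[OF True])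
  then have "dependent S" by (intro dependent_biggerset) (simp add: S_def)
  then obtain u v where u: "v \<in> S" "u v \<noteq> 0" "(\<Sum>v\<in>S. u v *\<^sub>R v) = 0"
    by (subst (asm) dependent_finite) (auto simp: S_def)
  from u(1) obtain i where "i \<le> DIM('v)" "v = w i" by (auto simp: S_def)
  then have "\<exists>i\<le>DIM('v). u (w i) \<noteq> 0" using u(2) by blast
  moreover have "(\<Sum>i\<le>DIM('v). u (w i) *\<^sub>R w i) = 0"
    using u(3) unfolding S_def by (simp add: sum.reindex[OF True])
  ultimately show thesis by (rule that[of "\<lambda>i. u (w i)"])
next
  case False
  then obtain i j where ij: "i \<le> DIM('v)" "j \<le> DIM('v)" "i \<noteq> j" "w i = w j"
    by (auto simp: inj_on_def)
  define c where "c k = (if k = i then 1 else if k = j then - 1 else 0 :: real)" for k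
  have "(\<Sum>k\<le>DIM('v). c k *\<^sub>R w k) = (\<Sum>k\<in>{i, j}. c k *\<^sub>R w k)"
    by (rule sum.mono_neutral_right) (use ij in \<open>auto simp: c_def\<close>)
  also have "\<dots> = 0" using ij by (simp add: c_def)
  finally have s0: "(\<Sum>k\<le>DIM('v). c k *\<^sub>R w k) = 0" .
  have "\<exists>k\<le>DIM('v). c k \<noteq> 0" using ij(1) by (intro exI[of _ i]) (simp add: c_def)
  then show thesis using s0 by (rule that)
qed

lemma matrix_sum_vector: "(\<Sum>i\<in>S. f i) *v x = (\<Sum>i\<in>S. f i *v (x :: real ^ 'n))"
  by (induction S rule: infinite_finite_induct) (simp_all add: matrix_vector_mult_add_rdistrib)

text \<open>The matrices form a finite-dimensional space, so enough powers are dependent; any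
  annihilating polynomial will do.\<close>

lemma matrix_powers_dependent:
  fixes B :: "real ^ 'n ^ 'n"
  obtains c :: "nat \<Rightarrow> real" and N where "\<exists>i\<le>N. c i \<noteq> 0"
    "\<And>x. (\<Sum>i\<le>N. c i *\<^sub>R (((\<lambda>x. B *v x) ^^ i) x)) = 0"
proof -
  define M where "M i = ((\<lambda>C. B ** C) ^^ i) (Finite_Cartesian_Product.mat 1)" for i :: nat
  have M: "M i *v x = ((\<lambda>x. B *v x) ^^ i) x" for i x
    by (induction i) (simp_all add: M_def matrix_vector_mul_assoc[symmetric])
  obtain c :: "nat \<Rightarrow> real" where c: "\<exists>i\<le>DIM(real ^ 'n ^ 'n). c i \<noteq> 0" "(\<Sum>i\<le>DIM(real ^ 'n ^ 'n). c i *\<^sub>R M i) = 0"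
    by (rule euclidean_sequence_dependent)
  have "(\<Sum>i\<le>DIM(real ^ 'n ^ 'n). c i *\<^sub>R (((\<lambda>x. B *v x) ^^ i) x)) = 0" for x
  proof -
    have "(\<Sum>i\<le>DIM(real ^ 'n ^ 'n). c i *\<^sub>R (((\<lambda>x. B *v x) ^^ i) x)) = (\<Sum>i\<le>DIM(real ^ 'n ^ 'n). c i *\<^sub>R M i) *v x"
      unfolding matrix_sum_vector by (simp add: M scaleR_matrix_vector_assoc[symmetric])
    then show ?thesis unfolding c(2) by simp
  qed
  then show thesis using that c(1) by blast
qed

lemma matrix_recurrence:
  fixes B :: "real ^ 'n ^ 'n"
  obtains ch :: "nat \<Rightarrow> real" and D where
    "\<And>n x. ((\<lambda>x. B *v x) ^^ (n + D)) x = (\<Sum>i<D. ch i *\<^sub>R (((\<lambda>x. B *v x) ^^ (n + i)) x))"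
proof -
  obtain c :: "nat \<Rightarrow> real" and N where c: "\<exists>i\<le>N. c i \<noteq> 0"
    "\<And>x. (\<Sum>i\<le>N. c i *\<^sub>R (((\<lambda>x. B *v x) ^^ i) x)) = 0"
    using matrix_powers_dependent[of B] by metis
  define D where "D = Max {i. i \<le> N \<and> c i \<noteq> 0}"
  have D: "D \<in> {i. i \<le> N \<and> c i \<noteq> 0}" unfolding D_def by (rule Max_in) (use c(1) in auto)
  have top: "c i = 0" if "D < i" "i \<le> N" for i
  proof (rule ccontr)
    assume "c i \<noteq> 0"
    then have "i \<le> D" unfolding D_def using that by (intro Max_ge) auto
    then show False using that by simp
  qed
  show thesis
  proof (rule that[where D = D and ch = "\<lambda>i. - (c i / c D)"])
    fix n x
    define y where "y = ((\<lambda>x. B *v x) ^^ n) x"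
    have pow: "((\<lambda>x. B *v x) ^^ i) y = ((\<lambda>x. B *v x) ^^ (n + i)) x" for i
      by (simp add: y_def funpow_add add.commute[of n])
    have "0 = (\<Sum>i\<le>N. c i *\<^sub>R (((\<lambda>x. B *v x) ^^ i) y))" using c(2)[of y] by simp
    also have "\<dots> = (\<Sum>i\<le>D. c i *\<^sub>R (((\<lambda>x. B *v x) ^^ i) y))"
      by (rule sum.mono_neutral_right) (use D top in auto)
    also have "\<dots> = (\<Sum>i<D. c i *\<^sub>R (((\<lambda>x. B *v x) ^^ i) y)) + c D *\<^sub>R (((\<lambda>x. B *v x) ^^ D) y)"
      by (simp only: lessThan_Suc_atMost[symmetric] sum.lessThan_Suc)
    finally have e: "c D *\<^sub>R (((\<lambda>x. B *v x) ^^ D) y) = - (\<Sum>i<D. c i *\<^sub>R (((\<lambda>x. B *v x) ^^ i) y))"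
      by (simp add: eq_neg_iff_add_eq_0 add.commute)
    have "((\<lambda>x. B *v x) ^^ D) y = (1 / c D) *\<^sub>R (c D *\<^sub>R (((\<lambda>x. B *v x) ^^ D) y))" using D by simp
    also have "\<dots> = (\<Sum>i<D. - (c i / c D) *\<^sub>R (((\<lambda>x. B *v x) ^^ i) y))"
      unfolding e by (simp add: scaleR_sum_right sum_negf)
    finally show "((\<lambda>x. B *v x) ^^ (n + D)) x = (\<Sum>i<D. - (c i / c D) *\<^sub>R (((\<lambda>x. B *v x) ^^ (n + i)) x))"
      by (simp only: pow)
  qed
qed

text \<open>Take a polynomial of least degree annihilating all coordinate sequences
  \<open>n \<mapsto> B^n x\<close>. Its roots are exactly the eigenvalues of \<open>B\<close>, hence
  of modulus below 1, and \<open>contracting_recurrence\<close> applies.\<close>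

lemma matrix_powers_tendsto_0:
  fixes B :: "real ^ 'n ^ 'n"
  assumes sr: "Defs.spectral_radius UNIV (\<lambda>i j. B $ i $ j) < 1"
  shows "(\<lambda>n. ((\<lambda>x. B *v x) ^^ n) x) \<longlonglongrightarrow> 0"
proof -
  define s where "s x j n = complex_of_real (((\<lambda>x. B *v x) ^^ n) x $ j)" for x j n
  have s_shift: "s x j (n + k) = s (((\<lambda>x. B *v x) ^^ k) x) j n" for x j n k
    by (simp add: s_def funpow_add)
  have s_Suc: "s x j (Suc n) = (\<Sum>k\<in>UNIV. complex_of_real (B $ j $ k) * s x k n)" for x j n
    by (simp add: s_def matrix_vector_mult_def)
  define S where "S = {f :: complex poly. f \<noteq> 0 \<and> (\<forall>x j. psh f (s x j) 0 = 0)}"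
  have "S \<noteq> {}"
  proof -
    obtain c :: "nat \<Rightarrow> real" and N where c: "\<exists>i\<le>N. c i \<noteq> 0"
      "\<And>x. (\<Sum>i\<le>N. c i *\<^sub>R (((\<lambda>x. B *v x) ^^ i) x)) = 0"
      using matrix_powers_dependent[of B] by metis
    define f where "f = (\<Sum>i\<le>N. monom (complex_of_real (c i)) i)"
    have cf: "coeff f i = (if i \<le> N then of_real (c i) else 0)" for i by (simp add: f_def coeff_sum)
    have "f \<noteq> 0" using c(1) cf by (metis coeff_0 of_real_eq_0_iff)
    moreover have "psh f (s x j) 0 = 0" for x j
    proof -
      have "degree f \<le> N" by (rule degree_le) (simp add: cf)
      then have "psh f (s x j) 0 = (\<Sum>i\<le>N. complex_of_real (c i) * s x j i)" by (simp add: psh_le cf)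
      also have "\<dots> = complex_of_real ((\<Sum>i\<le>N. c i *\<^sub>R (((\<lambda>x. B *v x) ^^ i) x)) $ j)"
        by (simp add: s_def)
      finally show ?thesis using c(2)[of x] by simp
    qed
    ultimately show ?thesis by (auto simp: S_def)
  qed
  then obtain f where f: "f \<in> S" and min: "\<And>g. g \<in> S \<Longrightarrow> degree f \<le> degree g"
    using ex_has_least_nat[of "\<lambda>f. f \<in> S" _ degree] by (metis all_not_in_conv)
  have f0: "f \<noteq> 0" and fs: "psh f (s x j) n = 0" for x j n
    using f s_shift[of x j _ n] psh_shift[of f "s x j" n 0] by (auto simp: S_def)
  define ev where "ev = complex_eigenvalues UNIV (\<lambda>i j. B $ i $ j)"
  \<comment> \<open>By minimality the cofactor \<open>g\<close> does not annihilate every sequence;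
    what it leaves is an eigenvector for \<open>z\<close>.\<close>
  have root_ev: "z \<in> ev" if z: "poly f z = 0" for z
  proof -
    define g where "g = synthetic_div f z"
    have fg: "f = [:- z, 1:] * g" using synthetic_div_root[OF z] by (simp add: g_def)
    have "g \<noteq> 0" using fg f0 by auto
    then have "degree f = Suc (degree g)" unfolding fg by (subst degree_mult_eq) auto
    then have "g \<notin> S" using min[of g] by auto
    then obtain x j where xj: "psh g (s x j) 0 \<noteq> 0" using \<open>g \<noteq> 0\<close> by (auto simp: S_def)
    define w where "w j = psh g (s x j) 0" for j
    have "(\<Sum>k\<in>UNIV. complex_of_real (B $ i $ k) * w k) = z * w i" for i
    proof -
      have "(\<Sum>k\<in>UNIV. complex_of_real (B $ i $ k) * w k) = psh g (\<lambda>n. \<Sum>k\<in>UNIV. s x k n * complex_of_real (B $ i $ k)) 0"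
        unfolding psh_sum_right by (simp add: w_def mult.commute)
      also have "(\<lambda>n. \<Sum>k\<in>UNIV. s x k n * complex_of_real (B $ i $ k)) = (\<lambda>n. s x i (n + 1))"
        by (simp add: s_Suc mult.commute fun_eq_iff)
      also have "psh g (\<lambda>n. s x i (n + 1)) 0 = psh g (s x i) 1" unfolding psh_shift by simp
      also have "\<dots> = z * psh g (s x i) 0"
        using fs[of x i 0] unfolding fg psh_mult by (simp add: psh_pCons)
      finally show ?thesis by (simp add: w_def)
    qed
    moreover have "w j \<noteq> 0" using xj by (simp add: w_def)
    ultimately show ?thesis unfolding ev_def complex_eigenvalues_def by blast
  qed
  \<comment> \<open>This inclusion makes the set of eigenvalues finite, without which the
    \<open>Max\<close> in the spectral radius would bound nothing. A complex eigenvector is split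
    into real vectors \<open>u\<close> and \<open>v\<close> to be iterated.\<close>
  have ev_root: "poly f c = 0" if c: "c \<in> ev" for c
  proof -
    obtain z i where z: "z i \<noteq> 0" "\<And>i. (\<Sum>j\<in>UNIV. complex_of_real (B $ i $ j) * z j) = c * z i"
      using c by (auto simp: ev_def complex_eigenvalues_def)
    define u v where "u = (\<chi> j. Re (z j))" and "v = (\<chi> j. Im (z j))"
    have "s u j n + \<i> * s v j n = c ^ n * z j" for j n
    proof (induction n arbitrary: j)
      case 0
      show ?case by (simp add: s_def u_def v_def complex_eq_iff)
    next
      case (Suc n)
      have "s u j (Suc n) + \<i> * s v j (Suc n) = (\<Sum>k\<in>UNIV. complex_of_real (B $ j $ k) * (s u k n + \<i> * s v k n))"
        unfolding s_Suc by (simp add: distrib_left sum.distrib sum_distrib_left mult_ac)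
      also have "\<dots> = c ^ n * (\<Sum>k\<in>UNIV. complex_of_real (B $ j $ k) * z k)"
        unfolding Suc by (simp add: sum_distrib_left mult_ac)
      finally show ?case by (simp only: z(2)) (simp add: mult_ac)
    qed
    then have "psh f (\<lambda>n. c ^ n * z i) 0 = psh f (\<lambda>n. s u i n - s v i n * (- \<i>)) 0"
      by (simp add: mult.commute)
    also have "\<dots> = psh f (s u i) 0 - psh f (\<lambda>n. \<Sum>k\<in>{i}. s v k n * (- \<i>)) 0"
      unfolding psh_diff_right by simp
    also have "\<dots> = 0" unfolding psh_sum_right by (simp add: fs)
    finally have "poly f c * z i = 0" unfolding psh_geometric by simp
    then show ?thesis using z(1) by simp
  qed
  have fin: "finite ev" using ev_root poly_roots_finite[OF f0] by (meson finite_subset mem_Collect_eq subsetI)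
  have small: "cmod z < 1" if "poly f z = 0" for z
  proof -
    have "cmod z \<le> Max (cmod ` ev)" using root_ev[OF that] fin by (intro Max_ge) auto
    then show ?thesis using sr by (simp add: Defs.spectral_radius_def ev_def)
  qed
  have "(\<lambda>n. ((\<lambda>x. B *v x) ^^ n) x $ j) \<longlonglongrightarrow> 0" for j
  proof -
    have "psh f (s x j) = (\<lambda>n. 0)" using fs by (intro ext)
    then have pl: "psh f (s x j) \<longlonglongrightarrow> 0" by simp
    have "s x j \<longlonglongrightarrow> 0" by (rule contracting_recurrence[OF f0 _ pl]) (rule small)
    then have "(\<lambda>n. Re (s x j n)) \<longlonglongrightarrow> Re 0" by (rule tendsto_Re)
    then show ?thesis by (simp add: s_def)
  qed
  then show ?thesis by (intro vec_tendstoI) simp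
qed

subsection \<open>The Fourier transform of a self-affine measure\<close>

locale affine_ifs =
  fixes m :: nat and \<phi> :: "nat \<Rightarrow> real ^ 'd \<Rightarrow> real ^ 'd" and A :: "real ^ 'd ^ 'd"
    and a :: "nat \<Rightarrow> real ^ 'd" and p :: "nat \<Rightarrow> real" and \<mu> :: "(real ^ 'd) measure"
  assumes ifs: "homogeneous_affine_IFS m \<phi> A a"
    and irr: "affinely_irreducible m \<phi>"
    and pp: "strictly_positive_prob_vector m p"
    and sa: "self_affine_measure borel m \<phi> p \<mu>"
begin

definition At :: "real ^ 'd \<Rightarrow> real ^ 'd" where
  "At x = Finite_Cartesian_Product.transpose A *v x"

text \<open>The inverse of the transpose, kept as a matrix so that \<open>matrix_recurrence\<close>
  applies to its powers; the choice repeats the formula of the library's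
  \<open>invertible\<close>.\<close>

definition Em :: "real ^ 'd ^ 'd" where
  "Em = Finite_Cartesian_Product.transpose (SOME A'. A ** A' = Finite_Cartesian_Product.mat 1 \<and> A' ** A = Finite_Cartesian_Product.mat 1)"

definition Ei :: "real ^ 'd \<Rightarrow> real ^ 'd" where
  "Ei x = Em *v x"

text \<open>Only differences of translations matter for the modulus of the mask, see
  \<open>P_dv\<close>; they are also the functionals through which orbits of \<open>Ei\<close> are
  observed.\<close>

definition dv :: "nat \<Rightarrow> real ^ 'd" where
  "dv l = a l - a 1"

definition muhat :: "real ^ 'd \<Rightarrow> complex" where
  "muhat \<xi> = (LINT x|\<mu>. ee (\<xi> \<bullet> x))"

definition P :: "real ^ 'd \<Rightarrow> complex" where
  "P \<xi> = (\<Sum>l\<in>{1..m}. p l * ee (\<xi> \<bullet> a l))"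

lemma m1: "1 \<le> m" and phi: "l \<in> {1..m} \<Longrightarrow> \<phi> l x = A *v x + a l"
  using ifs by (auto simp: homogeneous_affine_IFS_def)

lemma p_pos: "l \<in> {1..m} \<Longrightarrow> 0 < p l" and p_sum: "(\<Sum>l\<in>{1..m}. p l) = 1"
  using pp by (auto simp: strictly_positive_prob_vector_def)

lemma At_Ei [simp]: "At (Ei x) = x" and Ei_At [simp]: "Ei (At x) = x"
proof -
  define A' where "A' = (SOME A'. A ** A' = Finite_Cartesian_Product.mat 1 \<and> A' ** A = Finite_Cartesian_Product.mat 1)"
  have "\<exists>A'. A ** A' = Finite_Cartesian_Product.mat 1 \<and> A' ** A = Finite_Cartesian_Product.mat 1"
    using ifs by (simp add: homogeneous_affine_IFS_def invertible_def)
  then have A': "A ** A' = Finite_Cartesian_Product.mat 1" "A' ** A = Finite_Cartesian_Product.mat 1"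
    unfolding A'_def by (metis (mono_tags, lifting) someI_ex)+
  have "Finite_Cartesian_Product.transpose A ** Em = Finite_Cartesian_Product.mat 1"
    "Em ** Finite_Cartesian_Product.transpose A = Finite_Cartesian_Product.mat 1"
    unfolding Em_def A'_def[symmetric] matrix_transpose_mul[symmetric] A' by (simp_all add: transpose_mat)
  then show "At (Ei x) = x" "Ei (At x) = x"
    by (simp_all add: At_def Ei_def matrix_vector_mul_assoc del: transpose_matrix_vector)
qed

lemma linear_At: "linear At" and linear_Ei: "linear Ei"
  unfolding At_def[abs_def] Ei_def[abs_def] by (rule matrix_vector_mul_linear)+

lemma At_dot: "At \<xi> \<bullet> x = \<xi> \<bullet> (A *v x)"
  by (simp add: At_def dot_lmul_matrix[symmetric])

lemma linear_pow: "linear f \<Longrightarrow> linear (f ^^ n)" for f :: "real ^ 'd \<Rightarrow> real ^ 'd"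
  by (induction n) (auto simp: linear_id[unfolded id_def] id_def intro: linear_compose)

lemma At_pow_dot: "(At ^^ n) \<xi> \<bullet> x = \<xi> \<bullet> ((\<lambda>x. A *v x) ^^ n) x"
  by (induction n arbitrary: \<xi>) (simp_all add: funpow_Suc_right At_dot del: funpow.simps(2), simp add: funpow_swap1 At_dot)

lemma A_pow_tendsto: "(\<lambda>n. ((\<lambda>x. A *v x) ^^ n) x) \<longlonglongrightarrow> 0"
  using ifs by (intro matrix_powers_tendsto_0) (simp add: homogeneous_affine_IFS_def)

lemma At_pow_tendsto: "(\<lambda>n. (At ^^ n) \<xi>) \<longlonglongrightarrow> 0"
proof (rule vec_tendstoI)
  fix j
  have "(\<lambda>n. \<xi> \<bullet> ((\<lambda>x. A *v x) ^^ n) (axis j 1)) \<longlonglongrightarrow> \<xi> \<bullet> 0"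
    by (intro tendsto_inner tendsto_const A_pow_tendsto)
  then show "(\<lambda>n. (At ^^ n) \<xi> $ j) \<longlonglongrightarrow> 0 $ j"
    by (simp add: At_pow_dot[symmetric] inner_axis)
qed

lemma At_pow_uniform:
  obtains \<epsilon> :: "nat \<Rightarrow> real" where "\<epsilon> \<longlonglongrightarrow> 0" "\<And>n y. norm ((At ^^ n) y) \<le> \<epsilon> n * norm y"
proof (rule that[of "\<lambda>n. \<Sum>b\<in>Basis. norm ((At ^^ n) b)"])
  have "(\<lambda>n. \<Sum>b\<in>(Basis :: (real ^ 'd) set). norm ((At ^^ n) b)) \<longlonglongrightarrow> (\<Sum>b\<in>(Basis :: (real ^ 'd) set). norm (0 :: real ^ 'd))"
    by (intro tendsto_sum tendsto_norm At_pow_tendsto)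
  then show "(\<lambda>n. \<Sum>b\<in>(Basis :: (real ^ 'd) set). norm ((At ^^ n) b)) \<longlonglongrightarrow> 0" by simp
next
  fix n and y :: "real ^ 'd"
  have "(At ^^ n) y = (At ^^ n) (\<Sum>b\<in>Basis. (y \<bullet> b) *\<^sub>R b)" by (simp only: euclidean_representation)
  also have "\<dots> = (\<Sum>b\<in>Basis. (y \<bullet> b) *\<^sub>R (At ^^ n) b)"
    by (simp add: linear_sum[OF linear_pow[OF linear_At]] linear_scale[OF linear_pow[OF linear_At]])
  also have "norm \<dots> \<le> (\<Sum>b\<in>Basis. norm y * norm ((At ^^ n) b))"
    by (rule sum_norm_le) (simp add: Basis_le_norm mult_right_mono)
  finally show "norm ((At ^^ n) y) \<le> (\<Sum>b\<in>Basis. norm ((At ^^ n) b)) * norm y"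
    by (simp add: sum_distrib_left mult.commute)
qed

lemma At_Ei_pow [simp]: "(At ^^ n) ((Ei ^^ n) x) = x"
proof (induction n)
  case (Suc n)
  have "(At ^^ Suc n) ((Ei ^^ Suc n) x) = (At ^^ n) (At (Ei ((Ei ^^ n) x)))" by (simp add: funpow_swap1)
  then show ?case using Suc by simp
qed simp

lemma Ei_pow_At_pow: "n \<le> J \<Longrightarrow> (Ei ^^ n) ((At ^^ J) \<xi>) = (At ^^ (J - n)) \<xi>"
proof (induction n)
  case (Suc n)
  then have "(Ei ^^ Suc n) ((At ^^ J) \<xi>) = Ei ((At ^^ (J - n)) \<xi>)" by simp
  also have "J - n = Suc (J - Suc n)" using Suc.prems by simp
  finally show ?case by simp
qed simp

lemma Ei_pow_nonzero: "x \<noteq> 0 \<Longrightarrow> (Ei ^^ n) x \<noteq> 0"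
  using At_Ei_pow[of n x] linear_0[OF linear_pow[OF linear_At], of n] by metis

lemma sets_mu: "sets \<mu> = sets borel" using sa by (simp add: self_affine_measure_def)

sublocale prob_space \<mu>
  using self_affine_prob_space[OF sa] .

lemma fourier_muhat: "fourier_transform \<mu> \<xi> = muhat \<xi>"
  unfolding fourier_transform_def muhat_def ee_def cis_conv_exp
  by (rule Bochner_Integration.integral_cong) (simp_all add: mult_ac)

lemma ee_meas: "(\<lambda>x. ee (\<xi> \<bullet> x)) \<in> borel_measurable \<mu>"
proof -
  have "(\<lambda>x. ee (\<xi> \<bullet> x)) \<in> borel_measurable borel" by measurable
  then show ?thesis unfolding measurable_cong_sets[OF sets_mu refl] .
qed

lemma muhat_step: "muhat \<xi> = P \<xi> * muhat (At \<xi>)"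
proof -
  have meas: "\<phi> l \<in> measurable borel borel" if "l \<in> {1..m}" for l
  proof -
    have "\<phi> l = (\<lambda>x. A *v x + a l)" using phi[OF that] by (simp add: fun_eq_iff)
    moreover have "continuous_on UNIV (\<lambda>x. A *v x + a l)"
      by (intro continuous_intros linear_continuous_on) (simp add: linear_conv_bounded_linear[symmetric])
    ultimately show ?thesis by (metis borel_measurable_continuous_onI)
  qed
  have "muhat \<xi> = (\<Sum>l\<in>{1..m}. p l * (LINT x|\<mu>. ee (\<xi> \<bullet> \<phi> l x)))"
    unfolding muhat_def by (rule self_affine_integral[OF sa pp meas, where B = 1]) auto
  also have "\<dots> = (\<Sum>l\<in>{1..m}. p l * (ee (\<xi> \<bullet> a l) * muhat (At \<xi>)))"
  proof (rule sum.cong)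
    fix l assume l: "l \<in> {1..m}"
    have "ee (\<xi> \<bullet> \<phi> l x) = ee (\<xi> \<bullet> a l) * ee (At \<xi> \<bullet> x)" for x
      by (simp add: phi[OF l] inner_add_right At_dot ee_add mult.commute)
    then show "p l * (LINT x|\<mu>. ee (\<xi> \<bullet> \<phi> l x)) = p l * (ee (\<xi> \<bullet> a l) * muhat (At \<xi>))"
      by (simp add: muhat_def)
  qed simp
  finally show ?thesis by (simp add: P_def sum_distrib_right mult.assoc)
qed

lemma norm_P_le_1: "cmod (P \<xi>) \<le> 1"
proof -
  have "cmod (P \<xi>) \<le> (\<Sum>l\<in>{1..m}. p l)"
    unfolding P_def by (rule sum_norm_le) (simp add: norm_mult p_pos less_imp_le)
  then show ?thesis by (simp only: p_sum)
qed

lemma norm_muhat_le_At: "cmod (muhat \<xi>) \<le> cmod (muhat (At \<xi>))"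
  by (subst muhat_step) (simp add: norm_mult norm_P_le_1 mult_left_le_one_le)

lemma norm_muhat_le_At_pow: "cmod (muhat \<xi>) \<le> cmod (muhat ((At ^^ n) \<xi>))"
  by (induction n) (auto intro: order_trans norm_muhat_le_At)

lemma muhat_tendsto:
  assumes "X \<longlonglongrightarrow> \<xi>" shows "(\<lambda>n. muhat (X n)) \<longlonglongrightarrow> muhat \<xi>"
  unfolding muhat_def
proof (rule integral_dominated_convergence[where w = "\<lambda>_. 1"])
  have "(\<lambda>n. ee (X n \<bullet> x)) \<longlonglongrightarrow> ee (\<xi> \<bullet> x)" for x
  proof -
    have "(\<lambda>n. X n \<bullet> x) \<longlonglongrightarrow> \<xi> \<bullet> x" by (intro tendsto_inner assms tendsto_const)
    from continuous_on_tendsto_compose[OF continuous_ee[of UNIV] this] show ?thesis by simp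
  qed
  then show "AE x in \<mu>. (\<lambda>n. ee (X n \<bullet> x)) \<longlonglongrightarrow> ee (\<xi> \<bullet> x)" by (intro AE_I2)
  show "AE x in \<mu>. norm (ee (X n \<bullet> x)) \<le> 1" for n by (intro AE_I2) (simp only: norm_ee)
qed (rule ee_meas, rule ee_meas, simp)

lemma muhat_0: "muhat 0 = 1"
  by (simp add: muhat_def prob_space)

lemma muhat_At_pow_tendsto: "(\<lambda>n. muhat ((At ^^ n) \<xi>)) \<longlonglongrightarrow> 1"
  using muhat_tendsto[OF At_pow_tendsto[of \<xi>]] by (simp only: muhat_0)

text \<open>\<open>X n\<close> is brought back to \<open>X 0\<close> by \<open>At ^^ n\<close>,
  whose norm tends to 0. As \<open>X 0\<close> is not 0, the orbit cannot stay bounded, so it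
  reaches the region where \<open>muhat\<close> is small.\<close>

lemma rajchman_orbit:
  assumes raj: "rajchman \<mu>" and X0: "X 0 \<noteq> 0" and X: "\<And>n. At (X (Suc n)) = X n" and c: "c > 0"
  shows "\<exists>n. cmod (muhat (X n)) < c"
proof -
  have "((\<lambda>\<xi>. cmod (muhat \<xi>)) \<longlongrightarrow> 0) at_infinity"
    using raj by (simp add: rajchman_def fourier_muhat)
  then obtain R where R: "\<And>\<xi>. norm \<xi> \<ge> R \<Longrightarrow> cmod (muhat \<xi>) < c"
    using c by (fastforce simp: Lim_at_infinity dist_norm)
  obtain \<epsilon> :: "nat \<Rightarrow> real" where \<epsilon>: "\<epsilon> \<longlonglongrightarrow> 0" "\<And>n y. norm ((At ^^ n) y) \<le> \<epsilon> n * norm y"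
    using At_pow_uniform by blast
  have AX: "(At ^^ n) (X n) = X 0" for n
    by (induction n) (simp_all add: funpow_swap1 X)
  have "\<exists>n. norm (X n) \<ge> R"
  proof (rule ccontr)
    assume "\<not> ?thesis"
    then have small: "norm (X n) \<le> R" for n by (meson linear)
    have e0: "0 \<le> \<epsilon> n" for n
    proof -
      have "0 \<le> \<epsilon> n * norm (X n)" by (rule order_trans[OF norm_ge_zero \<epsilon>(2)])
      moreover have "norm (X n) > 0" using AX[of n] X0 linear_0[OF linear_pow[OF linear_At], of n] by (metis zero_less_norm_iff)
      ultimately show ?thesis by (simp add: zero_le_mult_iff)
    qed
    have "norm (X 0) \<le> \<epsilon> n * R" for n
      using \<epsilon>(2)[of n "X n"] mult_left_mono[OF small[of n] e0[of n]] by (simp only: AX)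
    moreover have "(\<lambda>n. \<epsilon> n * R) \<longlonglongrightarrow> 0 * R" by (intro tendsto_mult \<epsilon>(1) tendsto_const)
    ultimately have "norm (X 0) \<le> 0 * R" by (intro LIMSEQ_le_const) auto
    then show False using X0 by simp
  qed
  then show ?thesis using R by blast
qed

text \<open>A far point \<xi> with large \<open>muhat\<close> is pulled by \<open>At\<close> into
  the unit ball. The entry point \<eta> lies in a fixed annulus, and its first \<open>N\<close>
  images under \<open>Ei\<close> are images of \<xi> under powers of \<open>At\<close>, where
  \<open>muhat\<close> is at least as large. A limit of these entry points inherits the bound for
  all times.\<close>

lemma not_rajchman_orbit:
  assumes "\<not> rajchman \<mu>"
  obtains \<eta> c where "\<eta> \<noteq> 0" "c > 0" "\<And>n. c \<le> cmod (muhat ((Ei ^^ n) \<eta>))"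
proof -
  have "\<not> ((\<lambda>\<xi>. cmod (muhat \<xi>)) \<longlongrightarrow> 0) at_infinity"
    using assms by (simp add: rajchman_def fourier_muhat)
  then have "\<exists>c>0. \<forall>R. \<exists>\<xi>. R \<le> norm \<xi> \<and> \<not> cmod (muhat \<xi>) < c"
    unfolding Lim_at_infinity by (simp add: dist_norm not_less)
  then obtain c where c: "c > 0" "\<And>R. \<exists>\<xi>. R \<le> norm \<xi> \<and> c \<le> cmod (muhat \<xi>)" by (metis not_less)
  obtain K0 where K0: "\<And>x. norm (Ei x) \<le> K0 * norm x"
    using linear_bounded[OF linear_Ei] by (metis mult.commute)
  define K where "K = max K0 1"
  have K: "norm (Ei x) \<le> K * norm x" "1 \<le> K" for x
    using K0[of x] mult_right_mono[of K0 K "norm x"] by (auto simp: K_def intro: order_trans)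
  have Kpow: "norm ((Ei ^^ n) x) \<le> K ^ n * norm x" for n x
  proof (induction n)
    case (Suc n)
    have "norm ((Ei ^^ Suc n) x) \<le> K * norm ((Ei ^^ n) x)" using K(1) by simp
    also have "\<dots> \<le> K * (K ^ n * norm x)" using Suc K(2) by (intro mult_left_mono) auto
    finally show ?case by (simp add: mult.assoc)
  qed simp
  have ex: "\<exists>\<eta>. 1 / K \<le> norm \<eta> \<and> norm \<eta> \<le> 1 \<and> (\<forall>n\<le>N. c \<le> cmod (muhat ((Ei ^^ n) \<eta>)))" for N
  proof -
    obtain \<xi> where \<xi>: "K ^ N + 1 \<le> norm \<xi>" "c \<le> cmod (muhat \<xi>)" using c(2) by blast
    have "(\<lambda>n. norm ((At ^^ n) \<xi>)) \<longlonglongrightarrow> 0" using At_pow_tendsto by (rule tendsto_norm_zero)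
    from LIMSEQ_D[OF this, of 1] obtain j0 where "\<forall>n\<ge>j0. norm (norm ((At ^^ n) \<xi>) - 0) < 1" by auto
    then have "norm ((At ^^ j0) \<xi>) < 1" by auto
    then have exj: "\<exists>j. norm ((At ^^ j) \<xi>) \<le> 1" by (intro exI[of _ j0]) simp
    \<comment> \<open>The first entry time. Minimality gives \<open>norm (Ei \<eta>) > 1\<close>,
      hence \<open>norm \<eta> >= 1 / K\<close>; the size \<open>K ^ N + 1\<close> of \<xi> forces
      \<open>J\<close> beyond \<open>N\<close>.\<close>
    define J where "J = (LEAST j. norm ((At ^^ j) \<xi>) \<le> 1)"
    define \<eta> where "\<eta> = (At ^^ J) \<xi>"
    have J1: "norm \<eta> \<le> 1" unfolding \<eta>_def J_def by (rule LeastI_ex[OF exj])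
    have J2: "1 < norm ((At ^^ j) \<xi>)" if "j < J" for j
      using not_less_Least[of j "\<lambda>j. norm ((At ^^ j) \<xi>) \<le> 1"] that by (simp add: J_def)
    have \<xi>\<eta>: "(Ei ^^ J) \<eta> = \<xi>" unfolding \<eta>_def by (subst Ei_pow_At_pow) auto
    have "N < J"
    proof (rule ccontr)
      assume "\<not> N < J"
      then have "K ^ J \<le> K ^ N" using K(2) by (intro power_increasing) auto
      moreover have "norm \<xi> \<le> K ^ J * norm \<eta>" using Kpow[of J \<eta>] \<xi>\<eta> by simp
      moreover have "K ^ J * norm \<eta> \<le> K ^ J * 1" using J1 K(2) by (intro mult_left_mono) auto
      ultimately show False using \<xi>(1) by simp
    qed
    have "Ei \<eta> = (At ^^ (J - 1)) \<xi>" using Ei_pow_At_pow[of 1 J \<xi>] \<open>N < J\<close> by (simp add: \<eta>_def)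
    then have "1 < norm (Ei \<eta>)" using J2[of "J - 1"] \<open>N < J\<close> by simp
    then have "1 / K \<le> norm \<eta>" using K(1)[of \<eta>] K(2) by (simp add: field_simps)
    moreover have "c \<le> cmod (muhat ((Ei ^^ n) \<eta>))" if "n \<le> N" for n
    proof -
      have "(Ei ^^ n) \<eta> = (At ^^ (J - n)) \<xi>" unfolding \<eta>_def using that \<open>N < J\<close> by (intro Ei_pow_At_pow) simp
      then show ?thesis using norm_muhat_le_At_pow[of \<xi> "J - n"] \<xi>(2) by simp
    qed
    ultimately show ?thesis using J1 by (intro exI[of _ \<eta>]) simp
  qed
  obtain et where et0: "\<forall>N. 1 / K \<le> norm (et N) \<and> norm (et N) \<le> 1 \<and> (\<forall>n\<le>N. c \<le> cmod (muhat ((Ei ^^ n) (et N))))"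
    using choice[OF allI, of "\<lambda>N \<eta>. 1 / K \<le> norm \<eta> \<and> norm \<eta> \<le> 1 \<and> (\<forall>n\<le>N. c \<le> cmod (muhat ((Ei ^^ n) \<eta>)))", OF ex] by blast
  have et: "1 / K \<le> norm (et N)" "norm (et N) \<le> 1"
    "n \<le> N \<Longrightarrow> c \<le> cmod (muhat ((Ei ^^ n) (et N)))" for N n using et0 by simp_all
  have "compact (cball (0 :: real ^ 'd) 1)" by simp
  then obtain \<eta> r where \<eta>: "strict_mono r" "(et \<circ> r) \<longlonglongrightarrow> \<eta>"
    using et(2) unfolding compact_def by (metis mem_cball_0)
  have "1 / K \<le> norm \<eta>"
    by (rule LIMSEQ_le_const[OF tendsto_norm[OF \<eta>(2)]]) (use et(1) in auto)
  moreover have "1 / K > 0" using K(2) by simp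
  ultimately have "\<eta> \<noteq> 0" by auto
  moreover have "c \<le> cmod (muhat ((Ei ^^ n) \<eta>))" for n
  proof -
    have cn: "continuous_on UNIV (Ei ^^ n)"
      by (intro linear_continuous_on) (simp add: linear_conv_bounded_linear[symmetric] linear_pow linear_Ei)
    have "(\<lambda>N. (Ei ^^ n) ((et \<circ> r) N)) \<longlonglongrightarrow> (Ei ^^ n) \<eta>"
      by (rule continuous_on_tendsto_compose[OF cn \<eta>(2)]) auto
    from tendsto_norm[OF muhat_tendsto[OF this]]
    show ?thesis
    proof (rule LIMSEQ_le_const)
      have "c \<le> cmod (muhat ((Ei ^^ n) ((et \<circ> r) N)))" if "N \<ge> n" for N
        using et(3)[of n "r N"] strict_mono_imp_increasing[OF \<eta>(1), of N] that by simp
      then show "\<exists>M. \<forall>N\<ge>M. c \<le> norm (muhat ((Ei ^^ n) ((et \<circ> r) N)))" by blast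
    qed
  qed
  ultimately show thesis using that c(1) by blast
qed

subsection \<open>Consequences of irreducibility\<close>

lemma A_fixed_point_0: "A *v x = x \<Longrightarrow> x = 0"
proof -
  assume x: "A *v x = x"
  have "((\<lambda>x. A *v x) ^^ n) x = x" for n by (induction n) (simp_all add: x)
  then show "x = 0" using A_pow_tendsto[of x] by (simp add: LIMSEQ_const_iff)
qed

lemma fixed_point: obtains x1 where "A *v x1 + a 1 = x1"
proof -
  have lin: "linear (\<lambda>x. x - A *v x)" by (intro linear_compose_sub) (auto simp: linear_id[unfolded id_def])
  have "inj (\<lambda>x. x - A *v x)"
    unfolding linear_injective_0[OF lin] using A_fixed_point_0 by (metis eq_iff_diff_eq_0)
  then have "surj (\<lambda>x. x - A *v x)" by (rule linear_injective_imp_surjective[OF lin]) (rule refl)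
  then obtain x1 where "a 1 = x1 - A *v x1" by (rule surjE)
  then show thesis using that[of x1] by (simp add: algebra_simps)
qed

lemma invariant_subspace_image:
  fixes f :: "real ^ 'd \<Rightarrow> real ^ 'd"
  assumes "linear f" "inj f" "subspace U" "\<And>u. u \<in> U \<Longrightarrow> f u \<in> U"
  shows "f ` U = U"
proof (rule subspace_dim_equal)
  show "subspace (f ` U)" by (rule linear_subspace_image[OF assms(1,3)])
  have "dim (f ` U) = dim U" by (rule dim_image_eq[OF assms(1)]) (rule inj_on_subset[OF assms(2)], simp)
  then show "dim U \<le> dim (f ` U)" by simp
qed (use assms in auto)

lemma inj_Ei: "inj Ei" by (metis At_Ei injI)
lemma inj_A: "inj (\<lambda>x. A *v x)"
proof (rule injI)
  fix x y assume "A *v x = A *v y"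
  then have "\<xi> \<bullet> x = \<xi> \<bullet> y" for \<xi> using At_dot[of "Ei \<xi>" x] At_dot[of "Ei \<xi>" y] by simp
  then show "x = y" by (metis inner_commute vector_eq_ldot)
qed

text \<open>The unobservable vectors form an \<open>Ei\<close>-invariant subspace \<open>U\<close>.
  Its orthogonal complement \<open>W\<close> is invariant under \<open>A\<close> and contains all
  \<open>dv l\<close>, so the translate of \<open>W\<close> through the fixed point of
  \<open>\<phi> 1\<close> is mapped onto itself by every map. Irreducibility makes \<open>W\<close>
  the whole space, hence \<open>U\<close> trivial.\<close>

lemma irreducible_observable:
  assumes w: "\<And>n l. l \<in> {1..m} \<Longrightarrow> (Ei ^^ n) w \<bullet> dv l = 0"
  shows "w = 0"
proof (rule ccontr)
  assume w0: "w \<noteq> 0"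
  define U where "U = {w. \<forall>n. \<forall>l\<in>{1..m}. (Ei ^^ n) w \<bullet> dv l = 0}"
  have wU: "w \<in> U" using w by (auto simp: U_def)
  have subU: "subspace U"
    unfolding U_def subspace_def
    by (auto simp: linear_0[OF linear_pow[OF linear_Ei]] linear_add[OF linear_pow[OF linear_Ei]]
        linear_scale[OF linear_pow[OF linear_Ei]] inner_add_left)
  have EU: "Ei u \<in> U" if "u \<in> U" for u
    unfolding U_def
  proof (intro CollectI allI ballI)
    fix n l assume l: "l \<in> {1..m}"
    have "(Ei ^^ Suc n) u \<bullet> dv l = 0" using that l unfolding U_def by blast
    then show "(Ei ^^ n) (Ei u) \<bullet> dv l = 0" by (simp add: funpow_swap1)
  qed
  have EiU: "Ei ` U = U" by (rule invariant_subspace_image[OF linear_Ei inj_Ei subU EU])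
  have AU: "At u \<in> U" if u: "u \<in> U" for u
  proof -
    from u have "u \<in> Ei ` U" by (simp only: EiU)
    then obtain u' where "u' \<in> U" "u = Ei u'" by (rule imageE)
    then show ?thesis by simp
  qed
  define W where "W = {y. \<forall>u\<in>U. u \<bullet> y = 0}"
  have subW: "subspace W" by (auto simp: W_def subspace_def inner_add_right)
  have AW: "A *v y \<in> W" if "y \<in> W" for y using that AU by (auto simp: W_def At_dot[symmetric])
  have AWW: "(\<lambda>x. A *v x) ` W = W"
    by (rule invariant_subspace_image[OF _ inj_A subW AW]) auto
  have dvW: "dv l \<in> W" if "l \<in> {1..m}" for l
  proof -
    have "u \<bullet> dv l = 0" if "u \<in> U" for u
    proof -
      have "(Ei ^^ 0) u \<bullet> dv l = 0" using that \<open>l \<in> {1..m}\<close> unfolding U_def by blast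
      then show ?thesis by simp
    qed
    then show ?thesis by (simp add: W_def)
  qed
  obtain x1 where x1: "A *v x1 + a 1 = x1" by (rule fixed_point)
  define V where "V = (\<lambda>y. x1 + y) ` W"
  have phiV: "\<phi> l (x1 + y) = x1 + (A *v y + dv l)" if "l \<in> {1..m}" for l y
  proof -
    have "\<phi> l (x1 + y) = (A *v x1 + a 1) + (A *v y + dv l)"
      by (simp add: phi[OF that] dv_def matrix_vector_right_distrib)
    then show ?thesis by (simp only: x1)
  qed
  have "\<phi> l ` V = V" if l: "l \<in> {1..m}" for l
  proof
    show "\<phi> l ` V \<subseteq> V"
    proof
      fix z assume "z \<in> \<phi> l ` V"
      then obtain y where y: "y \<in> W" "z = \<phi> l (x1 + y)" by (auto simp: V_def)
      have "A *v y + dv l \<in> W" by (rule subspace_add[OF subW AW[OF y(1)] dvW[OF l]])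
      then show "z \<in> V" unfolding V_def y(2) phiV[OF l] by (rule imageI)
    qed
    show "V \<subseteq> \<phi> l ` V"
    proof
      fix z assume "z \<in> V"
      then obtain y where y: "y \<in> W" "z = x1 + y" by (auto simp: V_def)
      then have "y - dv l \<in> W" using dvW[OF l] subspace_diff[OF subW] by blast
      then have "y - dv l \<in> (\<lambda>x. A *v x) ` W" by (simp only: AWW)
      then obtain y' where y': "y' \<in> W" "A *v y' = y - dv l" by (auto elim: imageE)
      then have "z = \<phi> l (x1 + y')" by (simp add: phiV[OF l] y)
      then show "z \<in> \<phi> l ` V" using y'(1) by (auto simp: V_def)
    qed
  qed
  moreover have "affine V" unfolding V_def using affine_translation[of W x1] subspace_imp_affine[OF subW] by simp
  moreover have "V \<noteq> {}" using subspace_0[OF subW] by (auto simp: V_def)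
  moreover have "V \<noteq> UNIV"
  proof
    assume "V = UNIV"
    then have "x1 + w \<in> V" by simp
    then have "w \<in> W" by (auto simp: V_def)
    then show False using wU w0 by (auto simp: W_def)
  qed
  ultimately have "affine V \<and> V \<noteq> {} \<and> V \<noteq> UNIV \<and> (\<forall>l\<in>{1..m}. \<phi> l ` V = V)"
    by (intro conjI ballI)
  then have "\<exists>V. affine V \<and> V \<noteq> {} \<and> V \<noteq> UNIV \<and> (\<forall>l\<in>{1..m}. \<phi> l ` V = V)" by (rule exI)
  with irr show False unfolding affinely_irreducible_def by (rule notE)
qed

lemma Ei_recurrence:
  obtains ch :: "nat \<Rightarrow> real" and D where "\<And>n x. (Ei ^^ (n + D)) x = (\<Sum>i<D. ch i *\<^sub>R ((Ei ^^ (n + i)) x))"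
proof (rule matrix_recurrence[of Em])
  fix ch :: "nat \<Rightarrow> real" and D
  assume "\<And>n x. ((\<lambda>x. Em *v x) ^^ (n + D)) x = (\<Sum>i<D. ch i *\<^sub>R (((\<lambda>x. Em *v x) ^^ (n + i)) x))"
  then show thesis by (intro that[of D ch]) (simp only: Ei_def[abs_def])
qed

text \<open>By the recurrence of \<open>Ei\<close>, observations at \<open>D\<close> consecutive
  times determine the vector, so their sum of squares \<open>S\<close> is a positive definite
  quadratic form. Vanishing observations thus force \<open>(Ei ^^ n) y\<close> to tend to 0, and the
  contracting \<open>At ^^ n\<close> carries this back to \<open>y\<close>.\<close>

lemma observable_limit:
  assumes y: "\<And>l. l \<in> {1..m} \<Longrightarrow> (\<lambda>n. (Ei ^^ n) y \<bullet> dv l) \<longlonglongrightarrow> 0"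
  shows "y = 0"
proof -
  obtain D and ch :: "nat \<Rightarrow> real" where rec: "\<And>n x. (Ei ^^ (n + D)) x = (\<Sum>i<D. ch i *\<^sub>R ((Ei ^^ (n + i)) x))"
    by (rule Ei_recurrence) (rule that)
  define S where "S w = (\<Sum>i<D. \<Sum>l\<in>{1..m}. ((Ei ^^ i) w \<bullet> dv l)\<^sup>2)" for w
  have S_nonneg: "0 \<le> S w" for w by (simp add: S_def sum_nonneg)
  have S0: "w = 0" if "S w = 0" for w
  proof (rule irreducible_observable)
    fix n l assume l: "l \<in> {1..m}"
    have base: "(Ei ^^ i) w \<bullet> dv l = 0" if "i < D" for i
    proof -
      define f where "f i = (\<Sum>l\<in>{1..m}. ((Ei ^^ i) w \<bullet> dv l)\<^sup>2)" for i
      have fn: "0 \<le> f i" for i by (simp add: f_def sum_nonneg)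
      have "sum f {..<D} = 0" using \<open>S w = 0\<close> by (simp add: S_def f_def)
      then have "f i = 0" using sum_nonneg_eq_0_iff[of "{..<D}" f] fn that by simp
      define g where "g l = ((Ei ^^ i) w \<bullet> dv l)\<^sup>2" for l
      have "sum g {1..m} = 0" using \<open>f i = 0\<close> by (simp add: f_def g_def)
      then have "g l = 0" using sum_nonneg_eq_0_iff[of "{1..m}" g] l by (simp add: g_def)
      then show ?thesis by (simp add: g_def)
    qed
    show "(Ei ^^ n) w \<bullet> dv l = 0"
    proof (induction n rule: less_induct)
      case (less n)
      show ?case
      proof (cases "n < D")
        case False
        then have nD: "n - D + D = n" by simp
        have "(Ei ^^ n) w = (\<Sum>i<D. ch i *\<^sub>R ((Ei ^^ (n - D + i)) w))"
          using rec[of "n - D" w] unfolding nD .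
        then have "(Ei ^^ n) w \<bullet> dv l = (\<Sum>i<D. ch i * ((Ei ^^ (n - D + i)) w \<bullet> dv l))"
          by (simp only: inner_sum_left inner_scaleR_left)
        also have "\<dots> = 0"
        proof (intro sum.neutral ballI)
          fix i assume "i \<in> {..<D}"
          then have "n - D + i < n" using False by simp
          from less.IH[OF this] show "ch i * ((Ei ^^ (n - D + i)) w \<bullet> dv l) = 0" by (simp only: mult_zero_right)
        qed
        finally show ?thesis .
      qed (rule base)
    qed
  qed
  have cont: "continuous_on UNIV S"
    unfolding S_def
    by (intro continuous_intros linear_continuous_on) (simp add: linear_conv_bounded_linear[symmetric] linear_pow linear_Ei)
  obtain s where s: "s > 0" "\<And>w. norm w = 1 \<Longrightarrow> s \<le> S w"
  proof (cases "sphere (0 :: real ^ 'd) 1 = {}")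
    case True
    then show ?thesis using that[of 1] by auto
  next
    case False
    obtain w0 where w0: "w0 \<in> sphere 0 1" "\<And>w. w \<in> sphere 0 1 \<Longrightarrow> S w0 \<le> S w"
      using continuous_attains_inf[OF compact_sphere False continuous_on_subset[OF cont]] by blast
    have "S w0 \<noteq> 0" using S0[of w0] w0(1) by auto
    then show ?thesis using that[of "S w0"] S_nonneg[of w0] w0(2) by auto
  qed
  have S_ge: "s * (norm w)\<^sup>2 \<le> S w" for w
  proof (cases "w = 0")
    case False
    have "S w = (norm w)\<^sup>2 * S (w /\<^sub>R norm w)"
      using False unfolding S_def
      by (simp add: linear_scale[OF linear_pow[OF linear_Ei]] sum_distrib_left power_mult_distrib field_simps)
    moreover have "s \<le> S (w /\<^sub>R norm w)" using False by (intro s(2)) simp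
    moreover from this have "(norm w)\<^sup>2 * s \<le> (norm w)\<^sup>2 * S (w /\<^sub>R norm w)" by (rule mult_left_mono) simp
    ultimately show ?thesis by (simp only: mult.commute)
  qed (simp add: S_nonneg)
  have "(\<lambda>n. S ((Ei ^^ n) y)) \<longlonglongrightarrow> (\<Sum>i<D. \<Sum>l\<in>{1..m}. 0\<^sup>2)"
    unfolding S_def
  proof (intro tendsto_sum tendsto_power)
    fix i l assume l: "l \<in> {1..m}"
    have "(\<lambda>n. (Ei ^^ (n + i)) y \<bullet> dv l) \<longlonglongrightarrow> 0" by (rule LIMSEQ_ignore_initial_segment[OF y[OF l]])
    moreover have "(\<lambda>n. (Ei ^^ i) ((Ei ^^ n) y) \<bullet> dv l) = (\<lambda>n. (Ei ^^ (n + i)) y \<bullet> dv l)"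
      by (rule ext) (metis add.commute comp_apply funpow_add)
    ultimately show "(\<lambda>n. (Ei ^^ i) ((Ei ^^ n) y) \<bullet> dv l) \<longlonglongrightarrow> 0" by (simp only:)
  qed
  then have Sl: "(\<lambda>n. S ((Ei ^^ n) y) / s) \<longlonglongrightarrow> 0 / s" by (intro tendsto_divide tendsto_const) (use s in auto)
  have "(\<lambda>n. (norm ((Ei ^^ n) y))\<^sup>2) \<longlonglongrightarrow> 0"
  proof (rule real_tendsto_sandwich[OF _ _ tendsto_const])
    show "(\<lambda>n. S ((Ei ^^ n) y) / s) \<longlonglongrightarrow> 0" using Sl by simp
    show "\<forall>\<^sub>F n in sequentially. (norm ((Ei ^^ n) y))\<^sup>2 \<le> S ((Ei ^^ n) y) / s"
      using S_ge s(1) by (intro always_eventually allI) (simp add: field_simps)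
  qed simp
  from tendsto_real_sqrt[OF this] have nl: "(\<lambda>n. norm ((Ei ^^ n) y)) \<longlonglongrightarrow> 0" by simp
  obtain \<epsilon> :: "nat \<Rightarrow> real" where \<epsilon>: "\<epsilon> \<longlonglongrightarrow> 0" "\<And>n y. norm ((At ^^ n) y) \<le> \<epsilon> n * norm y"
    using At_pow_uniform by blast
  have "norm y \<le> \<epsilon> n * norm ((Ei ^^ n) y)" for n using \<epsilon>(2)[of n "(Ei ^^ n) y"] by simp
  moreover have "(\<lambda>n. \<epsilon> n * norm ((Ei ^^ n) y)) \<longlonglongrightarrow> 0 * 0" by (intro tendsto_mult \<epsilon>(1) nl)
  ultimately have "norm y \<le> 0 * 0" by (intro LIMSEQ_le_const) auto
  then show "y = 0" by simp
qed

end

subsection \<open>Avoiding the zeros of the mask along an orbit\<close>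

lemma ee_cong: "x - y \<in> \<int> \<Longrightarrow> ee x = ee y"
  using ee_add[of y "x - y"] ee_int[of "x - y"] by simp

text \<open>All terms point into the open right half-plane.\<close>

lemma ee_sum_nonzero:
  fixes p x :: "nat \<Rightarrow> real"
  assumes p: "\<And>l. l \<in> {1..m} \<Longrightarrow> 0 < p l" and m: "1 \<le> m"
    and x: "\<And>l. l \<in> {1..m} \<Longrightarrow> \<exists>y. x l - y \<in> \<int> \<and> \<bar>y\<bar> < 1 / 4"
  shows "(\<Sum>l\<in>{1..m}. p l * ee (x l)) \<noteq> 0"
proof -
  have pos: "0 < Re (p l * ee (x l))" if l: "l \<in> {1..m}" for l
  proof -
    obtain y where y: "x l - y \<in> \<int>" "\<bar>y\<bar> < 1 / 4" using x[OF l] by auto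
    have "\<bar>2 * pi * y\<bar> < pi / 2" using y(2) by (simp add: abs_mult)
    then have "0 < cos (2 * pi * y)" by (intro cos_gt_zero_pi) linarith+
    then show ?thesis using p[OF l] ee_cong[OF y(1)] by (simp add: ee_def)
  qed
  have "0 < (\<Sum>l\<in>{1..m}. Re (p l * ee (x l)))"
    by (rule sum_pos) (use m pos in auto)
  then have "0 < Re (\<Sum>l\<in>{1..m}. p l * ee (x l))" by (simp only: Re_sum)
  then show ?thesis by (intro notI) (simp only: zero_complex.sel less_irrefl)
qed

lemma poly_times_power_tendsto_0:
  fixes r :: real
  assumes "0 \<le> r" "r < 1"
  shows "(\<lambda>N. (real N + 1) ^ k * r ^ N) \<longlonglongrightarrow> 0"
  using assms
proof (induction k arbitrary: r)
  case 0
  then show ?case by (simp add: LIMSEQ_power_zero)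
next
  case (Suc k)
  define s where "s = sqrt r"
  have s: "0 \<le> s" "s < 1" "r = s * s" using Suc.prems by (auto simp: s_def)
  have "(\<lambda>N. real N * s ^ N + s ^ N) \<longlonglongrightarrow> 0 + 0"
    using s by (intro tendsto_add powser_times_n_limit_0 LIMSEQ_power_zero) auto
  from tendsto_mult[OF Suc.IH[OF s(1,2)] this]
  show ?case by (simp add: s(3) power_mult_distrib algebra_simps)
qed

text \<open>
  The contributions of the conjugates outside and inside the unit circle are \<open>\<phi>\<close> and \<open>\<iota>\<close>. Near time
  \<open>0\<close> the phase depends on \<open>b\<close> only through the small frequency \<open>\<iota> t l (n + L)\<close> modulo 1, near time \<open>- L\<close> it
  depends on \<open>a\<close> only through the small frequency \<open>\<phi> t l n\<close>, and elsewhere all phases are close to integers.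
  The parameter \<open>t\<close> is chosen so that these frequencies coincide only for related indices.
\<close>

lemma avoid_zeros:
  fixes \<phi> \<iota> :: "nat \<Rightarrow> nat \<Rightarrow> int \<Rightarrow> real" and p :: "nat \<Rightarrow> real"
  assumes p: "\<And>l. l \<in> {1..m} \<Longrightarrow> 0 < p l" and m: "1 \<le> m"
    and \<rho>: "0 < \<rho>" "\<rho> < 1" and C: "0 \<le> C"
    and int: "\<And>t l n. 0 \<le> n \<Longrightarrow> l \<in> {1..m} \<Longrightarrow> \<phi> t l n + \<iota> t l n \<in> \<int>"
    and b1: "\<And>t l n. n \<le> 0 \<Longrightarrow> l \<in> {1..m} \<Longrightarrow> \<bar>\<phi> t l n\<bar> \<le> C * (real t + 1) ^ D * \<rho> ^ nat (- n)"
    and b2: "\<And>t l n. 0 \<le> n \<Longrightarrow> l \<in> {1..m} \<Longrightarrow> \<bar>\<iota> t l n\<bar> \<le> C * (real t + 1) ^ D * \<rho> ^ nat n"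
    and triv: "\<And>t l l' n. R l l' \<Longrightarrow> \<phi> t l n = \<phi> t l' n"
    and nt1: "\<And>l l' n. l \<in> {1..m} \<Longrightarrow> l' \<in> {1..m} \<Longrightarrow> \<not> R l l' \<Longrightarrow>
        finite {t. \<phi> t l n = \<phi> t l' n} \<and> card {t. \<phi> t l n = \<phi> t l' n} \<le> D"
    and nt2: "\<And>l l' n. l \<in> {1..m} \<Longrightarrow> l' \<in> {1..m} \<Longrightarrow> \<not> R l l' \<Longrightarrow>
        finite {t. \<iota> t l n = \<iota> t l' n} \<and> card {t. \<iota> t l n = \<iota> t l' n} \<le> D"
    and l0: "l0 \<in> {1..m}" "l1 \<in> {1..m}" "\<not> R l0 l1"
  obtains t a b :: nat and L :: int where "0 < L"
    "\<And>n. (\<Sum>l\<in>{1..m}. p l * ee (real a * \<phi> t l n + real b * \<phi> t l (n + L))) \<noteq> 0"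
    "real a * \<phi> t l0 (- L) + real b * \<phi> t l0 0 \<noteq> real a * \<phi> t l1 (- L) + real b * \<phi> t l1 0"
proof -
  \<comment> \<open>Counting constants. Of the \<open>K * K\<close> pairs \<open>(a, b)\<close>, the
    two windows exclude at most \<open>2 * (2 * N + 1) * K * (2 * m)\<close> and the final condition
    at most \<open>K\<close>. Of the \<open>T\<close> parameters \<open>t\<close>, each of at most
    \<open>(2 * N + 1) * (m * m)\<close> triples \<open>(j, l, l')\<close> excludes at most
    \<open>2 * D\<close>.\<close>
  define Kf where "Kf N = 4 * m * (2 * N + 1) + 2" for N :: nat
  define Tf where "Tf N = 2 * (2 * N + 1) * (m * m) * D + 1" for N :: nat
  \<comment> \<open>\<open>K\<close> and \<open>T\<close> grow linearly in \<open>N\<close>, so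
    multiplier times deviation is at most a polynomial in \<open>N\<close> times
    \<open>\<rho> ^ N\<close>; \<open>c\<close> collects the constants, and \<open>N\<close> is
    chosen to push the product below 1/8.\<close>
  define c where "c = C * real (8 * m + 2) * real (4 * (m * m) * D + 2) ^ D"
  have "(\<lambda>N. c * ((real N + 1) ^ Suc D * \<rho> ^ N)) \<longlonglongrightarrow> c * 0"
    using \<rho> by (intro tendsto_mult tendsto_const poly_times_power_tendsto_0) auto
  then have "\<forall>\<^sub>F N in sequentially. c * ((real N + 1) ^ Suc D * \<rho> ^ N) < 1 / 8"
    by (intro order_tendstoD(2)[where y = "c * 0"]) auto
  then obtain N where N: "c * ((real N + 1) ^ Suc D * \<rho> ^ N) < 1 / 8"
    by (auto simp: eventually_sequentially)
  define K where "K = Kf N"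
  define T where "T = Tf N"
  \<comment> \<open>This offset moves the window \<open>J\<close> wholly into times at least
    \<open>N\<close> by \<open>+ L\<close> and at most \<open>- N\<close> by \<open>- L\<close>, so
    at most one of the two phases is away from its asymptotic regime.\<close>
  define L where "L = 2 * int N + 1"
  define J where "J = {- int N..int N}"
  have cardJ: "card J = 2 * N + 1" and finJ: "finite J" by (simp_all add: J_def)
  have "real K \<le> real (8 * m + 2) * (real N + 1)"
  proof -
    have "K \<le> (8 * m + 2) * (N + 1)" by (simp add: K_def Kf_def algebra_simps)
    then have "real K \<le> real ((8 * m + 2) * (N + 1))" by (simp only: of_nat_le_iff)
    then show ?thesis by (simp add: algebra_simps)
  qed
  moreover have TN: "(real T + 1) ^ D \<le> (real (4 * (m * m) * D + 2) * (real N + 1)) ^ D"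
  proof (rule power_mono)
    have "T + 1 \<le> (4 * (m * m) * D + 2) * (N + 1)" by (simp add: T_def Tf_def algebra_simps)
    then have "real (T + 1) \<le> real ((4 * (m * m) * D + 2) * (N + 1))" by (simp only: of_nat_le_iff)
    then show "real T + 1 \<le> real (4 * (m * m) * D + 2) * (real N + 1)" by (simp add: algebra_simps)
  qed simp
  ultimately have "real K * (real T + 1) ^ D
      \<le> (real (8 * m + 2) * (real N + 1)) * (real (4 * (m * m) * D + 2) * (real N + 1)) ^ D"
    by (intro mult_mono) auto
  then have "(C * \<rho> ^ N) * (real K * (real T + 1) ^ D)
      \<le> (C * \<rho> ^ N) * ((real (8 * m + 2) * (real N + 1)) * (real (4 * (m * m) * D + 2) * (real N + 1)) ^ D)"
    using C \<rho> by (intro mult_left_mono) auto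
  also have "\<dots> = c * ((real N + 1) ^ Suc D * \<rho> ^ N)"
    unfolding c_def power_mult_distrib power_Suc by (simp only: mult_ac)
  finally have small: "(C * \<rho> ^ N) * (real K * (real T + 1) ^ D) < 1 / 8" using N by linarith
  define Bad where "Bad = (\<Union>(j, l, l')\<in>{(j, l, l'). j \<in> J \<and> l \<in> {1..m} \<and> l' \<in> {1..m} \<and> \<not> R l l'}.
      {t. \<phi> t l (j - L) = \<phi> t l' (j - L)} \<union> {t. \<iota> t l (j + L) = \<iota> t l' (j + L)})"
  define I where "I = {(j, l, l'). j \<in> J \<and> l \<in> {1..m} \<and> l' \<in> {1..m} \<and> \<not> R l l'}"
  define BB where "BB = (\<lambda>(j, l, l'). {t. \<phi> t l (j - L) = \<phi> t l' (j - L)} \<union> {t. \<iota> t l (j + L) = \<iota> t l' (j + L)})"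
  have Isub: "I \<subseteq> J \<times> {1..m} \<times> {1..m}" by (auto simp: I_def)
  then have finI: "finite I" by (rule finite_subset) (simp add: finJ)
  have "card I \<le> card (J \<times> {1..m} \<times> {1..m})" by (rule card_mono[OF _ Isub]) (simp add: finJ)
  then have cardI: "card I \<le> (2 * N + 1) * (m * m)" by (simp only: card_cartesian_product cardJ) simp
  have BBfin: "finite (BB i) \<and> card (BB i) \<le> 2 * D" if i: "i \<in> I" for i
  proof -
    obtain j l l' where i': "i = (j, l, l')" "l \<in> {1..m}" "l' \<in> {1..m}" "\<not> R l l'" using i by (auto simp: I_def)
    have "card (BB i) \<le> card {t. \<phi> t l (j - L) = \<phi> t l' (j - L)} + card {t. \<iota> t l (j + L) = \<iota> t l' (j + L)}"
      by (simp add: BB_def i'(1) card_Un_le)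
    then show ?thesis using nt1[OF i'(2-4), of "j - L"] nt2[OF i'(2-4), of "j + L"]
      by (simp add: BB_def i'(1))
  qed
  have "\<exists>t\<in>{..<T}. t \<notin> (\<Union>i\<in>I. BB i)"
  proof (rule ccontr)
    assume "\<not> ?thesis"
    then have "{..<T} \<subseteq> (\<Union>i\<in>I. BB i)" by blast
    then have "card {..<T} \<le> card (\<Union>i\<in>I. BB i)" by (rule card_mono[rotated]) (use finI BBfin in auto)
    also have "\<dots> \<le> (\<Sum>i\<in>I. card (BB i))" by (rule card_UN_le[OF finI])
    also have "\<dots> \<le> (\<Sum>i\<in>I. 2 * D)" by (rule sum_mono) (use BBfin in auto)
    also have "\<dots> \<le> ((2 * N + 1) * (m * m)) * (2 * D)" using cardI by (simp del: One_nat_def)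
    finally show False by (simp add: T_def Tf_def algebra_simps)
  qed
  then obtain t where t: "t < T" "t \<notin> (\<Union>i\<in>I. BB i)" by auto
  have tne: "\<phi> t l (j - L) \<noteq> \<phi> t l' (j - L)" "\<iota> t l (j + L) \<noteq> \<iota> t l' (j + L)"
    if "j \<in> J" "l \<in> {1..m}" "l' \<in> {1..m}" "\<not> R l l'" for j l l'
  proof -
    have "(j, l, l') \<in> I" using that by (simp add: I_def)
    then have "t \<notin> BB (j, l, l')" using t(2) by blast
    then show "\<phi> t l (j - L) \<noteq> \<phi> t l' (j - L)" "\<iota> t l (j + L) \<noteq> \<iota> t l' (j + L)" by (auto simp: BB_def)
  qed
  define E where "E = C * (real t + 1) ^ D"
  have E0: "0 \<le> E" using C by (simp add: E_def)
  have KE: "real K * E * \<rho> ^ k < 1 / 8" if "N \<le> k" for k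
  proof -
    have "(real t + 1) ^ D \<le> (real T + 1) ^ D" using t(1) by (intro power_mono) auto
    moreover have "\<rho> ^ k \<le> \<rho> ^ N" using that \<rho> by (intro power_decreasing) auto
    ultimately have "(C * \<rho> ^ k) * (real K * (real t + 1) ^ D) \<le> (C * \<rho> ^ N) * (real K * (real T + 1) ^ D)"
      using C \<rho> by (intro mult_mono mult_left_mono) auto
    moreover have "real K * E * \<rho> ^ k = (C * \<rho> ^ k) * (real K * (real t + 1) ^ D)" by (simp add: E_def)
    ultimately show ?thesis using small by linarith
  qed
  have Kphi: "\<bar>\<phi> t l n\<bar> * real K < 1 / 8" if "n \<le> - int N" "l \<in> {1..m}" for l n
  proof -
    have "\<bar>\<phi> t l n\<bar> \<le> E * \<rho> ^ nat (- n)" using b1[of n l t] that by (simp add: E_def)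
    then have "\<bar>\<phi> t l n\<bar> * real K \<le> E * \<rho> ^ nat (- n) * real K" by (rule mult_right_mono) simp
    also have "\<dots> = real K * E * \<rho> ^ nat (- n)" by (simp only: mult_ac)
    also have "\<dots> < 1 / 8" by (rule KE) (use that in linarith)
    finally show ?thesis .
  qed
  have Kiota: "\<bar>\<iota> t l n\<bar> * real K < 1 / 8" if "int N \<le> n" "l \<in> {1..m}" for l n
  proof -
    have "\<bar>\<iota> t l n\<bar> \<le> E * \<rho> ^ nat n" using b2[of n l t] that by (simp add: E_def)
    then have "\<bar>\<iota> t l n\<bar> * real K \<le> E * \<rho> ^ nat n * real K" by (rule mult_right_mono) simp
    also have "\<dots> = real K * E * \<rho> ^ nat n" by (simp only: mult_ac)
    also have "\<dots> < 1 / 8" by (rule KE) (use that in linarith)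
    finally show ?thesis .
  qed
  have K0: "0 < K" by (simp add: K_def Kf_def)
  define F where "F a b n = (\<Sum>l\<in>{1..m}. p l * ee (real a * \<phi> t l n + real b * \<phi> t l (n + L)))" for a b :: nat and n
  \<comment> \<open>In the far past \<open>\<phi>\<close> itself is small; in the far future it
    differs from the small \<open>- \<iota>\<close> by an integer, and multiplication by the integer
    \<open>a\<close> preserves this.\<close>
  have near: "\<exists>y. real a * \<phi> t l n - y \<in> \<int> \<and> \<bar>y\<bar> < 1 / 8"
    if a: "a \<in> {1..K}" and n: "n \<le> - int N \<or> int N \<le> n" and l: "l \<in> {1..m}" for a l n
    using n
  proof
    assume "n \<le> - int N"
    then have "\<bar>\<phi> t l n\<bar> * real K < 1 / 8" using l by (rule Kphi)
    moreover have "\<bar>\<phi> t l n\<bar> * real a \<le> \<bar>\<phi> t l n\<bar> * real K" using a by (intro mult_left_mono) auto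
    ultimately have "\<bar>real a * \<phi> t l n\<bar> < 1 / 8" by (simp add: abs_mult mult.commute)
    then show ?thesis by (intro exI[of _ "real a * \<phi> t l n"]) simp
  next
    assume n': "int N \<le> n"
    then have "\<bar>\<iota> t l n\<bar> * real K < 1 / 8" using l by (rule Kiota)
    moreover have "\<bar>\<iota> t l n\<bar> * real a \<le> \<bar>\<iota> t l n\<bar> * real K" using a by (intro mult_left_mono) auto
    ultimately have "\<bar>- (real a * \<iota> t l n)\<bar> < 1 / 8" by (simp add: abs_mult mult.commute)
    moreover have "real a * (\<phi> t l n + \<iota> t l n) \<in> \<int>" by (intro Ints_mult int) (use n' l in auto)
    ultimately show ?thesis by (intro exI[of _ "- (real a * \<iota> t l n)"]) (simp add: distrib_left)
  qed
  have outside: "F a b n \<noteq> 0" if a: "a \<in> {1..K}" and b: "b \<in> {1..K}" and n: "n \<notin> J" "n + L \<notin> J" for a b n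
    unfolding F_def
  proof (rule ee_sum_nonzero[OF p m])
    fix l assume l: "l \<in> {1..m}"
    have "n \<le> - int N \<or> int N \<le> n" "n + L \<le> - int N \<or> int N \<le> n + L" using n by (auto simp: J_def)
    then obtain y y' where "real a * \<phi> t l n - y \<in> \<int>" "\<bar>y\<bar> < 1 / 8"
      "real b * \<phi> t l (n + L) - y' \<in> \<int>" "\<bar>y'\<bar> < 1 / 8"
      using near[OF a _ l] near[OF b _ l] by metis
    moreover from this have "(real a * \<phi> t l n - y) + (real b * \<phi> t l (n + L) - y') \<in> \<int>" by (intro Ints_add)
    ultimately show "\<exists>y. real a * \<phi> t l n + real b * \<phi> t l (n + L) - y \<in> \<int> \<and> \<bar>y\<bar> < 1 / 4"
      by (intro exI[of _ "y + y'"] conjI) (simp add: algebra_simps, linarith)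
  qed
  \<comment> \<open>The consistency hypothesis of \<open>exp_sum_zeros\<close> holds because equal
    frequencies force \<open>R l l'\<close> by the choice of \<open>t\<close>, and related indices
    have equal phases at every time.\<close>
  have cb: "card {b \<in> {1..K}. F a b j = 0} \<le> 2 * m" if j: "j \<in> J" for a j
  proof -
    have jL: "int N \<le> j + L" using j by (auto simp: J_def L_def)
    define S where "S = real ` {b \<in> {1..K}. F a b j = 0}"
    have "card S \<le> 2 * m"
    proof (rule exp_sum_zeros[where p = p and c = "\<lambda>l. real a * \<phi> t l j" and \<tau> = "\<lambda>l. - \<iota> t l (j + L)" and K = "real K"])
      show "\<bar>- \<iota> t l (j + L)\<bar> * real K < 1 / 8" if "l \<in> {1..m}" for l using Kiota[OF jL that] by simp
      show "real a * \<phi> t l j = real a * \<phi> t l' j"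
        if "l \<in> {1..m}" "l' \<in> {1..m}" "- \<iota> t l (j + L) = - \<iota> t l' (j + L)" for l l'
      proof -
        have "R l l'" using tne(2)[OF j that(1,2)] that(3) by linarith
        from triv[OF this, of t j] show ?thesis by simp
      qed
      show "(\<Sum>l\<in>{1..m}. p l * ee (real a * \<phi> t l j + s * - \<iota> t l (j + L))) = 0" if "s \<in> S" for s
      proof -
        from that obtain b where b: "s = real b" "F a b j = 0" unfolding S_def by (elim imageE CollectE conjE)
        have "(\<Sum>l\<in>{1..m}. p l * ee (real a * \<phi> t l j + s * - \<iota> t l (j + L))) = F a b j"
          unfolding F_def
        proof (rule sum.cong)
          fix l assume l: "l \<in> {1..m}"
          have "real b * (\<phi> t l (j + L) + \<iota> t l (j + L)) \<in> \<int>" by (intro Ints_mult int) (use jL l in auto)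
          then have "(real a * \<phi> t l j + real b * \<phi> t l (j + L)) - (real a * \<phi> t l j + s * - \<iota> t l (j + L)) \<in> \<int>"
            by (simp add: b(1) distrib_left)
          then show "p l * ee (real a * \<phi> t l j + s * - \<iota> t l (j + L)) = p l * ee (real a * \<phi> t l j + real b * \<phi> t l (j + L))"
            by (simp only: ee_cong)
        qed simp
        then show ?thesis using b(2) by simp
      qed
    qed (use p m K0 in \<open>auto simp: S_def\<close>)
    then show ?thesis by (simp add: S_def card_image)
  qed
  have ca: "card {a \<in> {1..K}. F a b (j - L) = 0} \<le> 2 * m" if j: "j \<in> J" for b j
  proof -
    have jL: "j - L \<le> - int N" using j by (auto simp: J_def L_def)
    define S where "S = real ` {a \<in> {1..K}. F a b (j - L) = 0}"
    have "card S \<le> 2 * m"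
    proof (rule exp_sum_zeros[where p = p and c = "\<lambda>l. real b * \<phi> t l j" and \<tau> = "\<lambda>l. \<phi> t l (j - L)" and K = "real K"])
      show "\<bar>\<phi> t l (j - L)\<bar> * real K < 1 / 8" if "l \<in> {1..m}" for l using Kphi[OF jL that] by simp
      show "real b * \<phi> t l j = real b * \<phi> t l' j"
        if "l \<in> {1..m}" "l' \<in> {1..m}" "\<phi> t l (j - L) = \<phi> t l' (j - L)" for l l'
      proof -
        have "R l l'" using tne(1)[OF j that(1,2)] that(3) by linarith
        from triv[OF this, of t j] show ?thesis by simp
      qed
      show "(\<Sum>l\<in>{1..m}. p l * ee (real b * \<phi> t l j + s * \<phi> t l (j - L))) = 0" if "s \<in> S" for s
      proof -
        from that obtain a where a: "s = real a" "F a b (j - L) = 0" unfolding S_def by (elim imageE CollectE conjE)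
        then show ?thesis by (simp add: F_def add.commute)
      qed
    qed (use p m K0 in \<open>auto simp: S_def\<close>)
    then show ?thesis by (simp add: S_def card_image)
  qed
  \<comment> \<open>This condition will certify that the orbit built from \<open>a\<close> and
    \<open>b\<close> is not the zero orbit. It is affine in \<open>a\<close> with nonzero slope, so
    each \<open>b\<close> excludes at most one \<open>a\<close>.\<close>
  define G where "G a b \<longleftrightarrow> real a * \<phi> t l0 (- L) + real b * \<phi> t l0 0 \<noteq> real a * \<phi> t l1 (- L) + real b * \<phi> t l1 0" for a b :: nat
  have cG: "card {a \<in> {1..K}. \<not> G a b} \<le> 1" for b
  proof -
    have ne: "\<phi> t l0 (- L) - \<phi> t l1 (- L) \<noteq> 0" using tne(1)[of 0 l0 l1] l0 by (simp add: J_def)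
    have "a = a'" if "\<not> G a b" "\<not> G a' b" for a a'
    proof -
      have "(real a - real a') * (\<phi> t l0 (- L) - \<phi> t l1 (- L)) = 0" using that unfolding G_def by (simp add: algebra_simps)
      then show ?thesis using ne by simp
    qed
    then show ?thesis by (intro card_le_Suc0_iff_eq[THEN iffD2, unfolded One_nat_def[symmetric]]) auto
  qed
  define B1 where "B1 = (\<Union>(j, a)\<in>J \<times> {1..K}. {a} \<times> {b \<in> {1..K}. F a b j = 0})"
  define B2 where "B2 = (\<Union>(j, b)\<in>J \<times> {1..K}. {a \<in> {1..K}. F a b (j - L) = 0} \<times> {b})"
  define B3 where "B3 = (\<Union>b\<in>{1..K}. {a \<in> {1..K}. \<not> G a b} \<times> {b})"
  have fin: "finite B1" "finite B2" "finite B3" by (auto simp: B1_def B2_def B3_def finJ)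
  have "card B1 \<le> (\<Sum>x\<in>J \<times> {1..K}. 2 * m)"
    unfolding B1_def
  proof (rule order_trans[OF card_UN_le sum_mono])
    fix x assume "x \<in> J \<times> {1..K}"
    then show "card (case x of (j, a) \<Rightarrow> {a} \<times> {b \<in> {1..K}. F a b j = 0}) \<le> 2 * m"
      using cb by (cases x) (simp add: card_cartesian_product)
  qed (simp add: finJ)
  moreover have "card B2 \<le> (\<Sum>x\<in>J \<times> {1..K}. 2 * m)"
    unfolding B2_def
  proof (rule order_trans[OF card_UN_le sum_mono])
    fix x assume "x \<in> J \<times> {1..K}"
    then show "card (case x of (j, b) \<Rightarrow> {a \<in> {1..K}. F a b (j - L) = 0} \<times> {b}) \<le> 2 * m"
      using ca by (cases x) (simp add: card_cartesian_product)
  qed (simp add: finJ)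
  moreover have "card B3 \<le> (\<Sum>b\<in>{1..K}. 1)"
    unfolding B3_def
  proof (rule order_trans[OF card_UN_le sum_mono])
    show "card ({a \<in> {1..K}. \<not> G a b} \<times> {b}) \<le> 1" for b using cG by (simp add: card_cartesian_product)
  qed simp
  moreover have "card (B1 \<union> B2 \<union> B3) \<le> card B1 + card B2 + card B3"
    by (rule order_trans[OF card_Un_le add_right_mono[OF card_Un_le]])
  ultimately have "card (B1 \<union> B2 \<union> B3) \<le> K * (4 * m * (2 * N + 1) + 1)"
    by (simp add: cardJ card_cartesian_product algebra_simps)
  also have "\<dots> < K * K" using K0 by (simp add: K_def Kf_def)
  finally have lt: "card (B1 \<union> B2 \<union> B3) < card ({1..K} \<times> {1..K})" by (simp add: card_cartesian_product)
  have "\<not> {1..K} \<times> {1..K} \<subseteq> B1 \<union> B2 \<union> B3"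
  proof
    assume "{1..K} \<times> {1..K} \<subseteq> B1 \<union> B2 \<union> B3"
    then have "card ({1..K} \<times> {1..K}) \<le> card (B1 \<union> B2 \<union> B3)" by (rule card_mono[rotated]) (simp add: fin)
    then show False using lt by linarith
  qed
  then obtain a b where ab: "a \<in> {1..K}" "b \<in> {1..K}" "(a, b) \<notin> B1" "(a, b) \<notin> B2" "(a, b) \<notin> B3" by blast
  have nz: "F a b n \<noteq> 0" for n
  proof (cases "n \<in> J")
    case True
    then show ?thesis using ab by (auto simp: B1_def)
  next
    case False
    show ?thesis
    proof (cases "n + L \<in> J")
      case True
      have "F a b ((n + L) - L) \<noteq> 0"
      proof
        assume "F a b ((n + L) - L) = 0"
        then have "(a, b) \<in> B2" unfolding B2_def by (intro UN_I[of "(n + L, b)"]) (use True ab in simp_all)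
        then show False using ab by simp
      qed
      then show ?thesis by simp
    next
      case False
      then show ?thesis using outside[OF ab(1,2) \<open>n \<notin> J\<close>] by simp
    qed
  qed
  have "G a b" using ab by (auto simp: B3_def)
  then show thesis using nz by (intro that[of L a t b]) (simp_all add: L_def G_def F_def)
qed

text \<open>Past the point \<open>n0\<close> where the tails of \<open>e\<close> stay below 1/2, the
  product of the factors \<open>1 - e n\<close> is at least one minus the sum of the
  \<open>e n\<close>; the finitely many earlier values are positive.\<close>

lemma product_bounded_below:
  fixes v e :: "nat \<Rightarrow> real"
  assumes v: "\<And>n. 0 < v n" and e: "\<And>n. 0 \<le> e n" "summable e"
    and step: "\<And>n. (1 - e n) * v n \<le> v (Suc n)"
  obtains c where "0 < c" "\<And>n. c \<le> v n"
proof -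
  obtain n0 where n0: "\<And>k. sum e {n0..<k} < 1 / 2"
  proof -
    have "\<exists>N. \<forall>m\<ge>N. \<forall>n. norm (sum e {m..<n}) < 1 / 2"
      using e(2) unfolding summable_Cauchy by (elim allE[of _ "1 / 2"]) simp
    then obtain N where N: "\<forall>m\<ge>N. \<forall>n. norm (sum e {m..<n}) < 1 / 2" by (rule exE)
    have "sum e {N..<k} < 1 / 2" for k
    proof -
      have "norm (sum e {N..<k}) < 1 / 2" using N by simp
      then show ?thesis unfolding real_norm_def by linarith
    qed
    then show thesis by (rule that)
  qed
  have half: "(1 - sum e {n0..<n0 + k}) * v n0 \<le> v (n0 + k)" for k
  proof (induction k)
    case (Suc k)
    define s where "s = sum e {n0..<n0 + k}"
    have s: "0 \<le> s" "s + e (n0 + k) < 1 / 2"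
      using n0[of "n0 + Suc k"] e(1) by (simp_all add: s_def sum_nonneg)
    have "(1 - sum e {n0..<n0 + Suc k}) * v n0 = (1 - s - e (n0 + k)) * v n0" by (simp add: s_def)
    also have "\<dots> \<le> ((1 - e (n0 + k)) * (1 - s)) * v n0"
    proof (rule mult_right_mono)
      have "0 \<le> s * e (n0 + k)" using s e(1) by simp
      then show "1 - s - e (n0 + k) \<le> (1 - e (n0 + k)) * (1 - s)" by (simp add: algebra_simps)
    qed (use v[of n0] in simp)
    also have "\<dots> = (1 - e (n0 + k)) * ((1 - s) * v n0)" by (simp only: mult.assoc)
    also have "\<dots> \<le> (1 - e (n0 + k)) * v (n0 + k)"
      using Suc s by (intro mult_left_mono) (auto simp: s_def)
    also have "\<dots> \<le> v (Suc (n0 + k))" by (rule step)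
    finally show ?case by simp
  qed simp
  have tail: "v n0 / 2 \<le> v n" if "n0 \<le> n" for n
  proof -
    have "1 / 2 * v n0 \<le> (1 - sum e {n0..<n0 + (n - n0)}) * v n0"
      using n0[of "n0 + (n - n0)"] v[of n0] by (intro mult_right_mono) auto
    also have "\<dots> \<le> v (n0 + (n - n0))" by (rule half)
    finally show ?thesis using that by simp
  qed
  define c where "c = Min (v ` {..n0}) / 2"
  have minpos: "0 < Min (v ` {..n0})" by (subst Min_gr_iff) (use v in auto)
  have cle: "c \<le> v n" for n
  proof (cases "n0 \<le> n")
    case True
    have "Min (v ` {..n0}) \<le> v n0" by (rule Min_le) auto
    then show ?thesis using tail[OF True] unfolding c_def by linarith
  next
    case False
    then have "Min (v ` {..n0}) \<le> v n" by (intro Min_le) auto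
    then show ?thesis using minpos unfolding c_def by linarith
  qed
  show thesis by (rule that[of c]) (use minpos cle in \<open>simp_all add: c_def\<close>)
qed

subsection \<open>Pisot systems of type I\<close>

lemma norm_ee_minus_1: "cmod (ee y - 1) \<le> 2 * pi * \<bar>y\<bar>"
proof -
  define t where "t = 2 * pi * y"
  have "(cmod (ee y - 1))\<^sup>2 = (cos t - 1)\<^sup>2 + (sin t)\<^sup>2"
    by (simp add: cmod_power2 ee_def t_def)
  also have "\<dots> = 2 - 2 * cos t" using sin_cos_squared_add[of t] by (simp add: power2_eq_square algebra_simps)
  also have "\<dots> = (2 * sin (t / 2))\<^sup>2" using cos_double_sin[of "t / 2"] by (simp add: power2_eq_square)
  also have "\<dots> \<le> \<bar>t\<bar>\<^sup>2"
    using abs_sin_x_le_abs_x[of "t / 2"] by (intro power2_le_iff_abs_le[THEN iffD2]) (auto simp: abs_mult)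
  finally show ?thesis using power2_le_imp_le[of "cmod (ee y - 1)" "\<bar>t\<bar>"] by (simp add: t_def abs_mult)
qed

lemma ee_sum_near_1:
  fixes p x :: "nat \<Rightarrow> real"
  assumes p: "\<And>l. l \<in> {1..m} \<Longrightarrow> 0 < p l" "(\<Sum>l\<in>{1..m}. p l) = 1"
    and x: "\<And>l. l \<in> {1..m} \<Longrightarrow> \<exists>y. x l - y \<in> \<int> \<and> \<bar>y\<bar> \<le> \<delta>"
  shows "1 - 2 * pi * \<delta> \<le> cmod (\<Sum>l\<in>{1..m}. p l * ee (x l))"
proof -
  have "(\<Sum>l\<in>{1..m}. p l * ee (x l)) = 1 + (\<Sum>l\<in>{1..m}. p l * (ee (x l) - 1))"
    using arg_cong[OF p(2), of complex_of_real] by (simp add: algebra_simps sum_subtractf)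
  moreover have "cmod (\<Sum>l\<in>{1..m}. p l * (ee (x l) - 1)) \<le> (\<Sum>l\<in>{1..m}. p l * (2 * pi * \<delta>))"
  proof (rule sum_norm_le)
    fix l assume l: "l \<in> {1..m}"
    obtain y where y: "x l - y \<in> \<int>" "\<bar>y\<bar> \<le> \<delta>" using x[OF l] by auto
    have "cmod (ee (x l) - 1) \<le> 2 * pi * \<bar>y\<bar>" using norm_ee_minus_1[of y] by (simp only: ee_cong[OF y(1)])
    also have "\<dots> \<le> 2 * pi * \<delta>" using y(2) by simp
    finally show "cmod (p l * (ee (x l) - 1)) \<le> p l * (2 * pi * \<delta>)"
      using p(1)[OF l] by (simp add: norm_mult)
  qed
  moreover have "(\<Sum>l\<in>{1..m}. p l * (2 * pi * \<delta>)) = 2 * pi * \<delta>"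
    unfolding sum_distrib_right[symmetric] p(2) by simp
  ultimately show ?thesis
    using norm_triangle_ineq4[of "1 + (\<Sum>l\<in>{1..m}. p l * (ee (x l) - 1))" "\<Sum>l\<in>{1..m}. p l * (ee (x l) - 1)"] by simp
qed

text \<open>Vandermonde in polynomial form: combining consecutive power sums with the coefficients
  of a polynomial vanishing on \<open>S\<close> except at \<open>z\<close> isolates the term of
  \<open>z\<close>.\<close>

lemma power_sums_vanish:
  fixes w :: "complex \<Rightarrow> complex" and n :: int
  assumes S: "finite S" "0 \<notin> S" "card S \<le> D"
    and zero: "\<And>i. i < D \<Longrightarrow> (\<Sum>z\<in>S. z powi (n + int i) * w z) = 0"
    and z: "z \<in> S"
  shows "w z = 0"
proof -
  define h where "h = (\<Prod>y\<in>S - {z}. [:- y, 1:])"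
  have "degree h \<le> (\<Sum>y\<in>S - {z}. degree [:- y, 1:])"
    unfolding h_def using degree_prod_sum_le[of "S - {z}" "\<lambda>y. [:- y, 1:]"] S(1) by (simp add: o_def)
  also have "\<dots> = card S - 1" using S(1) z by simp
  also have "\<dots> < card S" using card_gt_0_iff[of S] S(1) z by (intro diff_less) auto
  finally have dh: "degree h < D" using S(3) by simp
  have hy: "poly h y = 0" if "y \<in> S" "y \<noteq> z" for y
    unfolding h_def poly_prod using that S(1) by (intro prod_zero) auto
  have hz: "poly h z \<noteq> 0" unfolding h_def poly_prod using S(1) by auto
  have pw: "y powi (n + int i) = y powi n * y ^ i" if "y \<in> S" for y i
    using that S(2) by (subst power_int_add) auto
  have "(\<Sum>y\<in>S. y powi n * poly h y * w y) = (\<Sum>y\<in>S. \<Sum>i\<le>degree h. coeff h i * (y powi (n + int i) * w y))"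
  proof (rule sum.cong)
    fix y assume "y \<in> S"
    then show "y powi n * poly h y * w y = (\<Sum>i\<le>degree h. coeff h i * (y powi (n + int i) * w y))"
      by (simp add: poly_altdef pw sum_distrib_left sum_distrib_right mult_ac)
  qed simp
  also have "\<dots> = (\<Sum>i\<le>degree h. coeff h i * (\<Sum>y\<in>S. y powi (n + int i) * w y))"
    by (subst sum.swap) (simp add: sum_distrib_left)
  also have "\<dots> = 0"
    by (rule sum.neutral) (use zero dh in auto)
  finally have "(\<Sum>y\<in>S. y powi n * poly h y * w y) = 0" .
  moreover have "(\<Sum>y\<in>S. y powi n * poly h y * w y) = (\<Sum>y\<in>{z}. y powi n * poly h y * w y)"
    by (rule sum.mono_neutral_right) (use S(1) z hy in auto)
  ultimately have "z powi n * poly h z * w z = 0" by simp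
  moreover have "z \<noteq> 0" using z S(2) by metis
  ultimately show ?thesis using hz by simp
qed

lemma conjugate_sum_real:
  fixes w :: "complex \<Rightarrow> complex" and n :: int
  assumes "\<And>z. z \<in> S \<Longrightarrow> cnj z \<in> S" "\<And>z. z \<in> S \<Longrightarrow> w (cnj z) = cnj (w z)"
  shows "complex_of_real (Re (\<Sum>z\<in>S. z powi n * w z)) = (\<Sum>z\<in>S. z powi n * w z)"
proof -
  have pc: "cnj (z powi n) = cnj z powi n" for z by (simp add: power_int_def)
  have "(\<Sum>z\<in>S. z powi n * w z) = (\<Sum>z\<in>S. cnj (z powi n * w z))"
    by (rule sum.reindex_bij_witness[of _ cnj cnj]) (simp_all add: assms pc)
  also have "\<dots> = cnj (\<Sum>z\<in>S. z powi n * w z)" by (simp only: cnj_sum)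
  finally show ?thesis by (metis Reals_cnj_iff of_real_Re)
qed

text \<open>As a function of \<open>t\<close> the sum is a real polynomial whose coefficients are
  consecutive power sums; these cannot all vanish by \<open>power_sums_vanish\<close>. This is the
  reason for inserting the factor \<open>\<Sum>i<D. (t * z) ^ i\<close>: it lets \<open>t\<close>
  run along a moment curve.\<close>

lemma weighted_sum_zeros:
  fixes w :: "complex \<Rightarrow> complex" and n :: int
  assumes S: "finite S" "0 \<notin> S" "card S \<le> D"
    and cnj: "\<And>z. z \<in> S \<Longrightarrow> cnj z \<in> S" "\<And>z. z \<in> S \<Longrightarrow> w (cnj z) = cnj (w z)"
    and z: "z \<in> S" "w z \<noteq> 0"
  defines "Z \<equiv> {t :: nat. Re (\<Sum>z\<in>S. z powi n * ((\<Sum>i<D. (of_nat t * z) ^ i) * w z)) = 0}"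
  shows "finite Z \<and> card Z \<le> D"
proof -
  define s where "s i = (\<Sum>z\<in>S. z powi (n + int i) * w z)" for i
  define Q where "Q = (\<Sum>i<D. monom (Re (s i)) i)"
  have pw: "y powi (n + int i) = y powi n * y ^ i" if "y \<in> S" for y i
    using that S(2) by (subst power_int_add) auto
  have Zeq: "Z = {t. poly Q (real t) = 0}"
  proof -
    have "(\<Sum>z\<in>S. z powi n * ((\<Sum>i<D. (of_nat t * z) ^ i) * w z)) = (\<Sum>i<D. of_real (real t ^ i) * s i)" for t
    proof -
      have "(\<Sum>z\<in>S. z powi n * ((\<Sum>i<D. (of_nat t * z) ^ i) * w z))
        = (\<Sum>z\<in>S. \<Sum>i<D. of_real (real t ^ i) * (z powi (n + int i) * w z))"
        by (rule sum.cong) (simp_all add: pw sum_distrib_left sum_distrib_right power_mult_distrib mult_ac)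
      then show ?thesis by (simp only: sum.swap[of _ _ S] s_def sum_distrib_left)
    qed
    then show ?thesis by (simp add: Z_def Q_def poly_sum poly_monom mult.commute)
  qed
  have "Q \<noteq> 0"
  proof
    assume "Q = 0"
    have "s i = 0" if "i < D" for i
    proof -
      have "coeff Q i = Re (s i)" using that by (simp add: Q_def coeff_sum)
      then have "Re (s i) = 0" using \<open>Q = 0\<close> by simp
      then show ?thesis using conjugate_sum_real[of S w "n + int i", OF cnj] by (simp add: s_def)
    qed
    from power_sums_vanish[OF S, of n w, OF this[unfolded s_def] z(1)] show False using z(2) by simp
  qed
  have sub: "real ` Z \<subseteq> {x. poly Q x = 0}" by (auto simp: Zeq)
  have fin: "finite (real ` Z)" by (rule finite_subset[OF sub poly_roots_finite[OF \<open>Q \<noteq> 0\<close>]])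
  have "finite Z" using finite_imageD[OF fin] by simp
  moreover have "card Z = card (real ` Z)" by (simp add: card_image)
  moreover have "card (real ` Z) \<le> card {x. poly Q x = 0}" by (rule card_mono[OF poly_roots_finite[OF \<open>Q \<noteq> 0\<close>] sub])
  moreover have "card {x. poly Q x = 0} \<le> degree Q" by (rule card_poly_roots_bound[OF \<open>Q \<noteq> 0\<close>])
  moreover have "degree Q \<le> D" unfolding Q_def by (intro degree_sum_le) (auto intro: order_trans[OF degree_monom_le])
  ultimately show ?thesis by linarith
qed

text \<open>If all roots were contracting, the integers \<open>\<Sum> z ^ n / M'(z)\<close> would
  tend to 0 and hence vanish eventually, against \<open>power_sums_vanish\<close>.\<close>

lemma min_int_poly_expanding_root:
  assumes M: "min_int_poly M z0" and roots: "\<And>z. poly (cpoly M) z = 0 \<Longrightarrow> z \<noteq> 0 \<and> cmod z \<noteq> 1"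
  shows "\<exists>z. poly (cpoly M) z = 0 \<and> 1 < cmod z"
proof (rule ccontr)
  assume "\<not> ?thesis"
  then have small: "cmod z < 1" if "poly (cpoly M) z = 0" for z using roots[OF that] that by force
  have lM: "lead_coeff M = 1" and z0: "poly (cpoly M) z0 = 0" using M by (auto simp: min_int_poly_def)
  define S where "S = {z. poly (cpoly M) z = 0}"
  have M0: "cpoly M \<noteq> 0" using lM by auto
  have fin: "finite S" using poly_roots_finite[OF M0] by (simp add: S_def)
  have card: "card S \<le> degree M" using card_poly_roots_bound[OF M0] by (simp add: S_def)
  have simple: "\<And>z. poly (cpoly M) z = 0 \<Longrightarrow> poly (pderiv (cpoly M)) z \<noteq> 0" by (rule min_int_poly_simple_roots[OF M])
  define s where "s n = (\<Sum>z\<in>S. z ^ n * (1 / poly (pderiv (cpoly M)) z))" for n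
  have "s n \<in> \<int>" for n
    using sum_roots_over_deriv_int[OF lM min_int_poly_degree[OF M] simple, of "monom 1 n"]
    by (simp add: s_def S_def map_poly_monom poly_monom)
  moreover have "s \<longlonglongrightarrow> (\<Sum>z\<in>S. 0 * (1 / poly (pderiv (cpoly M)) z))"
    unfolding s_def[abs_def]
    by (intro tendsto_sum tendsto_mult tendsto_const LIMSEQ_power_zero) (use small in \<open>simp add: S_def\<close>)
  then have "s \<longlonglongrightarrow> 0" by simp
  then obtain N where N: "\<And>n. N \<le> n \<Longrightarrow> cmod (s n) < 1" using LIMSEQ_D[of s 0 1] by auto
  ultimately have s0: "s n = 0" if "N \<le> n" for n
  proof -
    obtain k where k: "s n = of_int k" using \<open>s n \<in> \<int>\<close> by (elim Ints_cases)
    have "cmod (of_int k) < 1" using N[OF that] by (simp only: k)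
    then have "\<bar>k\<bar> < 1" by (simp only: norm_of_int)
    then show ?thesis by (simp add: k)
  qed
  have "1 / poly (pderiv (cpoly M)) z0 = 0"
  proof (rule power_sums_vanish[OF fin _ card, of "int N" "\<lambda>z. 1 / poly (pderiv (cpoly M)) z"])
    show "(\<Sum>z\<in>S. z powi (int N + int i) * (1 / poly (pderiv (cpoly M)) z)) = 0" for i
      using s0[of "N + i"] unfolding s_def by (simp only: of_nat_add[symmetric] power_int_of_nat)
    show "0 \<notin> S" using roots[of 0] by (auto simp: S_def)
    show "z0 \<in> S" using z0 by (simp add: S_def)
  qed
  then show False using simple[OF z0] by simp
qed

text \<open>A witness of least degree does not vanish at 0, since a factor \<open>x\<close> could be
  dropped. The minimal polynomial of a contracting root divides it, so its roots are contracting or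
  belong to \<open>B\<close>; it may involve only part of \<open>B\<close>.\<close>

lemma pisot_type_I_min_int_poly:
  assumes "pisot_tuple_type_I B"
  obtains M z0 where "min_int_poly M z0" "cmod z0 < 1"
    "\<And>z. poly (cpoly M) z = 0 \<Longrightarrow> z \<noteq> 0 \<and> (cmod z < 1 \<or> z \<in> B \<and> 1 < cmod z)"
proof -
  obtain P z0 where P: "is_arg_min degree (pisot_witness B) P" and z0: "poly (cpoly P) z0 = 0" "cmod z0 < 1"
    using assms by (auto simp: pisot_tuple_type_I_def)
  have B: "1 < cmod z" if "z \<in> B" for z using assms that by (simp add: pisot_tuple_type_I_def pisot_tuple_def)
  have wP: "pisot_witness B P" and mP: "\<And>Q. pisot_witness B Q \<Longrightarrow> degree P \<le> degree Q"
    using P unfolding is_arg_min_linorder by auto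
  have lP: "lead_coeff P = 1" using wP by (simp add: pisot_witness_def)
  have rP: "z \<in> B \<or> cmod z < 1" if "poly (cpoly P) z = 0" for z using wP that by (auto simp: pisot_witness_def)
  have P0: "poly (cpoly P) 0 \<noteq> 0"
  proof
    assume "poly (cpoly P) 0 = 0"
    then have "coeff P 0 = 0" by (simp add: poly_0_coeff_0 coeff_map_poly)
    then obtain P' where P': "P = pCons 0 P'" by (cases P) auto
    have P'0: "P' \<noteq> 0" using lP P' by auto
    have "pisot_witness B P'"
      unfolding pisot_witness_def
    proof (intro conjI ballI allI impI)
      show "lead_coeff P' = 1" using lP P' P'0 by simp
      fix z assume z: "z \<in> B"
      then have "poly (cpoly P) z = 0" using wP by (simp add: pisot_witness_def)
      then show "poly (cpoly P') z = 0" using B[OF z] by (auto simp: P' cpoly_pCons)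
    next
      fix z assume "poly (cpoly P') z = 0 \<and> z \<notin> B"
      then show "cmod z < 1" using rP[of z] by (simp add: P' cpoly_pCons)
    qed
    from mP[OF this] show False using P'0 by (simp add: P')
  qed
  obtain M where M: "min_int_poly M z0" using min_int_poly_exists[OF lP z0(1)] by blast
  have "poly (cpoly M) z0 = 0" using M by (simp add: min_int_poly_def)
  then have "M dvd P" using min_int_poly_dvd[OF M _ z0(1)] by blast
  then obtain S where S: "P = M * S" by (rule dvdE)
  have "z \<noteq> 0 \<and> (cmod z < 1 \<or> z \<in> B \<and> 1 < cmod z)" if "poly (cpoly M) z = 0" for z
  proof -
    have "poly (cpoly P) z = 0" using that by (simp add: S cpoly_mult)
    then show ?thesis using rP[of z] B[of z] P0 by auto
  qed
  then show thesis using that M z0(2) by blast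
qed

context affine_ifs
begin

lemma P_dv: "cmod (P \<xi>) = cmod (\<Sum>l\<in>{1..m}. p l * ee (\<xi> \<bullet> dv l))"
proof -
  have "P \<xi> = ee (\<xi> \<bullet> a 1) * (\<Sum>l\<in>{1..m}. p l * ee (\<xi> \<bullet> dv l))"
    unfolding P_def sum_distrib_left
  proof (rule sum.cong)
    fix l
    have "ee (\<xi> \<bullet> a l) = ee (\<xi> \<bullet> a 1) * ee (\<xi> \<bullet> dv l)" unfolding ee_add[symmetric] by (simp add: dv_def inner_diff_right)
    then show "p l * ee (\<xi> \<bullet> a l) = ee (\<xi> \<bullet> a 1) * (p l * ee (\<xi> \<bullet> dv l))" by simp
  qed simp
  then show ?thesis by (simp add: norm_mult)
qed

text \<open>The real part of \<open>c * v\<close>. For an eigenvector \<open>v\<close> of the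
  transpose, \<open>At\<close> acts on such vectors by multiplying the scalar \<open>c\<close>, see
  \<open>At_rv\<close>.\<close>

definition rv :: "complex \<Rightarrow> complex ^ 'd \<Rightarrow> real ^ 'd" where
  "rv c v = (\<chi> j. Re (c * v $ j))"

lemma rv_dot: "rv c v \<bullet> x = Re (c * hermitian_inner v (complexify x))"
  by (simp add: rv_def hermitian_inner_def complexify_def inner_vec_def sum_distrib_left algebra_simps)

lemma At_rv:
  assumes "map_matrix complex_of_real (Finite_Cartesian_Product.transpose A) *v v = c' *s v"
  shows "At (rv c v) = rv (c * c') v"
proof -
  have "At (rv c v) $ i = rv (c * c') v $ i" for i
  proof -
    have "(\<Sum>j\<in>UNIV. complex_of_real (A $ j $ i) * v $ j) = c' * v $ i"
      using arg_cong[OF assms, of "\<lambda>v. v $ i"]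
      by (simp add: matrix_vector_mult_def map_matrix_def Finite_Cartesian_Product.transpose_def)
    then have "Re (c * c' * v $ i) = Re (\<Sum>j\<in>UNIV. c * (complex_of_real (A $ j $ i) * v $ j))"
      by (simp only: sum_distrib_left[symmetric] mult.assoc)
    also have "\<dots> = (\<Sum>j\<in>UNIV. A $ j $ i * Re (c * v $ j))"
      unfolding Re_sum by (rule sum.cong) (simp_all add: algebra_simps)
    finally show ?thesis
      by (simp add: At_def rv_def matrix_vector_mult_def Finite_Cartesian_Product.transpose_def del: transpose_matrix_vector)
  qed
  then show ?thesis by (simp add: Finite_Cartesian_Product.vec_eq_iff)
qed

text \<open>The real vectors obtained from multiples of \<open>v\<close> span an
  \<open>Ei\<close>-invariant space on which every \<open>dv l\<close> vanishes.\<close>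

lemma eigenvector_observable:
  assumes v: "map_matrix complex_of_real (Finite_Cartesian_Product.transpose A) *v v = inverse z *s v" "z \<noteq> 0"
    and dv: "\<And>l. l \<in> {1..m} \<Longrightarrow> hermitian_inner v (complexify (dv l)) = 0"
  shows "v = 0"
proof -
  have Ei: "Ei (rv c v) = rv (c * z) v" for c
    using arg_cong[OF At_rv[OF v(1), of "c * z"], of Ei] v(2) by (simp add: mult.assoc)
  have pw: "(Ei ^^ n) (rv c v) = rv (c * z ^ n) v" for n c
    by (induction n) (simp_all add: Ei mult_ac)
  have z: "rv c v = 0" for c
    by (rule irreducible_observable) (simp add: pw rv_dot dv)
  have "v $ j = 0" for j
    using arg_cong[OF z[of 1], of "\<lambda>v. v $ j"] arg_cong[OF z[of \<i>], of "\<lambda>v. v $ j"]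
    by (simp add: rv_def complex_eq_iff)
  then show ?thesis by (simp add: Finite_Cartesian_Product.vec_eq_iff)
qed

text \<open>The orbit is a combination of eigenvectors for the expanding roots of one minimal
  polynomial \<open>M\<close>. Its phases are the expanding part of a sum over all roots that is an
  integer at nonnegative times by Euler's identity, so they are close to integers in the future up
  to the contracting part, and small in the past. Once no mask factor vanishes, the exponentially
  small deficits keep \<open>muhat\<close> bounded below along the orbit.\<close>

theorem type_I_not_rajchman:
  assumes "generalized_pisot_IFS_type_I m \<phi> A a"
  shows "\<not> rajchman \<mu>"
proof
  assume raj: "rajchman \<mu>"
  obtain k \<beta> \<zeta> where data: "generalized_pisot_data m A a k \<beta> \<zeta>" and tI: "pisot_tuple_type_I (\<beta> ` {1..k})"
    using assms by (auto simp: generalized_pisot_IFS_type_I_def)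
  obtain M z0 where M: "min_int_poly M z0" and z0: "cmod z0 < 1"
    and roots: "\<And>z. poly (cpoly M) z = 0 \<Longrightarrow> z \<noteq> 0 \<and> (cmod z < 1 \<or> z \<in> \<beta> ` {1..k} \<and> 1 < cmod z)"
    by (rule pisot_type_I_min_int_poly[OF tI]) (rule that)
  define dM where "dM = poly (pderiv (cpoly M))"
  define D where "D = degree M"
  define Out where "Out = {z. poly (cpoly M) z = 0 \<and> 1 < cmod z}"
  define Inn where "Inn = {z. poly (cpoly M) z = 0 \<and> cmod z < 1}"
  have lM: "lead_coeff M = 1" and Mz0: "poly (cpoly M) z0 = 0" using M by (auto simp: min_int_poly_def)
  have M0: "cpoly M \<noteq> 0" using lM by auto
  have dM0: "\<And>z. poly (cpoly M) z = 0 \<Longrightarrow> dM z \<noteq> 0" unfolding dM_def by (rule min_int_poly_simple_roots[OF M])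
  have dMc: "dM (cnj z) = cnj (dM z)" for z
    unfolding dM_def cpoly_pderiv[symmetric] by (rule poly_cpoly_cnj)
  have Mc: "poly (cpoly M) (cnj z) = 0" if "poly (cpoly M) z = 0" for z using that by (simp add: poly_cpoly_cnj)
  have all: "{z. poly (cpoly M) z = 0} = Out \<union> Inn" "Out \<inter> Inn = {}"
    using roots by (auto simp: Out_def Inn_def)
  have finr: "finite {z. poly (cpoly M) z = 0}" by (rule poly_roots_finite[OF M0])
  have cardr: "card {z. poly (cpoly M) z = 0} \<le> D" using card_poly_roots_bound[OF M0] by (simp add: D_def)
  have subs: "Out \<subseteq> {z. poly (cpoly M) z = 0}" "Inn \<subseteq> {z. poly (cpoly M) z = 0}" by (auto simp: Out_def Inn_def)
  have fin: "finite Out" "finite Inn" using subs finr by (auto intro: finite_subset)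
  have card: "card Out \<le> D" "card Inn \<le> D"
    using card_mono[OF finr subs(1)] card_mono[OF finr subs(2)] cardr by linarith+
  have n0: "0 \<notin> Out" "0 \<notin> Inn" using roots[of 0] by (auto simp: Out_def Inn_def)
  have cc: "z \<in> Out \<Longrightarrow> cnj z \<in> Out" "z \<in> Inn \<Longrightarrow> cnj z \<in> Inn" for z using Mc by (auto simp: Out_def Inn_def)
  have "z0 \<in> Inn" using z0 Mz0 by (simp add: Inn_def)
  obtain o1 where o1: "o1 \<in> Out"
    using min_int_poly_expanding_root[OF M] roots by (force simp: Out_def)
  obtain Pl where Pl: "\<And>l j. l \<in> {1..m} \<Longrightarrow> j \<in> {1..k} \<Longrightarrow>
      hermitian_inner (\<zeta> j) (complexify (dv l)) = poly (cpoly (Pl l)) (\<beta> j)"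
  proof -
    have "\<forall>l\<in>{1..m}. \<exists>P :: int poly. \<forall>j\<in>{1..k}. hermitian_inner (\<zeta> j) (complexify (dv l)) = poly (cpoly P) (\<beta> j)"
      using data by (simp add: generalized_pisot_data_def dv_def)
    from bchoice[OF this] obtain f where "\<forall>l\<in>{1..m}. \<forall>j\<in>{1..k}. hermitian_inner (\<zeta> j) (complexify (dv l)) = poly (cpoly (f l)) (\<beta> j)"
      by (rule exE)
    then show thesis by (intro that[of f]) simp
  qed
  define Z where "Z z = \<zeta> (inv_into {1..k} \<beta> z)" for z
  have oB: "z \<in> \<beta> ` {1..k}" if "z \<in> Out" for z
    using that roots[of z] by (auto simp: Out_def)
  have ZP: "hermitian_inner (Z z) (complexify (dv l)) = poly (cpoly (Pl l)) z" if "z \<in> Out" "l \<in> {1..m}" for z l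
    using Pl[OF that(2) inv_into_into[OF oB[OF that(1)]]] unfolding Z_def f_inv_into_f[OF oB[OF that(1)]] .
  have Zeig: "map_matrix complex_of_real (Finite_Cartesian_Product.transpose A) *v Z z = inverse z *s Z z" and Z0: "Z z \<noteq> 0"
    if "z \<in> Out" for z
  proof -
    have "inv_into {1..k} \<beta> z \<in> {1..k}" by (rule inv_into_into[OF oB[OF that]])
    then have *: "\<zeta> (inv_into {1..k} \<beta> z) \<noteq> 0 \<and> map_matrix complex_of_real (Finite_Cartesian_Product.transpose A) *v \<zeta> (inv_into {1..k} \<beta> z) = inverse (\<beta> (inv_into {1..k} \<beta> z)) *s \<zeta> (inv_into {1..k} \<beta> z)"
      using data unfolding generalized_pisot_data_def by blast
    show "Z z \<noteq> 0" unfolding Z_def by (rule conjunct1[OF *])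
    show "map_matrix complex_of_real (Finite_Cartesian_Product.transpose A) *v Z z = inverse z *s Z z"
      using conjunct2[OF *] unfolding Z_def f_inv_into_f[OF oB[OF that]] .
  qed
  \<comment> \<open>For any weight \<open>w\<close> this is a two-sided orbit indexed by the
    integers: \<open>At\<close> lowers the time by one.\<close>
  define V where "V w n = (\<Sum>z\<in>Out. rv (z powi n * w z) (Z z))" for w :: "complex \<Rightarrow> complex" and n :: int
  have AtV: "At (V w (n + 1)) = V w n" for w n
    unfolding V_def linear_sum[OF linear_At]
  proof (rule sum.cong)
    fix z assume z: "z \<in> Out"
    then have "z \<noteq> 0" using n0 by auto
    then have "z powi (n + 1) = z powi n * z" by (intro power_int_add_1) simp
    then have "z powi (n + 1) * w z * inverse z = z powi n * w z" using \<open>z \<noteq> 0\<close> by (simp only:) simp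
    then show "At (rv (z powi (n + 1) * w z) (Z z)) = rv (z powi n * w z) (Z z)" by (simp only: At_rv[OF Zeig[OF z]])
  qed simp
  have Vdot: "V w n \<bullet> dv l = Re (\<Sum>z\<in>Out. z powi n * (w z * poly (cpoly (Pl l)) z))" if "l \<in> {1..m}" for w n l
    unfolding V_def inner_sum_left Re_sum by (rule sum.cong) (simp_all only: rv_dot ZP that mult.assoc)
  \<comment> \<open>The moment-curve factor required by \<open>weighted_sum_zeros\<close>. It is an
    integer polynomial in \<open>z\<close>, so integrality of the full sums is kept.\<close>
  define g where "g t z = (\<Sum>i<D. (of_nat t * z) ^ i)" for t and z :: complex
  define F where "F S t l n = Re (\<Sum>z\<in>S. z powi n * (g t z * (poly (cpoly (Pl l)) z / dM z)))" for S t l and n :: int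
  \<comment> \<open>Congruence modulo \<open>M\<close>: indices whose polynomials agree at one root
    of \<open>M\<close>, and therefore at all of them, cannot be told apart by any phase.\<close>
  define R where "R l l' \<longleftrightarrow> M dvd (Pl l - Pl l')" for l l'
  have Fdiff: "F S t l n = F S t l' n \<longleftrightarrow> Re (\<Sum>z\<in>S. z powi n * (g t z * (poly (cpoly (Pl l - Pl l')) z / dM z))) = 0" for S t l l' n
  proof -
    have "F S t l n - F S t l' n = Re (\<Sum>z\<in>S. z powi n * (g t z * (poly (cpoly (Pl l - Pl l')) z / dM z)))"
      unfolding F_def minus_complex.sel[symmetric] sum_subtractf[symmetric]
      by (simp only: cpoly_diff poly_diff diff_divide_distrib right_diff_distrib)
    then show ?thesis by linarith
  qed
  have Rz: "poly (cpoly (Pl l - Pl l')) z \<noteq> 0" if "\<not> R l l'" "poly (cpoly M) z = 0" for l l' z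
    using min_int_poly_dvd[OF M that(2)] that(1) by (auto simp: R_def)
  have ntS: "finite {t. F S t l n = F S t l' n} \<and> card {t. F S t l n = F S t l' n} \<le> D"
    if S: "finite S" "0 \<notin> S" "card S \<le> D" "\<And>z. z \<in> S \<Longrightarrow> cnj z \<in> S" "s \<in> S" "S \<subseteq> {z. poly (cpoly M) z = 0}"
      and nR: "\<not> R l l'" for S s l l' n
    unfolding Fdiff unfolding g_def
  proof (rule weighted_sum_zeros[OF S(1-4)])
    show "poly (cpoly (Pl l - Pl l')) (cnj z) / dM (cnj z) = cnj (poly (cpoly (Pl l - Pl l')) z / dM z)" for z
      by (simp add: poly_cpoly_cnj dMc)
    show "poly (cpoly (Pl l - Pl l')) s / dM s \<noteq> 0" using S(5,6) Rz[OF nR, of s] dM0[of s] by auto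
  qed (use S in auto)
  \<comment> \<open>Otherwise every \<open>dv l\<close> would pair to 0 with the eigenvector of the
    expanding root \<open>o1\<close>, contradicting observability.\<close>
  have "\<exists>l0\<in>{1..m}. \<not> R l0 1"
  proof (rule ccontr)
    assume "\<not> ?thesis"
    then have R1: "R l 1" if "l \<in> {1..m}" for l using that by blast
    have 1: "1 \<in> {1..m}" using m1 by simp
    have "hermitian_inner (Z o1) (complexify (dv l)) = 0" if l: "l \<in> {1..m}" for l
    proof -
      have "poly (cpoly (Pl l - Pl 1)) o1 = 0" using R1[OF l] o1 unfolding R_def Out_def by (auto simp: cpoly_mult elim!: dvdE)
      then have "poly (cpoly (Pl l)) o1 = poly (cpoly (Pl 1)) o1" by (simp add: cpoly_diff)
      also have "\<dots> = hermitian_inner (Z o1) (complexify (dv 1))" using ZP[OF o1 1] by simp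
      also have "\<dots> = 0" by (simp add: dv_def hermitian_inner_def complexify_def)
      finally show ?thesis using ZP[OF o1 l] by simp
    qed
    then have "Z o1 = 0" using o1 n0 by (intro eigenvector_observable[OF Zeig[OF o1]]) auto
    then show False using Z0[OF o1] by simp
  qed
  then obtain l0 where l0: "l0 \<in> {1..m}" "\<not> R l0 1" by blast
  have one: "(1::nat) \<in> {1..m}" using m1 by simp
  define \<rho> where "\<rho> = Max ((\<lambda>z. 1 / cmod z) ` Out \<union> cmod ` Inn)"
  have finU: "finite ((\<lambda>z. 1 / cmod z) ` Out \<union> cmod ` Inn)" using fin by simp
  have \<rho>Out: "1 / cmod z \<le> \<rho>" if "z \<in> Out" for z unfolding \<rho>_def by (rule Max_ge[OF finU]) (use that in simp)
  have \<rho>Inn: "cmod z \<le> \<rho>" if "z \<in> Inn" for z unfolding \<rho>_def by (rule Max_ge[OF finU]) (use that in simp)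
  have "cmod z0 \<le> \<rho>" by (rule \<rho>Inn[OF \<open>z0 \<in> Inn\<close>])
  moreover have "0 < cmod z0" using roots[OF Mz0] by simp
  ultimately have \<rho>0: "0 < \<rho>" by linarith
  have \<rho>1: "\<rho> < 1" unfolding \<rho>_def
    by (subst Max_less_iff[OF finU]) (use o1 in \<open>auto simp: Out_def Inn_def divide_less_eq\<close>)
  define W where "W = (\<lambda>(z, l). (\<Sum>i<D. cmod z ^ i) * cmod (poly (cpoly (Pl l)) z / dM z))"
  define C where "C = (\<Sum>x\<in>(Out \<union> Inn) \<times> {1..m}. W x)"
  have W0: "0 \<le> W x" for x by (cases x) (simp add: W_def sum_nonneg)
  have C0: "0 \<le> C" by (simp add: C_def W0 sum_nonneg)
  have Fb: "\<bar>F S t l n\<bar> \<le> C * (real t + 1) ^ D * r"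
    if S: "S \<subseteq> Out \<union> Inn" and l: "l \<in> {1..m}" and r: "\<And>z. z \<in> S \<Longrightarrow> cmod (z powi n) \<le> r" "0 \<le> r" for S t l n r
  proof -
    have finS: "finite S" using S fin by (auto intro: finite_subset)
    have gb: "cmod (g t z) \<le> (real t + 1) ^ D * (\<Sum>i<D. cmod z ^ i)" for z
    proof -
      have "cmod (g t z) \<le> (\<Sum>i<D. (real t + 1) ^ D * cmod z ^ i)"
        unfolding g_def
      proof (rule sum_norm_le)
        fix i assume i: "i \<in> {..<D}"
        have "real t ^ i \<le> (real t + 1) ^ i" by (rule power_mono) auto
        also have "\<dots> \<le> (real t + 1) ^ D" using i by (intro power_increasing) auto
        finally show "cmod ((of_nat t * z) ^ i) \<le> (real t + 1) ^ D * cmod z ^ i"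
          by (simp add: norm_power norm_mult power_mult_distrib mult_right_mono)
      qed
      then show ?thesis by (simp only: sum_distrib_left)
    qed
    have "\<bar>F S t l n\<bar> \<le> cmod (\<Sum>z\<in>S. z powi n * (g t z * (poly (cpoly (Pl l)) z / dM z)))"
      unfolding F_def by (rule abs_Re_le_cmod)
    also have "\<dots> \<le> (\<Sum>z\<in>S. r * ((real t + 1) ^ D * W (z, l)))"
    proof (rule sum_norm_le)
      fix z assume z: "z \<in> S"
      have "cmod (g t z) * cmod (poly (cpoly (Pl l)) z / dM z) \<le> (real t + 1) ^ D * (\<Sum>i<D. cmod z ^ i) * cmod (poly (cpoly (Pl l)) z / dM z)"
        by (rule mult_right_mono[OF gb]) simp
      also have "\<dots> = (real t + 1) ^ D * W (z, l)" by (simp add: W_def)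
      finally have "cmod (z powi n) * (cmod (g t z) * cmod (poly (cpoly (Pl l)) z / dM z)) \<le> r * ((real t + 1) ^ D * W (z, l))"
        by (rule mult_mono[OF r(1)[OF z] _ r(2)]) simp
      then show "cmod (z powi n * (g t z * (poly (cpoly (Pl l)) z / dM z))) \<le> r * ((real t + 1) ^ D * W (z, l))"
        by (simp only: norm_mult)
    qed
    also have "\<dots> = r * ((real t + 1) ^ D * (\<Sum>z\<in>S. W (z, l)))" by (simp only: sum_distrib_left)
    also have "\<dots> \<le> r * ((real t + 1) ^ D * C)"
    proof (intro mult_left_mono r(2))
      have "(\<Sum>z\<in>S. W (z, l)) = (\<Sum>x\<in>(\<lambda>z. (z, l)) ` S. W x)" by (subst sum.reindex) (auto simp: inj_on_def)
      also have "\<dots> \<le> C" unfolding C_def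
        by (rule sum_mono2) (use fin S l W0 in auto)
      finally show "(\<Sum>z\<in>S. W (z, l)) \<le> C" .
    qed simp
    finally show ?thesis by (simp add: mult_ac)
  qed
  have b1: "\<bar>F Out t l n\<bar> \<le> C * (real t + 1) ^ D * \<rho> ^ nat (- n)" if "n \<le> 0" "l \<in> {1..m}" for t l n
  proof (rule Fb)
    fix z assume z: "z \<in> Out"
    have "cmod (z powi n) = (1 / cmod z) ^ nat (- n)"
      using that(1) by (simp add: norm_power_int) (simp add: power_int_def power_one_over inverse_eq_divide)
    also have "\<dots> \<le> \<rho> ^ nat (- n)" by (rule power_mono[OF \<rho>Out[OF z]]) simp
    finally show "cmod (z powi n) \<le> \<rho> ^ nat (- n)" .
  qed (use that \<rho>0 in auto)
  have b2: "\<bar>F Inn t l n\<bar> \<le> C * (real t + 1) ^ D * \<rho> ^ nat n" if "0 \<le> n" "l \<in> {1..m}" for t l n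
  proof (rule Fb)
    fix z assume z: "z \<in> Inn"
    have "cmod (z powi n) = cmod z ^ nat n"
      using that(1) by (simp add: norm_power_int) (simp add: power_int_def)
    also have "\<dots> \<le> \<rho> ^ nat n" by (rule power_mono[OF \<rho>Inn[OF z]]) simp
    finally show "cmod (z powi n) \<le> \<rho> ^ nat n" .
  qed (use that \<rho>0 in auto)
  \<comment> \<open>Only for \<open>n >= 0\<close> is \<open>z powi n\<close> the value of an
    integer polynomial, as Euler's identity requires.\<close>
  have int: "F Out t l n + F Inn t l n \<in> \<int>" if "0 \<le> n" for t l n
  proof -
    define h where "h = monom 1 (nat n) * ((\<Sum>i<D. monom (int t ^ i) i) * Pl l)"
    have gc: "poly (cpoly (\<Sum>i<d. monom (int t ^ i) i)) z = (\<Sum>i<d. (of_nat t * z) ^ i)" for d z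
      by (induction d) (simp_all add: cpoly_add map_poly_monom poly_monom power_mult_distrib)
    have hz: "poly (cpoly h) z = z powi n * (g t z * poly (cpoly (Pl l)) z)" for z
      using that by (simp add: h_def cpoly_mult gc g_def map_poly_monom poly_monom power_int_def)
    have "(\<Sum>z | poly (cpoly M) z = 0. poly (cpoly h) z / dM z) \<in> \<int>"
      unfolding dM_def
      by (rule sum_roots_over_deriv_int[OF lM min_int_poly_degree[OF M] min_int_poly_simple_roots[OF M]])
    moreover have "(\<Sum>z | poly (cpoly M) z = 0. poly (cpoly h) z / dM z)
      = (\<Sum>z\<in>Out. z powi n * (g t z * (poly (cpoly (Pl l)) z / dM z))) + (\<Sum>z\<in>Inn. z powi n * (g t z * (poly (cpoly (Pl l)) z / dM z)))"
      unfolding all by (subst sum.union_disjoint[OF fin all(2)]) (simp add: hz)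
    ultimately obtain j where "(\<Sum>z\<in>Out. z powi n * (g t z * (poly (cpoly (Pl l)) z / dM z))) + (\<Sum>z\<in>Inn. z powi n * (g t z * (poly (cpoly (Pl l)) z / dM z))) = of_int j"
      by (auto elim: Ints_cases)
    then have "F Out t l n + F Inn t l n = Re (of_int j)" unfolding F_def by (simp only: plus_complex.sel[symmetric])
    then show ?thesis by simp
  qed
  obtain L a' t b where L: "0 < (L :: int)"
    and nz: "\<And>n. (\<Sum>l\<in>{1..m}. p l * ee (real a' * F Out t l n + real b * F Out t l (n + L))) \<noteq> 0"
    and ne: "real a' * F Out t l0 (- L) + real b * F Out t l0 0 \<noteq> real a' * F Out t 1 (- L) + real b * F Out t 1 0"
  proof (rule avoid_zeros[where \<phi> = "F Out" and \<iota> = "F Inn" and R = R and p = p and m = m and \<rho> = \<rho> and C = C and D = D and ?l0.0 = l0 and ?l1.0 = 1])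
    show "F Out t l n = F Out t l' n" if "R l l'" for t l l' n
    proof -
      have "poly (cpoly (Pl l - Pl l')) z = 0" if "z \<in> Out" for z
        using \<open>R l l'\<close> that unfolding R_def Out_def by (auto simp: cpoly_mult elim!: dvdE)
      then show ?thesis unfolding Fdiff by simp
    qed
    show "finite {t. F Out t l n = F Out t l' n} \<and> card {t. F Out t l n = F Out t l' n} \<le> D" if "\<not> R l l'" for l l' n
      by (rule ntS[OF fin(1) n0(1) card(1) cc(1) o1 subs(1) that])
    show "finite {t. F Inn t l n = F Inn t l' n} \<and> card {t. F Inn t l n = F Inn t l' n} \<le> D" if "\<not> R l l'" for l l' n
      by (rule ntS[OF fin(2) n0(2) card(2) cc(2) \<open>z0 \<in> Inn\<close> subs(2) that])
  qed (assumption | rule p_pos m1 \<rho>0 \<rho>1 C0 b1 b2 int l0 one that)+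
  \<comment> \<open>The weight of \<open>(a' + b * x ^ L) * g\<close> divided by \<open>M'\<close>:
    the resulting phase at time \<open>n\<close> combines those of \<open>F Out\<close> at
    \<open>n\<close> and \<open>n + L\<close>.\<close>
  define w where "w z = (of_nat a' + of_nat b * z powi L) * (g t z / dM z)" for z
  define X where "X n = V w n" for n
  have Xdv: "X n \<bullet> dv l = real a' * F Out t l n + real b * F Out t l (n + L)" if "l \<in> {1..m}" for n l
  proof -
    have "(\<Sum>z\<in>Out. z powi n * (w z * poly (cpoly (Pl l)) z))
      = of_real (real a') * (\<Sum>z\<in>Out. z powi n * (g t z * (poly (cpoly (Pl l)) z / dM z)))
       + of_real (real b) * (\<Sum>z\<in>Out. z powi (n + L) * (g t z * (poly (cpoly (Pl l)) z / dM z)))"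
      unfolding sum_distrib_left sum.distrib[symmetric]
    proof (rule sum.cong)
      fix z assume "z \<in> Out"
      then have "z \<noteq> 0" using n0 by auto
      then show "z powi n * (w z * poly (cpoly (Pl l)) z) = of_real (real a') * (z powi n * (g t z * (poly (cpoly (Pl l)) z / dM z)))
       + of_real (real b) * (z powi (n + L) * (g t z * (poly (cpoly (Pl l)) z / dM z)))"
        by (simp add: w_def power_int_add algebra_simps)
    qed simp
    then show ?thesis unfolding X_def Vdot[OF that] F_def by (simp only: plus_complex.sel times_complex.sel Re_complex_of_real Im_complex_of_real mult_zero_left diff_zero)
  qed
  have XAt: "At (X (n + 1)) = X n" for n unfolding X_def by (rule AtV)
  have XAtp: "(At ^^ j) (X n) = X (n - int j)" for j n
  proof (induction j)
    case (Suc j)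
    then show ?case using XAt[of "n - int j - 1"] by (simp add: algebra_simps)
  qed simp
  have Pnz: "P (X n) \<noteq> 0" for n
  proof -
    have "cmod (P (X n)) = cmod (\<Sum>l\<in>{1..m}. p l * ee (real a' * F Out t l n + real b * F Out t l (n + L)))"
      unfolding P_dv by (simp only: Xdv cong: sum.cong)
    then show ?thesis using nz[of n] by auto
  qed
  \<comment> \<open>If \<open>X 0\<close> were 0, so would be its image \<open>X (- L)\<close> under
    \<open>At ^^ nat L\<close>; but at time \<open>- L\<close> the phases of \<open>l0\<close> and 1
    differ.\<close>
  have X0: "X 0 \<noteq> 0"
  proof
    assume "X 0 = 0"
    then have "X (- L) = 0" using XAtp[of "nat L" 0] L linear_0[OF linear_pow[OF linear_At]] by simp
    then have "X (- L) \<bullet> dv l0 = X (- L) \<bullet> dv 1" by simp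
    then show False using ne by (simp only: Xdv[OF l0(1)] Xdv[OF one] add.left_inverse)
  qed
  \<comment> \<open>In the remote past the orbit is near 0 and \<open>muhat\<close> near 1. From
    such a time on, each step multiplies by a nonzero mask value.\<close>
  obtain J where J: "muhat (X (- int J)) \<noteq> 0"
  proof -
    have "\<forall>\<^sub>F n in sequentially. muhat ((At ^^ n) (X 0)) \<noteq> 0"
      by (rule tendsto_imp_eventually_ne[OF muhat_At_pow_tendsto]) simp
    then obtain N where "\<And>n. N \<le> n \<Longrightarrow> muhat ((At ^^ n) (X 0)) \<noteq> 0" by (auto simp: eventually_sequentially)
    from this[of N] show thesis using that[of N] by (simp add: XAtp)
  qed
  have mnz: "muhat (X (- int J + int j)) \<noteq> 0" for j
  proof (induction j)
    case 0
    then show ?case using J by simp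
  next
    case (Suc j)
    have "X (- int J + int j) = At (X (- int J + int (Suc j)))" using XAt[of "- int J + int j"] by (simp add: add_ac)
    then show ?case using Suc Pnz by (subst muhat_step) simp
  qed
  define c0 where "c0 = (real a' + real b) * (C * (real t + 1) ^ D)"
  have c00: "0 \<le> c0" using C0 by (simp add: c0_def)
  have Plow: "1 - 2 * pi * (c0 * \<rho> ^ n) \<le> cmod (P (X (int n)))" for n
    unfolding P_dv
  proof (rule ee_sum_near_1[OF p_pos p_sum])
    fix l assume l: "l \<in> {1..m}"
    define y where "y = - (real a' * F Inn t l (int n) + real b * F Inn t l (int n + L))"
    have "real a' * (F Out t l (int n) + F Inn t l (int n)) + real b * (F Out t l (int n + L) + F Inn t l (int n + L)) \<in> \<int>"
      using L by (intro Ints_add Ints_mult int) auto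
    then have "X (int n) \<bullet> dv l - y \<in> \<int>" by (simp add: Xdv[OF l] y_def algebra_simps)
    moreover have "\<bar>y\<bar> \<le> c0 * \<rho> ^ n"
    proof -
      define E where "E = C * (real t + 1) ^ D * \<rho> ^ n"
      have 1: "\<bar>F Inn t l (int n)\<bar> \<le> E" using b2[of "int n" l t] l by (simp add: E_def)
      have "\<bar>F Inn t l (int n + L)\<bar> \<le> C * (real t + 1) ^ D * \<rho> ^ nat (int n + L)" using b2[of "int n + L" l t] l L by simp
      also have "\<dots> \<le> E" unfolding E_def
        using C0 \<rho>0 \<rho>1 L by (intro mult_left_mono power_decreasing) auto
      finally have 2: "\<bar>F Inn t l (int n + L)\<bar> \<le> E" .
      have "\<bar>y\<bar> \<le> real a' * \<bar>F Inn t l (int n)\<bar> + real b * \<bar>F Inn t l (int n + L)\<bar>"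
        unfolding y_def abs_minus_cancel by (rule order_trans[OF abs_triangle_ineq]) (simp add: abs_mult)
      also have "\<dots> \<le> real a' * E + real b * E" by (intro add_mono mult_left_mono 1 2) auto
      also have "\<dots> = c0 * \<rho> ^ n" by (simp add: c0_def E_def algebra_simps)
      finally show ?thesis .
    qed
    ultimately show "\<exists>y. X (int n) \<bullet> dv l - y \<in> \<int> \<and> \<bar>y\<bar> \<le> c0 * \<rho> ^ n" by blast
  qed
  obtain c where c: "0 < c" "\<And>n. c \<le> cmod (muhat (X (int n)))"
  proof (rule product_bounded_below[where v = "\<lambda>n. cmod (muhat (X (int n)))" and e = "\<lambda>n. 2 * pi * (c0 * \<rho> ^ Suc n)"])
    show "0 < cmod (muhat (X (int n)))" for n using mnz[of "J + n"] by simp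
    show "0 \<le> 2 * pi * (c0 * \<rho> ^ Suc n)" for n using c00 \<rho>0 by simp
    have "summable (\<lambda>n. 2 * pi * c0 * \<rho> * \<rho> ^ n)" using \<rho>0 \<rho>1 by (intro summable_mult summable_geometric) simp
    then show "summable (\<lambda>n. 2 * pi * (c0 * \<rho> ^ Suc n))" by (simp add: mult_ac)
    show "(1 - 2 * pi * (c0 * \<rho> ^ Suc n)) * cmod (muhat (X (int n))) \<le> cmod (muhat (X (int (Suc n))))" for n
    proof -
      have "muhat (X (int (Suc n))) = P (X (int (Suc n))) * muhat (X (int n))"
        using muhat_step[of "X (int (Suc n))"] XAt[of "int n"] by (simp add: add_ac)
      then show ?thesis using mult_right_mono[OF Plow[of "Suc n"], of "cmod (muhat (X (int n)))"] by (simp only: norm_mult) simp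
    qed
  qed (rule that)
  have "\<exists>n. cmod (muhat (X (int n))) < c"
  proof (rule rajchman_orbit[OF raj _ _ c(1), of "\<lambda>n. X (int n)"])
    show "At (X (int (Suc n))) = X (int n)" for n using XAt[of "int n"] by (simp add: add_ac)
  qed (use X0 in simp)
  then show False using c(2) by (meson not_less)
qed

end

subsection \<open>Almost integral orbits\<close>

lemma sin_lower: "0 \<le> x \<Longrightarrow> x \<le> pi / 2 \<Longrightarrow> x / 2 \<le> sin x"
proof -
  assume x: "0 \<le> x" "x \<le> pi / 2"
  define s where "s = x / 2"
  have s: "0 \<le> s" "s \<le> pi / 4" using x by (auto simp: s_def)
  have c: "sqrt 2 / 2 \<le> cos y" if "0 \<le> y" "y \<le> s" for y
    using cos_monotone_0_pi_le[of y "pi / 4"] that s by (simp add: cos_45)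
  have "s * (sqrt 2 / 2) \<le> sin s"
  proof (cases "s = 0")
    case False
    then obtain y where y: "0 < y" "y < s" "sin s - sin 0 = (s - 0) * cos y"
      using MVT2[of 0 s sin cos] s by (auto simp: DERIV_sin)
    have "s * (sqrt 2 / 2) \<le> s * cos y" using c[of y] y s by (intro mult_left_mono) auto
    then show ?thesis using y by simp
  qed simp
  then have "(s * (sqrt 2 / 2)) * (sqrt 2 / 2) \<le> sin s * cos s"
    using c[of s] s sin_ge_zero[of s] pi_gt_zero by (intro mult_mono) auto
  moreover have "(s * (sqrt 2 / 2)) * (sqrt 2 / 2) = s / 2"
    by (simp add: mult.assoc)
  ultimately have "s / 2 \<le> sin s * cos s" by (simp only:)
  moreover have "sin x = 2 * (sin s * cos s)" using sin_double[of s] by (simp add: s_def)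
  moreover have "x = 2 * s" by (simp add: s_def)
  ultimately show ?thesis by linarith
qed

lemma one_minus_cos_lower:
  assumes "\<bar>y\<bar> \<le> 1 / 2" shows "2 * y\<^sup>2 \<le> 1 - cos (2 * pi * y)"
proof -
  have "pi * \<bar>y\<bar> \<le> pi * (1 / 2)" by (rule mult_left_mono[OF assms]) simp
  then have "pi * \<bar>y\<bar> / 2 \<le> sin (pi * \<bar>y\<bar>)" by (intro sin_lower) auto
  moreover have "2 * \<bar>y\<bar> \<le> pi * \<bar>y\<bar>" by (intro mult_right_mono pi_ge_two) auto
  ultimately have "\<bar>y\<bar>\<^sup>2 \<le> (sin (pi * \<bar>y\<bar>))\<^sup>2" by (intro power_mono) auto
  also have "(sin (pi * \<bar>y\<bar>))\<^sup>2 = (sin (pi * y))\<^sup>2" by (cases "0 \<le> y") auto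
  finally show ?thesis using cos_double_sin[of "pi * y"] by (simp add: mult.assoc)
qed

text \<open>With \<open>u = 1 - cos\<close>, the squared modulus is
  \<open>(r + s)^2 - 2 r s u\<close>. As \<open>r + s <= 1\<close>, it is at most
  \<open>(r + s)^2 - 2 (r + s) r s u\<close>, which lies below the square of
  \<open>r + s - r s u\<close>.\<close>

lemma two_phase_deficit:
  fixes r s :: real
  assumes rs: "0 < r" "0 < s" "r + s \<le> 1"
  shows "cmod (r + s * ee x) \<le> r + s - r * s * (1 - cos (2 * pi * x))"
proof -
  define u where "u = 1 - cos (2 * pi * x)"
  have u: "0 \<le> u" "u \<le> 2" using cos_ge_minus_one[of "2 * pi * x"] by (auto simp: u_def)
  define t where "t = 2 * pi * x"
  have "(cmod (r + s * ee x))\<^sup>2 = (r + s * cos t)\<^sup>2 + (s * sin t)\<^sup>2" by (simp add: cmod_power2 ee_def t_def)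
  also have "\<dots> = r\<^sup>2 + 2 * r * s * cos t + s\<^sup>2 * ((cos t)\<^sup>2 + (sin t)\<^sup>2)"
    by (simp add: power2_eq_square algebra_simps del: sin_cos_squared_add sin_cos_squared_add2 sin_cos_squared_add3)
  also have "\<dots> = (r + s)\<^sup>2 - 2 * (r * s * u)"
    unfolding sin_cos_squared_add2 by (simp add: u_def t_def power2_eq_square algebra_simps)
  also have "\<dots> \<le> (r + s)\<^sup>2 - 2 * ((r + s) * (r * s * u))"
    using mult_right_mono[OF rs(3), of "r * s * u"] rs u by simp
  also have "\<dots> \<le> (r + s - r * s * u)\<^sup>2"
  proof -
    have "(r + s - r * s * u)\<^sup>2 = (r + s)\<^sup>2 - 2 * ((r + s) * (r * s * u)) + (r * s * u)\<^sup>2"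
      by (simp add: power2_diff mult_ac)
    then show ?thesis using zero_le_power2[of "r * s * u"] by linarith
  qed
  finally have sq: "(cmod (r + s * ee x))\<^sup>2 \<le> (r + s - r * s * u)\<^sup>2" .
  have "r * s * u \<le> r * s * 2" using rs u by (intro mult_left_mono) auto
  also have "\<dots> \<le> (r + s) * (r + s)" using zero_le_power2[of "r - s"] zero_le_power2[of r] zero_le_power2[of s]
    by (simp add: power2_eq_square algebra_simps)
  also have "\<dots> \<le> 1 * (r + s)" using rs by (intro mult_right_mono) auto
  finally have "0 \<le> r + s - r * s * u" by simp
  then show ?thesis using power2_le_imp_le[OF sq] by (simp add: u_def)
qed

context affine_ifs
begin

lemma dv_1: "dv 1 = 0" by (simp add: dv_def)

text \<open>Only the terms 1 and \<open>l\<close> are compared, the first having phase 0 because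
  \<open>dv 1 = 0\<close>; the others enter by the triangle inequality.\<close>

lemma P_deficit:
  assumes l: "l \<in> {1..m}" "l \<noteq> 1"
  shows "cmod (P \<xi>) \<le> 1 - p l * p 1 * (2 * (\<xi> \<bullet> dv l - of_int (round (\<xi> \<bullet> dv l)))\<^sup>2)"
proof -
  define x where "x = \<xi> \<bullet> dv l"
  define y where "y = x - of_int (round x)"
  have one: "1 \<in> {1..m}" using m1 by simp
  have split: "{1..m} = insert 1 (insert l ({1..m} - {1, l}))" using l one by auto
  have sum2: "(\<Sum>l'\<in>{1..m}. g l') = g 1 + g l + (\<Sum>l'\<in>{1..m} - {1, l}. g l')" for g :: "nat \<Rightarrow> 'z::comm_monoid_add"
    by (subst split) (use l in \<open>simp add: add.assoc\<close>)
  have ps: "p 1 + p l + (\<Sum>l'\<in>{1..m} - {1, l}. p l') = 1" using p_sum sum2[of p] by simp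
  have rest0: "0 \<le> (\<Sum>l'\<in>{1..m} - {1, l}. p l')" by (intro sum_nonneg) (use p_pos in \<open>auto intro: less_imp_le\<close>)
  have exy: "ee x = ee y" by (rule ee_cong) (simp add: y_def)
  have "cmod (P \<xi>) = cmod (p 1 + p l * ee y + (\<Sum>l'\<in>{1..m} - {1, l}. p l' * ee (\<xi> \<bullet> dv l')))"
    unfolding P_dv sum2[of "\<lambda>l'. p l' * ee (\<xi> \<bullet> dv l')"] by (simp add: dv_1[simplified] x_def[symmetric] exy)
  also have "\<dots> \<le> cmod (p 1 + p l * ee y) + (\<Sum>l'\<in>{1..m} - {1, l}. p l')"
  proof (rule norm_triangle_le[OF add_left_mono[OF sum_norm_le]])
    show "cmod (p l' * ee (\<xi> \<bullet> dv l')) \<le> p l'" if "l' \<in> {1..m} - {1, l}" for l'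
      using p_pos[of l'] that by (simp add: norm_mult)
  qed
  also have "cmod (p 1 + p l * ee y) \<le> p 1 + p l - p 1 * p l * (1 - cos (2 * pi * y))"
    by (rule two_phase_deficit) (use p_pos[OF one] p_pos[OF l(1)] ps rest0 in linarith)+
  finally have "cmod (P \<xi>) \<le> 1 - p l * p 1 * (1 - cos (2 * pi * y))" using ps by (simp add: mult.commute)
  moreover have "2 * y\<^sup>2 \<le> 1 - cos (2 * pi * y)"
    by (rule one_minus_cos_lower) (use of_int_round_abs_le[of x] in \<open>simp add: y_def abs_minus_commute\<close>)
  then have "p l * p 1 * (2 * y\<^sup>2) \<le> p l * p 1 * (1 - cos (2 * pi * y))"
    by (rule mult_left_mono) (use p_pos[OF one] p_pos[OF l(1)] in simp)
  ultimately show ?thesis unfolding y_def x_def by linarith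
qed

section \<open>Integer polynomials in the expanding map\<close>

definition opr :: "int poly \<Rightarrow> real ^ 'd \<Rightarrow> real ^ 'd" where
  "opr f v = (\<Sum>i\<le>degree f. of_int (coeff f i) *\<^sub>R (Ei ^^ i) v)"

text \<open>The orbit of \<open>v\<close> observed through \<open>u\<close>, turned into a complex
  sequence so that \<open>opr\<close> becomes \<open>psh\<close> (\<open>sq_opr\<close>) and complex
  roots can be used.\<close>

definition sq :: "real ^ 'd \<Rightarrow> real ^ 'd \<Rightarrow> nat \<Rightarrow> complex" where
  "sq v u i = complex_of_real ((Ei ^^ i) v \<bullet> u)"

lemma sq_opr: "sq (opr f v) u n = psh (cpoly f) (sq v u) n"
proof -
  have "(Ei ^^ n) (opr f v) = (\<Sum>i\<le>degree f. of_int (coeff f i) *\<^sub>R (Ei ^^ (n + i)) v)"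
    by (simp add: opr_def linear_sum[OF linear_pow[OF linear_Ei]] linear_scale[OF linear_pow[OF linear_Ei]] funpow_add)
  then show ?thesis
    by (simp add: sq_def psh_def coeff_map_poly inner_sum_left)
qed

lemma sq_pow: "sq ((Ei ^^ k) v) u n = sq v u (n + k)"
  by (simp add: sq_def funpow_add)

lemma vec_eq_sq:
  assumes "\<And>u. sq v u 0 = sq v' u 0"
  shows "v = v'"
proof -
  have "v \<bullet> u = v' \<bullet> u" for u using assms[of u] by (simp add: sq_def)
  then show ?thesis by (rule vector_eq_rdot[THEN iffD1, OF allI])
qed

lemma opr_mult: "opr (f * g) v = opr f (opr g v)"
proof (rule vec_eq_sq)
  fix u
  have eq: "sq (opr g v) u = psh (cpoly g) (sq v u)" by (rule ext) (rule sq_opr)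
  show "sq (opr (f * g) v) u 0 = sq (opr f (opr g v)) u 0"
    unfolding sq_opr[of _ _ _ 0] cpoly_mult psh_mult eq by (rule refl)
qed

lemma opr_add: "opr (f + g) v = opr f v + opr g v"
proof (rule vec_eq_sq)
  fix u
  have "sq (opr f v + opr g v) u 0 = sq (opr f v) u 0 + sq (opr g v) u 0" by (simp add: sq_def inner_add_left)
  then show "sq (opr (f + g) v) u 0 = sq (opr f v + opr g v) u 0"
    by (simp only: sq_opr cpoly_add psh_add)
qed

lemma opr_0 [simp]: "opr f 0 = 0"
  by (simp add: opr_def linear_0[OF linear_pow[OF linear_Ei]])

lemma opr_pow: "opr f ((Ei ^^ k) v) = (Ei ^^ k) (opr f v)"
proof (rule vec_eq_sq)
  fix u
  have "sq ((Ei ^^ k) v) u = (\<lambda>n. sq v u (n + k))" by (rule ext) (rule sq_pow)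
  then show "sq (opr f ((Ei ^^ k) v)) u 0 = sq ((Ei ^^ k) (opr f v)) u 0"
    unfolding sq_pow sq_opr by (simp only: psh_shift)
qed

lemma opr_smult: "opr (smult c f) v = of_int c *\<^sub>R opr f v"
proof (rule vec_eq_sq)
  fix u
  have "sq (of_int c *\<^sub>R opr f v) u 0 = of_int c * sq (opr f v) u 0" by (simp add: sq_def)
  then show "sq (opr (smult c f) v) u 0 = sq (of_int c *\<^sub>R opr f v) u 0"
    by (simp only: sq_opr cpoly_smult psh_smult)
qed

lemma opr_1 [simp]: "opr 1 v = v"
  by (simp add: opr_def)

text \<open>Minimality among monic annihilators implies it among all nonzero ones: a Bezout
  combination yields a common divisor of \<open>Q\<close> and \<open>R\<close> that annihilates too,
  and as a divisor of \<open>Q\<close> it is monic up to sign.\<close>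

lemma minimal_annihilator_degree:
  assumes Q: "lead_coeff Q = 1" "opr Q \<eta> = 0"
    and min: "\<And>R. lead_coeff R = 1 \<Longrightarrow> opr R \<eta> = 0 \<Longrightarrow> degree Q \<le> degree R"
    and R: "R \<noteq> 0" "opr R \<eta> = 0"
  shows "degree Q \<le> degree R"
proof -
  have Q0: "Q \<noteq> 0" using Q by auto
  obtain W a b c where W: "W dvd Q" "W dvd R" "c \<noteq> 0" "smult c W = a * Q + b * R"
    using int_poly_bezout[OF Q0] by metis
  have "opr (smult c W) \<eta> = 0" unfolding W(4) by (simp add: opr_add opr_mult Q R)
  then have W0: "opr W \<eta> = 0" using W(3) by (simp add: opr_smult)
  obtain S where S: "Q = W * S" using W(1) by blast
  have "lead_coeff W * lead_coeff S = 1" using Q(1) by (simp add: S lead_coeff_mult)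
  then have lc1: "lead_coeff W * lead_coeff W = 1" by (auto simp: zmult_eq_1_iff)
  then have Wnz: "W \<noteq> 0" by auto
  have "degree Q \<le> degree (smult (lead_coeff W) W)"
    by (rule min) (use W0 lc1 Wnz in \<open>simp_all add: opr_smult\<close>)
  also have "\<dots> \<le> degree W" by (rule degree_smult_le)
  also have "\<dots> \<le> degree R" by (rule dvd_imp_degree_le[OF W(2) R(1)])
  finally show ?thesis .
qed

text \<open>The decreasing sequence of the values of \<open>muhat\<close> in modulus drops at each
  step by at least a multiple of the squared distance to the integers, because it stays above
  \<open>c\<close>; the drops telescope.\<close>

lemma non_rajchman_orbit_square_summable:
  assumes c: "0 < c" "\<And>n. c \<le> cmod (muhat ((Ei ^^ n) \<eta>))" and l: "l \<in> {1..m}"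
  shows "summable (\<lambda>n. ((Ei ^^ n) \<eta> \<bullet> dv l - of_int (round ((Ei ^^ n) \<eta> \<bullet> dv l)))\<^sup>2)"
proof (cases "l = 1")
  case True
  then show ?thesis by (simp add: dv_1[simplified])
next
  case False
  define d where "d n = ((Ei ^^ n) \<eta> \<bullet> dv l - of_int (round ((Ei ^^ n) \<eta> \<bullet> dv l)))\<^sup>2" for n
  define v where "v n = cmod (muhat ((Ei ^^ n) \<eta>))" for n
  define \<kappa> where "\<kappa> = p l * p 1 * 2 * c"
  have \<kappa>: "0 < \<kappa>" using p_pos[OF l] p_pos[of 1] m1 c(1) by (simp add: \<kappa>_def)
  have step: "\<kappa> * d (Suc n) \<le> v n - v (Suc n)" for n
  proof -
    have "v (Suc n) = cmod (P ((Ei ^^ Suc n) \<eta>)) * v n"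
      using muhat_step[of "(Ei ^^ Suc n) \<eta>"] by (simp add: v_def norm_mult)
    also have "\<dots> \<le> (1 - p l * p 1 * (2 * d (Suc n))) * v n"
      unfolding d_def by (rule mult_right_mono[OF P_deficit[OF l False]]) (simp add: v_def)
    finally have "p l * p 1 * (2 * d (Suc n)) * v n \<le> v n - v (Suc n)" by (simp add: left_diff_distrib)
    moreover have "p l * p 1 * (2 * d (Suc n)) * c \<le> p l * p 1 * (2 * d (Suc n)) * v n"
      using c(2)[of n] p_pos[OF l] p_pos[of 1] m1 by (intro mult_left_mono) (auto simp: v_def d_def)
    ultimately show ?thesis by (simp add: \<kappa>_def mult_ac)
  qed
  have "(\<Sum>n<N. \<kappa> * d (Suc n)) \<le> v 0" for N
  proof -
    have "(\<Sum>n<N. \<kappa> * d (Suc n)) \<le> v 0 - v N"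
    proof (induction N)
      case (Suc N)
      then show ?case using step[of N] by simp
    qed simp
    moreover have "0 \<le> v N" by (simp add: v_def)
    ultimately show ?thesis by linarith
  qed
  then have "summable (\<lambda>n. \<kappa> * d (Suc n))"
    by (intro summableI_nonneg_bounded[where x = "v 0"]) (use \<kappa> in \<open>auto simp: d_def\<close>)
  then have "summable (\<lambda>n. d (Suc n))" using \<kappa> by (subst (asm) summable_cmult_iff) simp
  then have "summable d" by (simp only: summable_Suc_iff)
  then show ?thesis by (simp only: d_def[abs_def])
qed

lemma Ei_pow_bound:
  obtains K where "1 \<le> K" "\<And>n x. norm ((Ei ^^ n) x) \<le> K ^ n * norm x"
proof -
  obtain K0 where K0: "\<And>x. norm (Ei x) \<le> norm x * K0"
    using linear_Ei linear_conv_bounded_linear[of Ei] bounded_linear.bounded[of Ei] by blast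
  define K where "K = max K0 1"
  have K1: "norm (Ei x) \<le> K * norm x" for x
    using K0[of x] mult_left_mono[of K0 K "norm x"] by (simp add: K_def mult.commute)
  have "norm ((Ei ^^ n) x) \<le> K ^ n * norm x" for n x
  proof (induction n)
    case (Suc n)
    have "norm ((Ei ^^ Suc n) x) \<le> K * norm ((Ei ^^ n) x)" using K1 by simp
    also have "\<dots> \<le> K * (K ^ n * norm x)" using Suc by (intro mult_left_mono) (auto simp: K_def)
    finally show ?case by (simp add: mult.assoc)
  qed simp
  then show thesis using that[of K] by (simp add: K_def)
qed

lemma eventually_zero_int_sequence:
  fixes k :: "nat \<Rightarrow> int"
  assumes "(\<lambda>n. complex_of_int (k n)) \<longlonglongrightarrow> 0"
  obtains N where "\<And>n. N \<le> n \<Longrightarrow> k n = 0"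
proof -
  obtain N where N: "\<And>n. N \<le> n \<Longrightarrow> cmod (of_int (k n)) < 1" using LIMSEQ_D[OF assms, of 1] by auto
  have "k n = 0" if "N \<le> n" for n
  proof -
    have "\<bar>k n\<bar> < 1" using N[OF that] by (simp only: norm_of_int)
    then show ?thesis by simp
  qed
  then show thesis by (rule that)
qed

text \<open>The nearest integers along the orbit of a non-Rajchman point satisfy monic recurrences,
  which observability transfers to the point itself. Integer sequences tending to 0 vanish
  eventually, and moving the starting point along the orbit makes the minimal recurrence exact from
  time 0.\<close>

lemma non_rajchman_integral_recurrence:
  assumes "\<not> rajchman \<mu>"
  obtains \<eta> N Q where "\<eta> \<noteq> 0" "muhat \<eta> \<noteq> 0" "lead_coeff Q = 1" "opr Q \<eta> = 0"
    "\<And>R. lead_coeff R = 1 \<Longrightarrow> opr R \<eta> = 0 \<Longrightarrow> degree Q \<le> degree R"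
    "\<And>l n. l \<in> {1..m} \<Longrightarrow> psh Q (N l) n = 0"
    "\<And>l. l \<in> {1..m} \<Longrightarrow> (\<lambda>n. sq \<eta> (dv l) n - of_int (N l n)) \<longlonglongrightarrow> 0"
proof -
  obtain \<eta> c where \<eta>0: "\<eta> \<noteq> 0" and c: "0 < c" "\<And>n. c \<le> cmod (muhat ((Ei ^^ n) \<eta>))"
    by (rule not_rajchman_orbit[OF assms]) (rule that)
  define x where "x l n = (Ei ^^ n) \<eta> \<bullet> dv l" for l n
  define N where "N l n = round (x l n)" for l n
  have sumd: "summable (\<lambda>n. (x l n - of_int (N l n))\<^sup>2)" if "l \<in> {1..m}" for l
    using non_rajchman_orbit_square_summable[OF c that] by (simp only: x_def N_def)
  have eps: "(\<lambda>n. sq \<eta> (dv l) n - of_int (N l n)) \<longlonglongrightarrow> 0" if "l \<in> {1..m}" for l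
  proof -
    have "(\<lambda>n. \<bar>x l n - of_int (N l n)\<bar>) \<longlonglongrightarrow> 0"
      using tendsto_real_sqrt[OF summable_LIMSEQ_zero[OF sumd[OF that]]] by simp
    then have "(\<lambda>n. complex_of_real (x l n - of_int (N l n))) \<longlonglongrightarrow> complex_of_real 0"
      by (intro tendsto_of_real) (simp add: tendsto_rabs_zero_iff)
    then show ?thesis by (simp add: sq_def x_def)
  qed
  have "\<exists>Q. lead_coeff Q = 1 \<and> (\<forall>n. psh Q (N l) n = 0)" if l: "l \<in> {1..m}" for l
  proof -
    obtain D and ch :: "nat \<Rightarrow> real" where rec: "\<And>n x. (Ei ^^ (n + D)) x = (\<Sum>i<D. ch i *\<^sub>R ((Ei ^^ (n + i)) x))"
      by (rule Ei_recurrence) (rule that)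
    obtain K where K: "1 \<le> K" "\<And>n x. norm ((Ei ^^ n) x) \<le> K ^ n * norm x" by (rule Ei_pow_bound) (rule that)
    have "\<exists>R. R \<noteq> 0 \<and> (\<forall>n. psh R (N l) n = 0)"
    proof (rule almost_integer_recurrence[where x = "x l" and Th = K and C = "norm \<eta> * norm (dv l) + 1"])
      show "x l (n + D) = (\<Sum>i<D. ch i * x l (n + i))" for n
        unfolding x_def rec by (simp add: inner_sum_left)
      show "\<bar>real_of_int (N l n)\<bar> \<le> (norm \<eta> * norm (dv l) + 1) * K ^ n" for n
      proof -
        have "\<bar>x l n\<bar> \<le> norm ((Ei ^^ n) \<eta>) * norm (dv l)" unfolding x_def by (rule Cauchy_Schwarz_ineq2)
        also have "\<dots> \<le> K ^ n * norm \<eta> * norm (dv l)" by (rule mult_right_mono[OF K(2)]) simp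
        finally have "\<bar>x l n\<bar> \<le> (norm \<eta> * norm (dv l)) * K ^ n" by (simp add: mult_ac)
        moreover have "\<bar>of_int (N l n) - x l n\<bar> \<le> 1 / 2" unfolding N_def by (rule of_int_round_abs_le)
        moreover have "1 \<le> K ^ n" using K(1) by simp
        ultimately show ?thesis by (simp only: distrib_right mult_1)
      qed
      show "summable (\<lambda>n. (x l n - of_int (N l n))\<^sup>2)" by (rule sumd[OF l])
    qed (use K in auto)
    then obtain R where "R \<noteq> 0" "\<And>n. psh R (N l) n = 0" by blast
    then show ?thesis by (rule integer_recurrence_monic)
  qed
  then have "\<forall>l\<in>{1..m}. \<exists>Q. lead_coeff Q = 1 \<and> (\<forall>n. psh Q (N l) n = 0)" by blast
  from bchoice[OF this] obtain Ql where Ql: "\<forall>l\<in>{1..m}. lead_coeff (Ql l) = 1 \<and> (\<forall>n. psh (Ql l) (N l) n = 0)" by (rule exE)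
  \<comment> \<open>One polynomial must serve all indices: the product contains each
    \<open>Ql l\<close> as a factor, so it annihilates every integer sequence.\<close>
  define Q1 where "Q1 = (\<Prod>l\<in>{1..m}. Ql l)"
  have Q1: "lead_coeff Q1 = 1" unfolding Q1_def lead_coeff_prod by (rule prod.neutral) (use Ql in simp)
  have psh_tail: "psh (cpoly f) (sq \<eta> (dv l)) n - of_int (psh f (N l) n) = psh (cpoly f) (\<lambda>n. sq \<eta> (dv l) n - of_int (N l n)) n" for f l n
    by (simp only: psh_diff_right psh_cpoly)
  \<comment> \<open>Applied to the phases, \<open>Q1\<close> leaves only its effect on the errors,
    which tends to 0. So the vector \<open>opr Q1 \<eta>\<close> has vanishing observations in the
    limit.\<close>
  have op_Q1: "opr Q1 \<eta> = 0"
  proof (rule observable_limit)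
    fix l assume l: "l \<in> {1..m}"
    have "Q1 = (\<Prod>l'\<in>{1..m} - {l}. Ql l') * Ql l"
      unfolding Q1_def using l by (subst prod.remove[of _ l]) (auto simp: mult.commute)
    then have "psh Q1 (N l) n = psh (\<Prod>l'\<in>{1..m} - {l}. Ql l') (psh (Ql l) (N l)) n" for n by (simp only: psh_mult)
    then have z: "psh Q1 (N l) n = 0" for n using Ql l by (simp add: psh_zero_right)
    have "(\<lambda>n. psh (cpoly Q1) (\<lambda>n. sq \<eta> (dv l) n - of_int (N l n)) n) \<longlonglongrightarrow> 0"
      using psh_tendsto_0[OF eps[OF l]] .
    then have "(\<lambda>n. sq (opr Q1 \<eta>) (dv l) n) \<longlonglongrightarrow> 0" unfolding psh_tail[symmetric] z sq_opr by simp
    then have "(\<lambda>n. complex_of_real ((Ei ^^ n) (opr Q1 \<eta>) \<bullet> dv l)) \<longlonglongrightarrow> complex_of_real 0" by (simp add: sq_def)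
    then show "(\<lambda>n. (Ei ^^ n) (opr Q1 \<eta>) \<bullet> dv l) \<longlonglongrightarrow> 0" by (simp only: tendsto_of_real_iff)
  qed
  have "\<exists>Q. (lead_coeff Q = 1 \<and> opr Q \<eta> = 0) \<and> (\<forall>R. lead_coeff R = 1 \<and> opr R \<eta> = 0 \<longrightarrow> degree Q \<le> degree R)"
    by (rule ex_has_least_nat[of "\<lambda>Q. lead_coeff Q = 1 \<and> opr Q \<eta> = 0" Q1 degree]) (use Q1 op_Q1 in simp)
  then obtain Q where Q: "lead_coeff Q = 1" "opr Q \<eta> = 0"
    and min: "\<And>R. lead_coeff R = 1 \<Longrightarrow> opr R \<eta> = 0 \<Longrightarrow> degree Q \<le> degree R" by blast
  \<comment> \<open>\<open>Q\<close> was chosen minimal for \<eta>, not for the integers, so its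
    relation for \<open>N l\<close> has to be recovered from convergence.\<close>
  have "\<exists>n0. \<forall>n\<ge>n0. psh Q (N l) n = 0" if l: "l \<in> {1..m}" for l
  proof -
    have "(\<lambda>n. - psh (cpoly Q) (\<lambda>n. sq \<eta> (dv l) n - of_int (N l n)) n) \<longlonglongrightarrow> - 0"
      by (intro tendsto_minus) (use psh_tendsto_0[OF eps[OF l]] in simp)
    moreover have "psh (cpoly Q) (sq \<eta> (dv l)) n = 0" for n
      unfolding sq_opr[symmetric] Q(2) by (simp add: sq_def linear_0[OF linear_pow[OF linear_Ei]])
    ultimately have "(\<lambda>n. complex_of_int (psh Q (N l) n)) \<longlonglongrightarrow> 0" unfolding psh_tail[symmetric] by simp
    then obtain n0 where "\<And>n. n0 \<le> n \<Longrightarrow> psh Q (N l) n = 0" by (rule eventually_zero_int_sequence) (rule that)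
    then show ?thesis by blast
  qed
  then have "\<forall>l\<in>{1..m}. \<exists>n0. \<forall>n\<ge>n0. psh Q (N l) n = 0" by blast
  from bchoice[OF this] obtain nl where nl: "\<forall>l\<in>{1..m}. \<forall>n\<ge>nl l. psh Q (N l) n = 0" by (rule exE)
  define n0 where "n0 = (\<Sum>l\<in>{1..m}. nl l)"
  have n0: "psh Q (N l) n = 0" if "l \<in> {1..m}" "n0 \<le> n" for l n
  proof -
    have "nl l \<le> n0" unfolding n0_def by (rule member_le_sum[OF that(1)]) auto
    then show ?thesis using nl that by simp
  qed
  show thesis
  proof (rule that[of "(Ei ^^ n0) \<eta>" Q "\<lambda>l n. N l (n + n0)"])
    show "(Ei ^^ n0) \<eta> \<noteq> 0" by (rule Ei_pow_nonzero[OF \<eta>0])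
    show "muhat ((Ei ^^ n0) \<eta>) \<noteq> 0" using c(1) c(2)[of n0] by auto
    show "opr Q ((Ei ^^ n0) \<eta>) = 0" by (simp add: opr_pow Q linear_0[OF linear_pow[OF linear_Ei]])
    show "degree Q \<le> degree R" if "lead_coeff R = 1" "opr R ((Ei ^^ n0) \<eta>) = 0" for R
    proof (rule min[OF that(1)])
      show "opr R \<eta> = 0" using that(2) Ei_pow_nonzero unfolding opr_pow by blast
    qed
    show "psh Q (\<lambda>n. N l (n + n0)) n = 0" if "l \<in> {1..m}" for l n
      unfolding psh_shift by (rule n0[OF that]) simp
    show "(\<lambda>n. sq ((Ei ^^ n0) \<eta>) (dv l) n - of_int (N l (n + n0))) \<longlonglongrightarrow> 0" if "l \<in> {1..m}" for l
      unfolding sq_pow by (rule LIMSEQ_ignore_initial_segment[OF eps[OF that]])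
  qed (rule Q)
qed

end

subsection \<open>Contracting conjugates yield Pisot data\<close>

context affine_ifs
begin

lemma sq_sum: "sq v u i = (\<Sum>j\<in>UNIV. sq v (axis j 1) i * complex_of_real (u $ j))"
  by (simp add: sq_def inner_axis) (simp add: inner_vec_def)

lemma sq_A: "sq v (A *v u) (Suc i) = sq v u i"
  using At_dot[of "(Ei ^^ Suc i) v" u] by (simp add: sq_def)

text \<open>The orbit is split along the roots \<open>z\<close> of \<open>M\<close> into
  eigenfunctionals \<open>w z\<close>. Components with modulus at most 1 vanish since the powers of
  \<open>A\<close> contract, while those with modulus at least 1 are nonzero and take exact
  polynomial values on \<open>dv l\<close>. Hence no root lies on the unit circle, the expanding
  components are Pisot data, and \<open>z0\<close> makes them of type I.\<close>

lemma contracting_root_pisot: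
  assumes \<eta>: "\<eta> \<noteq> 0" and M: "min_int_poly M z0" "cmod z0 \<le> 1" "opr M \<eta> = 0"
    and N: "\<And>l n. l \<in> {1..m} \<Longrightarrow> psh M (N l) n = 0"
    and eps: "\<And>l. l \<in> {1..m} \<Longrightarrow> (\<lambda>n. sq \<eta> (dv l) n - of_int (N l n)) \<longlonglongrightarrow> 0"
  shows "generalized_pisot_IFS_type_I m \<phi> A a"
proof -
  define Z where "Z = {z. poly (cpoly M) z = 0}"
  \<comment> \<open>Applying the quotient of \<open>M\<close> by \<open>x - z\<close> projects the
    observed orbit onto its \<open>z\<close>-component, which is geometric in \<open>n\<close> and
    linear in \<open>u\<close>.\<close>
  define w where "w z u n = psh (synthetic_div (cpoly M) z) (sq \<eta> u) n" for z u n
  have lM: "lead_coeff M = 1" and Mz0: "poly (cpoly M) z0 = 0" using M(1) by (auto simp: min_int_poly_def)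
  have M0: "cpoly M \<noteq> 0" using lM by auto
  have finZ: "finite Z" unfolding Z_def by (rule poly_roots_finite[OF M0])
  have simple: "\<And>z. poly (cpoly M) z = 0 \<Longrightarrow> poly (pderiv (cpoly M)) z \<noteq> 0" by (rule min_int_poly_simple_roots[OF M(1)])
  have geom: "psh (synthetic_div (cpoly M) z) x n = z ^ n * psh (synthetic_div (cpoly M) z) x 0"
    if "z \<in> Z" "\<And>n. psh (cpoly M) x n = 0" for z x n
  proof (rule linear_factor_recurrence)
    fix n
    have "psh (cpoly M) x n = psh ([:- z, 1:] * synthetic_div (cpoly M) z) x n"
      using synthetic_div_root[of "cpoly M" z] that(1) by (simp add: Z_def)
    then show "psh [:- z, 1:] (psh (synthetic_div (cpoly M) z) x) n = 0" using that(2)[of n] by (simp only: psh_mult)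
  qed
  have Msq: "psh (cpoly M) (sq \<eta> u) n = 0" for u n
    unfolding sq_opr[symmetric] M(3) by (simp add: sq_def linear_0[OF linear_pow[OF linear_Ei]])
  have wgeom: "w z u n = z ^ n * w z u 0" if "z \<in> Z" for z u n
    unfolding w_def by (rule geom[OF that Msq])
  have wA: "w z (A *v u) (Suc n) = w z u n" for z u n
    unfolding w_def by (simp add: psh_def sq_A)
  have wsum: "w z u n = (\<Sum>j\<in>UNIV. w z (axis j 1) n * complex_of_real (u $ j))" for z u n
  proof -
    have "sq \<eta> u = (\<lambda>i. \<Sum>j\<in>UNIV. sq \<eta> (axis j 1) i * complex_of_real (u $ j))" by (rule ext) (rule sq_sum)
    from arg_cong[OF this, of "\<lambda>x. psh (synthetic_div (cpoly M) z) x n"]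
    show ?thesis by (simp only: w_def psh_sum_right)
  qed
  have lagrange: "sq \<eta> u n = (\<Sum>z\<in>Z. (1 / poly (pderiv (cpoly M)) z) * w z u n)" for u n
  proof -
    have "(1 :: complex poly) = (\<Sum>z\<in>Z. smult (poly 1 z / poly (pderiv (cpoly M)) z) (synthetic_div (cpoly M) z))"
      unfolding Z_def by (rule lagrange_identity[OF simple]) (use min_int_poly_degree[OF M(1)] in simp_all)
    then have "psh 1 (sq \<eta> u) n = psh (\<Sum>z\<in>Z. smult (1 / poly (pderiv (cpoly M)) z) (synthetic_div (cpoly M) z)) (sq \<eta> u) n" by simp
    also have "\<dots> = (\<Sum>z\<in>Z. psh (smult (1 / poly (pderiv (cpoly M)) z) (synthetic_div (cpoly M) z)) (sq \<eta> u) n)"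
      using finZ by (induction Z rule: finite_induct) (simp_all add: psh_add)
    finally show ?thesis by (simp add: psh_smult w_def)
  qed
  \<comment> \<open>Moving \<open>k\<close> steps in time and applying \<open>A ^ k\<close> to
    \<open>u\<close> cancel, so \<open>w z u 0 = z ^ k * w z (A ^ k u) 0\<close>; the first factor
    is bounded and the second tends to 0.\<close>
  have small: "w z u 0 = 0" if z: "z \<in> Z" "cmod z \<le> 1" for z u
  proof -
    have iter: "w z (((\<lambda>x. A *v x) ^^ k) u) k = w z u 0" for k by (induction k) (simp_all add: wA)
    have bound: "cmod (w z u 0) \<le> cmod (w z (((\<lambda>x. A *v x) ^^ k) u) 0)" for k
    proof -
      have "w z u 0 = z ^ k * w z (((\<lambda>x. A *v x) ^^ k) u) 0"
        using iter[of k] wgeom[OF z(1), of "((\<lambda>x. A *v x) ^^ k) u" k] by (simp only:)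
      then have "cmod (w z u 0) = cmod z ^ k * cmod (w z (((\<lambda>x. A *v x) ^^ k) u) 0)" by (simp only: norm_mult norm_power)
      also have "\<dots> \<le> 1 * cmod (w z (((\<lambda>x. A *v x) ^^ k) u) 0)"
        by (intro mult_right_mono power_le_one z) auto
      finally show ?thesis by simp
    qed
    have "(\<lambda>k. w z (((\<lambda>x. A *v x) ^^ k) u) 0) \<longlonglongrightarrow> (\<Sum>j\<in>UNIV. w z (axis j 1) 0 * complex_of_real ((0 :: real ^ 'd) $ j))"
      unfolding wsum[of z "((\<lambda>x. A *v x) ^^ _) u" 0]
      by (intro tendsto_sum tendsto_mult tendsto_const tendsto_of_real tendsto_vec_nth A_pow_tendsto)
    then have "(\<lambda>k. w z (((\<lambda>x. A *v x) ^^ k) u) 0) \<longlonglongrightarrow> 0" by simp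
    from tendsto_norm[OF this] have "cmod (w z u 0) \<le> norm (0 :: complex)"
      by (rule LIMSEQ_le_const) (use bound in auto)
    then show ?thesis by simp
  qed
  have "\<forall>l. \<exists>h. \<forall>z. psh (synthetic_div (cpoly M) z) (\<lambda>i. of_int (N l i)) 0 = poly (cpoly h) z"
    by (intro allI psh_root_quotient)
  from choice[OF this] obtain h where h: "\<forall>l z. psh (synthetic_div (cpoly M) z) (\<lambda>i. of_int (N l i)) 0 = poly (cpoly (h l)) z" by (rule exE)
  \<comment> \<open>The component \<open>\<delta>\<close> of the deviation from the integers is
    geometric with ratio \<open>z\<close> of modulus at least 1, and it tends to 0, so it is 0 from
    the start.\<close>
  have pair: "w z (dv l) 0 = poly (cpoly (h l)) z" if z: "z \<in> Z" "1 \<le> cmod z" and l: "l \<in> {1..m}" for z l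
  proof -
    define \<delta> where "\<delta> n = psh (synthetic_div (cpoly M) z) (\<lambda>n. sq \<eta> (dv l) n - of_int (N l n)) n" for n
    have "\<delta> \<longlonglongrightarrow> 0" using psh_tendsto_0[OF eps[OF l]] by (simp only: \<delta>_def[abs_def])
    moreover have "\<delta> n = z ^ n * \<delta> 0" for n
      unfolding \<delta>_def by (rule geom[OF z(1)]) (simp only: psh_diff_right psh_cpoly Msq N[OF l] of_int_0 diff_0_right)
    then have "cmod (\<delta> 0) \<le> cmod (\<delta> n)" for n
    proof -
      assume "\<And>n. \<delta> n = z ^ n * \<delta> 0"
      then have "cmod (\<delta> n) = cmod z ^ n * cmod (\<delta> 0)" by (metis norm_mult norm_power)
      moreover have "1 * cmod (\<delta> 0) \<le> cmod z ^ n * cmod (\<delta> 0)" by (intro mult_right_mono one_le_power z) auto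
      ultimately show ?thesis by simp
    qed
    ultimately have "cmod (\<delta> 0) \<le> norm (0 :: complex)"
      by (intro LIMSEQ_le_const[OF tendsto_norm]) auto
    then have "\<delta> 0 = 0" by simp
    then show ?thesis using h by (simp add: \<delta>_def psh_diff_right w_def)
  qed
  \<comment> \<open>If one expanding component vanished, \<open>M\<close> would divide every
    \<open>h l\<close>, so all components would vanish on all \<open>dv l\<close>, and \<eta> would
    be unobservable.\<close>
  have nonzero: "\<exists>u. w z u 0 \<noteq> 0" if z: "z \<in> Z" "1 \<le> cmod z" for z
  proof (rule ccontr)
    assume "\<not> ?thesis"
    then have wz: "w z u 0 = 0" for u by simp
    have dvz: "w z' (dv l) 0 = 0" if z': "z' \<in> Z" and l: "l \<in> {1..m}" for z' l
    proof (cases "cmod z' \<le> 1")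
      case False
      have "poly (cpoly (h l)) z = 0" using pair[OF z l] wz by simp
      then have "M dvd h l" using min_int_poly_dvd[OF M(1)] z(1) by (simp add: Z_def)
      then have "poly (cpoly (h l)) z' = 0" using z' by (auto simp: Z_def cpoly_mult elim!: dvdE)
      then show ?thesis using pair[OF z' _ l] False by simp
    qed (rule small[OF z'])
    have "sq \<eta> (dv l) n = 0" if l: "l \<in> {1..m}" for l n
      unfolding lagrange
    proof (intro sum.neutral ballI)
      fix z' assume "z' \<in> Z"
      then show "1 / poly (pderiv (cpoly M)) z' * w z' (dv l) n = 0"
        using wgeom[of z' "dv l" n] dvz[OF _ l, of z'] by simp
    qed
    then have "\<eta> = 0" by (intro irreducible_observable) (simp add: sq_def)
    then show False using \<eta> by simp
  qed
  \<comment> \<open>On the unit circle both \<open>small\<close> and \<open>nonzero\<close> would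
    apply.\<close>
  have no1: "cmod z \<noteq> 1" if "z \<in> Z" for z
    using nonzero[OF that] small[OF that] by auto
  define B where "B = {z \<in> Z. 1 < cmod z}"
  have finB: "finite B" by (simp add: B_def finZ)
  have Bne: "B \<noteq> {}"
  proof
    assume "B = {}"
    then have "w z u 0 = 0" if "z \<in> Z" for z u using small[OF that] that by (force simp: B_def)
    then have "sq \<eta> u 0 = 0" for u unfolding lagrange by simp
    then have "\<eta> = 0" by (intro vec_eq_sq) (simp add: sq_def)
    then show False using \<eta> by simp
  qed
  have wit: "pisot_witness B M"
    unfolding pisot_witness_def using lM no1 by (force simp: B_def Z_def)
  have ptB: "pisot_tuple B"
    unfolding pisot_tuple_def
  proof (intro conjI ballI)
    fix z assume "z \<in> B"
    then show "algebraic_int z" "1 < cmod z"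
      using lM by (auto simp: B_def Z_def coeff_map_poly intro!: algebraic_int.intros[of "cpoly M"])
  qed (use finB Bne wit in auto)
  \<comment> \<open>Type I speaks of a witness \<open>P'\<close> of least degree. Like every witness
    it vanishes on \<open>B\<close>, so \<open>M\<close> divides it and it inherits the contracting
    root \<open>z0\<close>.\<close>
  have tI: "pisot_tuple_type_I B"
  proof -
    obtain P' where P': "is_arg_min degree (pisot_witness B) P'"
      using is_arg_min_arg_min_nat[of "pisot_witness B" M degree] wit by blast
    then have "pisot_witness B P'" by (simp add: is_arg_min_def)
    moreover obtain z where z: "z \<in> B" using Bne by blast
    ultimately have "poly (cpoly P') z = 0" by (simp add: pisot_witness_def)
    then have "M dvd P'" by (intro min_int_poly_dvd[OF M(1), of z]) (use z in \<open>simp_all add: B_def Z_def\<close>)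
    then have "poly (cpoly P') z0 = 0" using Mz0 by (auto simp: cpoly_mult elim!: dvdE)
    moreover have "cmod z0 < 1" using M(2) no1[of z0] Mz0 by (auto simp: Z_def)
    ultimately show ?thesis unfolding pisot_tuple_type_I_def using ptB P' by blast
  qed
  obtain \<beta> where \<beta>: "bij_betw \<beta> {1..card B} B" using ex_bij_betw_nat_finite_1[OF finB] by blast
  have \<beta>im: "\<beta> ` {1..card B} = B" and \<beta>inj: "inj_on \<beta> {1..card B}" using \<beta> by (auto simp: bij_betw_def)
  define \<zeta> :: "nat \<Rightarrow> complex ^ 'd" where "\<zeta> j = (\<chi> i. w (\<beta> j) (axis i 1) 0)" for j
  have herm: "hermitian_inner (\<zeta> j) (complexify u) = w (\<beta> j) u 0" for j u
    unfolding wsum[of _ u] by (simp add: hermitian_inner_def \<zeta>_def complexify_def)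
  have data: "generalized_pisot_data m A a (card B) \<beta> \<zeta>"
    unfolding generalized_pisot_data_def \<beta>im
  proof (intro conjI ballI ptB \<beta>inj)
    show "1 \<le> card B" using finB Bne by (simp add: Suc_le_eq card_gt_0_iff)
  next
    fix j assume "j \<in> {1..card B}"
    then have "\<beta> j \<in> B" using \<beta>im by blast
    then have b: "\<beta> j \<in> Z" "1 < cmod (\<beta> j)" by (auto simp: B_def)
    show "\<zeta> j \<noteq> 0"
    proof
      assume "\<zeta> j = 0"
      then have "w (\<beta> j) u 0 = 0" for u using herm[of j u] by (simp add: hermitian_inner_def)
      then show False using nonzero[OF b(1)] b(2) by simp
    qed
    have b0: "\<beta> j \<noteq> 0" using b(2) by auto
    show "map_matrix complex_of_real (Finite_Cartesian_Product.transpose A) *v \<zeta> j = inverse (\<beta> j) *s \<zeta> j"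
      unfolding Finite_Cartesian_Product.vec_eq_iff
    proof
      fix i
      have "(map_matrix complex_of_real (Finite_Cartesian_Product.transpose A) *v \<zeta> j) $ i = (\<Sum>k\<in>UNIV. complex_of_real (A $ k $ i) * \<zeta> j $ k)"
        by (simp add: matrix_vector_mult_def map_matrix_def Finite_Cartesian_Product.transpose_def)
      also have "\<dots> = hermitian_inner (\<zeta> j) (complexify (A *v axis i 1))"
        by (simp add: hermitian_inner_def complexify_def matrix_vector_mul_component inner_axis mult.commute)
      also have "\<dots> = w (\<beta> j) (A *v axis i 1) 0" by (rule herm)
      also have "\<dots> = inverse (\<beta> j) * w (\<beta> j) (axis i 1) 0"
        using wgeom[OF b(1), of "A *v axis i 1" 1] wA[of "\<beta> j" "axis i 1" 0] b0 by simp
      finally show "(map_matrix complex_of_real (Finite_Cartesian_Product.transpose A) *v \<zeta> j) $ i = (inverse (\<beta> j) *s \<zeta> j) $ i"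
        by (simp add: \<zeta>_def)
    qed
  next
    fix l assume l: "l \<in> {1..m}"
    show "\<exists>P. \<forall>j\<in>{1..card B}. hermitian_inner (\<zeta> j) (complexify (a l - a 1)) = poly (cpoly P) (\<beta> j)"
    proof (intro exI[of _ "h l"] ballI)
      fix j assume "j \<in> {1..card B}"
      then have "\<beta> j \<in> B" using \<beta>im by blast
      then have "\<beta> j \<in> Z" "1 \<le> cmod (\<beta> j)" by (auto simp: B_def)
      from pair[OF this l] show "hermitian_inner (\<zeta> j) (complexify (a l - a 1)) = poly (cpoly (h l)) (\<beta> j)"
        unfolding herm by (simp only: dv_def)
    qed
  qed
  show ?thesis
    unfolding generalized_pisot_IFS_type_I_def
    by (intro conjI exI[of _ "card B"] exI[of _ \<beta>] exI[of _ \<zeta>] ifs data) (simp only: \<beta>im tI)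
qed

text \<open>\<open>Q\<close> can have further factors. Writing \<open>Q = M * S\<close>, the vector
  \<open>opr S \<eta>\<close> is annihilated by \<open>M\<close> and is nonzero by minimality of
  \<open>Q\<close>; applying \<open>S\<close> to the integers keeps them integral and asymptotic to
  the phases.\<close>

lemma type_I_of_small_root:
  assumes \<eta>: "\<eta> \<noteq> 0" and Q: "lead_coeff Q = 1" "opr Q \<eta> = 0"
    and min: "\<And>R. lead_coeff R = 1 \<Longrightarrow> opr R \<eta> = 0 \<Longrightarrow> degree Q \<le> degree R"
    and N: "\<And>l n. l \<in> {1..m} \<Longrightarrow> psh Q (N l) n = 0"
    and eps: "\<And>l. l \<in> {1..m} \<Longrightarrow> (\<lambda>n. sq \<eta> (dv l) n - of_int (N l n)) \<longlonglongrightarrow> 0"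
    and z0: "poly (cpoly Q) z0 = 0" "cmod z0 \<le> 1"
  shows "generalized_pisot_IFS_type_I m \<phi> A a"
proof -
  obtain M where M: "min_int_poly M z0" by (rule min_int_poly_exists[OF Q(1) z0(1)]) (rule that)
  have lM: "lead_coeff M = 1" and Mz0: "poly (cpoly M) z0 = 0" using M by (auto simp: min_int_poly_def)
  have "M dvd Q" by (rule min_int_poly_dvd[OF M Mz0 z0(1)])
  then obtain S where S: "Q = M * S" by (rule dvdE)
  have lS: "lead_coeff S = 1" using Q(1) lM by (simp add: S lead_coeff_mult)
  have S0: "S \<noteq> 0" "M \<noteq> 0" using lS lM by auto
  have "opr S \<eta> \<noteq> 0"
  proof
    assume "opr S \<eta> = 0"
    from min[OF lS this] have "degree M = 0" using S0 by (simp add: S degree_mult_eq)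
    then show False using min_int_poly_degree[OF M] by simp
  qed
  then show ?thesis
  proof (rule contracting_root_pisot[OF _ M z0(2), where N = "\<lambda>l. psh S (N l)"])
    show "opr M (opr S \<eta>) = 0" using Q(2) by (simp only: S opr_mult)
    show "psh M (psh S (N l)) n = 0" if "l \<in> {1..m}" for l n
      using N[OF that, of n] by (simp only: S psh_mult)
    show "(\<lambda>n. sq (opr S \<eta>) (dv l) n - of_int (psh S (N l) n)) \<longlonglongrightarrow> 0" if "l \<in> {1..m}" for l
    proof -
      have "(\<lambda>n. psh (cpoly S) (\<lambda>n. sq \<eta> (dv l) n - of_int (N l n)) n) \<longlonglongrightarrow> 0"
        using psh_tendsto_0[OF eps[OF that]] .
      then show ?thesis by (simp only: psh_diff_right psh_cpoly sq_opr)
    qed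
  qed
qed

end

subsection \<open>Dual families and orthogonal projections\<close>

lemma span_image_coefficients:
  fixes \<gamma> :: "'i \<Rightarrow> 'v::real_vector"
  assumes "finite I" "x \<in> span (\<gamma> ` I)"
  obtains t where "x = (\<Sum>i\<in>I. t i *\<^sub>R \<gamma> i)"
proof -
  have "span (\<gamma> ` I) \<subseteq> {x. \<exists>t. x = (\<Sum>i\<in>I. t i *\<^sub>R \<gamma> i)}"
  proof (rule span_minimal)
    show "\<gamma> ` I \<subseteq> {x. \<exists>t. x = (\<Sum>i\<in>I. t i *\<^sub>R \<gamma> i)}"
    proof (intro image_subsetI CollectI)
      fix i assume "i \<in> I"
      then show "\<exists>t. \<gamma> i = (\<Sum>j\<in>I. t j *\<^sub>R \<gamma> j)"
        using assms(1) by (intro exI[of _ "\<lambda>j. if i = j then 1 else 0"]) (simp add: if_distrib[of "\<lambda>c. c *\<^sub>R _"] cong: if_cong)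
    qed
    show "subspace {x. \<exists>t. x = (\<Sum>i\<in>I. t i *\<^sub>R \<gamma> i)}"
      unfolding subspace_def
    proof (intro conjI ballI allI CollectI)
      show "\<exists>t. 0 = (\<Sum>i\<in>I. t i *\<^sub>R \<gamma> i)" by (rule exI[of _ "\<lambda>_. 0"]) simp
    next
      fix x y assume "x \<in> {x. \<exists>t. x = (\<Sum>i\<in>I. t i *\<^sub>R \<gamma> i)}" "y \<in> {x. \<exists>t. x = (\<Sum>i\<in>I. t i *\<^sub>R \<gamma> i)}"
      then obtain t t' where "x = (\<Sum>i\<in>I. t i *\<^sub>R \<gamma> i)" "y = (\<Sum>i\<in>I. t' i *\<^sub>R \<gamma> i)" by auto
      then show "\<exists>t. x + y = (\<Sum>i\<in>I. t i *\<^sub>R \<gamma> i)"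
        by (intro exI[of _ "\<lambda>i. t i + t' i"]) (simp add: scaleR_left_distrib sum.distrib)
    next
      fix c :: real and x assume "x \<in> {x. \<exists>t. x = (\<Sum>i\<in>I. t i *\<^sub>R \<gamma> i)}"
      then obtain t where "x = (\<Sum>i\<in>I. t i *\<^sub>R \<gamma> i)" by auto
      then show "\<exists>t. c *\<^sub>R x = (\<Sum>i\<in>I. t i *\<^sub>R \<gamma> i)"
        by (intro exI[of _ "\<lambda>i. c * t i"]) (simp add: scaleR_sum_right)
    qed
  qed
  then show thesis using assms(2) that by blast
qed

text \<open>\<open>d i\<close> is the component of \<open>\<gamma> i\<close> orthogonal to the other
  members, rescaled; it lies in the span, so it is the dual basis inside the subspace.\<close>

lemma dual_family:
  fixes \<gamma> :: "nat \<Rightarrow> 'v::euclidean_space"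
  assumes indep: "\<And>t i. (\<Sum>i<q. t i *\<^sub>R \<gamma> i) = 0 \<Longrightarrow> i < q \<Longrightarrow> t i = 0"
  obtains d where "\<And>i. i < q \<Longrightarrow> d i \<in> span (\<gamma> ` {..<q})"
    "\<And>i j. i < q \<Longrightarrow> j < q \<Longrightarrow> \<gamma> j \<bullet> d i = (if i = j then 1 else 0)"
proof -
  have "\<exists>d. d \<in> span (\<gamma> ` {..<q}) \<and> (\<forall>j<q. \<gamma> j \<bullet> d = (if i = j then 1 else 0))" if i: "i < q" for i
  proof -
    define S where "S = \<gamma> ` ({..<q} - {i})"
    obtain y z where yz: "y \<in> span S" "\<And>w. w \<in> span S \<Longrightarrow> orthogonal z w" "\<gamma> i = y + z"
      using orthogonal_subspace_decomp_exists[of S "\<gamma> i"] by metis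
    have SV: "span S \<subseteq> span (\<gamma> ` {..<q})" unfolding S_def by (intro span_mono) auto
    have "z \<noteq> 0"
    proof
      assume "z = 0"
      then have "\<gamma> i \<in> span (\<gamma> ` ({..<q} - {i}))" using yz by (simp add: S_def)
      then obtain t where t: "\<gamma> i = (\<Sum>j\<in>{..<q} - {i}. t j *\<^sub>R \<gamma> j)"
        by (rule span_image_coefficients[rotated]) auto
      have "(\<Sum>j<q. (if j = i then - 1 else t j) *\<^sub>R \<gamma> j) = - \<gamma> i + (\<Sum>j\<in>{..<q} - {i}. t j *\<^sub>R \<gamma> j)"
        using i by (subst sum.remove[of _ i]) auto
      then have "(\<Sum>j<q. (if j = i then - 1 else t j) *\<^sub>R \<gamma> j) = 0" using t by simp
      from indep[OF this i] show False by simp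
    qed
    then have zz: "z \<bullet> z \<noteq> 0" by simp
    have "z \<in> span (\<gamma> ` {..<q})"
    proof -
      have "y \<in> span (\<gamma> ` {..<q})" using yz(1) SV by blast
      moreover have "\<gamma> i \<in> span (\<gamma> ` {..<q})" using i by (intro span_base) simp
      ultimately have "\<gamma> i - y \<in> span (\<gamma> ` {..<q})" by (rule span_diff[rotated])
      then show ?thesis using yz(3) by simp
    qed
    moreover have "\<gamma> j \<bullet> ((1 / (z \<bullet> z)) *\<^sub>R z) = (if i = j then 1 else 0)" if j: "j < q" for j
    proof (cases "i = j")
      case True
      have "y \<bullet> z = 0" using yz(2)[OF yz(1)] unfolding orthogonal_def by (simp only: inner_commute)
      then show ?thesis using True yz(3) zz by (simp add: inner_add_left)
    next
      case False
      then have "\<gamma> j \<in> span S" using j by (intro span_base) (auto simp: S_def)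
      from yz(2)[OF this] have "\<gamma> j \<bullet> z = 0" unfolding orthogonal_def by (simp only: inner_commute)
      then show ?thesis using False by simp
    qed
    ultimately show ?thesis by (intro exI[of _ "(1 / (z \<bullet> z)) *\<^sub>R z"]) (simp add: span_mul)
  qed
  then have "\<forall>i\<in>{..<q}. \<exists>d. d \<in> span (\<gamma> ` {..<q}) \<and> (\<forall>j<q. \<gamma> j \<bullet> d = (if i = j then 1 else 0))" by simp
  from bchoice[OF this] obtain d where "\<forall>i\<in>{..<q}. d i \<in> span (\<gamma> ` {..<q}) \<and> (\<forall>j<q. \<gamma> j \<bullet> d i = (if i = j then 1 else 0))"
    by (rule exE)
  then show thesis by (intro that[of d]) auto
qed

lemma dual_expansion:
  fixes \<gamma> d :: "nat \<Rightarrow> 'v::euclidean_space"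
  assumes d: "\<And>i j. i < q \<Longrightarrow> j < q \<Longrightarrow> \<gamma> j \<bullet> d i = (if i = j then 1 else 0)"
    and x: "x \<in> span (\<gamma> ` {..<q})"
  shows "x = (\<Sum>j<q. (x \<bullet> d j) *\<^sub>R \<gamma> j)"
proof -
  obtain t where t: "x = (\<Sum>j<q. t j *\<^sub>R \<gamma> j)" by (rule span_image_coefficients[OF _ x]) auto
  have "x \<bullet> d j = t j" if "j < q" for j
    unfolding t inner_sum_left using that by (simp add: d if_distrib cong: if_cong)
  then show ?thesis by (subst t) simp
qed

lemma dual_family_dim:
  fixes \<gamma> d :: "nat \<Rightarrow> 'v::euclidean_space"
  assumes d: "\<And>i j. i < q \<Longrightarrow> j < q \<Longrightarrow> \<gamma> j \<bullet> d i = (if i = j then 1 else 0)"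
  shows "dim (span (\<gamma> ` {..<q})) = q"
proof -
  have inj: "inj_on \<gamma> {..<q}"
  proof (rule inj_onI)
    fix i j assume ij: "i \<in> {..<q}" "j \<in> {..<q}" "\<gamma> i = \<gamma> j"
    then show "i = j" using d[of i i] d[of i j] by (auto split: if_splits)
  qed
  have "\<not> dependent (\<gamma> ` {..<q})"
  proof
    assume "dependent (\<gamma> ` {..<q})"
    then obtain u v where u: "v \<in> \<gamma> ` {..<q}" "u v \<noteq> 0" "(\<Sum>v\<in>\<gamma> ` {..<q}. u v *\<^sub>R v) = 0"
      by (subst (asm) dependent_finite) auto
    then obtain i where i: "i < q" "v = \<gamma> i" by auto
    have "(\<Sum>j<q. u (\<gamma> j) *\<^sub>R \<gamma> j) \<bullet> d i = 0" using u(3) by (simp add: sum.reindex[OF inj])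
    moreover have "(\<Sum>j<q. u (\<gamma> j) *\<^sub>R \<gamma> j) \<bullet> d i = u (\<gamma> i)"
      unfolding inner_sum_left using i by (simp add: d if_distrib cong: if_cong)
    ultimately show False using u i by simp
  qed
  then have "dim (\<gamma> ` {..<q}) = card (\<gamma> ` {..<q})" by (rule dim_eq_card_independent)
  then show ?thesis by (simp add: card_image[OF inj])
qed

text \<open>The coordinates are the pairings with \<open>\<gamma>\<close>, not the coefficients in
  that basis: under pairing, \<open>A\<close> becomes the matrix of its transpose on the
  \<open>\<gamma> i\<close>.\<close>

lemma dual_family_bij:
  fixes \<gamma> d :: "nat \<Rightarrow> 'v::euclidean_space"
  assumes dV: "\<And>i. i < q \<Longrightarrow> d i \<in> span (\<gamma> ` {..<q})"
    and d: "\<And>i j. i < q \<Longrightarrow> j < q \<Longrightarrow> \<gamma> j \<bullet> d i = (if i = j then 1 else 0)"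
  shows "bij_betw (\<lambda>x. \<lambda>i\<in>{..<q}. \<gamma> i \<bullet> x + c i) (span (\<gamma> ` {..<q})) (Rq q)"
  unfolding bij_betw_def
proof
  show "inj_on (\<lambda>x. \<lambda>i\<in>{..<q}. \<gamma> i \<bullet> x + c i) (span (\<gamma> ` {..<q}))"
  proof (rule inj_onI)
    fix x y assume xy: "x \<in> span (\<gamma> ` {..<q})" "y \<in> span (\<gamma> ` {..<q})"
      and eq: "(\<lambda>i\<in>{..<q}. \<gamma> i \<bullet> x + c i) = (\<lambda>i\<in>{..<q}. \<gamma> i \<bullet> y + c i)"
    have V: "x - y \<in> span (\<gamma> ` {..<q})" using xy by (rule span_diff)
    have "orthogonal (x - y) (\<gamma> i)" if "i < q" for i
      using fun_cong[OF eq, of i] that by (simp add: orthogonal_def inner_diff_left inner_diff_right inner_commute)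
    then have "orthogonal (x - y) (x - y)" by (intro orthogonal_to_span[OF V]) auto
    then show "x = y" by (simp add: orthogonal_self)
  qed
  show "(\<lambda>x. \<lambda>i\<in>{..<q}. \<gamma> i \<bullet> x + c i) ` span (\<gamma> ` {..<q}) = Rq q"
  proof (intro equalityI subsetI)
    fix y assume y: "y \<in> Rq q"
    define x where "x = (\<Sum>i<q. (y i - c i) *\<^sub>R d i)"
    have xV: "x \<in> span (\<gamma> ` {..<q})" unfolding x_def by (intro span_sum span_mul) (simp add: dV)
    have Tx: "(\<lambda>i\<in>{..<q}. \<gamma> i \<bullet> x + c i) = y"
    proof
      fix i
      show "(\<lambda>i\<in>{..<q}. \<gamma> i \<bullet> x + c i) i = y i"
      proof (cases "i < q")
        case True
        then have "\<gamma> i \<bullet> x = y i - c i" unfolding x_def inner_sum_right by (simp add: d if_distrib cong: if_cong)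
        then show ?thesis using True by simp
      next
        case False
        then have "y i = undefined" using PiE_arb[OF y, of i] by simp
        then show ?thesis using False by simp
      qed
    qed
    show "y \<in> (\<lambda>x. \<lambda>i\<in>{..<q}. \<gamma> i \<bullet> x + c i) ` span (\<gamma> ` {..<q})"
      by (rule image_eqI[where x = x], rule Tx[symmetric], rule xV)
  qed (auto simp: PiE_iff extensional_def split: if_splits)
qed

lemma orth_proj:
  fixes V :: "(real ^ 'd) set"
  assumes V: "subspace V"
  shows "orth_proj V x \<in> V" "v \<in> V \<Longrightarrow> v \<bullet> orth_proj V x = v \<bullet> x"
proof -
  have sp: "span V = V" using V by (simp add: span_eq_iff)
  obtain y z where yz: "y \<in> V" "\<And>w. w \<in> V \<Longrightarrow> orthogonal z w" "x = y + z"
    using orthogonal_subspace_decomp_exists[of V x] unfolding sp by metis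
  have "orth_proj V x \<in> V \<and> (\<forall>v\<in>V. orthogonal (x - orth_proj V x) v)"
    unfolding orth_proj_def
  proof (rule theI[of _ y])
    show "y \<in> V \<and> (\<forall>v\<in>V. orthogonal (x - y) v)" using yz by simp
  next
    fix y' assume y': "y' \<in> V \<and> (\<forall>v\<in>V. orthogonal (x - y') v)"
    have V': "y - y' \<in> V" using subspace_diff[OF V] yz(1) y' by blast
    have "(y - y') \<bullet> (y - y') = (x - y') \<bullet> (y - y') - z \<bullet> (y - y')" by (simp add: yz(3) inner_diff_left inner_add_left)
    also have "\<dots> = 0" using y' yz(2)[OF V'] V' by (simp add: orthogonal_def)
    finally show "y' = y" by simp
  qed
  then show "orth_proj V x \<in> V" "v \<in> V \<Longrightarrow> v \<bullet> orth_proj V x = v \<bullet> x"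
    by (auto simp: orthogonal_def inner_diff_left inner_diff_right inner_commute)
qed

subsection \<open>Companion matrices\<close>

lemma monic_recurrence_zero:
  fixes x :: "nat \<Rightarrow> int"
  assumes Q: "lead_coeff Q = 1" and rec: "\<And>n. psh Q x n = 0" and x: "\<And>i. i < degree Q \<Longrightarrow> x i = 0"
  shows "x n = 0"
proof (induction n rule: less_induct)
  case (less n)
  show ?case
  proof (cases "n < degree Q")
    case False
    have "psh Q x (n - degree Q) = (\<Sum>i<degree Q. coeff Q i * x (n - degree Q + i)) + x n"
      using False Q by (simp add: psh_def lessThan_Suc_atMost[symmetric])
    moreover have "(\<Sum>i<degree Q. coeff Q i * x (n - degree Q + i)) = 0"
    proof (intro sum.neutral ballI)
      fix i assume "i \<in> {..<degree Q}"
      then have "x (n - degree Q + i) = 0" by (intro less) (use False in auto)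
      then show "coeff Q i * x (n - degree Q + i) = 0" by simp
    qed
    ultimately show ?thesis using rec by simp
  qed (rule x)
qed

text \<open>\<open>C\<close> is the companion matrix of \<open>Q\<close>, with eigenvectors
  \<open>(1, r, ..., r ^ (q - 1))\<close>, so the eigenvalues of its inverse \<open>B\<close> are
  inverses of roots of \<open>Q\<close>.\<close>

lemma inverse_companion_spectral_radius:
  fixes B C :: "nat \<Rightarrow> nat \<Rightarrow> real" and Q :: "int poly"
  assumes inv: "inverse_matrices_Rq q B C" and Q: "lead_coeff Q = 1" "degree Q = q" "0 < q"
    and roots: "\<And>r. poly (cpoly Q) r = 0 \<Longrightarrow> 1 < cmod r"
    and C: "\<And>i j. i < q \<Longrightarrow> j < q \<Longrightarrow> C i j = (if Suc i < q then if j = Suc i then 1 else 0 else - of_int (coeff Q j))"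
  shows "Defs.spectral_radius {..<q} B < 1"
proof -
  define ev where "ev = complex_eigenvalues {..<q} B"
  have poly: "poly (cpoly Q) r = (\<Sum>j<q. of_int (coeff Q j) * r ^ j) + r ^ q" for r
    using Q by (simp add: poly_altdef coeff_map_poly lessThan_Suc_atMost[symmetric])
  have Crow: "(\<Sum>j<q. complex_of_real (C i j) * z j) = (if Suc i < q then z (Suc i) else - (\<Sum>j<q. of_int (coeff Q j) * z j))"
    if "i < q" for i z
  proof (cases "Suc i < q")
    case True
    have "(\<Sum>j<q. complex_of_real (C i j) * z j) = (\<Sum>j<q. if j = Suc i then z j else 0)"
      by (rule sum.cong) (simp_all add: C that True)
    then show ?thesis using True by simp
  next
    case False
    have "(\<Sum>j<q. complex_of_real (C i j) * z j) = (\<Sum>j<q. - (of_int (coeff Q j) * z j))"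
      by (rule sum.cong) (simp_all add: C that False)
    then show ?thesis using False by (simp add: sum_negf)
  qed
  have delta: "(\<Sum>k<q. complex_of_real (f k) * (\<Sum>j<q. complex_of_real (g k j) * z j)) = z i"
    if i: "i < q" and fg: "\<And>j. j < q \<Longrightarrow> (\<Sum>k<q. f k * g k j) = (if i = j then 1 else 0)" for f g z i
  proof -
    have "(\<Sum>k<q. complex_of_real (f k) * (\<Sum>j<q. complex_of_real (g k j) * z j)) = (\<Sum>j<q. complex_of_real (\<Sum>k<q. f k * g k j) * z j)"
      by (simp add: sum_distrib_left sum_distrib_right mult.assoc) (rule sum.swap)
    also have "\<dots> = (\<Sum>j<q. if i = j then z j else 0)"
    proof (rule sum.cong)
      fix j assume "j \<in> {..<q}"
      then have "(\<Sum>k<q. f k * g k j) = (if i = j then 1 else 0)" by (intro fg) simp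
      then show "complex_of_real (\<Sum>k<q. f k * g k j) * z j = (if i = j then z j else 0)" by (simp only:) simp
    qed simp
    also have "\<dots> = z i" using i by simp
    finally show ?thesis .
  qed
  have BC: "(\<Sum>k<q. complex_of_real (B i k) * (\<Sum>j<q. complex_of_real (C k j) * z j)) = z i"
    and CB: "(\<Sum>k<q. complex_of_real (C i k) * (\<Sum>j<q. complex_of_real (B k j) * z j)) = z i" if "i < q" for i z
    by (rule delta[OF that]; use inv that in \<open>simp add: inverse_matrices_Rq_def\<close>)+
  have sub: "c \<noteq> 0 \<and> poly (cpoly Q) (inverse c) = 0" if "c \<in> ev" for c
  proof -
    obtain z where z: "\<exists>i<q. z i \<noteq> 0" "\<And>i. i < q \<Longrightarrow> (\<Sum>j<q. complex_of_real (B i j) * z j) = c * z i"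
      using \<open>c \<in> ev\<close> unfolding ev_def complex_eigenvalues_def by auto
    have zC: "z i = c * (\<Sum>k<q. complex_of_real (C i k) * z k)" if "i < q" for i
    proof -
      have "(\<Sum>k<q. complex_of_real (C i k) * (\<Sum>j<q. complex_of_real (B k j) * z j)) = c * (\<Sum>k<q. complex_of_real (C i k) * z k)"
        unfolding sum_distrib_left[of c] by (rule sum.cong) (simp_all add: z(2) mult.left_commute)
      then show ?thesis by (rule trans[OF CB[OF that, of z, symmetric]])
    qed
    obtain i0 where i0: "i0 < q" "z i0 \<noteq> 0" using z(1) by blast
    have c0: "c \<noteq> 0"
    proof
      assume "c = 0"
      then have "z i0 = 0" by (subst zC[OF i0(1)]) simp
      then show False using i0(2) by simp
    qed
    define r where "r = inverse c"
    have zr: "r * z i = (if Suc i < q then z (Suc i) else - (\<Sum>j<q. of_int (coeff Q j) * z j))" if "i < q" for i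
    proof -
      have "r * z i = r * (c * (\<Sum>k<q. complex_of_real (C i k) * z k))" by (rule arg_cong[OF zC[OF that]])
      also have "\<dots> = (\<Sum>k<q. complex_of_real (C i k) * z k)" using c0 by (simp add: r_def)
      finally show ?thesis unfolding Crow[OF that] .
    qed
    have pow: "z i = r ^ i * z 0" if "i < q" for i using that
    proof (induction i)
      case (Suc i)
      then show ?case using zr[of i] by (simp add: mult.assoc)
    qed simp
    have "z 0 \<noteq> 0"
    proof
      assume "z 0 = 0"
      then have "z i0 = 0" by (subst pow[OF i0(1)]) simp
      then show False using i0(2) by simp
    qed
    have "r * z (q - 1) = - (\<Sum>j<q. of_int (coeff Q j) * z j)" using zr[of "q - 1"] Q(3) by simp
    moreover have "r * z (q - 1) = r ^ q * z 0" using pow[of "q - 1"] Q(3) by (simp add: power_eq_if)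
    moreover have "(\<Sum>j<q. of_int (coeff Q j) * z j) = (\<Sum>j<q. of_int (coeff Q j) * r ^ j) * z 0"
      unfolding sum_distrib_right
    proof (rule sum.cong)
      fix j assume "j \<in> {..<q}"
      then have "j < q" by simp
      from pow[OF this] show "of_int (coeff Q j) * z j = of_int (coeff Q j) * r ^ j * z 0" by (simp only: mult.assoc)
    qed simp
    ultimately have "r ^ q * z 0 = - ((\<Sum>j<q. of_int (coeff Q j) * r ^ j) * z 0)" by metis
    then have "poly (cpoly Q) r * z 0 = 0" unfolding poly distrib_right by (simp only: right_minus)
    then show ?thesis using \<open>z 0 \<noteq> 0\<close> c0 by (simp add: r_def)
  qed
  have Q0: "cpoly Q \<noteq> 0" using Q by auto
  have "ev \<subseteq> inverse ` {r. poly (cpoly Q) r = 0}"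
  proof
    fix c assume "c \<in> ev"
    then show "c \<in> inverse ` {r. poly (cpoly Q) r = 0}" using sub by (intro image_eqI[of _ _ "inverse c"]) auto
  qed
  then have fin: "finite ev" by (rule finite_subset) (simp add: poly_roots_finite[OF Q0])
  have lt: "cmod c < 1" if "c \<in> ev" for c
    using sub[OF that] roots[of "inverse c"] by (simp add: norm_inverse one_less_inverse_iff)
  \<comment> \<open>A root is produced to show that \<open>B\<close> has an eigenvalue at all: the
    spectral radius is a \<open>Max\<close>, which says nothing for an empty set.\<close>
  have "\<not> constant (poly (cpoly Q))" using Q by (simp add: constant_degree)
  then obtain r where r: "poly (cpoly Q) r = 0" using fundamental_theorem_of_algebra by blast
  have r0: "r \<noteq> 0" using roots[OF r] by auto
  have Cz: "(\<Sum>j<q. complex_of_real (C i j) * r ^ j) = r * r ^ i" if i: "i < q" for i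
  proof (cases "Suc i < q")
    case False
    then have "q = Suc i" using i by simp
    have "- (\<Sum>j<q. of_int (coeff Q j) * r ^ j) = r ^ q" using r unfolding poly by (metis add.inverse_unique)
    then show ?thesis unfolding Crow[OF i, of "\<lambda>j. r ^ j"] using False by (simp add: \<open>q = Suc i\<close>)
  qed (use Crow[OF i, of "\<lambda>j. r ^ j"] in simp)
  have "inverse r \<in> ev"
    unfolding ev_def complex_eigenvalues_def
  proof (intro CollectI exI[of _ "\<lambda>j. r ^ j"] conjI ballI)
    show "\<exists>i\<in>{..<q}. r ^ i \<noteq> 0" using Q(3) r0 by (intro bexI[of _ 0]) auto
    fix i assume "i \<in> {..<q}"
    then have i: "i < q" by simp
    have "(\<Sum>k<q. complex_of_real (B i k) * (r * r ^ k)) = r ^ i"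
    proof -
      have "(\<Sum>k<q. complex_of_real (B i k) * (r * r ^ k)) = (\<Sum>k<q. complex_of_real (B i k) * (\<Sum>j<q. complex_of_real (C k j) * r ^ j))"
        by (rule sum.cong) (simp_all only: Cz lessThan_iff)
      then show ?thesis using BC[OF i, of "\<lambda>j. r ^ j"] by (rule trans)
    qed
    then have "r * (\<Sum>k<q. complex_of_real (B i k) * r ^ k) = r ^ i" by (simp add: sum_distrib_left mult_ac)
    then show "(\<Sum>j<q. complex_of_real (B i j) * r ^ j) = inverse r * r ^ i" using r0 by (simp add: field_simps)
  qed
  then have ne: "cmod ` ev \<noteq> {}" by auto
  show ?thesis unfolding Defs.spectral_radius_def ev_def[symmetric]
    by (subst Max_less_iff) (use fin ne lt in auto)
qed

subsection \<open>Expanding conjugates yield a singular integral factor\<close>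

context affine_ifs
begin

text \<open>A real relation among the first vectors of the orbit makes integer rows of observations
  dependent, so their Gram determinant is 0 and there is an integer relation. It gives a nonzero
  annihilator of degree below that of \<open>Q\<close>, contrary to minimality.\<close>

lemma integral_orbit_independent:
  assumes \<eta>: "\<eta> \<noteq> 0" and Q: "lead_coeff Q = 1" "opr Q \<eta> = 0"
    and min: "\<And>R. lead_coeff R = 1 \<Longrightarrow> opr R \<eta> = 0 \<Longrightarrow> degree Q \<le> degree R"
    and N: "\<And>l n. l \<in> {1..m} \<Longrightarrow> psh Q (N l) n = 0"
    and int: "\<And>l n. l \<in> {1..m} \<Longrightarrow> (Ei ^^ n) \<eta> \<bullet> dv l = of_int (N l n)"
    and t: "(\<Sum>i<degree Q. t i *\<^sub>R (Ei ^^ i) \<eta>) = 0" and i: "i < degree Q"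
  shows "t i = 0"
proof (rule ccontr)
  assume "t i \<noteq> 0"
  define q where "q = degree Q"
  \<comment> \<open>With the largest index of a nonzero coefficient, row \<open>k\<close> is a real
    combination of the rows before it, which is the triangular form of
    \<open>integer_rows_dependent\<close>.\<close>
  define k where "k = Max {i. i < q \<and> t i \<noteq> 0}"
  have fin: "finite {i. i < q \<and> t i \<noteq> 0}" by simp
  have ne: "{i. i < q \<and> t i \<noteq> 0} \<noteq> {}" using i \<open>t i \<noteq> 0\<close> by (auto simp: q_def)
  have k: "k < q" "t k \<noteq> 0" using Max_in[OF fin ne] by (auto simp: k_def)
  have above: "t j = 0" if "j < q" "k < j" for j
  proof (rule ccontr)
    assume "t j \<noteq> 0"
    then have "j \<le> k" unfolding k_def by (intro Max_ge[OF fin]) (use that in simp)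
    then show False using that by simp
  qed
  have tk: "(\<Sum>j<k. t j *\<^sub>R (Ei ^^ j) \<eta>) + t k *\<^sub>R (Ei ^^ k) \<eta> = 0"
  proof -
    have "(\<Sum>j<q. t j *\<^sub>R (Ei ^^ j) \<eta>) = (\<Sum>j\<in>{..<Suc k}. t j *\<^sub>R (Ei ^^ j) \<eta>)"
      by (rule sum.mono_neutral_right) (use k above in auto)
    then show ?thesis using t by (simp add: q_def)
  qed
  \<comment> \<open>The column index \<open>u\<close> encodes the pair of index
    \<open>u mod m + 1\<close> and time \<open>u div m\<close>. The \<open>q * m\<close> columns
    cover all times below \<open>q\<close>, which suffices because the monic recurrence of order
    \<open>q\<close> carries zeros on.\<close>
  define Y where "Y i u = N (u mod m + 1) (u div m + i)" for i u
  define c where "c i j = (if i = k then t j / t k else 0)" for i j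
  have lm: "u mod m + 1 \<in> {1..m}" for u using m1 by (simp add: Suc_le_eq)
  have row0: "of_int (Y k u) + (\<Sum>j<k. c k j * of_int (Y j u)) = 0" for u
  proof -
    define l where "l = u mod m + 1"
    define n where "n = u div m"
    have l: "l \<in> {1..m}" using lm by (simp add: l_def)
    have "(Ei ^^ n) ((\<Sum>j<k. t j *\<^sub>R (Ei ^^ j) \<eta>) + t k *\<^sub>R (Ei ^^ k) \<eta>) \<bullet> dv l = 0"
      unfolding tk by (simp add: linear_0[OF linear_pow[OF linear_Ei]])
    then have "(\<Sum>j<k. t j * of_int (N l (n + j))) + t k * of_int (N l (n + k)) = 0"
      by (simp add: linear_add[OF linear_pow[OF linear_Ei]] linear_sum[OF linear_pow[OF linear_Ei]]
          linear_scale[OF linear_pow[OF linear_Ei]] inner_add_left inner_sum_left int[OF l, symmetric] funpow_add)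
    then have "t k * (of_int (Y k u) + (\<Sum>j<k. c k j * of_int (Y j u))) = 0"
      using k(2) by (simp add: Y_def c_def l_def n_def sum_distrib_left distrib_left)
    then show ?thesis using k(2) by simp
  qed
  have "(\<Prod>i<Suc k. \<Sum>u<q * m. (of_int (Y i u) + (\<Sum>j<i. c i j * of_int (Y j u)))\<^sup>2) = 0"
    by (rule prod_zero) (use row0 in \<open>auto intro!: bexI[of _ k]\<close>)
  then have small: "(\<Prod>i<Suc k. \<Sum>u<q * m. (of_int (Y i u) + (\<Sum>j<i. c i j * of_int (Y j u)))\<^sup>2) < 1" by (simp only: zero_less_one)
  obtain r where r: "\<exists>i<Suc k. r i \<noteq> (0::int)" "\<And>u. u < q * m \<Longrightarrow> (\<Sum>i<Suc k. r i * Y i u) = 0"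
    by (rule integer_rows_dependent[OF small]) (rule that)
  define R where "R = (\<Sum>i<Suc k. monom (r i) i)"
  have cR: "coeff R i = (if i < Suc k then r i else 0)" for i
    by (simp add: R_def coeff_sum del: sum.lessThan_Suc)
  have R0: "R \<noteq> 0" using r(1) cR by (metis coeff_0)
  have dR: "degree R \<le> k" by (rule degree_le) (simp add: cR)
  have pR: "psh R x n = (\<Sum>i<Suc k. r i * x (n + i))" for x n
    unfolding psh_le[OF dR] lessThan_Suc_atMost by (rule sum.cong) (simp_all add: cR)
  have zero: "psh R (N l) n = 0" if l: "l \<in> {1..m}" for l n
  proof (rule monic_recurrence_zero[OF Q(1)])
    show "psh Q (psh R (N l)) n = 0" for n
      unfolding psh_mult_commute[of Q R] by (rule psh_zero_right) (rule N[OF l])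
    fix n assume n: "n < degree Q"
    define u where "u = n * m + (l - 1)"
    from l obtain l' where "l = Suc l'" "l' < m" by (cases l) auto
    then have um: "u mod m + 1 = l" "u div m = n" by (simp_all add: u_def)
    have "n * m + (l - 1) < Suc n * m" using l by auto
    also have "\<dots> \<le> q * m" using n by (intro mult_right_mono) (auto simp: q_def)
    finally have "u < q * m" by (simp add: u_def)
    from r(2)[OF this] show "psh R (N l) n = 0" unfolding pR Y_def um .
  qed
  have "opr R \<eta> = 0"
  proof (rule irreducible_observable)
    fix n l assume l: "l \<in> {1..m}"
    have eq: "sq \<eta> (dv l) = (\<lambda>n. of_int (N l n))" by (rule ext) (simp add: sq_def int[OF l])
    have "sq (opr R \<eta>) (dv l) n = 0" unfolding sq_opr eq psh_cpoly zero[OF l] by simp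
    then show "(Ei ^^ n) (opr R \<eta>) \<bullet> dv l = 0" by (simp add: sq_def)
  qed
  from minimal_annihilator_degree[OF Q min R0 this] show False using dR k(1) by (simp add: q_def)
qed

text \<open>The errors obey the recurrence of \<open>Q\<close>, whose roots are all expanding, and
  tend to 0, so the phases are exactly integral. On the span \<open>V\<close> of the orbit,
  \<open>Ei\<close> acts by the companion matrix of \<open>Q\<close> and the translations pair to
  integers. The image of \<mu> has the nonzero coefficient \<open>muhat \<eta>\<close>, up to a
  phase, at a lattice point.\<close>

lemma singular_factor_of_expanding_roots:
  assumes \<eta>: "\<eta> \<noteq> 0" "muhat \<eta> \<noteq> 0" and Q: "lead_coeff Q = 1" "opr Q \<eta> = 0"
    and min: "\<And>R. lead_coeff R = 1 \<Longrightarrow> opr R \<eta> = 0 \<Longrightarrow> degree Q \<le> degree R"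
    and N: "\<And>l n. l \<in> {1..m} \<Longrightarrow> psh Q (N l) n = 0"
    and eps: "\<And>l. l \<in> {1..m} \<Longrightarrow> (\<lambda>n. sq \<eta> (dv l) n - of_int (N l n)) \<longlonglongrightarrow> 0"
    and roots: "\<And>z. poly (cpoly Q) z = 0 \<Longrightarrow> 1 < cmod z"
  shows "\<exists>q \<psi> \<nu>. integral_factor_IFS q m \<psi> A a \<and> self_affine_measure (borel_Rq q) m \<psi> p \<nu> \<and>
           singular_wrt (lborel_Rq q) \<nu>"
proof -
  have Q0: "cpoly Q \<noteq> 0" using Q(1) by auto
  have int: "(Ei ^^ n) \<eta> \<bullet> dv l = of_int (N l n)" if l: "l \<in> {1..m}" for l n
  proof -
    have "sq \<eta> (dv l) n - of_int (N l n) = 0"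
    proof (rule expanding_recurrence[OF Q0 _ _ eps[OF l]])
      show "1 \<le> cmod z" if "poly (cpoly Q) z = 0" for z using roots[OF that] by simp
      show "psh (cpoly Q) (\<lambda>n. sq \<eta> (dv l) n - of_int (N l n)) n = 0" for n
        unfolding psh_diff_right psh_cpoly N[OF l] sq_opr[symmetric] Q(2)
        by (simp add: sq_def linear_0[OF linear_pow[OF linear_Ei]])
    qed
    then have "complex_of_real ((Ei ^^ n) \<eta> \<bullet> dv l) = complex_of_real (of_int (N l n))" by (simp add: sq_def)
    then show ?thesis by (simp only: of_real_eq_iff)
  qed
  define q where "q = degree Q"
  define \<gamma> where "\<gamma> i = (Ei ^^ i) \<eta>" for i
  define V where "V = span (\<gamma> ` {..<q})"
  have "0 < q"
  proof (rule ccontr)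
    assume "\<not> 0 < q"
    then have "Q = 1" using Q(1) by (auto simp: q_def one_pCons elim: degree_eq_zeroE)
    then show False using Q(2) \<eta>(1) by simp
  qed
  obtain d where dS: "\<And>i. i < q \<Longrightarrow> d i \<in> span (\<gamma> ` {..<q})"
    and d: "\<And>i j. i < q \<Longrightarrow> j < q \<Longrightarrow> \<gamma> j \<bullet> d i = (if i = j then 1 else 0)"
  proof (rule dual_family[where q = q and \<gamma> = \<gamma>])
    show "t i = 0" if "(\<Sum>i<q. t i *\<^sub>R \<gamma> i) = 0" "i < q" for t i
      by (rule integral_orbit_independent[OF \<eta>(1) Q min N int that[unfolded q_def \<gamma>_def]])
  qed (rule that)
  have subV: "subspace V" by (simp add: V_def)
  have \<gamma>V: "\<gamma> i \<in> V" if "i < q" for i unfolding V_def using that by (intro span_base) simp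
  have expand: "x = (\<Sum>j<q. (x \<bullet> d j) *\<^sub>R \<gamma> j)" if "x \<in> V" for x
    by (rule dual_expansion[OF d]) (use that in \<open>simp_all add: V_def\<close>)
  have Ei\<gamma>: "Ei (\<gamma> i) = \<gamma> (Suc i)" for i by (simp add: \<gamma>_def)
  have \<gamma>q: "\<gamma> q = (\<Sum>j<q. (- of_int (coeff Q j)) *\<^sub>R \<gamma> j)"
  proof -
    have "(\<Sum>j<q. of_int (coeff Q j) *\<^sub>R \<gamma> j) + \<gamma> q = 0"
      using Q unfolding opr_def q_def[symmetric] lessThan_Suc_atMost[symmetric] by (simp add: \<gamma>_def q_def[symmetric])
    then show ?thesis by (simp add: sum_negf eq_neg_iff_add_eq_0 add.commute)
  qed
  have Ei\<gamma>V: "Ei (\<gamma> i) \<in> V" if "i < q" for i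
  proof (cases "Suc i < q")
    case False
    then have "Suc i = q" using that by simp
    have "(\<Sum>j<q. (- of_int (coeff Q j)) *\<^sub>R \<gamma> j) \<in> V"
      by (intro subspace_sum[OF subV] subspace_scale[OF subV] \<gamma>V) simp
    then show ?thesis unfolding Ei\<gamma> \<open>Suc i = q\<close> \<gamma>q .
  qed (simp add: Ei\<gamma> \<gamma>V)
  have EiV: "Ei x \<in> V" if "x \<in> V" for x
  proof -
    have "Ei x = (\<Sum>j<q. (x \<bullet> d j) *\<^sub>R Ei (\<gamma> j))"
      using arg_cong[OF expand[OF that], of Ei] by (simp add: linear_sum[OF linear_Ei] linear_scale[OF linear_Ei])
    then show ?thesis by (simp only:) (intro subspace_sum[OF subV] subspace_scale[OF subV] Ei\<gamma>V, simp)
  qed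
  have EiVV: "Ei ` V = V" by (rule invariant_subspace_image[OF linear_Ei inj_Ei subV EiV])
  have AtV: "At x \<in> V" if x: "x \<in> V" for x
  proof -
    from x have "x \<in> Ei ` V" by (simp only: EiVV)
    then obtain y where "y \<in> V" "x = Ei y" by (rule imageE)
    then show ?thesis by simp
  qed
  define B where "B i j = At (\<gamma> i) \<bullet> d j" for i j
  define C where "C i j = Ei (\<gamma> i) \<bullet> d j" for i j
  define b where "b l i = \<gamma> i \<bullet> dv l" for l i
  have Bexp: "At (\<gamma> i) = (\<Sum>j<q. B i j *\<^sub>R \<gamma> j)" if "i < q" for i
    unfolding B_def by (rule expand[OF AtV[OF \<gamma>V[OF that]]])
  have Cexp: "Ei (\<gamma> i) = (\<Sum>j<q. C i j *\<^sub>R \<gamma> j)" if "i < q" for i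
    unfolding C_def by (rule expand[OF Ei\<gamma>V[OF that]])
  have inv: "inverse_matrices_Rq q B C"
    unfolding inverse_matrices_Rq_def
  proof (intro allI impI conjI)
    fix i j assume ij: "i < q" "j < q"
    have "(\<Sum>k<q. B i k * C k j) = Ei (\<Sum>k<q. B i k *\<^sub>R \<gamma> k) \<bullet> d j"
      by (simp add: C_def linear_sum[OF linear_Ei] linear_scale[OF linear_Ei] inner_sum_left)
    also have "\<dots> = \<gamma> i \<bullet> d j" unfolding Bexp[OF ij(1), symmetric] by simp
    finally show "(\<Sum>k<q. B i k * C k j) = (if i = j then 1 else 0)" by (simp add: d[OF ij(2,1)])
    have "(\<Sum>k<q. C i k * B k j) = At (\<Sum>k<q. C i k *\<^sub>R \<gamma> k) \<bullet> d j"
      by (simp add: B_def linear_sum[OF linear_At] linear_scale[OF linear_At] inner_sum_left)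
    also have "\<dots> = \<gamma> i \<bullet> d j" unfolding Cexp[OF ij(1), symmetric] by simp
    finally show "(\<Sum>k<q. C i k * B k j) = (if i = j then 1 else 0)" by (simp add: d[OF ij(2,1)])
  qed
  have Cform: "C i j = (if Suc i < q then if j = Suc i then 1 else 0 else - of_int (coeff Q j))"
    if ij: "i < q" "j < q" for i j
  proof (cases "Suc i < q")
    case True
    then show ?thesis by (simp add: C_def Ei\<gamma> d[OF ij(2)])
  next
    case False
    then have "Suc i = q" using ij by simp
    have "C i j = (\<Sum>k<q. (- of_int (coeff Q k)) * (\<gamma> k \<bullet> d j))"
      unfolding C_def Ei\<gamma> \<open>Suc i = q\<close> \<gamma>q by (simp only: inner_sum_left inner_scaleR_left)
    also have "\<dots> = (\<Sum>k<q. if j = k then - of_int (coeff Q k) else 0)"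
      by (rule sum.cong) (simp_all add: d[OF ij(2)])
    finally show ?thesis using False ij by simp
  qed
  have Cint: "C i j \<in> \<int>" if "i < q" "j < q" for i j using Cform[OF that] by simp
  have bint: "b l i \<in> \<int>" if "l \<in> {1..m}" for l i using int[OF that] by (simp add: b_def \<gamma>_def)
  have sr: "Defs.spectral_radius {..<q} B < 1"
    by (rule inverse_companion_spectral_radius[OF inv Q(1) q_def[symmetric] \<open>0 < q\<close> roots Cform])
  \<comment> \<open>Centring the coordinates at the fixed point of the first map replaces the
    translations \<open>a l\<close> by the differences \<open>dv l\<close>, whose pairings with the
    orbit are the integral ones.\<close>
  obtain x1 where x1: "A *v x1 + a 1 = x1" by (rule fixed_point)
  define T where "T x = (\<lambda>i\<in>{..<q}. \<gamma> i \<bullet> x + (- (\<gamma> i \<bullet> x1)))" for x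
  define \<psi> where "\<psi> l y = (\<lambda>i\<in>{..<q}. (\<Sum>j<q. B i j * y j) + b l i)" for l and y :: "nat \<Rightarrow> real"
  have T\<psi>: "\<psi> l (T x) = (\<lambda>i\<in>{..<q}. \<gamma> i \<bullet> (A *v x + a l) + (- (\<gamma> i \<bullet> x1)))" for l x
  proof
    fix i
    show "\<psi> l (T x) i = (\<lambda>i\<in>{..<q}. \<gamma> i \<bullet> (A *v x + a l) + (- (\<gamma> i \<bullet> x1))) i"
    proof (cases "i < q")
      case True
      have "(\<Sum>j<q. B i j * T x j) = (\<Sum>j<q. B i j * (\<gamma> j \<bullet> (x - x1)))"
        by (rule sum.cong) (simp_all add: T_def inner_diff_right)
      also have "\<dots> = (\<Sum>j<q. B i j *\<^sub>R \<gamma> j) \<bullet> (x - x1)" by (simp add: inner_sum_left)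
      also have "\<dots> = At (\<gamma> i) \<bullet> (x - x1)" by (simp only: Bexp[OF True])
      also have "\<dots> = \<gamma> i \<bullet> (A *v x) - \<gamma> i \<bullet> (A *v x1)" by (simp add: inner_diff_right At_dot)
      also have "A *v x1 = x1 - a 1" using x1 by (simp add: algebra_simps)
      finally show ?thesis using True by (simp add: \<psi>_def b_def dv_def inner_diff_right inner_add_right)
    qed (simp add: \<psi>_def)
  qed
  have factor: "factor_IFS q m \<psi> A a"
    unfolding factor_IFS_def
  proof (intro conjI exI[of _ V] exI[of _ T] ballI)
    have dimV: "dim V = q" unfolding V_def by (rule dual_family_dim[OF d])
    then show "dim V = q" .
    show "1 \<le> q" using \<open>0 < q\<close> by simp
    have "dim V \<le> DIM(real ^ 'd)" by (rule dim_subset_UNIV)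
    then show "q \<le> CARD('d)" using dimV by simp
    show "V \<noteq> {0}" using dimV \<open>0 < q\<close> by auto
    show "Finite_Cartesian_Product.transpose A *v x \<in> V" if "x \<in> V" for x using AtV[OF that] by (simp only: At_def)
    show bij: "invertible_affine_map_onto_Rq q V T"
      unfolding invertible_affine_map_onto_Rq_def
    proof (intro conjI exI[of _ "\<lambda>i x. \<gamma> i \<bullet> x"] exI[of _ "\<lambda>i. - (\<gamma> i \<bullet> x1)"] allI impI ballI)
      show "bij_betw T V (Rq q)" unfolding T_def[abs_def] V_def
        by (rule dual_family_bij[OF dS d])
      show "linear ((\<bullet>) (\<gamma> i))" for i by (rule bounded_linear.linear[OF bounded_linear_inner_right])
      show "T x = (\<lambda>i\<in>{..<q}. \<gamma> i \<bullet> x + - (\<gamma> i \<bullet> x1))" for x by (rule T_def)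
    qed
    fix l y assume y: "y \<in> Rq q"
    have img: "T ` V = Rq q" using bij by (simp add: invertible_affine_map_onto_Rq_def bij_betw_def)
    define x where "x = inv_into V T y"
    have x: "x \<in> V" "T x = y" using y unfolding img[symmetric] x_def by (auto intro: inv_into_into f_inv_into_f)
    have "\<psi> l y = (\<lambda>i\<in>{..<q}. \<gamma> i \<bullet> (A *v x + a l) + (- (\<gamma> i \<bullet> x1)))" using T\<psi>[of l x] by (simp only: x(2))
    also have "\<dots> = T (orth_proj V (A *v x) + orth_proj V (a l))"
      unfolding T_def by (rule restrict_ext) (simp add: inner_add_right orth_proj(2)[OF subV \<gamma>V])
    finally show "\<psi> l y = T (let x = inv_into V T y in orth_proj V (A *v x) + orth_proj V (a l))"
      by (simp only: x_def Let_def)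
  qed (rule subV)
  have integral: "integral_affine_IFS_Rq q m \<psi>"
    unfolding integral_affine_IFS_Rq_def
  proof (rule exI[of _ B], rule exI[of _ b], intro conjI)
    show "homogeneous_affine_IFS_Rq q m \<psi> B b"
      unfolding homogeneous_affine_IFS_Rq_def
    proof (intro conjI)
      show "\<exists>C. inverse_matrices_Rq q B C" by (rule exI[of _ C]) (rule inv)
      show "\<forall>l\<in>{1..m}. \<forall>x\<in>Rq q. \<psi> l x = (\<lambda>i\<in>{..<q}. (\<Sum>j<q. B i j * x j) + b l i)"
        unfolding \<psi>_def by (intro ballI refl)
    qed (rule m1, rule sr)
    show "\<exists>C. inverse_matrices_Rq q B C \<and> (\<forall>i<q. \<forall>j<q. C i j \<in> \<int>)"
      by (rule exI[of _ C]) (intro conjI inv allI impI Cint)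
    show "\<forall>l\<in>{1..m}. \<forall>i<q. b l i \<in> \<int>" by (intro ballI allI impI bint)
  qed
  have Tmeas: "T \<in> measurable borel (borel_Rq q)"
    unfolding T_def[abs_def] by (rule measurable_restrict) measurable
  have \<psi>meas: "\<psi> l \<in> measurable (borel_Rq q) (borel_Rq q)" for l
    unfolding \<psi>_def[abs_def]
    by (intro measurable_restrict borel_measurable_add borel_measurable_sum borel_measurable_times borel_measurable_const measurable_component_singleton) auto
  have Tmu: "T \<in> measurable \<mu> (borel_Rq q)" using Tmeas by (simp only: measurable_cong_sets[OF sets_mu refl])
  have spmu: "space \<mu> = UNIV" using sets_eq_imp_space_eq[OF sets_mu] by simp
  define \<nu> where "\<nu> = distr \<mu> (borel_Rq q) T"
  have sa\<nu>: "self_affine_measure (borel_Rq q) m \<psi> p \<nu>"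
    unfolding self_affine_measure_def
  proof (intro conjI ballI)
    show "sets \<nu> = sets (borel_Rq q)" by (simp add: \<nu>_def)
    show "emeasure \<nu> (space \<nu>) = 1" unfolding \<nu>_def by (rule prob_space.emeasure_space_1[OF prob_space_distr[OF Tmu]])
    fix E assume E: "E \<in> sets (borel_Rq q)"
    have TE: "T -` E \<in> sets borel" using measurable_sets[OF Tmeas E] by simp
    have "measure \<nu> E = measure \<mu> (T -` E)" unfolding \<nu>_def by (simp add: measure_distr[OF Tmu E] spmu)
    also have "\<dots> = (\<Sum>l\<in>{1..m}. p l * measure \<mu> (\<phi> l -` (T -` E) \<inter> space borel))"
      using sa TE unfolding self_affine_measure_def by blast
    also have "\<dots> = (\<Sum>l\<in>{1..m}. p l * measure \<nu> (\<psi> l -` E \<inter> space (borel_Rq q)))"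
    proof (rule sum.cong)
      fix l assume l: "l \<in> {1..m}"
      have "measure \<nu> (\<psi> l -` E \<inter> space (borel_Rq q)) = measure \<mu> (T -` (\<psi> l -` E \<inter> space (borel_Rq q)))"
        unfolding \<nu>_def by (simp add: measure_distr[OF Tmu measurable_sets[OF \<psi>meas E]] spmu)
      also have "T -` (\<psi> l -` E \<inter> space (borel_Rq q)) = \<phi> l -` (T -` E) \<inter> space borel"
      proof -
        have "T (\<phi> l x) = \<psi> l (T x)" for x unfolding T\<psi> phi[OF l] by (rule T_def)
        moreover have "T x \<in> space (borel_Rq q)" for x using measurable_space[OF Tmeas, of x] by simp
        ultimately show ?thesis by auto
      qed
      finally show "p l * measure \<mu> (\<phi> l -` (T -` E) \<inter> space borel) = p l * measure \<nu> (\<psi> l -` E \<inter> space (borel_Rq q))" by simp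
    qed simp
    finally show "measure \<nu> E = (\<Sum>l\<in>{1..m}. p l * measure \<nu> (\<psi> l -` E \<inter> space (borel_Rq q)))" .
  qed
  interpret I: integral_system q m \<psi> p \<nu> B C b
    by unfold_locales (assumption | rule sa\<nu> pp inv Cint bint | simp add: \<psi>_def)+
  \<comment> \<open>The first unit vector: its character composed with \<open>T\<close> is
    \<open>ee (\<eta> \<bullet> x)\<close> up to a constant phase.\<close>
  define k where "k = (\<lambda>i\<in>{..<q}. if i = 0 then 1 else (0::real))"
  have "I.nuhat k = muhat \<eta> * ee (- (\<gamma> 0 \<bullet> x1))"
  proof -
    have "I.nuhat k = (LINT x|\<mu>. chr q k (T x))"
      unfolding I.nuhat_def unfolding \<nu>_def by (rule integral_distr[OF Tmu chr_measurable])
    also have "\<dots> = (LINT x|\<mu>. ee (\<eta> \<bullet> x) * ee (- (\<gamma> 0 \<bullet> x1)))"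
    proof (rule Bochner_Integration.integral_cong)
      fix x
      have "(\<Sum>i<q. k i * T x i) = (\<Sum>i<q. if i = 0 then T x 0 else 0)" by (rule sum.cong) (simp_all add: k_def)
      also have "\<dots> = \<eta> \<bullet> x + (- (\<gamma> 0 \<bullet> x1))" using \<open>0 < q\<close> by (simp add: T_def \<gamma>_def)
      finally show "chr q k (T x) = ee (\<eta> \<bullet> x) * ee (- (\<gamma> 0 \<bullet> x1))" unfolding chr_def by (simp only: ee_add)
    qed simp
    finally show ?thesis by (simp add: muhat_def)
  qed
  moreover have "ee t \<noteq> 0" for t using norm_ee[of t] by (metis norm_zero zero_neq_one)
  ultimately have nz: "I.nuhat k \<noteq> 0" using \<eta>(2) by simp
  have AtpV: "(At ^^ n) \<eta> \<in> V" for n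
    using \<gamma>V[OF \<open>0 < q\<close>] AtV by (induction n) (auto simp: \<gamma>_def)
  \<comment> \<open>The iterates of \<open>Bt\<close> are the coefficients of
    \<open>(At ^^ n) \<eta>\<close> in the basis \<open>\<gamma>\<close>; the decay required for
    singularity is that of \<open>At\<close>.\<close>
  have Btk: "(I.Bt ^^ n) k i = (At ^^ n) \<eta> \<bullet> d i" if "i < q" for n i
    using that
  proof (induction n arbitrary: i)
    case 0
    then show ?case using d[OF 0 \<open>0 < q\<close>] by (simp add: k_def \<gamma>_def)
  next
    case (Suc n)
    have "(I.Bt ^^ Suc n) k i = (\<Sum>j<q. (I.Bt ^^ n) k j * B j i)" using Suc.prems by (simp add: I.Bt_def)
    also have "\<dots> = (\<Sum>j<q. ((At ^^ n) \<eta> \<bullet> d j) * (At (\<gamma> j) \<bullet> d i))"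
      by (rule sum.cong) (simp_all add: Suc.IH B_def)
    also have "\<dots> = At (\<Sum>j<q. ((At ^^ n) \<eta> \<bullet> d j) *\<^sub>R \<gamma> j) \<bullet> d i"
      by (simp add: linear_sum[OF linear_At] linear_scale[OF linear_At] inner_sum_left)
    also have "\<dots> = At ((At ^^ n) \<eta>) \<bullet> d i" by (simp only: expand[OF AtpV, symmetric])
    finally show ?case by simp
  qed
  have "singular_wrt (lborel_Rq q) \<nu>"
  proof (rule I.singular_of_nonvanishing_coefficient[OF _ _ nz])
    show "k \<in> I.lattice" by (auto simp: k_def I.lattice_def)
    show "\<exists>i<q. k i \<noteq> 0" using \<open>0 < q\<close> by (intro exI[of _ 0]) (simp add: k_def)
    show "(\<lambda>n. (I.Bt ^^ n) k i) \<longlonglongrightarrow> 0" if "i < q" for i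
    proof -
      have "(\<lambda>n. (At ^^ n) \<eta> \<bullet> d i) \<longlonglongrightarrow> 0 \<bullet> d i" by (intro tendsto_inner At_pow_tendsto tendsto_const)
      then show ?thesis by (simp add: Btk[OF that])
    qed
  qed
  then show ?thesis using factor integral sa\<nu> unfolding integral_factor_IFS_def by blast
qed

theorem not_rajchman_imp:
  assumes "\<not> rajchman \<mu>"
  shows "generalized_pisot_IFS_type_I m \<phi> A a \<or>
    (\<exists>q \<psi> \<nu>. integral_factor_IFS q m \<psi> A a \<and> self_affine_measure (borel_Rq q) m \<psi> p \<nu> \<and>
           singular_wrt (lborel_Rq q) \<nu>)"
proof -
  obtain \<eta> N Q where *: "\<eta> \<noteq> 0" "muhat \<eta> \<noteq> 0" "lead_coeff Q = 1" "opr Q \<eta> = 0"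
    "\<And>R. lead_coeff R = 1 \<Longrightarrow> opr R \<eta> = 0 \<Longrightarrow> degree Q \<le> degree R"
    "\<And>l n. l \<in> {1..m} \<Longrightarrow> psh Q (N l) n = 0"
    "\<And>l. l \<in> {1..m} \<Longrightarrow> (\<lambda>n. sq \<eta> (dv l) n - of_int (N l n)) \<longlonglongrightarrow> 0"
    by (rule non_rajchman_integral_recurrence[OF assms]) (rule that)
  show ?thesis
  proof (cases "\<exists>z. poly (cpoly Q) z = 0 \<and> cmod z \<le> 1")
    case True
    then obtain z0 where "poly (cpoly Q) z0 = 0" "cmod z0 \<le> 1" by blast
    from type_I_of_small_root[OF *(1,3-7) this] show ?thesis by (rule disjI1)
  next
    case False
    then have "1 < cmod z" if "poly (cpoly Q) z = 0" for z using that by (meson not_less)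
    from singular_factor_of_expanding_roots[OF * this] show ?thesis by (rule disjI2)
  qed
qed

end

subsection \<open>Singular integral factors\<close>

lemma linear_functional_inner:
  fixes L :: "'v::euclidean_space \<Rightarrow> real"
  assumes "linear L"
  shows "L x = (\<Sum>b\<in>Basis. L b *\<^sub>R b) \<bullet> x"
proof -
  have "L x = L (\<Sum>b\<in>Basis. (x \<bullet> b) *\<^sub>R b)" by (simp only: euclidean_representation)
  also have "\<dots> = (\<Sum>b\<in>Basis. (x \<bullet> b) * L b)" by (simp add: linear_sum[OF assms] linear_scale[OF assms])
  also have "\<dots> = (\<Sum>b\<in>Basis. L b *\<^sub>R b) \<bullet> x"
    unfolding inner_sum_left by (rule sum.cong) (simp_all add: inner_commute mult.commute)
  finally show ?thesis .
qed

context affine_ifs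
begin

text \<open>Frequencies \<open>k\<close> of the factor lift linearly to vectors
  \<open>\<theta> k\<close> with \<open>At (\<theta> k) = \<theta> (Bt k)\<close> and masks of equal
  modulus, so the two Fourier transforms have equal modulus at corresponding points. Singularity
  yields a nonzero coefficient at a nonzero lattice point, which repeats along its
  \<open>Ct\<close>-orbit; the lift is an orbit that a Rajchman measure does not allow.\<close>

theorem singular_integral_factor_not_rajchman:
  assumes fac: "integral_factor_IFS q m \<psi> A a"
    and sa\<nu>: "self_affine_measure (borel_Rq q) m \<psi> p \<nu>" and sing: "singular_wrt (lborel_Rq q) \<nu>"
  shows "\<not> rajchman \<mu>"
proof
  assume raj: "rajchman \<mu>"
  have "integral_affine_IFS_Rq q m \<psi>" using fac by (simp add: integral_factor_IFS_def)
  then obtain B b C where hom: "homogeneous_affine_IFS_Rq q m \<psi> B b" and inv: "inverse_matrices_Rq q B C"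
    and Cint: "\<forall>i<q. \<forall>j<q. C i j \<in> \<int>" and bint: "\<forall>l\<in>{1..m}. \<forall>i<q. b l i \<in> \<int>"
    unfolding integral_affine_IFS_Rq_def by (elim exE conjE)
  have psi: "\<psi> l y = (\<lambda>i\<in>{..<q}. (\<Sum>j<q. B i j * y j) + b l i)" if "l \<in> {1..m}" "y \<in> Rq q" for l y
    using hom that by (simp add: homogeneous_affine_IFS_Rq_def)
  interpret I: integral_system q m \<psi> p \<nu> B C b
  proof unfold_locales
    show "C i j \<in> \<int>" if "i < q" "j < q" for i j using Cint that by simp
    show "b l i \<in> \<int>" if "l \<in> {1..m}" "i < q" for l i using bint that by simp
  qed (rule sa\<nu>, rule pp, rule psi, assumption+, rule inv)
  have "factor_IFS q m \<psi> A a" using fac by (simp add: integral_factor_IFS_def)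
  then obtain V T where subV: "subspace V" and AtV0: "\<forall>x\<in>V. Finite_Cartesian_Product.transpose A *v x \<in> V"
    and T: "invertible_affine_map_onto_Rq q V T"
    and conj: "\<forall>l\<in>{1..m}. \<forall>y\<in>Rq q. \<psi> l y = T (let x = inv_into V T y in orth_proj V (A *v x) + orth_proj V (a l))"
    unfolding factor_IFS_def by (elim exE conjE)
  have AtV: "At x \<in> V" if "x \<in> V" for x using bspec[OF AtV0 that] by (simp only: At_def)
  obtain L c where bij: "bij_betw T V (Rq q)" and L: "\<forall>i<q. linear (L i)"
    and TL: "\<forall>x\<in>V. T x = (\<lambda>i\<in>{..<q}. L i x + c i)"
    using T unfolding invertible_affine_map_onto_Rq_def by (elim exE conjE)
  \<comment> \<open>Projecting the representing vector of \<open>L i\<close> into \<open>V\<close>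
    changes nothing on \<open>V\<close>, and makes pairing with \<open>w i\<close> blind to the
    orthogonal projections in the definition of a factor.\<close>
  define w where "w i = orth_proj V (\<Sum>b\<in>Basis. L i b *\<^sub>R b)" for i
  have wV: "w i \<in> V" for i unfolding w_def by (rule orth_proj(1)[OF subV])
  have Lw: "L i x = w i \<bullet> x" if "i < q" "x \<in> V" for i x
  proof -
    have "linear (L i)" using L that by simp
    then have "L i x = x \<bullet> (\<Sum>b\<in>Basis. L i b *\<^sub>R b)" using linear_functional_inner by (metis inner_commute)
    also have "\<dots> = x \<bullet> w i" unfolding w_def by (rule orth_proj(2)[OF subV that(2), symmetric])
    finally show ?thesis by (simp only: inner_commute)
  qed
  have Tw: "T x i = w i \<bullet> x + c i" if "i < q" "x \<in> V" for i x
    using TL that by (simp add: Lw)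
  have TR: "T x \<in> Rq q" if "x \<in> V" for x using bij that by (rule bij_betwE[THEN bspec])
  have key: "(\<Sum>j<q. B i j * (w j \<bullet> x + c j)) + b l i = w i \<bullet> (A *v x) + w i \<bullet> a l + c i"
    if l: "l \<in> {1..m}" and x: "x \<in> V" and i: "i < q" for l x i
  proof -
    have "inv_into V T (T x) = x" by (rule inv_into_f_f[OF bij_betw_imp_inj_on[OF bij] x])
    then have "\<psi> l (T x) = T (orth_proj V (A *v x) + orth_proj V (a l))"
      using conj l TR[OF x] by (simp add: Let_def)
    moreover have "orth_proj V (A *v x) + orth_proj V (a l) \<in> V"
      by (intro subspace_add[OF subV] orth_proj(1)[OF subV])
    ultimately have "\<psi> l (T x) i = w i \<bullet> (A *v x) + w i \<bullet> a l + c i"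
      by (simp add: Tw[OF i] inner_add_right orth_proj(2)[OF subV wV])
    moreover have "\<psi> l (T x) i = (\<Sum>j<q. B i j * (w j \<bullet> x + c j)) + b l i"
      unfolding psi[OF l TR[OF x]] using i x by (simp add: Tw)
    ultimately show ?thesis by simp
  qed
  have key0: "(\<Sum>j<q. B i j * c j) + b l i = w i \<bullet> a l + c i" if "l \<in> {1..m}" "i < q" for l i
    using key[OF that(1) subspace_0[OF subV] that(2)] by simp
  have one: "1 \<in> {1..m}" using m1 by simp
  \<comment> \<open>The difference \<open>D\<close> of the two sides lies in \<open>V\<close>, since
    \<open>V\<close> is invariant; testing \<open>key\<close> at \<open>x = D\<close>, and
    subtracting its instance at 0, gives \<open>D \<bullet> D = 0\<close>.\<close>
  have Atw: "At (w i) = (\<Sum>j<q. B i j *\<^sub>R w j)" if i: "i < q" for i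
  proof -
    define D where "D = At (w i) - (\<Sum>j<q. B i j *\<^sub>R w j)"
    have DV: "D \<in> V" unfolding D_def
      by (intro subspace_diff[OF subV] AtV wV subspace_sum[OF subV] subspace_scale[OF subV])
    have "(\<Sum>j<q. B i j * (w j \<bullet> D + c j)) = (\<Sum>j<q. B i j * (w j \<bullet> D)) + (\<Sum>j<q. B i j * c j)"
      by (simp only: distrib_left sum.distrib)
    then have "(\<Sum>j<q. B i j * (w j \<bullet> D)) = w i \<bullet> (A *v D)"
      using key[OF one DV i] key0[OF one i] by linarith
    then have "D \<bullet> D = 0" unfolding D_def[THEN arg_cong[of _ _ "\<lambda>v. v \<bullet> D"]]
      by (simp add: inner_diff_left inner_sum_left At_dot)
    then show ?thesis by (simp add: D_def)
  qed
  define \<theta> where "\<theta> k = (\<Sum>i<q. k i *\<^sub>R w i)" for k :: "nat \<Rightarrow> real"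
  have At\<theta>: "At (\<theta> k) = \<theta> (I.Bt k)" for k
  proof -
    have "At (\<theta> k) = (\<Sum>i<q. k i *\<^sub>R At (w i))" by (simp add: \<theta>_def linear_sum[OF linear_At] linear_scale[OF linear_At])
    also have "\<dots> = (\<Sum>i<q. \<Sum>j<q. (k i * B i j) *\<^sub>R w j)"
      by (rule sum.cong) (simp_all add: Atw scaleR_sum_right)
    also have "\<dots> = (\<Sum>j<q. \<Sum>i<q. (k i * B i j) *\<^sub>R w j)" by (rule sum.swap)
    also have "\<dots> = (\<Sum>j<q. (\<Sum>i<q. k i * B i j) *\<^sub>R w j)" by (simp only: scaleR_sum_left)
    also have "\<dots> = \<theta> (I.Bt k)" unfolding \<theta>_def by (rule sum.cong) (simp_all add: I.Bt_def)
    finally show ?thesis .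
  qed
  have At\<theta>p: "(At ^^ n) (\<theta> k) = \<theta> ((I.Bt ^^ n) k)" for n k
    by (induction n) (simp_all add: At\<theta>)
  have P\<theta>: "cmod (P (\<theta> k)) = cmod (I.Pb k)" for k
  proof -
    have "(\<Sum>l\<in>{1..m}. p l * ee (\<theta> k \<bullet> dv l)) = (\<Sum>l\<in>{1..m}. p l * ee (\<Sum>i<q. k i * b l i)) * ee (- (\<Sum>i<q. k i * b 1 i))"
      unfolding sum_distrib_right
    proof (rule sum.cong)
      fix l assume l: "l \<in> {1..m}"
      have "\<theta> k \<bullet> dv l = (\<Sum>i<q. k i * (b l i - b 1 i))"
        unfolding \<theta>_def inner_sum_left
      proof (rule sum.cong)
        fix i assume "i \<in> {..<q}"
        then have "i < q" by simp
        then have "w i \<bullet> dv l = b l i - b 1 i"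
          using key0[OF l] key0[OF one] by (simp add: dv_def inner_diff_right) (smt (verit))
        then show "k i *\<^sub>R w i \<bullet> dv l = k i * (b l i - b 1 i)" by simp
      qed simp
      also have "\<dots> = (\<Sum>i<q. k i * b l i) + (- (\<Sum>i<q. k i * b 1 i))" by (simp add: right_diff_distrib sum_subtractf)
      finally show "p l * ee (\<theta> k \<bullet> dv l) = p l * ee (\<Sum>i<q. k i * b l i) * ee (- (\<Sum>i<q. k i * b 1 i))"
        by (simp only: ee_add mult.assoc)
    qed simp
    then show ?thesis unfolding P_dv I.Pb_def by (simp only: norm_mult norm_ee mult_1_right)
  qed
  \<comment> \<open>Surjectivity of \<open>T\<close> supplies vectors dual to the
    \<open>w j\<close>, so the lift \<open>\<theta>\<close> is injective and coordinates of
    \<open>k\<close> can be read off \<open>\<theta> k\<close>.\<close>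
  have dual: "\<exists>x. \<forall>j<q. w j \<bullet> x = (if i = j then 1 else 0)" if "i < q" for i
  proof -
    define y where "y = (\<lambda>j\<in>{..<q}. (if i = j then 1 else 0) + c j)"
    have "y \<in> Rq q" by (auto simp: y_def)
    then have "y \<in> T ` V" using bij_betw_imp_surj_on[OF bij] by simp
    then obtain x where x: "x \<in> V" "y = T x" by (elim imageE)
    have "w j \<bullet> x = (if i = j then 1 else 0)" if "j < q" for j
    proof -
      have "y j = w j \<bullet> x + c j" using x(2) Tw[OF that x(1)] by simp
      then show ?thesis using that by (simp add: y_def)
    qed
    then show ?thesis by blast
  qed
  have coord: "\<exists>x. \<forall>k. \<theta> k \<bullet> x = k i" if i: "i < q" for i
  proof -
    obtain x where x: "\<forall>j<q. w j \<bullet> x = (if i = j then 1 else 0)" using dual[OF i] by (rule exE)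
    have "\<theta> k \<bullet> x = k i" for k
    proof -
      have "\<theta> k \<bullet> x = (\<Sum>j<q. if i = j then k j else 0)"
        unfolding \<theta>_def inner_sum_left by (rule sum.cong) (use x in auto)
      then show ?thesis using i by simp
    qed
    then show ?thesis by blast
  qed
  have decay: "(\<lambda>n. (I.Bt ^^ n) k i) \<longlonglongrightarrow> 0" if i: "i < q" for k i
  proof -
    obtain x where x: "\<forall>k. \<theta> k \<bullet> x = k i" using coord[OF i] by (rule exE)
    have "(\<lambda>n. (At ^^ n) (\<theta> k) \<bullet> x) \<longlonglongrightarrow> 0 \<bullet> x" by (intro tendsto_inner At_pow_tendsto tendsto_const)
    then show ?thesis by (simp add: At\<theta>p x)
  qed
  have muhat_nuhat: "cmod (muhat (\<theta> k)) = cmod (I.nuhat k)" for k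
  proof -
    \<comment> \<open>Stated as an equality of products, since mask values may vanish and cannot be
      divided out; both auxiliary factors tend to 1.\<close>
    have cross: "cmod (muhat (\<theta> k)) * cmod (I.nuhat ((I.Bt ^^ n) k)) = cmod (I.nuhat k) * cmod (muhat (\<theta> ((I.Bt ^^ n) k)))" for n
    proof (induction n arbitrary: k)
      case (Suc n)
      have "cmod (muhat (\<theta> k)) * cmod (I.nuhat ((I.Bt ^^ Suc n) k))
        = cmod (I.Pb k) * (cmod (muhat (\<theta> (I.Bt k))) * cmod (I.nuhat ((I.Bt ^^ n) (I.Bt k))))"
        by (simp only: muhat_step[of "\<theta> k"] norm_mult P\<theta> At\<theta> funpow_Suc_right o_apply mult.assoc)
      also have "\<dots> = cmod (I.Pb k) * (cmod (I.nuhat (I.Bt k)) * cmod (muhat (\<theta> ((I.Bt ^^ n) (I.Bt k)))))"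
        by (simp only: Suc.IH)
      also have "\<dots> = cmod (I.nuhat k) * cmod (muhat (\<theta> ((I.Bt ^^ Suc n) k)))"
        by (simp only: I.nuhat_step[of k] norm_mult funpow_Suc_right o_apply mult.assoc)
      finally show ?case .
    qed simp
    have "(\<lambda>n. cmod (muhat (\<theta> k)) * cmod (I.nuhat ((I.Bt ^^ n) k))) \<longlonglongrightarrow> cmod (muhat (\<theta> k)) * cmod (I.nuhat (\<lambda>_. 0))"
      by (intro tendsto_mult tendsto_const tendsto_norm I.nuhat_tendsto decay)
    moreover have "(\<lambda>n. cmod (I.nuhat k) * cmod (muhat (\<theta> ((I.Bt ^^ n) k)))) \<longlonglongrightarrow> cmod (I.nuhat k) * cmod 1"
      unfolding At\<theta>p[symmetric] by (intro tendsto_mult tendsto_const tendsto_norm muhat_At_pow_tendsto)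
    ultimately show ?thesis unfolding cross using LIMSEQ_unique by fastforce
  qed
  have "\<exists>k :: nat \<Rightarrow> int. (\<exists>i<q. k i \<noteq> 0) \<and> (LINT y|\<nu>. chr q (\<lambda>i. of_int (k i)) y) \<noteq> 0"
  proof (rule ccontr)
    assume no: "\<not> ?thesis"
    have "\<not> singular_wrt (lborel_Rq q) \<nu>"
      by (rule not_singular_of_vanishing_coefficients[OF I.prob_space_axioms I.sets_nu]) (use no in blast)
    then show False using sing by (rule notE)
  qed
  then obtain k0 :: "nat \<Rightarrow> int" and i0 where i0: "i0 < q" "k0 i0 \<noteq> 0"
    and nz: "(LINT y|\<nu>. chr q (\<lambda>i. of_int (k0 i)) y) \<noteq> 0" by blast
  define k where "k = (\<lambda>i\<in>{..<q}. real_of_int (k0 i))"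
  have kl: "k \<in> I.lattice" by (auto simp: k_def I.lattice_def)
  have "I.nuhat k = I.nuhat (\<lambda>i. of_int (k0 i))" by (rule I.nuhat_cong) (simp add: k_def)
  then have knz: "0 < cmod (I.nuhat k)" using nz by (simp add: I.nuhat_def)
  have "\<exists>n. cmod (muhat (\<theta> ((I.Ct ^^ n) k))) < cmod (I.nuhat k)"
  proof (rule rajchman_orbit[OF raj _ _ knz, of "\<lambda>n. \<theta> ((I.Ct ^^ n) k)"])
    show "\<theta> ((I.Ct ^^ 0) k) \<noteq> 0"
    proof
      assume "\<theta> ((I.Ct ^^ 0) k) = 0"
      moreover obtain x where "\<forall>k. \<theta> k \<bullet> x = k i0" using coord[OF i0(1)] by (rule exE)
      ultimately have "k i0 = 0" by (metis funpow_0 inner_zero_left)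
      then show False using i0 by (simp add: k_def)
    qed
    show "At (\<theta> ((I.Ct ^^ Suc n) k)) = \<theta> ((I.Ct ^^ n) k)" for n
      unfolding At\<theta> using I.Bt_Ct[OF I.lattice_Rq[OF I.Ct_pow_lattice[OF kl, of n]]] by simp
  qed
  then show False unfolding muhat_nuhat I.nuhat_Ct_pow[OF kl] by simp
qed

end

theorem theorem1p8:
  fixes m :: nat
    and \<phi> :: "nat \<Rightarrow> real ^ 'd \<Rightarrow> real ^ 'd"
    and A :: "real ^ 'd ^ 'd"
    and a :: "nat \<Rightarrow> real ^ 'd"
    and p :: "nat \<Rightarrow> real"
    and \<mu> :: "(real ^ 'd) measure"
  assumes "homogeneous_affine_IFS m \<phi> A a"
    and "affinely_irreducible m \<phi>"
    and "strictly_positive_prob_vector m p"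
    and "self_affine_measure borel m \<phi> p \<mu>"
  shows "\<not> rajchman \<mu> \<longleftrightarrow>
           generalized_pisot_IFS_type_I m \<phi> A a \<or>
           (\<exists>q \<psi> \<nu>. integral_factor_IFS q m \<psi> A a \<and>
                     self_affine_measure (borel_Rq q) m \<psi> p \<nu> \<and>
                     singular_wrt (lborel_Rq q) \<nu>)"
proof -
  interpret affine_ifs m \<phi> A a p \<mu> by (rule affine_ifs.intro) (fact assms)+
  show ?thesis
  proof
    assume "\<not> rajchman \<mu>"
    then show "generalized_pisot_IFS_type_I m \<phi> A a \<or>
           (\<exists>q \<psi> \<nu>. integral_factor_IFS q m \<psi> A a \<and>
                     self_affine_measure (borel_Rq q) m \<psi> p \<nu> \<and>
                     singular_wrt (lborel_Rq q) \<nu>)" by (rule not_rajchman_imp)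
  next
    assume "generalized_pisot_IFS_type_I m \<phi> A a \<or>
           (\<exists>q \<psi> \<nu>. integral_factor_IFS q m \<psi> A a \<and>
                     self_affine_measure (borel_Rq q) m \<psi> p \<nu> \<and>
                     singular_wrt (lborel_Rq q) \<nu>)"
    then show "\<not> rajchman \<mu>"
    proof
      assume "generalized_pisot_IFS_type_I m \<phi> A a"
      then show ?thesis by (rule type_I_not_rajchman)
    next
      assume "\<exists>q \<psi> \<nu>. integral_factor_IFS q m \<psi> A a \<and>
                     self_affine_measure (borel_Rq q) m \<psi> p \<nu> \<and>
                     singular_wrt (lborel_Rq q) \<nu>"
      then show ?thesis by (elim exE conjE) (rule singular_integral_factor_not_rajchman)
    qed
  qed
qed

end
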